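(* Let $\mathfrak X$ be a differentiable stack and let $x/X$ be a versal family for $\mathfrak X$. Then $\mathfrak X\cong B\,\underline{\mathrm{Isom}}(x,x)$ as groupoid fibrations over $\mathfrak S$.
   Context: Let $\mathfrak S$ be the category of $C^\infty$-manifolds (not necessarily Hausdorff) and smooth maps, with the Grothendieck topology whose covering families $\{U_i\to X\}$ are families of étale maps (local diffeomorphisms) with $\coprod_i U_i\to X$ surjective. A groupoid fibration is a category fibered in groupoids over $\mathfrak S$; these form a 2-category with 2-fibered products. A manifold is identified with the groupoid fibration it represents, and an object $x$ of $\mathfrak X$ over a manifold $S$ (an $\mathfrak X$-family $x/S$) is identified with a morphism $x:S\to\mathfrak X$. A stack is a groupoid fibration in which isomorphisms between objects, and objects, satisfy descent for covering families. A morphism $\mathfrak X\to\mathfrak Y$ is a representable submersion if for every manifold $U$ and every $U\to\mathfrak Y$ the fibered product $V=\mathfrak X\times_{\mathfrak Y}U$ is representable by a manifold and $V\to U$ is a submersion. It is an epimorphism if for every manifold $U\to\mathfrak Y$ there are a surjective submersion $V\to U$ and a morphism $V\to\mathfrak X$ making the resulting square over $\mathfrak Y$ 2-commute. A representable submersion is surjective if it is an epimorphism. A stack $\mathfrak X$ is differentiable if there exist a manifold $X$ and a surjective representable submersion $x:X\to\mathfrak X$; such a family $x/X$ is called a versal family. For families $x/S$, $y/T$ put $\underline{\mathrm{Isom}}(x,y)=S\times_{\mathfrak X}T$ (2-fibered product via $x$ and $y$). For a versal family $x/X$, $\underline{\mathrm{Isom}}(x,x)\rightrightarrows X$ is a Lie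 groupoid: its points are triples $(y,\phi,y')$ with $y,y'\in X$ and $\phi:x|y\to x|y'$ a morphism in the fiber of $\mathfrak X$ over a point, with $(y,\phi,y')\circ(y',\psi,y'')=(y,\psi\circ\phi,y'')$. For a Lie groupoid $\Gamma\rightrightarrows M$ (products $xy$ defined when $t(x)=s(y)$), a $\Gamma$-torsor over a manifold $S$ is a manifold $P$ with a surjective submersion $\pi:P\to S$ and a right $\Gamma$-action (with anchor map $P\to M$) such that for all $p,p'$ with $\pi(p)=\pi(p')$ there is a unique $\gamma$ with $p\cdot\gamma$ defined and equal to $p'$. Morphisms of torsors are commutative squares with $\Gamma$-equivariant top map. $B\Gamma$ denotes the category of $\Gamma$-torsors, fibered over $\mathfrak S$ by $(P\to S)\mapsto S$. *)

theory Defs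
  imports "HOL-Analysis.Analysis"
begin

section \<open>Manifolds\<close>

text \<open>
  The model space of dimension \<open>n\<close> is the library's \<^const>\<open>Euclidean_space\<close>, whose points are the
  sequences vanishing from index \<open>n\<close> on; this allows \<open>n\<close> to vary from chart to chart.
  A function is of class \<open>C\<^sup>k\<close> on an open set when all iterated partial derivatives up to
  order \<open>k\<close> exist and are continuous.
\<close>

definition partial_deriv :: "nat \<Rightarrow> ((nat \<Rightarrow> real) \<Rightarrow> real) \<Rightarrow> (nat \<Rightarrow> real) \<Rightarrow> real" where
  "partial_deriv i f u = deriv (\<lambda>t. f (u(i := t))) (u i)"

fun Ck_on :: "nat \<Rightarrow> nat \<Rightarrow> (nat \<Rightarrow> real) set \<Rightarrow> ((nat \<Rightarrow> real) \<Rightarrow> real) \<Rightarrow> bool" where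
  "Ck_on n 0 U f \<longleftrightarrow> continuous_map (subtopology (Euclidean_space n) U) euclideanreal f"
| "Ck_on n (Suc k) U f \<longleftrightarrow>
     continuous_map (subtopology (Euclidean_space n) U) euclideanreal f \<and>
     (\<forall>i<n. (\<forall>u\<in>U. (\<lambda>t. f (u(i := t))) field_differentiable (at (u i))) \<and>
            Ck_on n k U (partial_deriv i f))"

definition smooth_coords ::
  "nat \<Rightarrow> nat \<Rightarrow> (nat \<Rightarrow> real) set \<Rightarrow> ((nat \<Rightarrow> real) \<Rightarrow> nat \<Rightarrow> real) \<Rightarrow> bool" where
  "smooth_coords n m U f \<longleftrightarrow> (\<forall>j<m. \<forall>k. Ck_on n k U (\<lambda>u. f u j))"

record 'p chart =
  cdom :: "'p set"
  cdim :: nat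
  cmap :: "'p \<Rightarrow> nat \<Rightarrow> real"

definition is_chart :: "'p topology \<Rightarrow> 'p chart \<Rightarrow> bool" where
  "is_chart T c \<longleftrightarrow>
     openin T (cdom c) \<and> cmap c \<in> extensional (cdom c) \<and>
     embedding_map (subtopology T (cdom c)) (Euclidean_space (cdim c)) (cmap c) \<and>
     openin (Euclidean_space (cdim c)) (cmap c ` cdom c)"

definition cinv :: "'p chart \<Rightarrow> (nat \<Rightarrow> real) \<Rightarrow> 'p" where
  "cinv c = inv_into (cdom c) (cmap c)"

definition compatible :: "'p chart \<Rightarrow> 'p chart \<Rightarrow> bool" where
  "compatible c d \<longleftrightarrow>
     smooth_coords (cdim c) (cdim d) (cmap c ` (cdom c \<inter> cdom d)) (cmap d \<circ> cinv c) \<and>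
     smooth_coords (cdim d) (cdim c) (cmap d ` (cdom c \<inter> cdom d)) (cmap c \<circ> cinv d)"

record 'p mfd =
  mtop :: "'p topology"
  atlas :: "'p chart set"

abbreviation pts :: "'p mfd \<Rightarrow> 'p set" where
  "pts M \<equiv> topspace (mtop M)"

text \<open>
  Second countable, not necessarily Hausdorff, with a maximal smooth atlas.  The dimension is
  locally constant.  Charts are extensional so that the smooth structure determines the record.
\<close>

definition manifold :: "'p mfd \<Rightarrow> bool" where
  "manifold M \<longleftrightarrow>
     second_countable (mtop M) \<and>
     (\<forall>c\<in>atlas M. is_chart (mtop M) c) \<and>
     \<Union> (cdom ` atlas M) = pts M \<and>
     (\<forall>c\<in>atlas M. \<forall>d\<in>atlas M. compatible c d) \<and>
     (\<forall>c. is_chart (mtop M) c \<and> (\<forall>d\<in>atlas M. compatible c d) \<longrightarrow> c \<in> atlas M)"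

definition local_rep :: "'p chart \<Rightarrow> 'q chart \<Rightarrow> ('p \<Rightarrow> 'q) \<Rightarrow> (nat \<Rightarrow> real) \<Rightarrow> nat \<Rightarrow> real" where
  "local_rep c d f = cmap d \<circ> f \<circ> cinv c"

definition smooth_map :: "'p mfd \<Rightarrow> 'p mfd \<Rightarrow> ('p \<Rightarrow> 'p) \<Rightarrow> bool" where
  "smooth_map M N f \<longleftrightarrow>
     continuous_map (mtop M) (mtop N) f \<and>
     (\<forall>c\<in>atlas M. \<forall>d\<in>atlas N.
        smooth_coords (cdim c) (cdim d) (cmap c ` {z \<in> cdom c. f z \<in> cdom d}) (local_rep c d f))"

definition submersion :: "'p mfd \<Rightarrow> 'p mfd \<Rightarrow> ('p \<Rightarrow> 'p) \<Rightarrow> bool" where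
  "submersion M N f \<longleftrightarrow>
     smooth_map M N f \<and>
     (\<forall>z\<in>pts M. \<forall>c\<in>atlas M. \<forall>d\<in>atlas N. z \<in> cdom c \<and> f z \<in> cdom d \<longrightarrow>
        (\<forall>w :: nat \<Rightarrow> real. \<exists>v :: nat \<Rightarrow> real. \<forall>j<cdim d.
           (\<Sum>i<cdim c. partial_deriv i (\<lambda>u. local_rep c d f u j) (cmap c z) * v i) = w j))"

definition surj_submersion :: "'p mfd \<Rightarrow> 'p mfd \<Rightarrow> ('p \<Rightarrow> 'p) \<Rightarrow> bool" where
  "surj_submersion M N f \<longleftrightarrow> submersion M N f \<and> f ` pts M = pts N"

definition open_submfd :: "'p mfd \<Rightarrow> 'p set \<Rightarrow> 'p mfd" where
  "open_submfd M U = \<lparr>mtop = subtopology (mtop M) U, atlas = {c \<in> atlas M. cdom c \<subseteq> U}\<rparr>"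

definition diffeomorphism :: "'p mfd \<Rightarrow> 'p mfd \<Rightarrow> ('p \<Rightarrow> 'p) \<Rightarrow> bool" where
  "diffeomorphism M N f \<longleftrightarrow>
     bij_betw f (pts M) (pts N) \<and> smooth_map M N f \<and> smooth_map N M (inv_into (pts M) f)"

definition etale_map :: "'p mfd \<Rightarrow> 'p mfd \<Rightarrow> ('p \<Rightarrow> 'p) \<Rightarrow> bool" where
  "etale_map M N f \<longleftrightarrow>
     smooth_map M N f \<and>
     (\<forall>z\<in>pts M. \<exists>U. z \<in> U \<and> openin (mtop M) U \<and> openin (mtop N) (f ` U) \<and>
        diffeomorphism (open_submfd M U) (open_submfd N (f ` U)) f)"

section \<open>Categories and the site of manifolds\<close>

record ('o, 'm) cat =
  Obj :: "'o set"
  Arr :: "'m set"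
  Dom :: "'m \<Rightarrow> 'o"
  Cod :: "'m \<Rightarrow> 'o"
  Ide :: "'o \<Rightarrow> 'm"
  Cmp :: "'m \<Rightarrow> 'm \<Rightarrow> 'm"

text \<open>\<open>Cmp C b a\<close> is the composite "first \<open>a\<close>, then \<open>b\<close>".\<close>

definition category :: "('o, 'm) cat \<Rightarrow> bool" where
  "category C \<longleftrightarrow>
     (\<forall>a\<in>Arr C. Dom C a \<in> Obj C \<and> Cod C a \<in> Obj C) \<and>
     (\<forall>x\<in>Obj C. Ide C x \<in> Arr C \<and> Dom C (Ide C x) = x \<and> Cod C (Ide C x) = x) \<and>
     (\<forall>a\<in>Arr C. \<forall>b\<in>Arr C. Cod C a = Dom C b \<longrightarrow>
        Cmp C b a \<in> Arr C \<and> Dom C (Cmp C b a) = Dom C a \<and> Cod C (Cmp C b a) = Cod C b) \<and>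
     (\<forall>a\<in>Arr C. Cmp C a (Ide C (Dom C a)) = a \<and> Cmp C (Ide C (Cod C a)) a = a) \<and>
     (\<forall>a\<in>Arr C. \<forall>b\<in>Arr C. \<forall>c\<in>Arr C. Cod C a = Dom C b \<and> Cod C b = Dom C c \<longrightarrow>
        Cmp C c (Cmp C b a) = Cmp C (Cmp C c b) a)"

record ('o1, 'm1, 'o2, 'm2) ftr =
  fo :: "'o1 \<Rightarrow> 'o2"
  fa :: "'m1 \<Rightarrow> 'm2"

definition is_functor ::
  "('o1, 'm1) cat \<Rightarrow> ('o2, 'm2) cat \<Rightarrow> ('o1, 'm1, 'o2, 'm2) ftr \<Rightarrow> bool" where
  "is_functor C D F \<longleftrightarrow>
     (\<forall>x\<in>Obj C. fo F x \<in> Obj D \<and> fa F (Ide C x) = Ide D (fo F x)) \<and>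
     (\<forall>a\<in>Arr C. fa F a \<in> Arr D \<and> Dom D (fa F a) = fo F (Dom C a) \<and> Cod D (fa F a) = fo F (Cod C a)) \<and>
     (\<forall>a\<in>Arr C. \<forall>b\<in>Arr C. Cod C a = Dom C b \<longrightarrow> fa F (Cmp C b a) = Cmp D (fa F b) (fa F a))"

definition ftr_id :: "('o, 'm, 'o, 'm) ftr" where
  "ftr_id = \<lparr>fo = (\<lambda>x. x), fa = (\<lambda>a. a)\<rparr>"

definition ftr_comp ::
  "('o2, 'm2, 'o3, 'm3) ftr \<Rightarrow> ('o1, 'm1, 'o2, 'm2) ftr \<Rightarrow> ('o1, 'm1, 'o3, 'm3) ftr" where
  "ftr_comp G F = \<lparr>fo = fo G \<circ> fo F, fa = fa G \<circ> fa F\<rparr>"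

record 'p smap =
  src :: "'p mfd"
  tgt :: "'p mfd"
  fn :: "'p \<Rightarrow> 'p"

definition is_smap :: "'p smap \<Rightarrow> bool" where
  "is_smap f \<longleftrightarrow> manifold (src f) \<and> manifold (tgt f) \<and>
     fn f \<in> extensional (pts (src f)) \<and> smooth_map (src f) (tgt f) (fn f)"

definition sm_id :: "'p mfd \<Rightarrow> 'p smap" where
  "sm_id M = \<lparr>src = M, tgt = M, fn = restrict (\<lambda>z. z) (pts M)\<rparr>"

definition sm_comp :: "'p smap \<Rightarrow> 'p smap \<Rightarrow> 'p smap" where
  "sm_comp g f = \<lparr>src = src f, tgt = tgt g, fn = restrict (fn g \<circ> fn f) (pts (src f))\<rparr>"

definition const_smap :: "'p mfd \<Rightarrow> 'p mfd \<Rightarrow> 'p \<Rightarrow> 'p smap" where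
  "const_smap M N r = \<lparr>src = M, tgt = N, fn = restrict (\<lambda>_. r) (pts M)\<rparr>"

text \<open>
  The category of manifolds whose points lie in the type \<open>'p\<close>, which serves as the universe.
  A second countable manifold has at most continuum many points, so as soon as \<open>'p\<close> has
  at least that cardinality every manifold is diffeomorphic to an object of this category.
\<close>

definition Man :: "('p mfd, 'p smap) cat" where
  "Man = \<lparr>Obj = {M. manifold M}, Arr = {f. is_smap f}, Dom = src, Cod = tgt,
          Ide = sm_id, Cmp = sm_comp\<rparr>"

definition large_universe :: "'p itself \<Rightarrow> bool" where
  "large_universe _ \<longleftrightarrow> (\<exists>e :: real \<Rightarrow> 'p. inj e)"

definition pullback_square :: "'p smap \<Rightarrow> 'p smap \<Rightarrow> 'p smap \<Rightarrow> 'p smap \<Rightarrow> bool" where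
  "pullback_square f g p q \<longleftrightarrow>
     is_smap f \<and> is_smap g \<and> is_smap p \<and> is_smap q \<and>
     tgt f = tgt g \<and> src p = src q \<and> tgt p = src f \<and> tgt q = src g \<and>
     sm_comp f p = sm_comp g q \<and>
     (\<forall>p' q'. is_smap p' \<and> is_smap q' \<and> src p' = src q' \<and> tgt p' = src f \<and> tgt q' = src g \<and>
              sm_comp f p' = sm_comp g q' \<longrightarrow>
        (\<exists>!h. is_smap h \<and> src h = src p' \<and> tgt h = src p \<and> sm_comp p h = p' \<and> sm_comp q h = q'))"

text \<open>
  Covering families are indexed by their own members.  Surjectivity of the map from the
  coproduct is expressed as joint surjectivity.
\<close>

definition covering :: "'p mfd \<Rightarrow> 'p smap set \<Rightarrow> bool" where
  "covering S C \<longleftrightarrow>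
     manifold S \<and>
     (\<forall>f\<in>C. is_smap f \<and> tgt f = S \<and> etale_map (src f) S (fn f)) \<and>
     (\<Union>f\<in>C. fn f ` pts (src f)) = pts S"

section \<open>Groupoid fibrations\<close>

text \<open>A category over manifolds: total category and projection functor on objects and arrows.\<close>

record ('o, 'm, 'p) gfib =
  tot :: "('o, 'm) cat"
  po :: "'o \<Rightarrow> 'p mfd"
  pa :: "'m \<Rightarrow> 'p smap"

definition groupoid_fibration :: "('o, 'm, 'p) gfib \<Rightarrow> bool" where
  "groupoid_fibration X \<longleftrightarrow>
     category (tot X) \<and>
     is_functor (tot X) Man \<lparr>fo = po X, fa = pa X\<rparr> \<and>
     (\<forall>f x. is_smap f \<and> x \<in> Obj (tot X) \<and> po X x = tgt f \<longrightarrow>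
        (\<exists>a\<in>Arr (tot X). Cod (tot X) a = x \<and> pa X a = f)) \<and>
     (\<forall>a\<in>Arr (tot X). \<forall>b\<in>Arr (tot X). \<forall>h.
        Cod (tot X) a = Cod (tot X) b \<and> is_smap h \<and>
        src h = src (pa X b) \<and> tgt h = src (pa X a) \<and> sm_comp (pa X a) h = pa X b \<longrightarrow>
        (\<exists>!c. c \<in> Arr (tot X) \<and> Dom (tot X) c = Dom (tot X) b \<and> Cod (tot X) c = Dom (tot X) a \<and>
              pa X c = h \<and> Cmp (tot X) a c = b))"

definition gf_mor ::
  "('o1, 'm1, 'p) gfib \<Rightarrow> ('o2, 'm2, 'p) gfib \<Rightarrow> ('o1, 'm1, 'o2, 'm2) ftr \<Rightarrow> bool" where
  "gf_mor X Y F \<longleftrightarrow>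
     is_functor (tot X) (tot Y) F \<and>
     (\<forall>x\<in>Obj (tot X). po Y (fo F x) = po X x) \<and>
     (\<forall>a\<in>Arr (tot X). pa Y (fa F a) = pa X a)"

text \<open>
  2-morphisms lie over identities; they are invertible because the fibres are groupoids.
\<close>

definition gf_2mor ::
  "('o1, 'm1, 'p) gfib \<Rightarrow> ('o2, 'm2, 'p) gfib \<Rightarrow> ('o1, 'm1, 'o2, 'm2) ftr \<Rightarrow>
   ('o1, 'm1, 'o2, 'm2) ftr \<Rightarrow> ('o1 \<Rightarrow> 'm2) \<Rightarrow> bool" where
  "gf_2mor X Y F G \<eta> \<longleftrightarrow>
     (\<forall>x\<in>Obj (tot X). \<eta> x \<in> Arr (tot Y) \<and> Dom (tot Y) (\<eta> x) = fo F x \<and>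
        Cod (tot Y) (\<eta> x) = fo G x \<and> pa Y (\<eta> x) = sm_id (po X x)) \<and>
     (\<forall>a\<in>Arr (tot X).
        Cmp (tot Y) (\<eta> (Cod (tot X) a)) (fa F a) = Cmp (tot Y) (fa G a) (\<eta> (Dom (tot X) a)))"

definition gf_equivalence ::
  "('o1, 'm1, 'p) gfib \<Rightarrow> ('o2, 'm2, 'p) gfib \<Rightarrow> ('o1, 'm1, 'o2, 'm2) ftr \<Rightarrow> bool" where
  "gf_equivalence X Y F \<longleftrightarrow>
     groupoid_fibration X \<and> groupoid_fibration Y \<and> gf_mor X Y F \<and>
     (\<exists>G \<eta> \<epsilon>. gf_mor Y X G \<and>
        gf_2mor X X (ftr_comp G F) ftr_id \<eta> \<and> gf_2mor Y Y (ftr_comp F G) ftr_id \<epsilon>)"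

definition gf_isomorphic :: "('o1, 'm1, 'p) gfib \<Rightarrow> ('o2, 'm2, 'p) gfib \<Rightarrow> bool"
    (infix \<open>\<cong>\<^sub>\<SS>\<close> 50) where
  "X \<cong>\<^sub>\<SS> Y \<longleftrightarrow> (\<exists>F. gf_equivalence X Y F)"

subsection \<open>Manifolds and families as groupoid fibrations and morphisms\<close>

text \<open>
  The fibration represented by \<open>M\<close>: objects over \<open>T\<close> are smooth maps from \<open>T\<close> to \<open>M\<close>.  The arrow
  \<open>(h, f)\<close> is the morphism from \<open>f \<circ> h\<close> to \<open>f\<close> lying over \<open>h\<close>.
\<close>

definition Rep :: "'p mfd \<Rightarrow> ('p smap, 'p smap \<times> 'p smap, 'p) gfib" where
  "Rep M = \<lparr>
     tot = \<lparr>
       Obj = {f. is_smap f \<and> tgt f = M},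
       Arr = {(h, f). is_smap h \<and> is_smap f \<and> tgt h = src f \<and> tgt f = M},
       Dom = (\<lambda>(h, f). sm_comp f h),
       Cod = snd,
       Ide = (\<lambda>f. (sm_id (src f), f)),
       Cmp = (\<lambda>(h', f') (h, f). (sm_comp h' h, f'))\<rparr>,
     po = src,
     pa = fst\<rparr>"

definition Rep_map :: "'p smap \<Rightarrow> ('p smap, 'p smap \<times> 'p smap, 'p smap, 'p smap \<times> 'p smap) ftr" where
  "Rep_map g = \<lparr>fo = sm_comp g, fa = (\<lambda>(h, f). (h, sm_comp g f))\<rparr>"

text \<open>
  A chosen pullback arrow to \<open>x\<close> over \<open>f\<close>; its domain is \<open>x\<close> restricted along \<open>f\<close>.
  These choices turn an object \<open>x\<close> over \<open>S\<close> into the morphism from \<open>S\<close> that it is identified with.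
\<close>

definition pull_arr :: "('o, 'm, 'p) gfib \<Rightarrow> 'o \<Rightarrow> 'p smap \<Rightarrow> 'm" where
  "pull_arr X x f = (SOME a. a \<in> Arr (tot X) \<and> Cod (tot X) a = x \<and> pa X a = f)"

definition fam_mor :: "('o, 'm, 'p) gfib \<Rightarrow> 'o \<Rightarrow> ('p smap, 'p smap \<times> 'p smap, 'o, 'm) ftr" where
  "fam_mor X x = \<lparr>
     fo = (\<lambda>f. Dom (tot X) (pull_arr X x f)),
     fa = (\<lambda>(h, f). THE c. c \<in> Arr (tot X) \<and>
             Dom (tot X) c = Dom (tot X) (pull_arr X x (sm_comp f h)) \<and>
             Cod (tot X) c = Dom (tot X) (pull_arr X x f) \<and>
             pa X c = h \<and>
             Cmp (tot X) (pull_arr X x f) c = pull_arr X x (sm_comp f h))\<rparr>"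

subsection \<open>2-fibered products\<close>

text \<open>
  Objects are triples \<open>(x, y, \<phi>)\<close> with \<open>\<phi> : F x \<rightarrow> G y\<close> over an identity.  An arrow
  \<open>(\<phi>, a, b, \<phi>')\<close> is a pair \<open>(a, b)\<close> intertwining the \<open>\<phi>\<close> of its domain and the \<open>\<phi>'\<close> of its codomain.
\<close>

definition fibprod_obj ::
  "('o1, 'm1, 'p) gfib \<Rightarrow> ('o2, 'm2, 'p) gfib \<Rightarrow> ('o3, 'm3, 'p) gfib \<Rightarrow>
   ('o1, 'm1, 'o3, 'm3) ftr \<Rightarrow> ('o2, 'm2, 'o3, 'm3) ftr \<Rightarrow> ('o1 \<times> 'o2 \<times> 'm3) set" where
  "fibprod_obj X Y Z F G =
     {(x, y, \<phi>). x \<in> Obj (tot X) \<and> y \<in> Obj (tot Y) \<and> po X x = po Y y \<and>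
        \<phi> \<in> Arr (tot Z) \<and> Dom (tot Z) \<phi> = fo F x \<and> Cod (tot Z) \<phi> = fo G y \<and>
        pa Z \<phi> = sm_id (po X x)}"

definition fibprod ::
  "('o1, 'm1, 'p) gfib \<Rightarrow> ('o2, 'm2, 'p) gfib \<Rightarrow> ('o3, 'm3, 'p) gfib \<Rightarrow>
   ('o1, 'm1, 'o3, 'm3) ftr \<Rightarrow> ('o2, 'm2, 'o3, 'm3) ftr \<Rightarrow>
   ('o1 \<times> 'o2 \<times> 'm3, 'm3 \<times> 'm1 \<times> 'm2 \<times> 'm3, 'p) gfib" where
  "fibprod X Y Z F G = \<lparr>
     tot = \<lparr>
       Obj = fibprod_obj X Y Z F G,
       Arr = {(\<phi>, a, b, \<phi>'). a \<in> Arr (tot X) \<and> b \<in> Arr (tot Y) \<and> pa X a = pa Y b \<and>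
                (Dom (tot X) a, Dom (tot Y) b, \<phi>) \<in> fibprod_obj X Y Z F G \<and>
                (Cod (tot X) a, Cod (tot Y) b, \<phi>') \<in> fibprod_obj X Y Z F G \<and>
                Cmp (tot Z) \<phi>' (fa F a) = Cmp (tot Z) (fa G b) \<phi>},
       Dom = (\<lambda>(\<phi>, a, b, \<phi>'). (Dom (tot X) a, Dom (tot Y) b, \<phi>)),
       Cod = (\<lambda>(\<phi>, a, b, \<phi>'). (Cod (tot X) a, Cod (tot Y) b, \<phi>')),
       Ide = (\<lambda>(x, y, \<phi>). (\<phi>, Ide (tot X) x, Ide (tot Y) y, \<phi>)),
       Cmp = (\<lambda>(\<psi>, a', b', \<psi>') (\<phi>, a, b, \<phi>'). (\<phi>, Cmp (tot X) a' a, Cmp (tot Y) b' b, \<psi>'))\<rparr>,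
     po = (\<lambda>(x, y, \<phi>). po X x),
     pa = (\<lambda>(\<phi>, a, b, \<phi>'). pa X a)\<rparr>"

subsection \<open>Representable submersions and epimorphisms\<close>

text \<open>
  The morphism \<open>V \<rightarrow> U\<close> in the first definition is the smooth map corresponding to the composite
  of \<open>E\<close> with the second projection, i.e. the image of the identity of \<open>V\<close>.
\<close>

definition representable_submersion ::
  "('o1, 'm1, 'p) gfib \<Rightarrow> ('o2, 'm2, 'p) gfib \<Rightarrow> ('o1, 'm1, 'o2, 'm2) ftr \<Rightarrow> bool" where
  "representable_submersion X Y F \<longleftrightarrow>
     gf_mor X Y F \<and>
     (\<forall>U G. manifold U \<and> gf_mor (Rep U) Y G \<longrightarrow>
        (\<exists>V E. manifold V \<and> gf_equivalence (Rep V) (fibprod X (Rep U) Y F G) E \<and>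
           submersion V U (fn (fst (snd (fo E (sm_id V)))))))"

definition epimorphism ::
  "('o1, 'm1, 'p) gfib \<Rightarrow> ('o2, 'm2, 'p) gfib \<Rightarrow> ('o1, 'm1, 'o2, 'm2) ftr \<Rightarrow> bool" where
  "epimorphism X Y F \<longleftrightarrow>
     gf_mor X Y F \<and>
     (\<forall>U G. manifold U \<and> gf_mor (Rep U) Y G \<longrightarrow>
        (\<exists>v H \<eta>. is_smap v \<and> tgt v = U \<and> surj_submersion (src v) U (fn v) \<and>
           gf_mor (Rep (src v)) X H \<and>
           gf_2mor (Rep (src v)) Y (ftr_comp F H) (ftr_comp G (Rep_map v)) \<eta>))"

definition surj_representable_submersion ::
  "('o1, 'm1, 'p) gfib \<Rightarrow> ('o2, 'm2, 'p) gfib \<Rightarrow> ('o1, 'm1, 'o2, 'm2) ftr \<Rightarrow> bool" where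
  "surj_representable_submersion X Y F \<longleftrightarrow> representable_submersion X Y F \<and> epimorphism X Y F"

section \<open>Stacks\<close>

text \<open>
  Restrictions are given by arbitrary arrows over the map in question, since in a groupoid
  fibration any such arrow exhibits its domain as the restriction of its codomain.  \<open>over X a f y x\<close>
  says that \<open>a : y \<rightarrow> x\<close> lies over \<open>f\<close>.
\<close>

definition over :: "('o, 'm, 'p) gfib \<Rightarrow> 'm \<Rightarrow> 'p smap \<Rightarrow> 'o \<Rightarrow> 'o \<Rightarrow> bool" where
  "over X a f y x \<longleftrightarrow>
     a \<in> Arr (tot X) \<and> pa X a = f \<and> Dom (tot X) a = y \<and> Cod (tot X) a = x"

text \<open>
  Descent for isomorphisms.  \<open>a f\<close> and \<open>b f\<close> exhibit \<open>xr f\<close> and \<open>yr f\<close> as the restrictions of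
  \<open>x\<close> and \<open>y\<close> along \<open>f\<close>.  The hypothesis says that \<open>\<phi> f\<close> and \<open>\<phi> g\<close> agree on the overlap: for \<open>z\<close>
  the restriction of \<open>x\<close> to the overlap, both induce the same morphism from \<open>z\<close> to the restriction
  of \<open>y\<close>, i.e. the same arrow \<open>z \<rightarrow> y\<close>.
\<close>

definition iso_descent :: "('o, 'm, 'p) gfib \<Rightarrow> bool" where
  "iso_descent X \<longleftrightarrow>
     (\<forall>S C x y xr yr a b \<phi>.
        covering S C \<and>
        x \<in> Obj (tot X) \<and> po X x = S \<and> y \<in> Obj (tot X) \<and> po X y = S \<and>
        (\<forall>f\<in>C. over X (a f) f (xr f) x \<and> over X (b f) f (yr f) y \<and>
               over X (\<phi> f) (sm_id (src f)) (xr f) (yr f)) \<and>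
        (\<forall>f\<in>C. \<forall>g\<in>C. \<forall>p q z u v.
           pullback_square f g p q \<and> over X u p z (xr f) \<and> over X v q z (xr g) \<and>
           Cmp (tot X) (a f) u = Cmp (tot X) (a g) v \<longrightarrow>
           Cmp (tot X) (b f) (Cmp (tot X) (\<phi> f) u) = Cmp (tot X) (b g) (Cmp (tot X) (\<phi> g) v)) \<longrightarrow>
        (\<exists>!\<psi>. over X \<psi> (sm_id S) x y \<and>
              (\<forall>f\<in>C. Cmp (tot X) \<psi> (a f) = Cmp (tot X) (b f) (\<phi> f))))"

text \<open>
  Descent data for objects: \<open>xo f\<close> over the members \<open>f\<close> of the cover, overlaps with projections
  \<open>p f g\<close>, \<open>q f g\<close>, restrictions \<open>l f g\<close> of \<open>xo f\<close> and \<open>r f g\<close> of \<open>xo g\<close> to them via \<open>a f g\<close>,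
  \<open>b f g\<close>, and isomorphisms \<open>\<phi> f g : l f g \<rightarrow> r f g\<close>.  The cocycle condition for \<open>f\<close>, \<open>g\<close>, \<open>h\<close>
  is stated on every \<open>z\<close> over a manifold mapping to the triple overlap: \<open>u\<close>, \<open>v\<close>, \<open>w\<close> restrict
  \<open>\<phi> f g\<close>, \<open>\<phi> g h\<close>, \<open>\<phi> f h\<close> to it, matching the source of \<open>\<phi> f g\<close> with that of \<open>\<phi> f h\<close> and the
  target of \<open>\<phi> f g\<close> with the source of \<open>\<phi> g h\<close>.
\<close>

definition descent_datum ::
  "('o, 'm, 'p) gfib \<Rightarrow> 'p smap set \<Rightarrow> ('p smap \<Rightarrow> 'o) \<Rightarrow>
   ('p smap \<Rightarrow> 'p smap \<Rightarrow> 'p smap) \<Rightarrow> ('p smap \<Rightarrow> 'p smap \<Rightarrow> 'p smap) \<Rightarrow>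
   ('p smap \<Rightarrow> 'p smap \<Rightarrow> 'o) \<Rightarrow> ('p smap \<Rightarrow> 'p smap \<Rightarrow> 'o) \<Rightarrow>
   ('p smap \<Rightarrow> 'p smap \<Rightarrow> 'm) \<Rightarrow> ('p smap \<Rightarrow> 'p smap \<Rightarrow> 'm) \<Rightarrow>
   ('p smap \<Rightarrow> 'p smap \<Rightarrow> 'm) \<Rightarrow> bool" where
  "descent_datum X C xo p q l r a b \<phi> \<longleftrightarrow>
     (\<forall>f\<in>C. xo f \<in> Obj (tot X) \<and> po X (xo f) = src f) \<and>
     (\<forall>f\<in>C. \<forall>g\<in>C.
        pullback_square f g (p f g) (q f g) \<and>
        over X (a f g) (p f g) (l f g) (xo f) \<and> over X (b f g) (q f g) (r f g) (xo g) \<and>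
        over X (\<phi> f g) (sm_id (src (p f g))) (l f g) (r f g)) \<and>
     (\<forall>f\<in>C. \<forall>g\<in>C. \<forall>h\<in>C. \<forall>z u v w.
        over X u (pa X u) z (l f g) \<and> over X v (pa X v) z (l g h) \<and> over X w (pa X w) z (l f h) \<and>
        Cmp (tot X) (a f g) u = Cmp (tot X) (a f h) w \<and>
        Cmp (tot X) (b f g) (Cmp (tot X) (\<phi> f g) u) = Cmp (tot X) (a g h) v \<and>
        sm_comp (q g h) (pa X v) = sm_comp (q f h) (pa X w) \<longrightarrow>
        Cmp (tot X) (b g h) (Cmp (tot X) (\<phi> g h) v) = Cmp (tot X) (b f h) (Cmp (tot X) (\<phi> f h) w))"

text \<open>
  The arrows \<open>e f : xo f \<rightarrow> x\<close> over \<open>f\<close> are the isomorphisms of \<open>xo f\<close> with the restrictions of \<open>x\<close>.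
\<close>

definition obj_descent :: "('o, 'm, 'p) gfib \<Rightarrow> bool" where
  "obj_descent X \<longleftrightarrow>
     (\<forall>S C xo p q l r a b \<phi>.
        covering S C \<and> descent_datum X C xo p q l r a b \<phi> \<longrightarrow>
        (\<exists>x e. x \<in> Obj (tot X) \<and> po X x = S \<and>
           (\<forall>f\<in>C. over X (e f) f (xo f) x) \<and>
           (\<forall>f\<in>C. \<forall>g\<in>C. Cmp (tot X) (e f) (a f g) =
                          Cmp (tot X) (e g) (Cmp (tot X) (b f g) (\<phi> f g)))))"

definition stack :: "('o, 'm, 'p) gfib \<Rightarrow> bool" where
  "stack X \<longleftrightarrow> groupoid_fibration X \<and> iso_descent X \<and> obj_descent X"

definition versal_family :: "('o, 'm, 'p) gfib \<Rightarrow> 'o \<Rightarrow> bool" where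
  "versal_family X x \<longleftrightarrow>
     x \<in> Obj (tot X) \<and> surj_representable_submersion (Rep (po X x)) X (fam_mor X x)"

definition differentiable_stack :: "('o, 'm, 'p) gfib \<Rightarrow> bool" where
  "differentiable_stack X \<longleftrightarrow> stack X \<and> (\<exists>x. versal_family X x)"

section \<open>Lie groupoids and torsors\<close>

record 'p lgpd =
  base :: "'p mfd"
  arrs :: "'p mfd"
  gs :: "'p \<Rightarrow> 'p"
  gt :: "'p \<Rightarrow> 'p"
  gu :: "'p \<Rightarrow> 'p"
  gi :: "'p \<Rightarrow> 'p"
  gm :: "'p \<Rightarrow> 'p \<Rightarrow> 'p"

text \<open>
  \<open>smooth_on_fibprod A B N f g m\<close>: the map \<open>m\<close> from the fibered product of \<open>A\<close> and \<open>B\<close> along \<open>f\<close>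
  and \<open>g\<close> to \<open>N\<close> is smooth.  A map from a manifold \<open>T\<close> to the fibered product is a pair of maps to
  \<open>A\<close> and \<open>B\<close>; taking \<open>T\<close> to be the fibered product itself recovers \<open>m\<close>.
\<close>

definition smooth_on_fibprod ::
  "'p mfd \<Rightarrow> 'p mfd \<Rightarrow> 'p mfd \<Rightarrow> ('p \<Rightarrow> 'p) \<Rightarrow> ('p \<Rightarrow> 'p) \<Rightarrow> ('p \<Rightarrow> 'p \<Rightarrow> 'p) \<Rightarrow> bool" where
  "smooth_on_fibprod A B N f g m \<longleftrightarrow>
     (\<forall>T p q. manifold T \<and> smooth_map T A p \<and> smooth_map T B q \<and> (\<forall>z\<in>pts T. f (p z) = g (q z)) \<longrightarrow>
        smooth_map T N (\<lambda>z. m (p z) (q z)))"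

definition lie_groupoid :: "'p lgpd \<Rightarrow> bool" where
  "lie_groupoid \<Gamma> \<longleftrightarrow>
     manifold (base \<Gamma>) \<and> manifold (arrs \<Gamma>) \<and>
     surj_submersion (arrs \<Gamma>) (base \<Gamma>) (gs \<Gamma>) \<and> surj_submersion (arrs \<Gamma>) (base \<Gamma>) (gt \<Gamma>) \<and>
     smooth_map (base \<Gamma>) (arrs \<Gamma>) (gu \<Gamma>) \<and> smooth_map (arrs \<Gamma>) (arrs \<Gamma>) (gi \<Gamma>) \<and>
     smooth_on_fibprod (arrs \<Gamma>) (arrs \<Gamma>) (arrs \<Gamma>) (gt \<Gamma>) (gs \<Gamma>) (gm \<Gamma>) \<and>
     (\<forall>x\<in>pts (arrs \<Gamma>). \<forall>y\<in>pts (arrs \<Gamma>). gt \<Gamma> x = gs \<Gamma> y \<longrightarrow>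
        gm \<Gamma> x y \<in> pts (arrs \<Gamma>) \<and> gs \<Gamma> (gm \<Gamma> x y) = gs \<Gamma> x \<and> gt \<Gamma> (gm \<Gamma> x y) = gt \<Gamma> y) \<and>
     (\<forall>x\<in>pts (arrs \<Gamma>). \<forall>y\<in>pts (arrs \<Gamma>). \<forall>z\<in>pts (arrs \<Gamma>). gt \<Gamma> x = gs \<Gamma> y \<and> gt \<Gamma> y = gs \<Gamma> z \<longrightarrow>
        gm \<Gamma> (gm \<Gamma> x y) z = gm \<Gamma> x (gm \<Gamma> y z)) \<and>
     (\<forall>m\<in>pts (base \<Gamma>). gs \<Gamma> (gu \<Gamma> m) = m \<and> gt \<Gamma> (gu \<Gamma> m) = m) \<and>
     (\<forall>x\<in>pts (arrs \<Gamma>). gm \<Gamma> (gu \<Gamma> (gs \<Gamma> x)) x = x \<and> gm \<Gamma> x (gu \<Gamma> (gt \<Gamma> x)) = x) \<and>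
     (\<forall>x\<in>pts (arrs \<Gamma>). gs \<Gamma> (gi \<Gamma> x) = gt \<Gamma> x \<and> gt \<Gamma> (gi \<Gamma> x) = gs \<Gamma> x \<and>
        gm \<Gamma> x (gi \<Gamma> x) = gu \<Gamma> (gs \<Gamma> x) \<and> gm \<Gamma> (gi \<Gamma> x) x = gu \<Gamma> (gt \<Gamma> x))"

record 'p tors =
  tproj :: "'p smap"
  tanch :: "'p smap"
  tact :: "'p \<Rightarrow> 'p \<Rightarrow> 'p"

abbreviation tpts :: "'p tors \<Rightarrow> 'p set" where
  "tpts P \<equiv> pts (src (tproj P))"

text \<open>
  The action preserves the fibres of the projection, and its value is fixed to \<^const>\<open>undefined\<close>
  outside its domain.  Pointwise uniqueness of \<open>\<gamma>\<close> yields a smooth division map only because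
  manifolds are second countable: otherwise the real line with translations by the discrete group
  of reals would be a torsor over a point that is not locally trivial.
\<close>

definition torsor :: "'p lgpd \<Rightarrow> 'p tors \<Rightarrow> bool" where
  "torsor \<Gamma> P \<longleftrightarrow>
     is_smap (tproj P) \<and> is_smap (tanch P) \<and>
     src (tanch P) = src (tproj P) \<and> tgt (tanch P) = base \<Gamma> \<and>
     surj_submersion (src (tproj P)) (tgt (tproj P)) (fn (tproj P)) \<and>
     smooth_on_fibprod (src (tproj P)) (arrs \<Gamma>) (src (tproj P)) (fn (tanch P)) (gs \<Gamma>) (tact P) \<and>
     (\<forall>p\<in>tpts P. \<forall>\<gamma>\<in>pts (arrs \<Gamma>). fn (tanch P) p = gs \<Gamma> \<gamma> \<longrightarrow>
        tact P p \<gamma> \<in> tpts P \<and> fn (tanch P) (tact P p \<gamma>) = gt \<Gamma> \<gamma> \<and>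
        fn (tproj P) (tact P p \<gamma>) = fn (tproj P) p) \<and>
     (\<forall>p\<in>tpts P. tact P p (gu \<Gamma> (fn (tanch P) p)) = p) \<and>
     (\<forall>p\<in>tpts P. \<forall>\<gamma>\<in>pts (arrs \<Gamma>). \<forall>\<delta>\<in>pts (arrs \<Gamma>).
        fn (tanch P) p = gs \<Gamma> \<gamma> \<and> gt \<Gamma> \<gamma> = gs \<Gamma> \<delta> \<longrightarrow>
        tact P (tact P p \<gamma>) \<delta> = tact P p (gm \<Gamma> \<gamma> \<delta>)) \<and>
     (\<forall>p \<gamma>. \<not> (p \<in> tpts P \<and> \<gamma> \<in> pts (arrs \<Gamma>) \<and> fn (tanch P) p = gs \<Gamma> \<gamma>) \<longrightarrow>
        tact P p \<gamma> = undefined) \<and>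
     (\<forall>p\<in>tpts P. \<forall>p'\<in>tpts P. fn (tproj P) p = fn (tproj P) p' \<longrightarrow>
        (\<exists>!\<gamma>. \<gamma> \<in> pts (arrs \<Gamma>) \<and> fn (tanch P) p = gs \<Gamma> \<gamma> \<and> tact P p \<gamma> = p'))"

definition torsor_mor :: "'p lgpd \<Rightarrow> 'p tors \<Rightarrow> 'p smap \<Rightarrow> 'p smap \<Rightarrow> 'p tors \<Rightarrow> bool" where
  "torsor_mor \<Gamma> P k f Q \<longleftrightarrow>
     torsor \<Gamma> P \<and> torsor \<Gamma> Q \<and> is_smap k \<and> is_smap f \<and>
     src k = src (tproj P) \<and> tgt k = src (tproj Q) \<and> src f = tgt (tproj P) \<and> tgt f = tgt (tproj Q) \<and>
     sm_comp (tproj Q) k = sm_comp f (tproj P) \<and>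
     sm_comp (tanch Q) k = tanch P \<and>
     (\<forall>p\<in>tpts P. \<forall>\<gamma>\<in>pts (arrs \<Gamma>). fn (tanch P) p = gs \<Gamma> \<gamma> \<longrightarrow>
        fn k (tact P p \<gamma>) = tact Q (fn k p) \<gamma>)"

definition B :: "'p lgpd \<Rightarrow> ('p tors, 'p tors \<times> 'p smap \<times> 'p smap \<times> 'p tors, 'p) gfib" where
  "B \<Gamma> = \<lparr>
     tot = \<lparr>
       Obj = {P. torsor \<Gamma> P},
       Arr = {(P, k, f, Q). torsor_mor \<Gamma> P k f Q},
       Dom = (\<lambda>(P, k, f, Q). P),
       Cod = (\<lambda>(P, k, f, Q). Q),
       Ide = (\<lambda>P. (P, sm_id (src (tproj P)), sm_id (tgt (tproj P)), P)),
       Cmp = (\<lambda>(P', k', f', Q') (P, k, f, Q). (P, sm_comp k' k, sm_comp f' f, Q'))\<rparr>,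
     po = (\<lambda>P. tgt (tproj P)),
     pa = (\<lambda>(P, k, f, Q). f)\<rparr>"

section \<open>The groupoid of automorphisms of a family\<close>

definition Isom ::
  "('o, 'm, 'p) gfib \<Rightarrow> 'o \<Rightarrow> 'o \<Rightarrow>
   ('p smap \<times> 'p smap \<times> 'm, 'm \<times> ('p smap \<times> 'p smap) \<times> ('p smap \<times> 'p smap) \<times> 'm, 'p) gfib" where
  "Isom X x y = fibprod (Rep (po X x)) (Rep (po X y)) X (fam_mor X x) (fam_mor X y)"

text \<open>
  \<open>isom_groupoid X x \<Gamma>\<close>: the Lie groupoid \<open>\<Gamma>\<close> is \<open>Isom(x, x)\<close>, which as a fibered product is
  determined up to the choice of a representing manifold \<open>arrs \<Gamma>\<close>.  Via \<open>E\<close>, a point \<open>r\<close> of this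
  manifold, seen as a map from a one-point manifold \<open>Q\<close>, becomes a triple \<open>(y, y', \<phi>)\<close> with
  \<open>\<phi> : x|y \<rightarrow> x|y'\<close>; then \<open>y\<close>, \<open>y'\<close> are the source and target of \<open>r\<close>, and multiplication
  composes the \<open>\<phi>\<close>.  Units and inverses are determined by this.
\<close>

definition isom_groupoid :: "('o, 'm, 'p) gfib \<Rightarrow> 'o \<Rightarrow> 'p lgpd \<Rightarrow> bool" where
  "isom_groupoid X x \<Gamma> \<longleftrightarrow>
     lie_groupoid \<Gamma> \<and> base \<Gamma> = po X x \<and>
     (\<exists>E. gf_equivalence (Rep (arrs \<Gamma>)) (Isom X x x) E \<and>
       (\<forall>Q. manifold Q \<and> (\<exists>z. pts Q = {z}) \<longrightarrow>
         (let pt = const_smap Q (base \<Gamma>);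
              E_at = (\<lambda>r. fo E (const_smap Q (arrs \<Gamma>) r));
              iso = (\<lambda>r. snd (snd (E_at r)))
          in (\<forall>r\<in>pts (arrs \<Gamma>). E_at r = (pt (gs \<Gamma> r), pt (gt \<Gamma> r), iso r)) \<and>
             (\<forall>r\<in>pts (arrs \<Gamma>). \<forall>r'\<in>pts (arrs \<Gamma>). gt \<Gamma> r = gs \<Gamma> r' \<longrightarrow>
                iso (gm \<Gamma> r r') = Cmp (tot X) (iso r') (iso r)))))"

end

theory Submission
  imports Defs "HOL-Homology.Homology"
begin

text \<open>
  For every family \<open>y\<close> over \<open>S\<close>, representability of \<open>Isom(x, y)\<close> yields a manifold \<open>V y\<close> whose
  points over \<open>b \<in> S\<close> are the isomorphisms from some \<open>x|a\<close> to \<open>y|b\<close>.  Precomposition with inverses makes it a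
  torsor under \<open>Isom(x, x)\<close>, and \<open>y \<mapsto> V y\<close> is the equivalence.  It is fully faithful since
  \<open>V y \<rightarrow> S\<close> is a submersion with local sections, over which \<open>y\<close> is tautologically a restriction of
  \<open>x\<close>: an equivariant map \<open>V y \<rightarrow> V y'\<close> is a compatible family of local arrows \<open>y \<rightarrow> y'\<close> and descends.
  Conversely, for a torsor \<open>P\<close> over \<open>S\<close> with local sections \<open>\<sigma>\<close>, the restrictions of \<open>x\<close> along the
  anchors of the \<open>\<sigma>\<close> are glued by the arrows of \<open>Isom(x, x)\<close> that carry one section to another, and
  the resulting family \<open>y\<close> has \<open>V y\<close> isomorphic to \<open>P\<close>.

  The gluing arrows have to depend smoothly on the point, while division in a torsor is only given
  pointwise.  In adapted charts the orbit map \<open>(b, \<gamma>) \<mapsto> \<sigma>(b) \<gamma>\<close> is an injective smooth map over \<open>S\<close>.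
  If its fibres had too small a dimension, the countably many compact pieces covering a fibre of \<open>P\<close>
  would have images with empty interior, by invariance of domain, contradicting Baire's theorem; so
  somewhere the orbit map has a smooth inverse, and translations transport this to every point.
\<close>

section \<open>Calculus on Euclidean space\<close>

text \<open>Restriction in a groupoid fibration is a matter of choice and not strictly functorial,
  so restrictions cannot be compared by equality of objects. Every arrow is cartesian, however:
  arrows with the same domain over the same map agree as soon as their composites with a further
  arrow agree. Most identities between arrows are proved in this way. The structure maps of the
  groupoid are prescribed at points only, through one-point manifolds, so points have to control
  families. Composites and translates of families exist by representability and restrict to points,
  where they are determined by their data, and smooth maps that agree at all points are equal.
  Fibered products of manifolds are constructed only for inclusions of open sets. Smoothness of an
  action is tested on manifolds with points in \<open>'p\<close>; the orbit map becomes such a test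
  once open sets of the model space are transported into \<open>'p\<close>, which needs a large
  universe. Pullbacks of torsors are obtained indirectly: a torsor comes from a family, and the
  restricted family has the pulled back torsor. Thus their existence is a consequence of essential
  surjectivity.\<close>

abbreviation espace :: "nat \<Rightarrow> (nat \<Rightarrow> real) set" where
  "espace n \<equiv> topspace (Euclidean_space n)"

text \<open>Boxes rather than balls: coordinates can be moved one at a time within their own bounds,
  which is how partial derivatives probe a function.\<close>

definition nbox :: "nat \<Rightarrow> (nat \<Rightarrow> real) \<Rightarrow> real \<Rightarrow> (nat \<Rightarrow> real) set" where
  "nbox n u e = {v \<in> espace n. \<forall>i<n. \<bar>v i - u i\<bar> < e}"

lemma Euclidean_space_eq: "Euclidean_space n = top_of_set (espace n)"
  by (simp add: Euclidean_space_def euclidean_product_topology)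

lemma openin_Euclidean_space: "openin (Euclidean_space n) U \<longleftrightarrow> openin (top_of_set (espace n)) U"
  by (subst Euclidean_space_eq) simp

lemma espaceD: "u \<in> espace n \<Longrightarrow> n \<le> i \<Longrightarrow> u i = 0"
  by (simp add: topspace_Euclidean_space)

lemma espaceI: "(\<And>i. n \<le> i \<Longrightarrow> u i = 0) \<Longrightarrow> u \<in> espace n"
  by (simp add: topspace_Euclidean_space)

lemma espace_upd: "u \<in> espace n \<Longrightarrow> i < n \<Longrightarrow> u(i := t) \<in> espace n"
  by (auto simp: topspace_Euclidean_space)

lemma continuous_map_Euclidean_real:
  "continuous_map (subtopology (Euclidean_space n) U) euclideanreal f \<longleftrightarrow> continuous_on (espace n \<inter> U) f"
  by (subst Euclidean_space_eq) (simp add: subtopology_subtopology)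

lemma continuous_on_coord: "continuous_on S (\<lambda>u. (u :: nat \<Rightarrow> real) i)"
  by (rule continuous_on_subset[OF continuous_on_product_coordinates subset_UNIV])

lemma openin_nbox: "openin (Euclidean_space n) (nbox n u e)"
proof -
  have "nbox n u e = (\<Inter>i<n. {v \<in> espace n. v i \<in> {u i - e<..<u i + e}}) \<inter> espace n"
    by (force simp: nbox_def abs_less_iff)
  moreover have "openin (Euclidean_space n) {v \<in> espace n. v i \<in> {u i - e<..<u i + e}}" for i
    using continuous_openin_preimage[OF continuous_on_coord[of "espace n" i], of UNIV "{u i - e<..<u i + e}"]
    by (simp add: openin_Euclidean_space Collect_conj_eq vimage_def)
  ultimately show ?thesis
    by (cases "n = 0") (auto intro!: openin_Int openin_INT)
qed

lemma in_nbox_self: "u \<in> espace n \<Longrightarrow> 0 < e \<Longrightarrow> u \<in> nbox n u e"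
  by (simp add: nbox_def)

lemma nbox_mono: "d \<le> e \<Longrightarrow> nbox n u d \<subseteq> nbox n u e"
  by (force simp: nbox_def)

lemma nbox_subset_open:
  assumes "openin (Euclidean_space n) U" "u \<in> U"
  obtains e where "e > 0" "nbox n u e \<subseteq> U"
proof -
  obtain T where T: "open T" "U = espace n \<inter> T"
    using assms(1) openin_Euclidean_space openin_open by metis
  have oT: "openin (product_topology (\<lambda>_. euclidean) UNIV) T"
    using T(1) by (simp add: euclidean_product_topology)
  obtain X where X: "u \<in> (\<Pi>\<^sub>E i\<in>UNIV. X i)" "\<And>i. open (X i)" "finite {i. X i \<noteq> UNIV}" "(\<Pi>\<^sub>E i\<in>UNIV. X i) \<subseteq> T"
    using product_topology_open_contains_basis[OF oT, of u] assms(2) T(2)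
    by auto
  have "\<exists>e>0. \<forall>y. \<bar>y - u i\<bar> < e \<longrightarrow> y \<in> X i" for i
    using X(1) X(2)[of i] by (auto simp: open_dist dist_real_def PiE_iff)
  then obtain e where e: "\<And>i. e i > 0" "\<And>i y. \<bar>y - u i\<bar> < e i \<Longrightarrow> y \<in> X i"
    by metis
  \<comment> \<open>The added \<open>1\<close> keeps the minimum defined for
    \<open>n = 0\<close>.\<close>
  define d where "d = Min (insert 1 (e ` {..<n}))"
  have d: "d > 0" "\<And>i. i < n \<Longrightarrow> d \<le> e i"
    using e(1) by (auto simp: d_def)
  have "nbox n u d \<subseteq> U"
  proof
    fix v assume v: "v \<in> nbox n u d"
    have "v i \<in> X i" for i
    proof (cases "i < n")
      case True
      then show ?thesis using v d(2)[of i] e(2)[of "v i" i] by (force simp: nbox_def)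
    next
      case False
      then have "v i = u i"
        using v assms(2) T(2) by (auto simp: nbox_def topspace_Euclidean_space)
      then show ?thesis using X(1) by auto
    qed
    then show "v \<in> U" using X(4) T(2) v by (auto simp: nbox_def PiE_iff)
  qed
  then show ?thesis using that d by blast
qed

lemma openin_espace_subset: "openin (Euclidean_space n) U \<Longrightarrow> U \<subseteq> espace n"
  by (rule openin_subset)

lemma continuous_on_espace_iff:
  assumes U: "openin (Euclidean_space n) U"
  shows "continuous_on U (f :: _ \<Rightarrow> real) \<longleftrightarrow>
    (\<forall>u\<in>U. \<forall>e>0. \<exists>d>0. nbox n u d \<subseteq> U \<and> (\<forall>v\<in>nbox n u d. \<bar>f v - f u\<bar> < e))"
proof
  assume f: "continuous_on U f"
  show "\<forall>u\<in>U. \<forall>e>0. \<exists>d>0. nbox n u d \<subseteq> U \<and> (\<forall>v\<in>nbox n u d. \<bar>f v - f u\<bar> < e)"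
  proof (intro ballI allI impI)
    fix u and e :: real assume u: "u \<in> U" "0 < e"
    have "openin (top_of_set U) (U \<inter> f -` {f u - e<..<f u + e})"
      by (rule continuous_openin_preimage[OF f, of UNIV]) auto
    then have "openin (Euclidean_space n) (U \<inter> f -` {f u - e<..<f u + e})"
      using U openin_trans openin_Euclidean_space by blast
    then obtain d where "d > 0" "nbox n u d \<subseteq> U \<inter> f -` {f u - e<..<f u + e}"
      by (rule nbox_subset_open[where u = u]) (use u in auto)
    then show "\<exists>d>0. nbox n u d \<subseteq> U \<and> (\<forall>v\<in>nbox n u d. \<bar>f v - f u\<bar> < e)"
      by (force simp: abs_less_iff)
  qed
next
  assume R: "\<forall>u\<in>U. \<forall>e>0. \<exists>d>0. nbox n u d \<subseteq> U \<and> (\<forall>v\<in>nbox n u d. \<bar>f v - f u\<bar> < e)"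
  show "continuous_on U f"
    unfolding continuous_on_eq_continuous_within continuous_within tendsto_iff
  proof (intro ballI allI impI)
    fix u and e :: real assume u: "u \<in> U" "0 < e"
    then obtain d where d: "d > 0" "nbox n u d \<subseteq> U" "\<forall>v\<in>nbox n u d. \<bar>f v - f u\<bar> < e"
      using R by blast
    obtain T where T: "open T" "nbox n u d = espace n \<inter> T"
      using openin_nbox[of n u d] openin_Euclidean_space openin_open by metis
    have "u \<in> T" using T(2) in_nbox_self[of u n d] d(1) u(1) openin_subset[OF U] by blast
    then show "\<forall>\<^sub>F x in at u within U. dist (f x) (f u) < e"
      unfolding eventually_at_topological dist_real_def
      using T d(3) openin_subset[OF U] by blast
  qed
qed

section \<open>Partial derivatives and functions of class C^k\<close>

lemma eventually_upd:
  assumes U: "openin (Euclidean_space n) U" "u \<in> U" "i < n"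
  shows "\<forall>\<^sub>F t in nhds (u i). u(i := t) \<in> U"
proof -
  obtain e where e: "e > 0" "nbox n u e \<subseteq> U" using nbox_subset_open[OF U(1,2)] by blast
  have uE: "u \<in> espace n" using openin_espace_subset[OF U(1)] U(2) by blast
  have "\<forall>\<^sub>F t in nhds (u i). \<bar>t - u i\<bar> < e"
    using e(1) eventually_nhds_metric[of _ "u i"] by (auto simp: dist_real_def)
  then show ?thesis
  proof eventually_elim
    case (elim t)
    then have "u(i := t) \<in> nbox n u e"
      using espace_upd[OF uE U(3)] e(1) by (auto simp: nbox_def)
    then show ?case using e(2) by blast
  qed
qed

text \<open>Relational, because \<open>deriv\<close> returns a value even where no derivative
  exists; in this form the one-variable derivative rules apply directly.\<close>

definition has_pd :: "nat \<Rightarrow> ((nat \<Rightarrow> real) \<Rightarrow> real) \<Rightarrow> real \<Rightarrow> (nat \<Rightarrow> real) \<Rightarrow> bool" where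
  "has_pd i f D u \<longleftrightarrow> ((\<lambda>t. f (u(i := t))) has_real_derivative D) (at (u i))"

lemma has_pd_partial_deriv: "has_pd i f D u \<Longrightarrow> partial_deriv i f u = D"
  by (simp add: has_pd_def partial_deriv_def DERIV_imp_deriv)

lemma field_differentiable_has_pd:
  "(\<lambda>t. f (u(i := t))) field_differentiable (at (u i)) \<longleftrightarrow> has_pd i f (partial_deriv i f u) u"
  unfolding has_pd_def partial_deriv_def
  using DERIV_deriv_iff_field_differentiable by blast

lemma has_pd_cong:
  assumes "openin (Euclidean_space n) U" "u \<in> U" "i < n" "\<And>v. v \<in> U \<Longrightarrow> f v = g v"
  shows "has_pd i f D u \<longleftrightarrow> has_pd i g D u"
  unfolding has_pd_def
  by (rule DERIV_cong_ev) (use eventually_upd[OF assms(1-3)] assms(4) in \<open>auto elim!: eventually_mono\<close>)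

lemma Ck_0: "openin (Euclidean_space n) U \<Longrightarrow> Ck_on n 0 U f \<longleftrightarrow> continuous_on U f"
  using openin_espace_subset[of n U] by (simp add: continuous_map_Euclidean_real Int_absorb1)

lemma Ck_Suc: "openin (Euclidean_space n) U \<Longrightarrow> Ck_on n (Suc k) U f \<longleftrightarrow> continuous_on U f \<and>
    (\<forall>i<n. (\<forall>u\<in>U. has_pd i f (partial_deriv i f u) u) \<and> Ck_on n k U (partial_deriv i f))"
  using openin_espace_subset[of n U]
  by (simp add: continuous_map_Euclidean_real Int_absorb1 field_differentiable_has_pd)

lemmas Ck_simps = Ck_0 Ck_Suc
declare Ck_on.simps [simp del]

text \<open>On an open set a partial derivative depends only on nearby values along a coordinate
  line, so agreement on \<open>U\<close> passes to all iterated derivatives.\<close>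

lemma Ck_cong:
  assumes U: "openin (Euclidean_space n) U" and fg: "\<And>u. u \<in> U \<Longrightarrow> f u = g u"
  shows "Ck_on n k U f \<longleftrightarrow> Ck_on n k U g"
  using fg
proof (induction k arbitrary: f g)
  case 0
  then show ?case using U by (simp add: Ck_0 cong: continuous_on_cong)
next
  case (Suc k)
  have hp: "has_pd i f D u \<longleftrightarrow> has_pd i g D u" if "i < n" "u \<in> U" for i u D
    by (rule has_pd_cong[OF U]) (use that Suc.prems in auto)
  have pd: "partial_deriv i f u = partial_deriv i g u" if "i < n" "u \<in> U" for i u
    using hp[OF that] by (simp add: partial_deriv_def deriv_def has_pd_def)
  have c: "continuous_on U f \<longleftrightarrow> continuous_on U g"
    using Suc.prems by (simp cong: continuous_on_cong)
  show ?case
    using hp pd c Suc.IH U unfolding Ck_Suc[OF U] by metis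
qed

text \<open>Allows the derivative to be named by a formula \<open>D\<close>; outside
  \<open>U\<close> it may differ from \<open>partial_deriv\<close>, which \<open>Ck_cong\<close>
  absorbs.\<close>

lemma Ck_SucI:
  assumes U: "openin (Euclidean_space n) U" "continuous_on U f"
    and "\<And>i u. i < n \<Longrightarrow> u \<in> U \<Longrightarrow> has_pd i f (D i u) u"
    and "\<And>i. i < n \<Longrightarrow> Ck_on n k U (D i)"
  shows "Ck_on n (Suc k) U f"
  unfolding Ck_Suc[OF U(1)]
  using assms has_pd_partial_deriv[OF assms(3)] Ck_cong[OF U(1), of "partial_deriv _ f" "D _" k] by simp

lemma Ck_subset:
  assumes "openin (Euclidean_space n) U" "openin (Euclidean_space n) V" "V \<subseteq> U"
  shows "Ck_on n k U f \<Longrightarrow> Ck_on n k V f"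
  by (induction k arbitrary: f)
     (use assms in \<open>auto simp: Ck_simps intro: continuous_on_subset\<close>)

lemma Ck_SucD:
  assumes "openin (Euclidean_space n) U"
  shows "Ck_on n (Suc k) U f \<Longrightarrow> Ck_on n k U f"
  by (induction k arbitrary: f) (use assms in \<open>auto simp: Ck_simps\<close>)

lemma Ck_mono: "openin (Euclidean_space n) U \<Longrightarrow> Ck_on n k U f \<Longrightarrow> l \<le> k \<Longrightarrow> Ck_on n l U f"
  by (induction k) (auto simp: le_Suc_eq dest: Ck_SucD)

lemma Ck_continuous: "openin (Euclidean_space n) U \<Longrightarrow> Ck_on n k U f \<Longrightarrow> continuous_on U f"
  by (cases k) (auto simp: Ck_simps)

lemma continuous_on_espace_local:
  assumes U: "openin (Euclidean_space n) U"
    and loc: "\<And>u. u \<in> U \<Longrightarrow> \<exists>V. u \<in> V \<and> openin (Euclidean_space n) V \<and> continuous_on V (f :: _ \<Rightarrow> real)"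
  shows "continuous_on U f"
  unfolding continuous_on_espace_iff[OF U]
proof (intro ballI allI impI)
  fix u and e :: real assume u: "u \<in> U" "e > 0"
  then obtain V where V: "u \<in> V" "openin (Euclidean_space n) V" "continuous_on V f" using loc by blast
  obtain d where d: "d > 0" "\<forall>v\<in>nbox n u d. \<bar>f v - f u\<bar> < e"
    using V u unfolding continuous_on_espace_iff[OF V(2)] by blast
  obtain d' where "d' > 0" "nbox n u d' \<subseteq> U" using nbox_subset_open[OF U u(1)] by blast
  then show "\<exists>d>0. nbox n u d \<subseteq> U \<and> (\<forall>v\<in>nbox n u d. \<bar>f v - f u\<bar> < e)"
    using d nbox_mono[of "min d d'" d n u] nbox_mono[of "min d d'" d' n u]
    by (intro exI[of _ "min d d'"]) auto
qed

lemma Ck_local: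
  assumes U: "openin (Euclidean_space n) U"
    and loc: "\<And>u. u \<in> U \<Longrightarrow> \<exists>V. u \<in> V \<and> openin (Euclidean_space n) V \<and> Ck_on n k V f"
  shows "Ck_on n k U f"
  using loc
proof (induction k arbitrary: f)
  case (0 f)
  then show ?case unfolding Ck_0[OF U] by (intro continuous_on_espace_local[OF U]) (blast intro: Ck_continuous)
next
  case (Suc k f)
  have "continuous_on U f"
    by (rule continuous_on_espace_local[OF U]) (meson Suc.prems Ck_continuous)
  moreover have "has_pd i f (partial_deriv i f u) u" if "i < n" "u \<in> U" for i u
    using Suc.prems[OF that(2)] Ck_Suc that(1) by blast
  moreover have "Ck_on n k U (partial_deriv i f)" if "i < n" for i
  proof (rule Suc.IH)
    fix u assume "u \<in> U"
    then obtain V where V: "u \<in> V" "openin (Euclidean_space n) V" "Ck_on n (Suc k) V f"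
      using Suc.prems by blast
    then show "\<exists>V. u \<in> V \<and> openin (Euclidean_space n) V \<and> Ck_on n k V (partial_deriv i f)"
      using that unfolding Ck_Suc[OF V(2)] by blast
  qed
  ultimately show ?case unfolding Ck_Suc[OF U] by blast
qed

lemma Ck_const [simp]: "openin (Euclidean_space n) U \<Longrightarrow> Ck_on n k U (\<lambda>_. c)"
proof (induction k arbitrary: c)
  case (Suc k)
  show ?case
    by (rule Ck_SucI[OF Suc.prems, where D = "\<lambda>_ _. 0"]) (auto simp: has_pd_def Suc)
qed (simp add: Ck_0)

lemma Ck_coord: "openin (Euclidean_space n) U \<Longrightarrow> Ck_on n k U (\<lambda>u. u i)"
proof (induction k)
  case (Suc k)
  show ?case
  proof (rule Ck_SucI[OF Suc.prems continuous_on_coord, where D = "\<lambda>j _. of_bool (i = j)"])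
    fix j u show "has_pd j (\<lambda>u. u i) (of_bool (i = j)) u"
      by (cases "i = j") (auto simp: has_pd_def intro!: derivative_eq_intros)
  qed (use Suc in auto)
qed (simp add: Ck_0 continuous_on_coord)

lemma Ck_add:
  assumes "openin (Euclidean_space n) U"
  shows "Ck_on n k U f \<Longrightarrow> Ck_on n k U g \<Longrightarrow> Ck_on n k U (\<lambda>u. f u + g u)"
proof (induction k arbitrary: f g)
  case (Suc k)
  show ?case
  proof (rule Ck_SucI[OF assms, where D = "\<lambda>i u. partial_deriv i f u + partial_deriv i g u"])
    show "continuous_on U (\<lambda>u. f u + g u)"
      using Suc.prems Ck_continuous[OF assms] by (blast intro: continuous_on_add)
    show "has_pd i (\<lambda>u. f u + g u) (partial_deriv i f u + partial_deriv i g u) u" if "i < n" "u \<in> U" for i u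
      using Suc.prems that unfolding Ck_Suc[OF assms] has_pd_def by (auto intro!: derivative_intros)
  qed (use Suc assms in \<open>auto simp: Ck_Suc\<close>)
qed (use assms in \<open>auto simp: Ck_0 intro: continuous_on_add\<close>)

lemma Ck_mult:
  assumes "openin (Euclidean_space n) U"
  shows "Ck_on n k U f \<Longrightarrow> Ck_on n k U g \<Longrightarrow> Ck_on n k U (\<lambda>u. f u * g u)"
proof (induction k arbitrary: f g)
  case (Suc k)
  show ?case
  proof (rule Ck_SucI[OF assms, where D = "\<lambda>i u. partial_deriv i f u * g u + partial_deriv i g u * f u"])
    show "continuous_on U (\<lambda>u. f u * g u)"
      using Suc.prems Ck_continuous[OF assms] by (blast intro: continuous_on_mult)
    show "has_pd i (\<lambda>u. f u * g u) (partial_deriv i f u * g u + partial_deriv i g u * f u) u"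
      if "i < n" "u \<in> U" for i u
      using Suc.prems that DERIV_mult[of "\<lambda>t. f (u(i := t))" _ "u i" UNIV "\<lambda>t. g (u(i := t))"]
      unfolding Ck_Suc[OF assms] has_pd_def by auto
    show "Ck_on n k U (\<lambda>u. partial_deriv i f u * g u + partial_deriv i g u * f u)" if "i < n" for i
      using Suc.prems that Ck_SucD[OF assms]
      by (intro Ck_add assms Suc.IH) (auto simp: Ck_Suc[OF assms])
  qed
qed (use assms in \<open>auto simp: Ck_0 intro: continuous_on_mult\<close>)

lemma Ck_sum:
  assumes "openin (Euclidean_space n) U" "finite A" "\<And>a. a \<in> A \<Longrightarrow> Ck_on n k U (f a)"
  shows "Ck_on n k U (\<lambda>u. \<Sum>a\<in>A. f a u)"
  using assms(2,3) by (induction A) (auto simp: assms(1) intro: Ck_add)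

lemma Ck_inverse:
  assumes "openin (Euclidean_space n) U"
  shows "Ck_on n k U f \<Longrightarrow> (\<And>u. u \<in> U \<Longrightarrow> f u \<noteq> 0) \<Longrightarrow> Ck_on n k U (\<lambda>u. inverse (f u))"
proof (induction k arbitrary: f)
  case (Suc k)
  let ?g = "\<lambda>u. inverse (f u)"
  show ?case
  proof (rule Ck_SucI[OF assms, where D = "\<lambda>i u. (- 1 * partial_deriv i f u) * (?g u * ?g u)"])
    show "continuous_on U (\<lambda>u. inverse (f u))"
      using Suc.prems Ck_continuous[OF assms] by (blast intro: continuous_on_inverse)
    show "has_pd i (\<lambda>u. inverse (f u)) ((- 1 * partial_deriv i f u) * (?g u * ?g u)) u"
      if "i < n" "u \<in> U" for i u
      using Suc.prems(1) Suc.prems(2)[OF that(2)] that DERIV_inverse_fun[of "\<lambda>t. f (u(i := t))" _ "u i" UNIV]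
      unfolding Ck_Suc[OF assms] has_pd_def by (auto simp: power2_eq_square power_Suc)
    show "Ck_on n k U (\<lambda>u. (- 1 * partial_deriv i f u) * (?g u * ?g u))" if "i < n" for i
      using Suc.prems that Ck_SucD[OF assms Suc.prems(1)]
      by (intro Ck_mult Ck_const assms Suc.IH) (auto simp: Ck_Suc[OF assms])
  qed
qed (use assms in \<open>auto simp: Ck_0 intro: continuous_on_inverse\<close>)

text \<open>
  Differentiability in Caratheodory's form, by changing one coordinate after the other.
\<close>

lemma Ck_caratheodory:
  assumes W: "openin (Euclidean_space m) W" "Ck_on m (Suc 0) W f" "w \<in> W"
  obtains A e where "e > 0" "nbox m w e \<subseteq> W"
    "\<And>v. v \<in> nbox m w e \<Longrightarrow> f v - f w = (\<Sum>j<m. A j v * (v j - w j))"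
    "\<And>j \<delta>. j < m \<Longrightarrow> \<delta> > 0 \<Longrightarrow> \<exists>d>0. \<forall>v\<in>nbox m w d. \<bar>A j v - partial_deriv j f w\<bar> < \<delta>"
proof -
  obtain e where e: "e > 0" "nbox m w e \<subseteq> W" using nbox_subset_open[OF W(1,3)] by blast
  have wE: "w \<in> espace m" using W(1,3) openin_espace_subset by blast
  \<comment> \<open>The hybrids lead from \<open>w\<close> to \<open>v\<close>; two consecutive ones
    differ in a single coordinate, where the mean value theorem applies.\<close>
  define hyb where "hyb v j = (\<lambda>i. if i < j then v i else w i)" for v :: "nat \<Rightarrow> real" and j :: nat
  have pd: "has_pd j f (partial_deriv j f u) u" if "u \<in> W" "j < m" for u j
    using W(2) that unfolding Ck_Suc[OF W(1)] by blast
  have "\<exists>z. f (hyb v (Suc j)) - f (hyb v j) = partial_deriv j f ((hyb v j)(j := z)) * (v j - w j)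
      \<and> \<bar>z - w j\<bar> \<le> \<bar>v j - w j\<bar>"
    if v: "v \<in> nbox m w e" and j: "j < m" for v j
  proof -
    define g where "g t = f ((hyb v j)(j := t))" for t
    have hW: "(hyb v j)(j := t) \<in> W" if "\<bar>t - w j\<bar> \<le> \<bar>v j - w j\<bar>" for t
    proof -
      have "(hyb v j)(j := t) \<in> nbox m w e"
        using v j that wE e(1) by (auto simp: nbox_def hyb_def topspace_Euclidean_space)
      then show ?thesis using e(2) by blast
    qed
    have der: "(g has_real_derivative partial_deriv j f ((hyb v j)(j := t))) (at t)" if "\<bar>t - w j\<bar> \<le> \<bar>v j - w j\<bar>" for t
      using pd[OF hW[OF that] j] by (simp add: has_pd_def g_def[abs_def])
    have ends: "g (v j) = f (hyb v (Suc j))" "g (w j) = f (hyb v j)"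
    proof -
      have "(hyb v j)(j := v j) = hyb v (Suc j)" "(hyb v j)(j := w j) = hyb v j"
        by (auto simp: hyb_def fun_eq_iff less_Suc_eq)
      then show "g (v j) = f (hyb v (Suc j))" "g (w j) = f (hyb v j)" by (simp_all add: g_def)
    qed
    have "\<exists>z. \<bar>z - w j\<bar> \<le> \<bar>v j - w j\<bar> \<and> g (v j) - g (w j) = partial_deriv j f ((hyb v j)(j := z)) * (v j - w j)"
    proof (cases "v j" "w j" rule: linorder_cases)
      case less
      obtain z where "v j < z" "z < w j" "g (w j) - g (v j) = (w j - v j) * partial_deriv j f ((hyb v j)(j := z))"
        using MVT2[OF less, of g "\<lambda>z. partial_deriv j f ((hyb v j)(j := z))"] der less by fastforce
      then show ?thesis by (intro exI[of _ z]) (auto simp: algebra_simps)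
    next
      case greater
      obtain z where "w j < z" "z < v j" "g (v j) - g (w j) = (v j - w j) * partial_deriv j f ((hyb v j)(j := z))"
        using MVT2[OF greater, of g "\<lambda>z. partial_deriv j f ((hyb v j)(j := z))"] der greater by fastforce
      then show ?thesis by (intro exI[of _ z]) (auto simp: algebra_simps)
    qed auto
    then show ?thesis unfolding ends by blast
  qed
  then obtain Z where Z: "\<And>v j. v \<in> nbox m w e \<Longrightarrow> j < m \<Longrightarrow>
      f (hyb v (Suc j)) - f (hyb v j) = partial_deriv j f ((hyb v j)(j := Z v j)) * (v j - w j)
      \<and> \<bar>Z v j - w j\<bar> \<le> \<bar>v j - w j\<bar>" by metis
  define A where "A j v = partial_deriv j f ((hyb v j)(j := Z v j))" for j v
  have sum: "f v - f w = (\<Sum>j<m. A j v * (v j - w j))" if v: "v \<in> nbox m w e" for v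
  proof -
    have "hyb v m = v" "hyb v 0 = w"
      using v wE by (auto simp: hyb_def nbox_def topspace_Euclidean_space fun_eq_iff)
    then have "f v - f w = (\<Sum>j<m. f (hyb v (Suc j)) - f (hyb v j))"
      using sum_lessThan_telescope[of "\<lambda>j. f (hyb v j)" m] by simp
    also have "\<dots> = (\<Sum>j<m. A j v * (v j - w j))" using Z[OF v] by (simp add: A_def)
    finally show ?thesis .
  qed
  have lim: "\<exists>d>0. \<forall>v\<in>nbox m w d. \<bar>A j v - partial_deriv j f w\<bar> < \<delta>" if j: "j < m" "\<delta> > 0" for j \<delta>
  proof -
    have "continuous_on W (partial_deriv j f)"
      using W(2) j Ck_continuous[OF W(1)] unfolding Ck_Suc[OF W(1)] by blast
    then obtain d where d: "d > 0" "\<forall>v\<in>nbox m w d. \<bar>partial_deriv j f v - partial_deriv j f w\<bar> < \<delta>"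
      unfolding continuous_on_espace_iff[OF W(1)] using W(3) j(2) by blast
    have "\<bar>A j v - partial_deriv j f w\<bar> < \<delta>" if v: "v \<in> nbox m w (min d e)" for v
    proof -
      have ve: "v \<in> nbox m w e" "v \<in> nbox m w d"
        using v nbox_mono[of "min d e" d m w] nbox_mono[of "min d e" e m w] by auto
      have "(hyb v j)(j := Z v j) \<in> nbox m w d"
        using Z[OF ve(1) j(1)] ve(2) wE j(1) d(1)
        by (auto simp: nbox_def hyb_def topspace_Euclidean_space intro: le_less_trans)
      then show ?thesis using d(2) by (auto simp: A_def)
    qed
    then show ?thesis using d(1) e(1) by (intro exI[of _ "min d e"]) auto
  qed
  show ?thesis by (rule that[OF e sum lim])
qed

text \<open>The Caratheodory coefficients converge along the curve and multiply its difference
  quotients, so the chain rule is obtained without a total derivative of \<open>f\<close>.\<close>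

lemma has_derivative_along_curve:
  assumes W: "openin (Euclidean_space m) W" "Ck_on m (Suc 0) W f"
    and c: "\<forall>\<^sub>F t in nhds a. c t \<in> W"
    and d: "\<And>j. j < m \<Longrightarrow> ((\<lambda>t. c t j) has_real_derivative D j) (at a)"
  shows "((\<lambda>t. f (c t)) has_real_derivative (\<Sum>j<m. partial_deriv j f (c a) * D j)) (at a)"
proof -
  have cW: "c a \<in> W" using eventually_nhds_x_imp_x[OF c] .
  obtain A e where e: "e > 0" "nbox m (c a) e \<subseteq> W"
    and A: "\<And>v. v \<in> nbox m (c a) e \<Longrightarrow> f v - f (c a) = (\<Sum>j<m. A j v * (v j - c a j))"
    and lim: "\<And>j \<delta>. j < m \<Longrightarrow> \<delta> > 0 \<Longrightarrow> \<exists>d>0. \<forall>v\<in>nbox m (c a) d. \<bar>A j v - partial_deriv j f (c a)\<bar> < \<delta>"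
    by (rule Ck_caratheodory[OF W cW]) blast
  have ev: "\<forall>\<^sub>F t in at a. c t \<in> nbox m (c a) d" if "d > 0" for d
  proof -
    have "\<forall>\<^sub>F t in at a. \<forall>j\<in>{..<m}. \<bar>c t j - c a j\<bar> < d"
    proof (intro eventually_ball_finite ballI finite_lessThan)
      fix j assume "j \<in> {..<m}"
      then have "isCont (\<lambda>t. c t j) a" using d[of j] DERIV_isCont by auto
      then show "\<forall>\<^sub>F t in at a. \<bar>c t j - c a j\<bar> < d"
        unfolding isCont_def tendsto_iff dist_real_def using that by blast
    qed
    moreover have "\<forall>\<^sub>F t in at a. c t \<in> espace m"
      using c openin_espace_subset[OF W(1)] unfolding eventually_nhds_conv_at by (auto elim: eventually_mono)
    ultimately show ?thesis by eventually_elim (auto simp: nbox_def)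
  qed
  have A_lim: "((\<lambda>t. A j (c t)) \<longlongrightarrow> partial_deriv j f (c a)) (at a)" if j: "j < m" for j
    unfolding tendsto_iff dist_real_def
  proof (intro allI impI)
    fix \<delta> :: real assume "\<delta> > 0"
    then obtain d where "d > 0" "\<forall>v\<in>nbox m (c a) d. \<bar>A j v - partial_deriv j f (c a)\<bar> < \<delta>"
      using lim[OF j] by blast
    then show "\<forall>\<^sub>F t in at a. \<bar>A j (c t) - partial_deriv j f (c a)\<bar> < \<delta>"
      using ev[of d] by (auto elim: eventually_mono)
  qed
  have "((\<lambda>t. \<Sum>j<m. A j (c t) * ((c t j - c a j) / (t - a))) \<longlongrightarrow> (\<Sum>j<m. partial_deriv j f (c a) * D j)) (at a)"
    using d A_lim unfolding has_field_derivative_iff by (intro tendsto_sum tendsto_mult) auto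
  moreover have "\<forall>\<^sub>F t in at a. (\<Sum>j<m. A j (c t) * ((c t j - c a j) / (t - a))) = (f (c t) - f (c a)) / (t - a)"
    using ev[OF e(1)] by eventually_elim (simp add: A sum_divide_distrib)
  ultimately show ?thesis
    unfolding has_field_derivative_iff by (rule Lim_transform_eventually)
qed

lemma has_pd_comp:
  assumes U: "openin (Euclidean_space n) U" "u \<in> U" "i < n"
    and W: "openin (Euclidean_space m) W" "Ck_on m (Suc 0) W f" "g ` U \<subseteq> W"
    and g: "\<And>j. j < m \<Longrightarrow> has_pd i (\<lambda>u. g u j) (D j) u"
  shows "has_pd i (\<lambda>u. f (g u)) (\<Sum>j<m. partial_deriv j f (g u) * D j) u"
proof -
  have "\<forall>\<^sub>F t in nhds (u i). g (u(i := t)) \<in> W"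
    using eventually_upd[OF U] W(3) by (auto elim!: eventually_mono)
  from has_derivative_along_curve[OF W(1,2) this, of D] show ?thesis
    using g by (simp add: has_pd_def)
qed

lemma continuous_on_into_espace:
  assumes "\<And>u. u \<in> U \<Longrightarrow> g u \<in> espace m" "\<And>j. j < m \<Longrightarrow> continuous_on U (\<lambda>u. g u j)"
  shows "continuous_on U g"
proof (rule continuous_on_coordinatewise_then_product)
  fix j show "continuous_on U (\<lambda>u. g u j)"
  proof (cases "j < m")
    case False
    then have "\<And>u. u \<in> U \<Longrightarrow> g u j = 0" using assms(1) espaceD by force
    then show ?thesis by (simp cong: continuous_on_cong)
  qed (rule assms(2))
qed

text \<open>The derivative of the composite is a sum of products in which the partial derivatives of
  \<open>f\<close> are composed with the same \<open>g\<close>; hence the induction on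
  \<open>k\<close> generalises over \<open>f\<close> alone.\<close>

lemma Ck_comp:
  assumes U: "openin (Euclidean_space n) U" and W: "openin (Euclidean_space m) W" "g ` U \<subseteq> W"
  shows "Ck_on m k W f \<Longrightarrow> (\<And>j. j < m \<Longrightarrow> Ck_on n k U (\<lambda>u. g u j)) \<Longrightarrow> Ck_on n k U (\<lambda>u. f (g u))"
proof (induction k arbitrary: f)
  case (0 f)
  have "continuous_on U g"
    by (rule continuous_on_into_espace[where m = m])
       (use 0 W openin_espace_subset[OF W(1)] U in \<open>auto simp: Ck_0\<close>)
  then show ?case
    using 0 W U continuous_on_compose2[of W f U g] by (simp add: Ck_0)
next
  case (Suc k f)
  have "continuous_on U g"
    by (rule continuous_on_into_espace[where m = m])
       (use W openin_espace_subset[OF W(1)] Ck_continuous[OF U Suc.prems(2)] in auto)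
  then have c: "continuous_on U (\<lambda>u. f (g u))"
    using W Ck_continuous[OF W(1) Suc.prems(1)] continuous_on_compose2[of W f U g] by blast
  have g: "has_pd i (\<lambda>u. g u j) (partial_deriv i (\<lambda>u. g u j) u) u"
    "Ck_on n k U (partial_deriv i (\<lambda>u. g u j))" if "j < m" "i < n" "u \<in> U" for i j u
    using Suc.prems(2)[OF that(1)] that unfolding Ck_Suc[OF U] by blast+
  show ?case
  proof (rule Ck_SucI[OF U c, where D = "\<lambda>i u. \<Sum>j<m. partial_deriv j f (g u) * partial_deriv i (\<lambda>u. g u j) u"])
    fix i u assume "i < n" "u \<in> U"
    then show "has_pd i (\<lambda>u. f (g u)) (\<Sum>j<m. partial_deriv j f (g u) * partial_deriv i (\<lambda>u. g u j) u) u"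
      using g Ck_mono[OF W(1) Suc.prems(1), of "Suc 0"] by (intro has_pd_comp[OF U _ _ W(1) _ W(2)]) auto
  next
    fix i assume i: "i < n"
    show "Ck_on n k U (\<lambda>u. \<Sum>j<m. partial_deriv j f (g u) * partial_deriv i (\<lambda>u. g u j) u)"
    proof (intro Ck_sum Ck_mult U finite_lessThan)
      fix j assume "j \<in> {..<m}"
      then have j: "j < m" by simp
      show "Ck_on n k U (\<lambda>u. partial_deriv j f (g u))"
        by (rule Suc.IH) (use Suc.prems j Ck_SucD[OF U] in \<open>auto simp: Ck_Suc[OF W(1)]\<close>)
      show "Ck_on n k U (partial_deriv i (\<lambda>u. g u j))"
        using Suc.prems(2)[OF j] i unfolding Ck_Suc[OF U] by blast
    qed
  qed
qed

section \<open>Smooth maps between open sets of model spaces\<close>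

abbreviation eopen :: "nat \<Rightarrow> (nat \<Rightarrow> real) set \<Rightarrow> bool" where
  "eopen n \<equiv> openin (Euclidean_space n)"

lemma smooth_coordsD: "smooth_coords n m U f \<Longrightarrow> j < m \<Longrightarrow> Ck_on n k U (\<lambda>u. f u j)"
  by (simp add: smooth_coords_def)

lemma smooth_coords_comp:
  assumes "eopen n U" "eopen m W" "g ` U \<subseteq> W" "smooth_coords m p W f" "smooth_coords n m U g"
  shows "smooth_coords n p U (\<lambda>u. f (g u))"
  unfolding smooth_coords_def
proof (intro allI impI)
  fix j k assume "j < p"
  then show "Ck_on n k U (\<lambda>u. f (g u) j)"
    using Ck_comp[OF assms(1,2,3), of k "\<lambda>w. f w j"] assms(4,5) by (simp add: smooth_coords_def)
qed

lemma smooth_coords_subset: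
  "eopen n U \<Longrightarrow> eopen n V \<Longrightarrow> V \<subseteq> U \<Longrightarrow> smooth_coords n m U f \<Longrightarrow> smooth_coords n m V f"
  using Ck_subset by (simp add: smooth_coords_def)

lemma smooth_coords_cong:
  assumes "eopen n U" "\<And>u j. u \<in> U \<Longrightarrow> j < m \<Longrightarrow> f u j = g u j"
  shows "smooth_coords n m U f \<longleftrightarrow> smooth_coords n m U g"
proof -
  have "Ck_on n k U (\<lambda>u. f u j) \<longleftrightarrow> Ck_on n k U (\<lambda>u. g u j)" if "j < m" for k j
    by (rule Ck_cong) (use assms that in auto)
  then show ?thesis by (simp add: smooth_coords_def)
qed

lemma smooth_coords_id: "eopen n U \<Longrightarrow> smooth_coords n m U (\<lambda>u. u)"
  by (simp add: smooth_coords_def Ck_coord)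

lemma smooth_coords_continuous:
  assumes "eopen n U" "smooth_coords n m U g" "g ` U \<subseteq> espace m"
  shows "continuous_map (subtopology (Euclidean_space n) U) (Euclidean_space m) g"
proof -
  have "topspace (subtopology (Euclidean_space n) U) = U"
    using openin_espace_subset[OF assms(1)] by (simp add: Int_absorb1)
  moreover have "continuous_on U g"
    by (rule continuous_on_into_espace[where m = m])
       (use assms(3) Ck_continuous[OF assms(1) smooth_coordsD[OF assms(2)]] in auto)
  ultimately show ?thesis
    using assms(3) by (simp add: cm_Euclidean_space_iff_continuous_on image_subset_iff_funcset)
qed

lemma eopen_preimage:
  assumes "eopen n U" "smooth_coords n m U g" "g ` U \<subseteq> espace m" "eopen m W"
  shows "eopen n {u \<in> U. g u \<in> W}"
proof -
  have "topspace (subtopology (Euclidean_space n) U) = U"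
    using openin_espace_subset[OF assms(1)] by (simp add: Int_absorb1)
  then show ?thesis
    using openin_continuous_map_preimage[OF smooth_coords_continuous[OF assms(1-3)] assms(4)]
      openin_trans_full[OF _ assms(1)] by simp
qed

text \<open>
  The one-dimensional implicit function theorem.
\<close>

lemma coord_replace:
  assumes W: "eopen n W" and g: "\<And>k. Ck_on n k W g" and u0: "u0 \<in> W" and i: "i < n"
    and nz: "partial_deriv i g u0 \<noteq> 0"
  obtains U V h where "eopen n U" "u0 \<in> U" "U \<subseteq> W" "eopen n V" "\<And>k. Ck_on n k V h"
    "\<And>u. u \<in> U \<Longrightarrow> u(i := g u) \<in> V \<and> h (u(i := g u)) = u i"
    "\<And>w. w \<in> V \<Longrightarrow> w(i := h w) \<in> U \<and> g (w(i := h w)) = w i"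
proof -
  have pdC: "Ck_on n k W (partial_deriv j g)" if "j < n" for j k
    using g[of "Suc k"] that unfolding Ck_Suc[OF W] by blast
  have pd: "has_pd j g (partial_deriv j g u) u" if "j < n" "u \<in> W" for j u
    using g[of "Suc 0"] that unfolding Ck_Suc[OF W] by blast
  have "continuous_on W (partial_deriv i g)" using Ck_continuous[OF W pdC[OF i, of 0]] .
  then obtain e where e: "e > 0" "nbox n u0 e \<subseteq> W"
    and near: "\<forall>v\<in>nbox n u0 e. \<bar>partial_deriv i g v - partial_deriv i g u0\<bar> < \<bar>partial_deriv i g u0\<bar>"
    unfolding continuous_on_espace_iff[OF W] using u0 nz by (metis zero_less_abs_iff)
  \<comment> \<open>The sign makes \<open>s * g\<close> increasing in the \<open>i\<close>-th
    coordinate on the box, whichever sign the derivative has.\<close>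
  define s where "s = sgn (partial_deriv i g u0)"
  have s: "s * s = 1" "s \<noteq> 0" using nz by (auto simp: s_def sgn_if)
  define U where "U = nbox n u0 e"
  have oU: "eopen n U" by (simp add: U_def openin_nbox)
  have UE: "U \<subseteq> espace n" and UW: "U \<subseteq> W" using e(2) by (auto simp: U_def nbox_def)
  have u0U: "u0 \<in> U" using in_nbox_self e(1) u0 openin_espace_subset[OF W] by (auto simp: U_def)
  have pos: "s * partial_deriv i g u > 0" if "u \<in> U" for u
    using near that nz by (auto simp: U_def s_def sgn_if abs_if split: if_splits)
  have nzU: "partial_deriv i g u \<noteq> 0" if "u \<in> U" for u using pos[OF that] by auto
  have seg: "u(i := t) \<in> U" if "u(i := a) \<in> U" "u(i := b) \<in> U" "a \<le> t" "t \<le> b" for u a b t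
  proof -
    have "\<bar>t - u0 i\<bar> < e"
      using that i by (auto simp: U_def nbox_def abs_less_iff dest!: spec[of _ i])
    then show ?thesis using that(1) i by (auto simp: U_def nbox_def topspace_Euclidean_space split: if_splits)
  qed
  have der: "((\<lambda>t. s * g (u(i := t))) has_real_derivative s * partial_deriv i g (u(i := t))) (at t)"
    if "u(i := t) \<in> U" for u t
    using pd[OF i, of "u(i := t)"] that UW by (auto simp: has_pd_def intro!: DERIV_cmult)
  have mono: "s * g (u(i := a)) < s * g (u(i := b))" if "u(i := a) \<in> U" "u(i := b) \<in> U" "a < b" for u a b
    by (rule DERIV_pos_imp_increasing[OF that(3)]) (use der pos seg[OF that(1,2)] in blast)
  define \<Theta> where "\<Theta> u = u(i := g u)" for u
  have inj: "inj_on \<Theta> U"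
  proof (rule inj_onI)
    fix u v assume uv: "u \<in> U" "v \<in> U" "\<Theta> u = \<Theta> v"
    have v: "v = u(i := v i)" using uv(3) by (auto simp: \<Theta>_def fun_eq_iff split: if_splits)
    have gg: "g u = g v" using uv(3) by (auto simp: \<Theta>_def dest: fun_cong[of _ _ i])
    have "u i = v i"
    proof (rule ccontr)
      assume "u i \<noteq> v i"
      then have "s * g (u(i := u i)) \<noteq> s * g (u(i := v i))"
        using mono[of u "u i" "v i"] mono[of u "v i" "u i"] uv(1,2) v by (cases "u i < v i") auto
      then show False using gg v by simp
    qed
    then show "u = v" using v fun_upd_triv by metis
  qed
  define V where "V = \<Theta> ` U"
  define h where "h w = inv_into U \<Theta> w i" for w
  have h1: "h (\<Theta> u) = u i" if "u \<in> U" for u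
    using inj that by (simp add: h_def)
  have h2: "w(i := h w) \<in> U \<and> \<Theta> (w(i := h w)) = w" if w: "w \<in> V" for w
  proof -
    obtain u where u: "u \<in> U" "w = \<Theta> u" using w by (auto simp: V_def)
    have "h w = u i" using h1[OF u(1)] u(2) by simp
    then have "w(i := h w) = u" using u(2) by (auto simp: \<Theta>_def)
    then show ?thesis using u by simp
  qed
  \<comment> \<open>One statement yields both openness of \<open>V\<close> and continuity of
    \<open>h\<close>. The values of \<open>s * g\<close> at \<open>a\<close> and \<open>b\<close>
    lie strictly on either side of the wanted value; this persists for nearby \<open>w\<close>, and
    the intermediate value theorem gives a solution between \<open>a\<close> and
    \<open>b\<close>.\<close>
  have key: "\<exists>d>0. \<forall>w\<in>nbox n w0 d. w \<in> V \<and> \<bar>h w - h w0\<bar> < \<epsilon>" if w0: "w0 \<in> V" and \<epsilon>: "\<epsilon> > 0" for w0 \<epsilon>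
  proof -
    define u1 where "u1 = w0(i := h w0)"
    have u1: "u1 \<in> U" "\<Theta> u1 = w0" using h2[OF w0] by (auto simp: u1_def)
    obtain r where r: "r > 0" "nbox n u1 r \<subseteq> U" using nbox_subset_open[OF oU u1(1)] by blast
    define q where "q = min (r/2) (\<epsilon>/2)"
    have q: "q > 0" "q < r" "q < \<epsilon>" using r \<epsilon> by (auto simp: q_def)
    have inU: "u1(i := t) \<in> U" if "\<bar>t - u1 i\<bar> \<le> q" for t
      using that q r u1(1) UE i by (intro subsetD[OF r(2)]) (auto simp: nbox_def espace_upd)
    define a b where "a = u1 i - q" and "b = u1 i + q"
    have ab: "u1(i := a) \<in> U" "u1(i := b) \<in> U" using inU q by (auto simp: a_def b_def)
    have w0i: "g u1 = w0 i" using u1(2) by (auto simp: \<Theta>_def)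
    have m1: "s * g (u1(i := a)) < s * w0 i" and m2: "s * w0 i < s * g (u1(i := b))"
      using mono[of u1 a "u1 i"] mono[of u1 "u1 i" b] ab q u1(1) w0i by (auto simp: a_def b_def)
    \<comment> \<open>Half of the smaller gap: the endpoint values and the wanted value may each
      move by less than \<open>\<eta>\<close> without crossing.\<close>
    define \<eta> where "\<eta> = min (s * w0 i - s * g (u1(i := a))) (s * g (u1(i := b)) - s * w0 i) / 2"
    have \<eta>: "\<eta> > 0" using m1 m2 by (auto simp: \<eta>_def)
    have \<eta>': "2 * \<eta> \<le> s * w0 i - s * g (u1(i := a))" "2 * \<eta> \<le> s * g (u1(i := b)) - s * w0 i"
      by (auto simp: \<eta>_def)
    have gc: "continuous_on U g" using Ck_continuous[OF W g] UW continuous_on_subset by blast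
    obtain d1 where d1: "d1 > 0" "nbox n (u1(i := a)) d1 \<subseteq> U" "\<forall>v\<in>nbox n (u1(i := a)) d1. \<bar>g v - g (u1(i := a))\<bar> < \<eta>"
      using gc ab(1) \<eta> unfolding continuous_on_espace_iff[OF oU] by blast
    obtain d2 where d2: "d2 > 0" "nbox n (u1(i := b)) d2 \<subseteq> U" "\<forall>v\<in>nbox n (u1(i := b)) d2. \<bar>g v - g (u1(i := b))\<bar> < \<eta>"
      using gc ab(2) \<eta> unfolding continuous_on_espace_iff[OF oU] by blast
    define d where "d = min \<eta> (min d1 d2)"
    have "d > 0" using d1 d2 \<eta> by (simp add: d_def)
    moreover have "w \<in> V \<and> \<bar>h w - h w0\<bar> < \<epsilon>" if w: "w \<in> nbox n w0 d" for w
    proof -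
      have wE: "w \<in> espace n" using w by (simp add: nbox_def)
      have off: "\<bar>w l - u1 l\<bar> < d" if "l < n" "l \<noteq> i" for l using w that by (auto simp: nbox_def u1_def)
      have wi: "\<bar>w i - w0 i\<bar> < d" using w i by (auto simp: nbox_def)
      have wa: "w(i := a) \<in> nbox n (u1(i := a)) d1" and wb: "w(i := b) \<in> nbox n (u1(i := b)) d2"
        using off d1 d2 wE i by (auto simp: nbox_def d_def espace_upd)
      have wU: "w(i := a) \<in> U" "w(i := b) \<in> U" using wa wb d1 d2 by auto
      have sabs: "\<bar>s * x - s * y\<bar> = \<bar>x - y\<bar>" for x y
        using s(1) by (metis abs_mult abs_mult_self_eq mult_cancel_right1 right_diff_distrib abs_1 square_eq_1_iff abs_minus_cancel mult.commute)
      have "\<bar>s * g (w(i := a)) - s * g (u1(i := a))\<bar> < \<eta>" "\<bar>s * g (w(i := b)) - s * g (u1(i := b))\<bar> < \<eta>"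
        "\<bar>s * w i - s * w0 i\<bar> < \<eta>"
        unfolding sabs using d1(3) d2(3) wa wb wi by (auto simp: d_def)
      then have lt: "s * g (w(i := a)) < s * w i" "s * w i < s * g (w(i := b))"
        using \<eta>' by (simp_all only: abs_less_iff) linarith+
      have "\<exists>t\<ge>a. t \<le> b \<and> s * g (w(i := t)) = s * w i"
      proof (rule IVT)
        show "a \<le> b" using q by (simp add: a_def b_def)
        show "\<forall>t. a \<le> t \<and> t \<le> b \<longrightarrow> isCont (\<lambda>t. s * g (w(i := t))) t"
          using der[OF seg[OF wU]] DERIV_isCont by blast
      qed (use lt in auto)
      then obtain t where t: "a \<le> t" "t \<le> b" "g (w(i := t)) = w i" using s(2) by auto
      have tU: "w(i := t) \<in> U" using seg[OF wU t(1,2)] .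
      have "\<Theta> (w(i := t)) = w" using t(3) by (auto simp: \<Theta>_def fun_eq_iff)
      then have "w \<in> V" "h w = t" using tU h1[OF tU] by (simp_all add: V_def rev_image_eqI)
      moreover have "h w0 = u1 i" by (simp add: u1_def)
      ultimately show ?thesis using t q by (auto simp: a_def b_def)
    qed
    ultimately show ?thesis by blast
  qed
  have VE: "V \<subseteq> espace n" using UE i by (auto simp: V_def \<Theta>_def espace_upd)
  have oV: "eopen n V"
  proof (subst openin_subopen, intro ballI)
    fix w assume w: "w \<in> V"
    obtain d where "d > 0" "\<forall>w'\<in>nbox n w d. w' \<in> V" using key[OF w, of 1] by auto
    then show "\<exists>T. eopen n T \<and> w \<in> T \<and> T \<subseteq> V"
      using w VE by (intro exI[of _ "nbox n w d"]) (auto intro!: openin_nbox in_nbox_self)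
  qed
  have hc: "continuous_on V h"
    unfolding continuous_on_espace_iff[OF oV] using key by (metis subsetI)
  define \<Psi> where "\<Psi> w = w(i := h w)" for w
  have g\<Psi>: "g (\<Psi> w) = w i" if "w \<in> V" for w
    using h2[OF that] unfolding \<Theta>_def \<Psi>_def by (metis fun_upd_same)
  \<comment> \<open>The formula of implicit differentiation: the inverse of the \<open>i\<close>-th
    partial derivative of \<open>g\<close> if \<open>j = i\<close>, and minus the quotient of the
    \<open>j\<close>-th by the \<open>i\<close>-th otherwise.\<close>
  define D where "D j w = (of_bool (i = j) + (- of_bool (i \<noteq> j)) * partial_deriv j g (\<Psi> w)) * inverse (partial_deriv i g (\<Psi> w))" for j w
  have hpd: "has_pd j h (D j w) w" if j: "j < n" and w: "w \<in> V" for j w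
  proof -
    have \<Psi>U: "\<Psi> w \<in> U" using h2[OF w] by (simp add: \<Psi>_def)
    have "Ck_on n (Suc 0) U g" using Ck_subset[OF W oU UW g] .
    then obtain A r where r: "r > 0" "nbox n (\<Psi> w) r \<subseteq> U"
      and A: "\<And>v. v \<in> nbox n (\<Psi> w) r \<Longrightarrow> g v - g (\<Psi> w) = (\<Sum>l<n. A l v * (v l - \<Psi> w l))"
      and lim: "\<And>l \<delta>. l < n \<Longrightarrow> \<delta> > 0 \<Longrightarrow> \<exists>d>0. \<forall>v\<in>nbox n (\<Psi> w) d. \<bar>A l v - partial_deriv l g (\<Psi> w)\<bar> < \<delta>"
      using \<Psi>U by (rule Ck_caratheodory[OF oU]) blast
    define c where "c t = \<Psi> (w(j := t))" for t
    have cw: "c (w j) = \<Psi> w" by (simp add: c_def)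
    have ev: "\<forall>\<^sub>F t in at (w j). w(j := t) \<in> V \<and> c t \<in> nbox n (\<Psi> w) d" if d: "d > 0" for d
    proof -
      obtain d' where d': "d' > 0" "\<forall>w'\<in>nbox n w d'. w' \<in> V \<and> \<bar>h w' - h w\<bar> < d" using key[OF w d] by blast
      have "\<forall>\<^sub>F t in nhds (w j). w(j := t) \<in> nbox n w (min d d')"
        using eventually_upd[OF openin_nbox in_nbox_self j] w VE d d' by auto
      then have "\<forall>\<^sub>F t in at (w j). w(j := t) \<in> nbox n w (min d d')"
        by (simp add: eventually_nhds_conv_at)
      then show ?thesis
      proof eventually_elim
        case (elim t)
        then have "w(j := t) \<in> nbox n w d'" "w(j := t) \<in> nbox n w d"
          using nbox_mono[of "min d d'" d n w] nbox_mono[of "min d d'" d' n w] by auto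
        then show ?case using d' i unfolding c_def \<Psi>_def by (auto simp: nbox_def espace_upd)
      qed
    qed
    have A_lim: "((\<lambda>t. A l (c t)) \<longlongrightarrow> partial_deriv l g (\<Psi> w)) (at (w j))" if l: "l < n" for l
      unfolding tendsto_iff dist_real_def
    proof (intro allI impI)
      fix \<delta> :: real assume "\<delta> > 0"
      then obtain d where "d > 0" "\<forall>v\<in>nbox n (\<Psi> w) d. \<bar>A l v - partial_deriv l g (\<Psi> w)\<bar> < \<delta>"
        using lim[OF l] by blast
      then show "\<forall>\<^sub>F t in at (w j). \<bar>A l (c t) - partial_deriv l g (\<Psi> w)\<bar> < \<delta>"
        using ev[of d] by (auto elim: eventually_mono)
    qed
    have Ai: "\<forall>\<^sub>F t in at (w j). A i (c t) \<noteq> 0"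
      using tendsto_imp_eventually_ne[OF A_lim[OF i] nzU[OF \<Psi>U]] .
    have "\<forall>\<^sub>F t in at (w j). t \<noteq> w j" by (simp add: eventually_at_filter)
    with ev[OF r(1)] Ai have "\<forall>\<^sub>F t in at (w j).
        (of_bool (i = j) + (- of_bool (i \<noteq> j)) * A j (c t)) * inverse (A i (c t)) = (h (w(j := t)) - h w) / (t - w j)"
    proof eventually_elim
      case (elim t)
      have "g (c t) = (w(j := t)) i" "g (\<Psi> w) = w i"
        using g\<Psi>[OF w] g\<Psi>[of "w(j := t)"] elim(1) by (auto simp: c_def)
      \<comment> \<open>Applying \<open>g\<close> after \<open>\<Psi>\<close> returns the
        \<open>i\<close>-th coordinate, which moves only if \<open>i = j\<close>, while the argument
        of \<open>g\<close> moves only in the coordinates \<open>i\<close> and \<open>j\<close>.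
        Solving for the increment of \<open>h\<close> gives its difference quotient.\<close>
      then have "of_bool (i = j) * (t - w j) = (\<Sum>l<n. A l (c t) * (c t l - \<Psi> w l))"
        using A[of "c t"] elim(1) by auto
      also have "\<dots> = (\<Sum>l\<in>{i,j}. A l (c t) * (c t l - \<Psi> w l))"
        by (rule sum.mono_neutral_right) (use i j in \<open>auto simp: c_def \<Psi>_def\<close>)
      also have "\<dots> = A i (c t) * (h (w(j := t)) - h w) + of_bool (i \<noteq> j) * (A j (c t) * (t - w j))"
        by (cases "i = j") (auto simp: c_def \<Psi>_def)
      finally show ?case using elim(2,3) by (cases "i = j") (auto simp: field_simps)
    qed
    moreover have "((\<lambda>t. (of_bool (i = j) + (- of_bool (i \<noteq> j)) * A j (c t)) * inverse (A i (c t))) \<longlongrightarrow> D j w) (at (w j))"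
      unfolding D_def by (intro tendsto_intros A_lim i j nzU \<Psi>U)
    ultimately show ?thesis
      unfolding has_pd_def has_field_derivative_iff using Lim_transform_eventually by force
  qed
  have "Ck_on n k V h" for k
  proof (induction k)
    case (Suc k)
    \<comment> \<open>Bootstrapping: if \<open>h\<close> is of class C^k, so are
      \<open>\<Psi>\<close> and the formula \<open>D\<close>, and then \<open>h\<close> is of class
      C^(k+1).\<close>
    have \<Psi>c: "Ck_on n k V (\<lambda>w. f (\<Psi> w))" if "Ck_on n k U f" for f
    proof (rule Ck_comp[OF oV oU _ that])
      show "\<Psi> ` V \<subseteq> U" using h2 by (auto simp: \<Psi>_def)
      show "Ck_on n k V (\<lambda>w. \<Psi> w j)" for j
        using Suc Ck_coord[OF oV] by (cases "j = i") (auto simp: \<Psi>_def)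
    qed
    show ?case
    proof (rule Ck_SucI[OF oV hc hpd])
      fix j assume j: "j < n"
      show "Ck_on n k V (D j)"
        unfolding D_def
        by (intro Ck_mult Ck_add Ck_const Ck_inverse \<Psi>c oV Ck_subset[OF W oU UW] pdC i j)
           (use h2 nzU in \<open>auto simp: \<Psi>_def\<close>)
    qed
  qed (simp add: Ck_0 oV hc)
  then show ?thesis
  proof (rule that[OF oU u0U UW oV])
    show "u(i := g u) \<in> V \<and> h (u(i := g u)) = u i" if "u \<in> U" for u
      using h1[OF that] that by (auto simp: V_def \<Theta>_def)
    show "w(i := h w) \<in> U \<and> g (w(i := h w)) = w i" if "w \<in> V" for w
      using h2[OF that] g\<Psi>[OF that] by (simp add: \<Psi>_def)
  qed
qed

section \<open>Changes of coordinates\<close>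

definition local_diffeo ::
  "nat \<Rightarrow> (nat \<Rightarrow> real) set \<Rightarrow> (nat \<Rightarrow> real) set \<Rightarrow> ((nat \<Rightarrow> real) \<Rightarrow> nat \<Rightarrow> real) \<Rightarrow> ((nat \<Rightarrow> real) \<Rightarrow> nat \<Rightarrow> real) \<Rightarrow> bool" where
  "local_diffeo n U V F G \<longleftrightarrow> eopen n U \<and> eopen n V \<and> smooth_coords n n U F \<and> smooth_coords n n V G \<and>
     (\<forall>u\<in>U. F u \<in> V \<and> G (F u) = u) \<and> (\<forall>v\<in>V. G v \<in> U \<and> F (G v) = v)"

lemma local_diffeo_id: "eopen n U \<Longrightarrow> local_diffeo n U U (\<lambda>u. u) (\<lambda>u. u)"
  by (simp add: local_diffeo_def smooth_coords_id)

lemma local_diffeo_comp: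
  assumes "local_diffeo n U V F G" "local_diffeo n V W F' G'"
  shows "local_diffeo n U W (\<lambda>u. F' (F u)) (\<lambda>w. G (G' w))"
proof -
  have "smooth_coords n n U (\<lambda>u. F' (F u))" "smooth_coords n n W (\<lambda>w. G (G' w))"
    by (rule smooth_coords_comp[where W = V]; use assms in \<open>auto simp: local_diffeo_def\<close>)+
  then show ?thesis using assms by (auto simp: local_diffeo_def)
qed

lemma local_diffeo_restrict:
  assumes F: "local_diffeo n U V F G" and V': "eopen n V'" "V' \<subseteq> V"
  shows "local_diffeo n {u \<in> U. F u \<in> V'} V' F G"
proof -
  have "eopen n {u \<in> U. F u \<in> V'}"
    by (rule eopen_preimage[where m = n])
       (use F V' openin_espace_subset in \<open>fastforce simp: local_diffeo_def\<close>)+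
  moreover have "smooth_coords n n {u \<in> U. F u \<in> V'} F"
    by (rule smooth_coords_subset[OF _ calculation]) (use F in \<open>auto simp: local_diffeo_def\<close>)
  moreover have "smooth_coords n n V' G"
    by (rule smooth_coords_subset[OF _ V']) (use F in \<open>auto simp: local_diffeo_def\<close>)
  ultimately show ?thesis using F V' by (auto simp: local_diffeo_def)
qed

text \<open>Serves to reorder coordinates when the slot or component found by a nonvanishing
  derivative is not the one wanted next.\<close>

definition swap_coords :: "nat \<Rightarrow> nat \<Rightarrow> (nat \<Rightarrow> real) \<Rightarrow> nat \<Rightarrow> real" where
  "swap_coords i j u = u(i := u j, j := u i)"

lemma swap_coords_swap [simp]: "swap_coords i j (swap_coords i j u) = u"
  by (simp add: swap_coords_def fun_eq_iff)

lemma swap_coords_apply: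
  "swap_coords i j u i = u j" "swap_coords i j u j = u i"
  "l \<noteq> i \<Longrightarrow> l \<noteq> j \<Longrightarrow> swap_coords i j u l = u l"
  by (simp_all add: swap_coords_def)

lemma swap_coords_espace: "i < n \<Longrightarrow> j < n \<Longrightarrow> u \<in> espace n \<Longrightarrow> swap_coords i j u \<in> espace n"
  by (rule espaceI) (auto simp: swap_coords_def espaceD)

lemma smooth_coords_swap: "eopen n U \<Longrightarrow> smooth_coords n m U (swap_coords i j)"
  unfolding smooth_coords_def
proof (intro allI impI)
  fix l k assume "eopen n U"
  then show "Ck_on n k U (\<lambda>u. swap_coords i j u l)"
    by (cases "l = j"; cases "l = i") (simp_all add: swap_coords_def Ck_coord)
qed

lemma local_diffeo_swap:
  assumes "i < n" "j < n" "eopen n U"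
  shows "local_diffeo n U {v \<in> espace n. swap_coords i j v \<in> U} (swap_coords i j) (swap_coords i j)"
proof -
  have "eopen n {v \<in> espace n. swap_coords i j v \<in> U}"
    by (rule eopen_preimage[where m = n])
       (use assms in \<open>auto simp: smooth_coords_swap swap_coords_espace\<close>)
  then show ?thesis
    using assms openin_espace_subset[OF assms(3)]
    by (auto simp: local_diffeo_def smooth_coords_swap swap_coords_espace subset_iff)
qed

lemma local_diffeo_coord_replace:
  assumes "eopen n W" "\<And>k. Ck_on n k W g" "u0 \<in> W" "i < n" "partial_deriv i g u0 \<noteq> 0"
  obtains U V G where "local_diffeo n U V (\<lambda>u. u(i := g u)) G" "u0 \<in> U" "U \<subseteq> W"
    "\<And>w j. j \<noteq> i \<Longrightarrow> G w j = w j" "\<And>w. w \<in> V \<Longrightarrow> g (G w) = w i"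
proof -
  obtain U V h where U: "eopen n U" "u0 \<in> U" "U \<subseteq> W" "eopen n V" and h: "\<And>k. Ck_on n k V h"
    and inv: "\<And>u. u \<in> U \<Longrightarrow> u(i := g u) \<in> V \<and> h (u(i := g u)) = u i"
    "\<And>w. w \<in> V \<Longrightarrow> w(i := h w) \<in> U \<and> g (w(i := h w)) = w i"
    using coord_replace[OF assms] by metis
  have "smooth_coords n n U (\<lambda>u. u(i := g u))" unfolding smooth_coords_def
  proof (intro allI impI)
    fix j k show "Ck_on n k U (\<lambda>u. (u(i := g u)) j)"
      using Ck_coord[OF U(1)] Ck_subset[OF assms(1) U(1,3) assms(2)] by (cases "j = i") auto
  qed
  moreover have "smooth_coords n n V (\<lambda>w. w(i := h w))" unfolding smooth_coords_def
  proof (intro allI impI)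
    fix j k show "Ck_on n k V (\<lambda>w. (w(i := h w)) j)"
      using Ck_coord[OF U(4)] h by (cases "j = i") auto
  qed
  ultimately have "local_diffeo n U V (\<lambda>u. u(i := g u)) (\<lambda>w. w(i := h w))"
    using U inv by (simp add: local_diffeo_def)
  then show ?thesis using that[of U V "\<lambda>w. w(i := h w)"] U inv by auto
qed

text \<open>
  The components of a submersion can be introduced as coordinates one at a time: at each step
  surjectivity of the Jacobian prevents the next component from depending, to first order, only
  on the coordinates already replaced.
\<close>

lemma submersion_straighten_aux:
  assumes W: "eopen n W" and f: "smooth_coords n d W f" and u0: "u0 \<in> W"
    and surj: "\<And>w. \<exists>v. \<forall>j<d. (\<Sum>i<n. partial_deriv i (\<lambda>u. f u j) u0 * v i) = w j"
  shows "j \<le> d \<Longrightarrow> j \<le> n \<and> (\<exists>U V F G. local_diffeo n U V F G \<and> u0 \<in> U \<and> U \<subseteq> W \<and> (\<forall>u\<in>U. \<forall>l<j. F u l = f u l))"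
proof (induction j)
  case 0
  then show ?case using local_diffeo_id[OF W] u0 by blast
next
  case (Suc j)
  then obtain U V F G where D: "local_diffeo n U V F G" and U: "u0 \<in> U" "U \<subseteq> W"
    and F: "\<And>u l. u \<in> U \<Longrightarrow> l < j \<Longrightarrow> F u l = f u l" and jn: "j \<le> n" by auto
  have jd: "j < d" using Suc.prems by simp
  have op: "eopen n U" "eopen n V" and sF: "smooth_coords n n U F" and sG: "smooth_coords n n V G"
    and FG: "\<And>u. u \<in> U \<Longrightarrow> F u \<in> V \<and> G (F u) = u" "\<And>v. v \<in> V \<Longrightarrow> G v \<in> U \<and> F (G v) = v"
    using D by (auto simp: local_diffeo_def)
  define g where "g v = f (G v) j" for v
  have gs: "Ck_on n k V g" for k
    unfolding g_def
    by (rule Ck_comp[OF op(2) W, where f = "\<lambda>u. f u j"])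
       (use FG U smooth_coordsD[OF f jd] smooth_coordsD[OF sG] in auto)
  have "\<exists>i. j \<le> i \<and> i < n \<and> partial_deriv i g (F u0) \<noteq> 0"
  proof (rule ccontr)
    assume no: "\<nexists>i. j \<le> i \<and> i < n \<and> partial_deriv i g (F u0) \<noteq> 0"
    define a where "a l = partial_deriv l g (F u0)" for l
    have Fpd: "has_pd i (\<lambda>u. F u l) (partial_deriv i (\<lambda>u. F u l) u0) u0" if "i < n" "l < n" for i l
      using smooth_coordsD[OF sF that(2), of "Suc 0"] that(1) U(1) unfolding Ck_Suc[OF op(1)] by blast
    \<comment> \<open>If no such derivative exists, the gradient of the \<open>j\<close>-th
      component is a combination of the gradients of the earlier ones, which contradicts
      surjectivity of the Jacobian.\<close>
    have pdf: "partial_deriv i (\<lambda>u. f u j) u0 = (\<Sum>l<j. a l * partial_deriv i (\<lambda>u. f u l) u0)" if i: "i < n" for i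
    proof -
      have "has_pd i (\<lambda>u. g (F u)) (\<Sum>l<n. partial_deriv l g (F u0) * partial_deriv i (\<lambda>u. F u l) u0) u0"
        by (rule has_pd_comp[OF op(1) U(1) i op(2) gs]) (use FG Fpd i in auto)
      moreover have "has_pd i (\<lambda>u. g (F u)) D u0 \<longleftrightarrow> has_pd i (\<lambda>u. f u j) D u0" for D
        by (rule has_pd_cong[OF op(1) U(1) i]) (use FG in \<open>auto simp: g_def\<close>)
      ultimately have "partial_deriv i (\<lambda>u. f u j) u0 = (\<Sum>l<n. a l * partial_deriv i (\<lambda>u. F u l) u0)"
        by (simp add: has_pd_partial_deriv a_def)
      also have "\<dots> = (\<Sum>l<j. a l * partial_deriv i (\<lambda>u. F u l) u0)"
        by (rule sum.mono_neutral_right) (use no jn in \<open>auto simp: a_def\<close>)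
      also have "\<dots> = (\<Sum>l<j. a l * partial_deriv i (\<lambda>u. f u l) u0)"
      proof (intro sum.cong refl arg_cong2[of _ _ _ _ "(*)"])
        fix l assume l: "l \<in> {..<j}"
        then have "has_pd i (\<lambda>u. F u l) D u0 \<longleftrightarrow> has_pd i (\<lambda>u. f u l) D u0" for D
          by (intro has_pd_cong[OF op(1) U(1) i]) (use F in auto)
        then have "has_pd i (\<lambda>u. f u l) (partial_deriv i (\<lambda>u. F u l) u0) u0"
          using Fpd[OF i, of l] l jn by simp
        then show "partial_deriv i (\<lambda>u. F u l) u0 = partial_deriv i (\<lambda>u. f u l) u0"
          by (simp add: has_pd_partial_deriv)
      qed
      finally show ?thesis .
    qed
    \<comment> \<open>A direction in which, to first order, the \<open>j\<close>-th component varies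
      and no other component does.\<close>
    obtain v where v: "\<And>l. l < d \<Longrightarrow> (\<Sum>i<n. partial_deriv i (\<lambda>u. f u l) u0 * v i) = of_bool (l = j)"
      using surj[of "\<lambda>l. of_bool (l = j)"] by blast
    have "1 = (\<Sum>i<n. (\<Sum>l<j. a l * partial_deriv i (\<lambda>u. f u l) u0) * v i)"
      using v[OF jd] pdf by simp
    also have "\<dots> = (\<Sum>l<j. a l * (\<Sum>i<n. partial_deriv i (\<lambda>u. f u l) u0 * v i))"
      unfolding sum_distrib_left sum_distrib_right by (subst sum.swap) (simp add: mult.assoc)
    also have "\<dots> = 0" using v jd by (intro sum.neutral) auto
    finally show False by simp
  qed
  \<comment> \<open>Since \<open>j \<le> i\<close>, the components already in place are not
    overwritten, and \<open>j < n\<close> follows.\<close>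
  then obtain i where i: "j \<le> i" "i < n" "partial_deriv i g (F u0) \<noteq> 0" by blast
  have "F u0 \<in> V" using FG U by blast
  then obtain U1 V1 G1 where D1: "local_diffeo n U1 V1 (\<lambda>u. u(i := g u)) G1" and U1: "F u0 \<in> U1" "U1 \<subseteq> V"
    using local_diffeo_coord_replace[OF op(2) gs _ i(2,3)] by metis
  let ?U = "{u \<in> U. F u \<in> U1}"
  have oV1: "eopen n V1" "eopen n U1" using D1 by (auto simp: local_diffeo_def)
  have D2: "local_diffeo n ?U U1 F G" by (rule local_diffeo_restrict[OF D oV1(2) U1(2)])
  have D3: "local_diffeo n ?U {v \<in> espace n. swap_coords j i v \<in> V1}
      (\<lambda>u. swap_coords j i ((F u)(i := g (F u)))) (\<lambda>w. G (G1 (swap_coords j i w)))"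
    by (rule local_diffeo_comp[OF local_diffeo_comp[OF D2 D1] local_diffeo_swap])
       (use i oV1 in auto)
  have "swap_coords j i ((F u)(i := g (F u))) l = f u l" if "u \<in> ?U" "l < Suc j" for u l
    using that F[of u l] FG i(1) by (cases "l = j") (auto simp: swap_coords_apply g_def)
  then show ?case using D3 i U U1 by (intro conjI exI[of _ ?U] exI) auto
qed

lemmas submersion_straighten = submersion_straighten_aux[OF _ _ _ _ order_refl]

text \<open>
  If all components had vanishing derivative in some direction along the slice, the map would be
  constant on a segment; otherwise some component replaces a further coordinate.
\<close>

lemma injective_slice_left_inverse:
  assumes W: "eopen n W" and F: "smooth_coords n m W F" "F ` W \<subseteq> espace m"
    and d: "d \<le> n" "d \<le> m" and Fd: "\<And>u j. u \<in> W \<Longrightarrow> j < d \<Longrightarrow> F u j = u j"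
    and c: "c \<in> W" and inj: "inj_on F {u \<in> W. \<forall>j<d. u j = c j}"
  shows "n \<le> m \<and> (\<exists>u0\<in>W. (\<forall>j<d. u0 j = c j) \<and> (\<exists>U V L. eopen n U \<and> u0 \<in> U \<and> U \<subseteq> W \<and>
    eopen m V \<and> smooth_coords m n V L \<and> L ` V \<subseteq> espace n \<and> (\<forall>u\<in>U. F u \<in> V \<and> L (F u) = u)))"
  using assms
proof (induction "n - d" arbitrary: d W F c)
  case 0
  then have nd: "d = n" by simp
  \<comment> \<open>All \<open>n\<close> source coordinates already appear among the components of
    \<open>F\<close>, so truncation inverts it.\<close>
  define L where "L w = (\<lambda>i. if i < n then w i else 0)" for w :: "nat \<Rightarrow> real"
  have "smooth_coords m n (espace m) L"
    by (simp add: smooth_coords_def L_def Ck_coord)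
  moreover have "L (F u) = u" if "u \<in> W" for u
    using 0(7)[OF that] openin_espace_subset[OF 0(2)] that nd
    by (auto simp: L_def fun_eq_iff espaceD subset_iff)
  moreover have "L ` espace m \<subseteq> espace n" by (auto simp: L_def intro!: espaceI)
  ultimately show ?case
    using 0 nd openin_topspace[of "Euclidean_space m"]
    by (intro conjI bexI[of _ c] exI[of _ W] exI[of _ "espace m"] exI[of _ L]) auto
next
  case (Suc e)
  then have dn: "d < n" by simp
  note W = Suc.prems(1) and F = Suc.prems(2,3) and dm = Suc.prems(5) and Fd = Suc.prems(6)
    and c = Suc.prems(7) and inj = Suc.prems(8)
  have cE: "c \<in> espace n" using c openin_espace_subset[OF W] by blast
  have Fpd: "has_pd d (\<lambda>u. F u j) (partial_deriv d (\<lambda>u. F u j) u) u" if "u \<in> W" "j < m" for u j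
    using smooth_coordsD[OF F(1) that(2), of "Suc 0"] that dn unfolding Ck_Suc[OF W] by blast
  have "\<exists>u\<in>W. (\<forall>l<d. u l = c l) \<and> (\<exists>j<m. partial_deriv d (\<lambda>u. F u j) u \<noteq> 0)"
  proof (rule ccontr)
    assume "\<not> ?thesis"
    then have no: "\<And>u j. u \<in> W \<Longrightarrow> (\<And>l. l < d \<Longrightarrow> u l = c l) \<Longrightarrow> j < m \<Longrightarrow> partial_deriv d (\<lambda>u. F u j) u = 0"
      by blast
    obtain r where r: "r > 0" "nbox n c r \<subseteq> W" using nbox_subset_open[OF W c] by blast
    define b where "b = c d + r / 2"
    have inW: "c(d := t) \<in> W" if "c d \<le> t" "t \<le> b" for t
      using that r cE dn by (intro subsetD[OF r(2)]) (auto simp: nbox_def espace_upd b_def)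
    have "F (c(d := b)) j = F (c(d := c d)) j" for j
    proof (cases "j < m")
      case True
      show ?thesis
      proof (rule DERIV_isconst_end[where f = "\<lambda>t. F (c(d := t)) j"])
        show lt: "c d < b" using r by (simp add: b_def)
        have der: "((\<lambda>t. F (c(d := t)) j) has_real_derivative 0) (at t)" if "c d \<le> t" "t \<le> b" for t
          using Fpd[OF inW[OF that] True] no[OF inW[OF that] _ True] by (simp add: has_pd_def)
        show "continuous_on {c d..b} (\<lambda>t. F (c(d := t)) j)"
          using der DERIV_isCont by (fastforce intro: continuous_at_imp_continuous_on)
        show "((\<lambda>t. F (c(d := t)) j) has_real_derivative 0) (at t)" if "c d < t" "t < b" for t
          using der that by simp
      qed
    next
      case False
      have "c d \<le> b" using r by (simp add: b_def)
      then have "F (c(d := b)) \<in> espace m" "F (c(d := c d)) \<in> espace m"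
        using F(2) inW[of b] c by auto
      then show ?thesis using False by (auto simp: espaceD)
    qed
    then have "F (c(d := b)) = F c" by (simp add: fun_eq_iff)
    moreover have "c d \<le> b" "b \<noteq> c d" using r by (auto simp: b_def)
    moreover have "c(d := b) \<in> W" using inW[of b] \<open>c d \<le> b\<close> by simp
    ultimately have "c(d := b) = c" using inj c by (auto simp: inj_on_def)
    then show False using \<open>b \<noteq> c d\<close> by (metis fun_upd_same)
  qed
  then obtain u1 j where u1: "u1 \<in> W" "\<And>l. l < d \<Longrightarrow> u1 l = c l"
    and j: "j < m" "partial_deriv d (\<lambda>u. F u j) u1 \<noteq> 0" by blast
  \<comment> \<open>The first \<open>d\<close> components are coordinates themselves and do not vary
    with coordinate \<open>d\<close>.\<close>
  have dj: "d \<le> j"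
  proof (rule ccontr)
    assume "\<not> d \<le> j"
    then have jd: "j < d" by simp
    have "has_pd d (\<lambda>u. F u j) D u1 \<longleftrightarrow> has_pd d (\<lambda>u. u j) D u1" for D
      by (rule has_pd_cong[OF W u1(1) dn]) (use Fd jd in auto)
    moreover have "has_pd d (\<lambda>u. u j) 0 u1" using jd by (simp add: has_pd_def)
    ultimately show False using j(2) has_pd_partial_deriv by metis
  qed
  then have dm': "d < m" using j by simp
  show ?case
  proof (rule local_diffeo_coord_replace[OF W smooth_coordsD[OF F(1) j(1)] u1(1) dn j(2)])
  fix U1 V1 G
  assume D: "local_diffeo n U1 V1 (\<lambda>u. u(d := F u j)) G" and U1: "u1 \<in> U1" "U1 \<subseteq> W"
    and G: "\<And>w l. l \<noteq> d \<Longrightarrow> G w l = w l" "\<And>w. w \<in> V1 \<Longrightarrow> F (G w) j = w d"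
  have op: "eopen n U1" "eopen n V1" and sG: "smooth_coords n n V1 G"
    and inv: "\<And>u. u \<in> U1 \<Longrightarrow> u(d := F u j) \<in> V1 \<and> G (u(d := F u j)) = u"
      "\<And>v. v \<in> V1 \<Longrightarrow> G v \<in> U1 \<and> (G v)(d := F (G v) j) = v"
    using D by (auto simp: local_diffeo_def)
  define sw where "sw = swap_coords d j"
  \<comment> \<open>In the new source coordinates component \<open>j\<close> of \<open>F\<close> is
    coordinate \<open>d\<close>, and the swap in the target makes it component \<open>d\<close>; so
    \<open>F'\<close> preserves one coordinate more.\<close>
  define F' where "F' w = sw (F (G w))" for w
  define c' where "c' = u1(d := F u1 j)"
  have c': "c' \<in> V1" "G c' = u1" using inv(1)[OF U1(1)] by (auto simp: c'_def)
  have GW: "G ` V1 \<subseteq> W" using inv(2) U1(2) by blast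
  have sF: "smooth_coords n m V1 F'" unfolding F'_def sw_def
    by (rule smooth_coords_comp[OF op(2) openin_topspace _ smooth_coords_swap smooth_coords_comp[OF op(2) W GW F(1) sG]])
       (use GW F(2) in auto)
  have F'E: "F' ` V1 \<subseteq> espace m"
    using GW F(2) by (auto simp: F'_def sw_def intro!: swap_coords_espace dm' j)
  have F'd: "F' w l = w l" if "w \<in> V1" "l < Suc d" for w l
  proof (cases "l = d")
    case True
    then show ?thesis using G(2)[OF that(1)] by (simp add: F'_def sw_def swap_coords_apply)
  next
    case False
    then have "F' w l = F (G w) l" using that dj by (simp add: F'_def sw_def swap_coords_apply)
    also have "\<dots> = G w l" using Fd that GW False by auto
    finally show ?thesis using G(1) False by simp
  qed
  \<comment> \<open>\<open>G\<close> alters coordinate \<open>d\<close> only, so it carries the new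
    slice, on which one coordinate more is fixed, into the old slice through
    \<open>c\<close>.\<close>
  have inj': "inj_on F' {w \<in> V1. \<forall>l<Suc d. w l = c' l}"
  proof (rule inj_onI)
    fix v w assume v: "v \<in> {w \<in> V1. \<forall>l<Suc d. w l = c' l}" and w: "w \<in> {w \<in> V1. \<forall>l<Suc d. w l = c' l}"
      and eq: "F' v = F' w"
    have sl: "G v \<in> {u \<in> W. \<forall>j<d. u j = c j}" if "v \<in> {w \<in> V1. \<forall>l<Suc d. w l = c' l}" for v
      using that GW G(1) u1(2) by (auto simp: c'_def)
    have "F (G v) = F (G w)" using eq unfolding F'_def sw_def by (metis swap_coords_swap)
    then have "G v = G w" using inj sl[OF v] sl[OF w] by (auto dest: inj_onD)
    then show "v = w" using inv(2) v w by (metis (lifting) mem_Collect_eq)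
  qed
  have "n \<le> m \<and> (\<exists>u0\<in>V1. (\<forall>j<Suc d. u0 j = c' j) \<and> (\<exists>U V L. eopen n U \<and> u0 \<in> U \<and> U \<subseteq> V1 \<and>
    eopen m V \<and> smooth_coords m n V L \<and> L ` V \<subseteq> espace n \<and> (\<forall>u\<in>U. F' u \<in> V \<and> L (F' u) = u)))"
    by (rule Suc.hyps(1)[OF _ op(2) sF F'E _ _ F'd c'(1) inj']) (use Suc.hyps(2) dn dm' in auto)
  then obtain v0 U V L where nm: "n \<le> m" and v0: "v0 \<in> V1" "\<forall>l<Suc d. v0 l = c' l"
    and U: "eopen n U" "v0 \<in> U" "U \<subseteq> V1" and V: "eopen m V" and L: "smooth_coords m n V L" "L ` V \<subseteq> espace n"
    "\<forall>u\<in>U. F' u \<in> V \<and> L (F' u) = u" by (elim conjE bexE exE) (rule that; assumption)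
  define U2 where "U2 = {u \<in> U1. u(d := F u j) \<in> U}"
  define V2 where "V2 = {v \<in> espace m. sw v \<in> {w \<in> V. L w \<in> V1}}"
  have oU2: "eopen n U2" "G v0 \<in> U2" "U2 \<subseteq> W"
    using local_diffeo_restrict[OF D U(1,3)] inv(2)[of v0] U U1 v0(1)
    by (auto simp: U2_def local_diffeo_def)
  have oV': "eopen m {w \<in> V. L w \<in> V1}" by (rule eopen_preimage[OF V L(1,2) op(2)])
  have oV2: "eopen m V2" unfolding V2_def sw_def
    by (rule eopen_preimage[OF openin_topspace smooth_coords_swap _ oV'])
       (auto intro!: swap_coords_espace dm' j)
  have sL: "smooth_coords m n V2 (\<lambda>w. G (L (sw w)))"
  proof (rule smooth_coords_comp[OF oV2 op(2) _ sG])
    show "smooth_coords m n V2 (\<lambda>w. L (sw w))"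
      by (rule smooth_coords_comp[OF oV2 V _ L(1)])
         (use oV2 in \<open>auto simp: V2_def sw_def intro!: smooth_coords_swap\<close>)
  qed (auto simp: V2_def)
  have "F u \<in> V2 \<and> G (L (sw (F u))) = u" if u: "u \<in> U2" for u
  proof -
    have uU: "u \<in> U1" "u(d := F u j) \<in> U" using u by (auto simp: U2_def)
    have "F' (u(d := F u j)) = sw (F u)" using inv(1)[OF uU(1)] by (simp add: F'_def)
    then have "sw (F u) \<in> V" "L (sw (F u)) = u(d := F u j)" using bspec[OF L(3) uU(2)] by auto
    then show ?thesis using inv(1)[OF uU(1)] uU U1 F(2) by (auto simp: V2_def)
  qed
  moreover have "(\<lambda>w. G (L (sw w))) ` V2 \<subseteq> espace n"
    using GW openin_espace_subset[OF W] by (fastforce simp: V2_def)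
  moreover have "G v0 l = c l" if "l < d" for l
    using that G(1)[of l v0] v0(2) u1(2)[of l] by (simp add: c'_def)
  ultimately show ?case
    using nm oU2 oV2 sL
    by (intro conjI bexI[of _ "G v0"] exI[of _ U2] exI[of _ V2] exI[of _ "\<lambda>w. G (L (sw w))"]) auto
  qed
qed

section \<open>Manifolds\<close>

lemma is_chartD:
  assumes "is_chart T c"
  shows "openin T (cdom c)" "cmap c \<in> extensional (cdom c)" "eopen (cdim c) (cmap c ` cdom c)"
    "inj_on (cmap c) (cdom c)" "cdom c \<subseteq> topspace T"
    "continuous_map (subtopology T (cdom c)) (Euclidean_space (cdim c)) (cmap c)"
    "\<And>W. openin T W \<Longrightarrow> W \<subseteq> cdom c \<Longrightarrow> eopen (cdim c) (cmap c ` W)"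
proof -
  show c: "openin T (cdom c)" "cmap c \<in> extensional (cdom c)" "eopen (cdim c) (cmap c ` cdom c)"
    using assms by (auto simp: is_chart_def)
  then show sub: "cdom c \<subseteq> topspace T" using openin_subset by blast
  then have top: "topspace (subtopology T (cdom c)) = cdom c" by (simp add: Int_absorb1)
  have "homeomorphic_map (subtopology T (cdom c)) (subtopology (Euclidean_space (cdim c)) (cmap c ` cdom c)) (cmap c)"
    using assms top by (simp add: is_chart_def embedding_map_def)
  then have h: "continuous_map (subtopology T (cdom c)) (subtopology (Euclidean_space (cdim c)) (cmap c ` cdom c)) (cmap c)"
    "open_map (subtopology T (cdom c)) (subtopology (Euclidean_space (cdim c)) (cmap c ` cdom c)) (cmap c)"
    "inj_on (cmap c) (cdom c)"
    using top by (auto simp: homeomorphic_eq_everything_map)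
  show "inj_on (cmap c) (cdom c)" by (rule h)
  show "continuous_map (subtopology T (cdom c)) (Euclidean_space (cdim c)) (cmap c)"
    using h(1) continuous_map_into_fulltopology by blast
  fix W assume W: "openin T W" "W \<subseteq> cdom c"
  then have "openin (subtopology T (cdom c)) W"
    by (simp add: openin_open_subtopology c)
  then have "openin (subtopology (Euclidean_space (cdim c)) (cmap c ` cdom c)) (cmap c ` W)"
    using h(2) by (simp add: open_map_def)
  then show "eopen (cdim c) (cmap c ` W)"
    using c(3) openin_trans_full by blast
qed

lemma is_chart_preimage:
  assumes "is_chart T c" "eopen (cdim c) U"
  shows "openin T {z \<in> cdom c. cmap c z \<in> U}"
proof -
  have "topspace (subtopology T (cdom c)) = cdom c" using is_chartD(5)[OF assms(1)] by (simp add: Int_absorb1)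
  then show ?thesis
    using openin_continuous_map_preimage[OF is_chartD(6)[OF assms(1)] assms(2)]
      openin_trans_full[OF _ is_chartD(1)[OF assms(1)]] by simp
qed

lemma cinv_cmap: "is_chart T c \<Longrightarrow> z \<in> cdom c \<Longrightarrow> cinv c (cmap c z) = z"
  using is_chartD(4)[of T c] by (simp add: cinv_def)

lemma cmap_cinv: "u \<in> cmap c ` cdom c \<Longrightarrow> cinv c u \<in> cdom c \<and> cmap c (cinv c u) = u"
  by (simp add: cinv_def inv_into_into f_inv_into_f)

lemma manifoldD:
  assumes "manifold M"
  shows "second_countable (mtop M)" "\<And>c. c \<in> atlas M \<Longrightarrow> is_chart (mtop M) c"
    "\<And>z. z \<in> pts M \<Longrightarrow> \<exists>c\<in>atlas M. z \<in> cdom c"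
    "\<And>c d. c \<in> atlas M \<Longrightarrow> d \<in> atlas M \<Longrightarrow> compatible c d"
    "\<And>c. is_chart (mtop M) c \<Longrightarrow> (\<And>d. d \<in> atlas M \<Longrightarrow> compatible c d) \<Longrightarrow> c \<in> atlas M"
  using assms unfolding manifold_def by blast+

section \<open>Smooth functions and smooth maps\<close>

definition sfun :: "'p mfd \<Rightarrow> 'p set \<Rightarrow> ('p \<Rightarrow> real) \<Rightarrow> bool" where
  "sfun M W g \<longleftrightarrow> openin (mtop M) W \<and>
     (\<forall>c\<in>atlas M. \<forall>k. Ck_on (cdim c) k (cmap c ` (cdom c \<inter> W)) (\<lambda>u. g (cinv c u)))"

text \<open>Splits smoothness of a map into statements about real functions, one for each coordinate
  of a target chart; closure properties can then be proved for \<open>sfun\<close>.\<close>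

lemma smooth_map_iff_sfun:
  "smooth_map M N f \<longleftrightarrow> continuous_map (mtop M) (mtop N) f \<and>
    (\<forall>d\<in>atlas N. \<forall>j<cdim d. \<forall>c\<in>atlas M. \<forall>k.
      Ck_on (cdim c) k (cmap c ` {z \<in> cdom c. f z \<in> cdom d}) (\<lambda>u. cmap d (f (cinv c u)) j))"
  unfolding smooth_map_def smooth_coords_def local_rep_def by (auto simp: o_def)

lemma smooth_map_sfun:
  assumes "manifold M" "manifold N" "smooth_map M N f" "d \<in> atlas N" "j < cdim d"
  shows "sfun M {z \<in> pts M. f z \<in> cdom d} (\<lambda>z. cmap d (f z) j)"
  unfolding sfun_def
proof (intro conjI ballI allI)
  show "openin (mtop M) {z \<in> pts M. f z \<in> cdom d}"
    by (rule openin_continuous_map_preimage[OF conjunct1[OF assms(3)[unfolded smooth_map_def]]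
          is_chartD(1)[OF manifoldD(2)[OF assms(2,4)]]])
  fix c k assume c: "c \<in> atlas M"
  have "cdom c \<inter> {z \<in> pts M. f z \<in> cdom d} = {z \<in> cdom c. f z \<in> cdom d}"
    using is_chartD(5)[OF manifoldD(2)[OF assms(1) c]] by auto
  then show "Ck_on (cdim c) k (cmap c ` (cdom c \<inter> {z \<in> pts M. f z \<in> cdom d})) (\<lambda>u. cmap d (f (cinv c u)) j)"
    using assms(3-5) c unfolding smooth_map_iff_sfun by simp
qed

lemma chart_openin_image:
  "manifold M \<Longrightarrow> c \<in> atlas M \<Longrightarrow> openin (mtop M) W \<Longrightarrow> eopen (cdim c) (cmap c ` (cdom c \<inter> W))"
  by (intro is_chartD(7)[OF manifoldD(2)]) (auto intro!: openin_Int is_chartD(1)[OF manifoldD(2)])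

lemma sfun_open: "sfun M W g \<Longrightarrow> openin (mtop M) W"
  by (simp add: sfun_def)

text \<open>Transition maps are smooth, so one chart around each point decides smoothness in every
  chart.\<close>

lemma sfun_chartI:
  assumes M: "manifold M" and W: "openin (mtop M) W"
    and loc: "\<And>z. z \<in> W \<Longrightarrow> \<exists>c\<in>atlas M. z \<in> cdom c \<and> (\<exists>V. eopen (cdim c) V \<and> cmap c z \<in> V \<and>
      V \<subseteq> cmap c ` (cdom c \<inter> W) \<and> (\<forall>k. Ck_on (cdim c) k V (\<lambda>u. g (cinv c u))))"
  shows "sfun M W g"
  unfolding sfun_def
proof (intro conjI ballI allI W)
  fix c k assume c: "c \<in> atlas M"
  have oc: "eopen (cdim c) (cmap c ` (cdom c \<inter> W))" by (rule chart_openin_image[OF M c W])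
  show "Ck_on (cdim c) k (cmap c ` (cdom c \<inter> W)) (\<lambda>u. g (cinv c u))"
  proof (rule Ck_local[OF oc])
    fix u assume "u \<in> cmap c ` (cdom c \<inter> W)"
    then obtain z where z: "z \<in> cdom c" "z \<in> W" "u = cmap c z" by blast
    obtain d V where d: "d \<in> atlas M" "z \<in> cdom d" and V: "eopen (cdim d) V" "cmap d z \<in> V"
      "V \<subseteq> cmap d ` (cdom d \<inter> W)" "\<And>k. Ck_on (cdim d) k V (\<lambda>u. g (cinv d u))"
      using loc[OF z(2)] by blast
    define Y where "Y = {y \<in> cdom d. cmap d y \<in> V}"
    have oY: "openin (mtop M) Y"
      unfolding Y_def by (rule is_chart_preimage[OF manifoldD(2)[OF M d(1)] V(1)])
    let ?U = "cmap c ` (cdom c \<inter> Y)" let ?Z = "cmap c ` (cdom c \<inter> cdom d)"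
    have oU: "eopen (cdim c) ?U" by (rule chart_openin_image[OF M c oY])
    have oZ: "eopen (cdim c) ?Z" using chart_openin_image[OF M c is_chartD(1)[OF manifoldD(2)[OF M d(1)]]] .
    have cd: "smooth_coords (cdim c) (cdim d) ?Z (\<lambda>u. cmap d (cinv c u))"
      using manifoldD(4)[OF M c d(1)] by (simp add: compatible_def o_def)
    have inv: "cinv c v \<in> Y \<and> cinv d (cmap d (cinv c v)) = cinv c v" if "v \<in> ?U" for v
      using that cinv_cmap[OF manifoldD(2)[OF M c]] cinv_cmap[OF manifoldD(2)[OF M d(1)]]
      by (auto simp: Y_def)
    have "Ck_on (cdim c) k ?U (\<lambda>u. g (cinv d (cmap d (cinv c u))))"
    proof (rule Ck_comp[OF oU V(1) _ V(4)])
      show "(\<lambda>u. cmap d (cinv c u)) ` ?U \<subseteq> V" using inv by (auto simp: Y_def)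
      fix j assume "j < cdim d"
      then show "Ck_on (cdim c) k ?U (\<lambda>u. cmap d (cinv c u) j)"
        by (intro Ck_subset[OF oZ oU _ smooth_coordsD[OF cd]]) (auto simp: Y_def)
    qed
    then have "Ck_on (cdim c) k ?U (\<lambda>u. g (cinv c u))"
      using Ck_cong[OF oU, of "\<lambda>u. g (cinv c u)" "\<lambda>u. g (cinv d (cmap d (cinv c u)))"] inv by simp
    moreover have "u \<in> ?U" using z V d by (auto simp: Y_def)
    ultimately show "\<exists>V. u \<in> V \<and> eopen (cdim c) V \<and> Ck_on (cdim c) k V (\<lambda>u. g (cinv c u))"
      using oU by (intro exI[of _ ?U]) simp
  qed
qed

lemma sfun_Ck: "sfun M W g \<Longrightarrow> c \<in> atlas M \<Longrightarrow> Ck_on (cdim c) k (cmap c ` (cdom c \<inter> W)) (\<lambda>u. g (cinv c u))"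
  by (simp add: sfun_def)

lemma sfun_local:
  assumes M: "manifold M" and loc: "\<And>z. z \<in> W \<Longrightarrow> \<exists>V. z \<in> V \<and> V \<subseteq> W \<and> sfun M V g"
  shows "sfun M W g"
proof -
  have W: "openin (mtop M) W" 
  proof (subst openin_subopen, intro ballI)
    fix z assume "z \<in> W"
    then obtain V where "z \<in> V" "V \<subseteq> W" "sfun M V g" using loc by blast
    then show "\<exists>T. openin (mtop M) T \<and> z \<in> T \<and> T \<subseteq> W"
      by (intro exI[of _ V]) (simp add: sfun_open)
  qed
  show ?thesis
  proof (rule sfun_chartI[OF M W])
    fix z assume "z \<in> W"
    then obtain V where V: "z \<in> V" "V \<subseteq> W" "sfun M V g" using loc by blast
    then obtain c where c: "c \<in> atlas M" "z \<in> cdom c"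
      using manifoldD(3)[OF M, of z] openin_subset[OF W] by blast
    have "eopen (cdim c) (cmap c ` (cdom c \<inter> V))" using chart_openin_image[OF M c(1) sfun_open[OF V(3)]] .
    then show "\<exists>c\<in>atlas M. z \<in> cdom c \<and> (\<exists>V. eopen (cdim c) V \<and> cmap c z \<in> V \<and>
      V \<subseteq> cmap c ` (cdom c \<inter> W) \<and> (\<forall>k. Ck_on (cdim c) k V (\<lambda>u. g (cinv c u))))"
      using c V sfun_Ck[OF V(3) c(1)]
      by (intro bexI[of _ c] conjI exI[of _ "cmap c ` (cdom c \<inter> V)"]) auto
  qed
qed

lemma sfun_subset:
  assumes "manifold M" "sfun M W g" "openin (mtop M) V" "V \<subseteq> W"
  shows "sfun M V g"
  unfolding sfun_def
proof (intro conjI ballI allI assms(3))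
  fix c k assume c: "c \<in> atlas M"
  show "Ck_on (cdim c) k (cmap c ` (cdom c \<inter> V)) (\<lambda>u. g (cinv c u))"
    by (rule Ck_subset[OF chart_openin_image[OF assms(1) c sfun_open[OF assms(2)]]
          chart_openin_image[OF assms(1) c assms(3)] _ sfun_Ck[OF assms(2) c]])
       (use assms(4) in auto)
qed

lemma sfun_cong:
  assumes M: "manifold M" and eq: "\<And>z. z \<in> W \<Longrightarrow> f z = g z"
  shows "sfun M W f \<longleftrightarrow> sfun M W g"
proof -
  have "Ck_on (cdim c) k (cmap c ` (cdom c \<inter> W)) (\<lambda>u. f (cinv c u)) \<longleftrightarrow>
      Ck_on (cdim c) k (cmap c ` (cdom c \<inter> W)) (\<lambda>u. g (cinv c u))"
    if "openin (mtop M) W" "c \<in> atlas M" for c k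
    by (rule Ck_cong[OF chart_openin_image[OF M that(2,1)]])
       (use eq cinv_cmap[OF manifoldD(2)[OF M that(2)]] in auto)
  then show ?thesis by (auto simp: sfun_def)
qed

lemma sfun_const: "manifold M \<Longrightarrow> openin (mtop M) W \<Longrightarrow> sfun M W (\<lambda>_. a)"
  by (simp add: sfun_def chart_openin_image)

lemma sfun_chart_coord:
  assumes M: "manifold M" and c: "c \<in> atlas M"
  shows "sfun M (cdom c) (\<lambda>z. cmap c z j)"
proof (rule sfun_chartI[OF M is_chartD(1)[OF manifoldD(2)[OF M c]]])
  fix z assume z: "z \<in> cdom c"
  have oc: "eopen (cdim c) (cmap c ` cdom c)" using is_chartD(3)[OF manifoldD(2)[OF M c]] .
  have "Ck_on (cdim c) k (cmap c ` cdom c) (\<lambda>u. cmap c (cinv c u) j)" for k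
    using Ck_cong[OF oc, of "\<lambda>u. cmap c (cinv c u) j" "\<lambda>u. u j"] Ck_coord[OF oc] cmap_cinv[of _ c] by simp
  then show "\<exists>c'\<in>atlas M. z \<in> cdom c' \<and> (\<exists>V. eopen (cdim c') V \<and> cmap c' z \<in> V \<and>
      V \<subseteq> cmap c' ` (cdom c' \<inter> cdom c) \<and> (\<forall>k. Ck_on (cdim c') k V (\<lambda>u. cmap c (cinv c' u) j)))"
    using c z oc by (intro bexI[of _ c] conjI exI[of _ "cmap c ` cdom c"]) auto
qed

lemma sfun_comp_Ck:
  assumes M: "manifold M" and W: "openin (mtop M) W" and Y: "eopen m Y"
    and G: "\<And>j. j < m \<Longrightarrow> sfun M W (\<lambda>z. G z j)" "\<And>z. z \<in> W \<Longrightarrow> G z \<in> Y"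
    and F: "\<And>k. Ck_on m k Y F"
  shows "sfun M W (\<lambda>z. F (G z))"
  unfolding sfun_def
proof (intro conjI ballI allI W)
  fix c k assume c: "c \<in> atlas M"
  show "Ck_on (cdim c) k (cmap c ` (cdom c \<inter> W)) (\<lambda>u. F (G (cinv c u)))"
    by (rule Ck_comp[OF chart_openin_image[OF M c W] Y _ F])
       (use G(2) sfun_Ck[OF G(1) c] cinv_cmap[OF manifoldD(2)[OF M c]] in auto)
qed

lemma sfun_preimage_open:
  assumes M: "manifold M" and W: "openin (mtop M) W"
    and G: "\<And>j. j < m \<Longrightarrow> sfun M W (\<lambda>z. G z j)" "\<And>z. z \<in> W \<Longrightarrow> G z \<in> espace m" and Y: "eopen m Y"
  shows "openin (mtop M) {z \<in> W. G z \<in> Y}"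
proof (subst openin_subopen, intro ballI)
  fix z assume z: "z \<in> {z \<in> W. G z \<in> Y}"
  then obtain c where c: "c \<in> atlas M" "z \<in> cdom c"
    using manifoldD(3)[OF M, of z] openin_subset[OF W] by blast
  let ?U = "cmap c ` (cdom c \<inter> W)"
  have inv: "\<And>z. z \<in> cdom c \<Longrightarrow> cinv c (cmap c z) = z" using cinv_cmap[OF manifoldD(2)[OF M c(1)]] .
  have "eopen (cdim c) {u \<in> ?U. G (cinv c u) \<in> Y}"
    by (rule eopen_preimage[OF chart_openin_image[OF M c(1) W] _ _ Y])
       (use G(2) inv sfun_Ck[OF G(1) c(1)] in \<open>auto simp: smooth_coords_def\<close>)
  then have "openin (mtop M) {y \<in> cdom c. cmap c y \<in> {u \<in> ?U. G (cinv c u) \<in> Y}}"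
    by (rule is_chart_preimage[OF manifoldD(2)[OF M c(1)]])
  moreover have "{y \<in> cdom c. cmap c y \<in> {u \<in> ?U. G (cinv c u) \<in> Y}} \<subseteq> {z \<in> W. G z \<in> Y}"
    using inv by auto (metis inv)+
  moreover have "z \<in> {y \<in> cdom c. cmap c y \<in> {u \<in> ?U. G (cinv c u) \<in> Y}}"
    using z c inv by auto
  ultimately show "\<exists>T. openin (mtop M) T \<and> z \<in> T \<and> T \<subseteq> {z \<in> W. G z \<in> Y}" by blast
qed

lemma chart_cmap_espace: "is_chart T c \<Longrightarrow> z \<in> cdom c \<Longrightarrow> cmap c z \<in> espace (cdim c)"
  using is_chartD(3) openin_espace_subset by blast

text \<open>Here \<open>f\<close> enters only through its coordinates in one target chart, so the
  lemma is available before \<open>f\<close> is known to be continuous.\<close>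

lemma sfun_comp_chart:
  assumes M: "manifold M" and N: "manifold N" and W: "openin (mtop M) W" and d: "d \<in> atlas N"
    and f: "f ` W \<subseteq> cdom d \<inter> V" "\<And>j. j < cdim d \<Longrightarrow> sfun M W (\<lambda>z. cmap d (f z) j)" and g: "sfun N V g"
  shows "sfun M W (\<lambda>z. g (f z))"
proof -
  have "sfun M W (\<lambda>z. g (cinv d (cmap d (f z))))"
    by (rule sfun_comp_Ck[OF M W chart_openin_image[OF N d sfun_open[OF g]] f(2)])
       (use f(1) sfun_Ck[OF g d] in \<open>auto simp: image_subset_iff\<close>)
  then show ?thesis
    using sfun_cong[OF M, of W "\<lambda>z. g (cinv d (cmap d (f z)))" "\<lambda>z. g (f z)"] f(1)
      cinv_cmap[OF manifoldD(2)[OF N d]] by (auto simp: image_subset_iff)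
qed

lemma smooth_map_continuous: "smooth_map M N f \<Longrightarrow> continuous_map (mtop M) (mtop N) f"
  by (simp add: smooth_map_def)

lemma smooth_map_pts: "smooth_map M N f \<Longrightarrow> z \<in> pts M \<Longrightarrow> f z \<in> pts N"
  using smooth_map_continuous continuous_map_image_subset_topspace by blast

lemma smooth_map_preimage: "smooth_map M N f \<Longrightarrow> openin (mtop N) V \<Longrightarrow> openin (mtop M) {z \<in> pts M. f z \<in> V}"
  using smooth_map_continuous openin_continuous_map_preimage by blast

lemma sfun_comp_smooth:
  assumes M: "manifold M" and N: "manifold N" and f: "smooth_map M N f" and g: "sfun N V g"
  shows "sfun M {z \<in> pts M. f z \<in> V} (\<lambda>z. g (f z))"
proof (rule sfun_local[OF M])
  fix z assume z: "z \<in> {z \<in> pts M. f z \<in> V}"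
  then obtain d where d: "d \<in> atlas N" "f z \<in> cdom d" using manifoldD(3)[OF N smooth_map_pts[OF f]] by blast
  let ?W = "{z \<in> pts M. f z \<in> cdom d \<inter> V}"
  have oW: "openin (mtop M) ?W"
    by (rule smooth_map_preimage[OF f]) (use is_chartD(1)[OF manifoldD(2)[OF N d(1)]] sfun_open[OF g] in auto)
  have "sfun M ?W (\<lambda>z. g (f z))"
    by (rule sfun_comp_chart[OF M N oW d(1) _ sfun_subset[OF M smooth_map_sfun[OF M N f d(1)] oW] g]) auto
  then show "\<exists>W. z \<in> W \<and> W \<subseteq> {z \<in> pts M. f z \<in> V} \<and> sfun M W (\<lambda>z. g (f z))"
    using z d by (intro exI[of _ ?W]) auto
qed

text \<open>Continuity is not presupposed: near each point the preimage of an open set is cut out by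
  the coordinates of the map, which are continuous, and the target chart is a homeomorphism onto an
  open set.\<close>

lemma smooth_mapI:
  assumes M: "manifold M" and N: "manifold N"
    and loc: "\<And>z. z \<in> pts M \<Longrightarrow> \<exists>W. \<exists>d\<in>atlas N. z \<in> W \<and> openin (mtop M) W \<and> f ` W \<subseteq> cdom d \<and>
      (\<forall>j<cdim d. sfun M W (\<lambda>z. cmap d (f z) j))"
  shows "smooth_map M N f"
proof -
  have pre: "openin (mtop M) {z \<in> pts M. f z \<in> V}" if V: "openin (mtop N) V" for V
  proof (subst openin_subopen, intro ballI)
    fix z assume z: "z \<in> {z \<in> pts M. f z \<in> V}"
    then obtain W d where d: "d \<in> atlas N" and W: "z \<in> W" "openin (mtop M) W" "f ` W \<subseteq> cdom d"
      "\<And>j. j < cdim d \<Longrightarrow> sfun M W (\<lambda>z. cmap d (f z) j)" using loc by blast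
    have dc: "is_chart (mtop N) d" using manifoldD(2)[OF N d] .
    have "openin (mtop M) {y \<in> W. cmap d (f y) \<in> cmap d ` (cdom d \<inter> V)}"
      by (rule sfun_preimage_open[OF M W(2,4) _ chart_openin_image[OF N d V]])
         (use W(3) chart_cmap_espace[OF dc] in auto)
    moreover have "{y \<in> W. cmap d (f y) \<in> cmap d ` (cdom d \<inter> V)} \<subseteq> {z \<in> pts M. f z \<in> V}"
      using W(3) openin_subset[OF W(2)] is_chartD(4)[OF dc] by (auto simp: inj_on_def subset_iff)
    moreover have "z \<in> {y \<in> W. cmap d (f y) \<in> cmap d ` (cdom d \<inter> V)}" using z W by auto
    ultimately show "\<exists>T. openin (mtop M) T \<and> z \<in> T \<and> T \<subseteq> {z \<in> pts M. f z \<in> V}" by blast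
  qed
  have "f z \<in> pts N" if "z \<in> pts M" for z
    using loc[OF that] is_chartD(5)[OF manifoldD(2)[OF N]] by blast
  then have cont: "continuous_map (mtop M) (mtop N) f"
    using pre by (auto simp: continuous_map_def)
  have sf: "sfun M {z \<in> pts M. f z \<in> cdom d} (\<lambda>z. cmap d (f z) j)" if d: "d \<in> atlas N" for d j
  proof (rule sfun_local[OF M])
    fix z assume z: "z \<in> {z \<in> pts M. f z \<in> cdom d}"
    then obtain W d' where d': "d' \<in> atlas N" and W: "z \<in> W" "openin (mtop M) W" "f ` W \<subseteq> cdom d'"
      "\<And>j. j < cdim d' \<Longrightarrow> sfun M W (\<lambda>z. cmap d' (f z) j)" using loc by blast
    let ?W = "W \<inter> {z \<in> pts M. f z \<in> cdom d}"
    have oW: "openin (mtop M) ?W"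
      using W(2) pre[OF is_chartD(1)[OF manifoldD(2)[OF N d]]] by blast
    have "sfun M ?W (\<lambda>z. cmap d (f z) j)"
      by (rule sfun_comp_chart[OF M N oW d' _ sfun_subset[OF M W(4) oW] sfun_chart_coord[OF N d]])
         (use W(3) in auto)
    then show "\<exists>W. z \<in> W \<and> W \<subseteq> {z \<in> pts M. f z \<in> cdom d} \<and> sfun M W (\<lambda>z. cmap d (f z) j)"
      using z W by (intro exI[of _ ?W]) auto
  qed
  have dm: "cdom c \<inter> {z \<in> pts M. f z \<in> cdom d} = {z \<in> cdom c. f z \<in> cdom d}" if "c \<in> atlas M" for c d
    using is_chartD(5)[OF manifoldD(2)[OF M that]] by auto
  show ?thesis
    unfolding smooth_map_iff_sfun
  proof (intro conjI cont ballI allI impI)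
    fix d j c k assume "d \<in> atlas N" and c: "c \<in> atlas M"
    then show "Ck_on (cdim c) k (cmap c ` {z \<in> cdom c. f z \<in> cdom d}) (\<lambda>u. cmap d (f (cinv c u)) j)"
      using sfun_Ck[OF sf c] by (simp add: dm[OF c])
  qed
qed

lemma smooth_map_compose:
  assumes "manifold L" "manifold M" "manifold N" "smooth_map L M f" "smooth_map M N g"
  shows "smooth_map L N (\<lambda>z. g (f z))"
proof (rule smooth_mapI[OF assms(1,3)])
  fix z assume z: "z \<in> pts L"
  then obtain d where d: "d \<in> atlas N" "g (f z) \<in> cdom d"
    using manifoldD(3)[OF assms(3)] smooth_map_pts[OF assms(4)] smooth_map_pts[OF assms(5)] by blast
  let ?W = "{z \<in> pts L. f z \<in> {y \<in> pts M. g y \<in> cdom d}}"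
  have "sfun L ?W (\<lambda>z. cmap d (g (f z)) j)" if "j < cdim d" for j
    by (rule sfun_comp_smooth[OF assms(1,2,4) smooth_map_sfun[OF assms(2,3,5) d(1) that]])
  moreover have "openin (mtop L) ?W"
    by (intro smooth_map_preimage[OF assms(4)] smooth_map_preimage[OF assms(5)]
          is_chartD(1)[OF manifoldD(2)[OF assms(3) d(1)]])
  ultimately show "\<exists>W. \<exists>d\<in>atlas N. z \<in> W \<and> openin (mtop L) W \<and> (\<lambda>z. g (f z)) ` W \<subseteq> cdom d \<and>
      (\<forall>j<cdim d. sfun L W (\<lambda>z. cmap d (g (f z)) j))"
    using z d smooth_map_pts[OF assms(4)] by (intro exI[of _ ?W] bexI[of _ d]) auto
qed

lemma smooth_map_cong:
  assumes M: "manifold M" and N: "manifold N" and eq: "\<And>z. z \<in> pts M \<Longrightarrow> f z = g z" and f: "smooth_map M N f"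
  shows "smooth_map M N g"
proof (rule smooth_mapI[OF M N])
  fix z assume z: "z \<in> pts M"
  then obtain d where d: "d \<in> atlas N" "f z \<in> cdom d" using manifoldD(3)[OF N smooth_map_pts[OF f]] by blast
  let ?W = "{z \<in> pts M. f z \<in> cdom d}"
  have "sfun M ?W (\<lambda>z. cmap d (g z) j)" if "j < cdim d" for j
    using smooth_map_sfun[OF M N f d(1) that] sfun_cong[OF M, of ?W "\<lambda>z. cmap d (f z) j" "\<lambda>z. cmap d (g z) j"] eq
    by simp
  moreover have "openin (mtop M) ?W"
    by (intro smooth_map_preimage[OF f] is_chartD(1)[OF manifoldD(2)[OF N d(1)]])
  ultimately show "\<exists>W. \<exists>d\<in>atlas N. z \<in> W \<and> openin (mtop M) W \<and> g ` W \<subseteq> cdom d \<and>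
      (\<forall>j<cdim d. sfun M W (\<lambda>z. cmap d (g z) j))"
    using z d eq by (intro exI[of _ ?W] bexI[of _ d]) auto
qed

lemma smooth_map_id:
  assumes M: "manifold M" shows "smooth_map M M (\<lambda>z. z)"
proof (rule smooth_mapI[OF M M])
  fix z assume "z \<in> pts M"
  then obtain d where d: "d \<in> atlas M" "z \<in> cdom d" using manifoldD(3)[OF M] by blast
  then show "\<exists>W. \<exists>d\<in>atlas M. z \<in> W \<and> openin (mtop M) W \<and> (\<lambda>z. z) ` W \<subseteq> cdom d \<and>
      (\<forall>j<cdim d. sfun M W (\<lambda>z. cmap d z j))"
    using is_chartD(1)[OF manifoldD(2)[OF M d(1)]] sfun_chart_coord[OF M d(1)]
    by (intro exI[of _ "cdom d"] bexI[of _ d]) auto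
qed

lemma smooth_map_const:
  assumes M: "manifold M" and N: "manifold N" and r: "r \<in> pts N" shows "smooth_map M N (\<lambda>_. r)"
proof (rule smooth_mapI[OF M N])
  fix z assume z: "z \<in> pts M"
  obtain d where d: "d \<in> atlas N" "r \<in> cdom d" using manifoldD(3)[OF N r] by blast
  then show "\<exists>W. \<exists>d\<in>atlas N. z \<in> W \<and> openin (mtop M) W \<and> (\<lambda>_. r) ` W \<subseteq> cdom d \<and>
      (\<forall>j<cdim d. sfun M W (\<lambda>_. cmap d r j))"
    using z sfun_const[OF M, of "pts M"] by (intro exI[of _ "pts M"] bexI[of _ d]) auto
qed

lemma smooth_coords_sfun:
  assumes "manifold M" "d \<in> atlas M" "openin (mtop M) W" "\<And>j. j < m \<Longrightarrow> sfun M W (\<lambda>z. G z j)"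
  shows "smooth_coords (cdim d) m (cmap d ` (cdom d \<inter> W)) (\<lambda>u. G (cinv d u))"
  using sfun_Ck[OF assms(4,2)] by (simp add: smooth_coords_def)

section \<open>Changing and restricting charts\<close>

definition chart_change :: "'p chart \<Rightarrow> (nat \<Rightarrow> real) set \<Rightarrow> ((nat \<Rightarrow> real) \<Rightarrow> nat \<Rightarrow> real) \<Rightarrow> 'p chart" where
  "chart_change c U F = \<lparr>cdom = {z \<in> cdom c. cmap c z \<in> U}, cdim = cdim c,
     cmap = restrict (\<lambda>z. F (cmap c z)) {z \<in> cdom c. cmap c z \<in> U}\<rparr>"

text \<open>The atlas is maximal, so being a chart and compatibility are all that has to be checked.
  Recording the image \<open>V\<close> allows charts to be chosen whose image is a box.\<close>

lemma chart_change_atlas: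
  assumes M: "manifold M" and c0: "c0 \<in> atlas M" and U: "U \<subseteq> cmap c0 ` cdom c0"
    and F: "local_diffeo (cdim c0) U V F G"
  shows "chart_change c0 U F \<in> atlas M" "cmap (chart_change c0 U F) ` cdom (chart_change c0 U F) = V"
proof -
  let ?n = "cdim c0" and ?D = "{z \<in> cdom c0. cmap c0 z \<in> U}" and ?c = "chart_change c0 U F"
  have ch0: "is_chart (mtop M) c0" using manifoldD(2)[OF M c0] .
  have op: "eopen ?n U" "eopen ?n V" and sF: "smooth_coords ?n ?n U F" and sG: "smooth_coords ?n ?n V G"
    and FG: "\<And>u. u \<in> U \<Longrightarrow> F u \<in> V \<and> G (F u) = u" "\<And>v. v \<in> V \<Longrightarrow> G v \<in> U \<and> F (G v) = v"
    using F by (auto simp: local_diffeo_def)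
  have oD: "openin (mtop M) ?D" by (rule is_chart_preimage[OF ch0 op(1)])
  have Dpts: "?D \<subseteq> pts M" using openin_subset[OF oD] .
  have c: "cdom ?c = ?D" "cdim ?c = ?n" "\<And>z. z \<in> ?D \<Longrightarrow> cmap ?c z = F (cmap c0 z)"
    "cmap ?c \<in> extensional ?D"
    by (auto simp: chart_change_def)
  have img: "cmap c0 ` ?D = U" using U by auto
  have "cmap ?c ` ?D = F ` cmap c0 ` ?D" using c(3) by (force simp: image_image)
  also have "\<dots> = V" unfolding img using FG by force
  finally have im: "cmap ?c ` ?D = V" .
  then show "cmap ?c ` cdom ?c = V" using c(1) by simp
  have inV: "cmap ?c z \<in> V" if "z \<in> ?D" for z using c(3)[OF that] FG(1) that by simp
  have VE: "V \<subseteq> espace ?n" using openin_espace_subset[OF op(2)] .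
  have top: "topspace (subtopology (mtop M) ?D) = ?D" using Dpts by (simp add: Int_absorb1)
  have inj: "inj_on (cmap ?c) ?D"
  proof (rule inj_onI)
    fix y z assume yz: "y \<in> ?D" "z \<in> ?D" "cmap ?c y = cmap ?c z"
    then have "F (cmap c0 y) = F (cmap c0 z)" using c(3) by simp
    then have "cmap c0 y = cmap c0 z" using FG(1) yz by (metis (no_types, lifting) mem_Collect_eq)
    then show "y = z" using is_chartD(4)[OF ch0] yz by (auto dest: inj_onD)
  qed
  have sf: "sfun M ?D (\<lambda>z. cmap ?c z j)" if "j < ?n" for j
  proof -
    have oc: "openin (mtop M) (cdom c0)" using is_chartD(1)[OF ch0] .
    have "sfun M ?D (\<lambda>z. F (cmap c0 z) j)"
      by (rule sfun_comp_Ck[OF M oD op(1) _ _ smooth_coordsD[OF sF that]])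
         (auto intro: sfun_subset[OF M sfun_chart_coord[OF M c0] oD])
    then show ?thesis using sfun_cong[OF M, of ?D "\<lambda>z. cmap ?c z j" "\<lambda>z. F (cmap c0 z) j"] c(3) by simp
  qed
  have "continuous_map (subtopology (mtop M) ?D) (Euclidean_space ?n) (cmap ?c)"
    unfolding continuous_map_def top
  proof (intro conjI allI impI)
    show "cmap ?c \<in> ?D \<rightarrow> espace ?n" using im VE by blast
    fix Y assume Y: "eopen ?n Y"
    have "openin (mtop M) {z \<in> ?D. cmap ?c z \<in> Y}"
      by (rule sfun_preimage_open[OF M oD sf subsetD[OF VE inV] Y])
    then show "openin (subtopology (mtop M) ?D) {z \<in> ?D. cmap ?c z \<in> Y}"
      by (auto simp: openin_open_subtopology oD)
  qed
  moreover have "open_map (subtopology (mtop M) ?D) (Euclidean_space ?n) (cmap ?c)"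
    unfolding open_map_def
  proof (intro allI impI)
    fix W assume "openin (subtopology (mtop M) ?D) W"
    then have W: "openin (mtop M) W" "W \<subseteq> ?D" by (auto simp: openin_open_subtopology oD)
    have oW: "eopen ?n (cmap c0 ` W)" by (rule is_chartD(7)[OF ch0 W(1)]) (use W in auto)
    have "eopen ?n {v \<in> V. G v \<in> cmap c0 ` W}"
      by (rule eopen_preimage[OF op(2) sG _ oW]) (use FG openin_espace_subset[OF op(1)] in blast)
    moreover have "cmap ?c ` W = F ` cmap c0 ` W" using c(3) W(2) by (force simp: image_image)
    moreover have "F ` cmap c0 ` W = {v \<in> V. G v \<in> cmap c0 ` W}"
    proof (intro equalityI subsetI)
      fix v assume "v \<in> F ` cmap c0 ` W"
      then obtain z where "z \<in> W" "v = F (cmap c0 z)" by auto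
      then show "v \<in> {v \<in> V. G v \<in> cmap c0 ` W}" using FG(1)[of "cmap c0 z"] W(2) by auto
    next
      fix v assume v: "v \<in> {v \<in> V. G v \<in> cmap c0 ` W}"
      then have "v = F (G v)" "G v \<in> cmap c0 ` W" using FG(2) by auto
      then show "v \<in> F ` cmap c0 ` W" by (rule image_eqI)
    qed
    ultimately show "eopen ?n (cmap ?c ` W)" by simp
  qed
  ultimately have "embedding_map (subtopology (mtop M) ?D) (Euclidean_space ?n) (cmap ?c)"
    using inj top by (intro injective_open_imp_embedding_map) auto
  then have ch: "is_chart (mtop M) ?c"
    using c oD im op(2) by (simp add: is_chart_def)
  show "?c \<in> atlas M"
  proof (rule manifoldD(5)[OF M ch])
    fix d assume d: "d \<in> atlas M"
    let ?W = "cmap ?c ` (cdom ?c \<inter> cdom d)" and ?Z = "cmap c0 ` (cdom c0 \<inter> cdom d)"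
    have od: "openin (mtop M) (cdom d)" using is_chartD(1)[OF manifoldD(2)[OF M d]] .
    have oW: "eopen ?n ?W"
      using is_chartD(7)[OF ch openin_Int[OF is_chartD(1)[OF ch] od]] c(2) by auto
    have inv: "cinv ?c v = cinv c0 (G v) \<and> v \<in> V \<and> G v \<in> ?Z" if vW: "v \<in> ?W" for v
    proof -
      obtain z where z: "z \<in> ?D" "z \<in> cdom d" "v = cmap ?c z" using vW c(1) by auto
      have v: "v = F (cmap c0 z)" using z c(3) by simp
      have "cinv ?c v = z" using cinv_cmap[OF ch] z c(1) by simp
      moreover have "G v = cmap c0 z" using v FG(1) z by auto
      ultimately show ?thesis using z inV[OF z(1)] cinv_cmap[OF ch0, of z] by auto
    qed
    have "smooth_coords ?n (cdim d) ?W (\<lambda>u. cmap d (cinv c0 (G u)))"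
    proof (rule smooth_coords_comp[OF oW chart_openin_image[OF M c0 od],
          where g = G and f = "\<lambda>u. cmap d (cinv c0 u)"])
      show "smooth_coords ?n (cdim d) ?Z (\<lambda>u. cmap d (cinv c0 u))"
        using manifoldD(4)[OF M c0 d] by (simp add: compatible_def o_def)
      show "smooth_coords ?n ?n ?W G"
        by (rule smooth_coords_subset[OF op(2) oW _ sG]) (use inv in blast)
    qed (use inv in blast)
    then have "smooth_coords ?n (cdim d) ?W (\<lambda>u. cmap d (cinv ?c u))"
      using smooth_coords_cong[OF oW, of "cdim d" "\<lambda>u. cmap d (cinv ?c u)" "\<lambda>u. cmap d (cinv c0 (G u))"] inv
      by simp
    moreover have "smooth_coords (cdim d) ?n (cmap d ` (cdom d \<inter> ?D)) (\<lambda>u. cmap ?c (cinv d u))"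
      by (rule smooth_coords_sfun[OF M d oD sf])
    ultimately show "compatible ?c d" by (simp add: compatible_def o_def c(1,2) Int_commute)
  qed
qed

definition chart_restrict :: "'p chart \<Rightarrow> 'p set \<Rightarrow> 'p chart" where
  "chart_restrict c W = \<lparr>cdom = cdom c \<inter> W, cdim = cdim c, cmap = restrict (cmap c) (cdom c \<inter> W)\<rparr>"

text \<open>The coordinate change is the identity on a smaller open set; cutting down the map as
  well keeps the chart extensional.\<close>

lemma chart_restrict_atlas:
  assumes M: "manifold M" and c: "c \<in> atlas M" and W: "openin (mtop M) W"
  shows "chart_restrict c W \<in> atlas M"
proof -
  let ?U = "cmap c ` (cdom c \<inter> W)"
  have "{z \<in> cdom c. cmap c z \<in> ?U} = cdom c \<inter> W"
    using is_chartD(4)[OF manifoldD(2)[OF M c]] by (auto simp: inj_on_def)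
  then have "chart_change c ?U (\<lambda>u. u) = chart_restrict c W"
    by (simp add: chart_change_def chart_restrict_def)
  then show ?thesis
    using chart_change_atlas(1)[OF M c _ local_diffeo_id[OF chart_openin_image[OF M c W]]] by auto
qed

subsection \<open>Open submanifolds\<close>

lemma is_chart_open_submfd:
  assumes "openin T U"
  shows "is_chart (subtopology T U) c \<longleftrightarrow> is_chart T c \<and> cdom c \<subseteq> U"
proof (cases "cdom c \<subseteq> U")
  case True
  then have "subtopology (subtopology T U) (cdom c) = subtopology T (cdom c)"
    by (simp add: subtopology_subtopology Int_absorb1)
  then show ?thesis using True assms by (simp add: is_chart_def openin_open_subtopology)
next
  case False
  then show ?thesis using assms by (simp add: is_chart_def openin_open_subtopology)
qed

lemma atlas_open_submfd [simp]: "c \<in> atlas (open_submfd M U) \<longleftrightarrow> c \<in> atlas M \<and> cdom c \<subseteq> U"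
  by (simp add: open_submfd_def)

lemma mtop_open_submfd [simp]: "mtop (open_submfd M U) = subtopology (mtop M) U"
  by (simp add: open_submfd_def)

text \<open>Serves the maximality of the atlas of an open submanifold: charts there are tested
  against charts inside \<open>U\<close>, and the restriction of any chart to \<open>U\<close> is
  one of these.\<close>

lemma compatible_restrict:
  assumes c: "is_chart T c" "is_chart T d" "cdom c \<subseteq> U" "openin T U"
  shows "compatible c (chart_restrict d U) \<longleftrightarrow> compatible c d"
proof -
  let ?d = "chart_restrict d U"
  have sets: "cdom c \<inter> cdom ?d = cdom c \<inter> cdom d" "cmap ?d ` (cdom c \<inter> cdom d) = cmap d ` (cdom c \<inter> cdom d)"
    "cdim ?d = cdim d"
    using c by (auto simp: chart_restrict_def)
  have o1: "eopen (cdim c) (cmap c ` (cdom c \<inter> cdom d))" "eopen (cdim d) (cmap d ` (cdom c \<inter> cdom d))"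
    using is_chartD(7)[OF c(1) openin_Int[OF is_chartD(1)[OF c(1)] is_chartD(1)[OF c(2)]]]
      is_chartD(7)[OF c(2) openin_Int[OF is_chartD(1)[OF c(1)] is_chartD(1)[OF c(2)]]] by auto
  have "smooth_coords (cdim c) (cdim d) (cmap c ` (cdom c \<inter> cdom d)) (\<lambda>u. cmap ?d (cinv c u)) \<longleftrightarrow>
    smooth_coords (cdim c) (cdim d) (cmap c ` (cdom c \<inter> cdom d)) (\<lambda>u. cmap d (cinv c u))"
    by (rule smooth_coords_cong[OF o1(1)])
       (use c cinv_cmap[OF c(1)] in \<open>auto simp: chart_restrict_def subset_iff\<close>)
  moreover have "smooth_coords (cdim d) (cdim c) (cmap d ` (cdom c \<inter> cdom d)) (\<lambda>u. cmap c (cinv ?d u)) \<longleftrightarrow>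
    smooth_coords (cdim d) (cdim c) (cmap d ` (cdom c \<inter> cdom d)) (\<lambda>u. cmap c (cinv d u))"
  proof (rule smooth_coords_cong[OF o1(2)])
    fix u j assume "u \<in> cmap d ` (cdom c \<inter> cdom d)"
    then obtain z where z: "z \<in> cdom d" "z \<in> U" "u = cmap d z" using c(3) by auto
    have "inj_on (cmap ?d) (cdom ?d)"
      using is_chartD(4)[OF c(2)] by (auto simp: chart_restrict_def inj_on_def)
    moreover have "z \<in> cdom ?d" "cmap ?d z = u" using z by (auto simp: chart_restrict_def)
    ultimately have "cinv ?d u = z" using inv_into_f_f by (fastforce simp: cinv_def)
    then show "cmap c (cinv ?d u) j = cmap c (cinv d u) j" using z cinv_cmap[OF c(2)] by simp
  qed
  ultimately show ?thesis
    unfolding compatible_def o_def sets by blast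
qed

lemma manifold_open_submfd:
  assumes M: "manifold M" and U: "openin (mtop M) U"
  shows "manifold (open_submfd M U)"
  unfolding manifold_def
proof (intro conjI ballI allI impI)
  have UM: "U \<subseteq> pts M" using openin_subset[OF U] .
  show "second_countable (mtop (open_submfd M U))"
    using second_countable_subtopology[OF manifoldD(1)[OF M]] by simp
  show "is_chart (mtop (open_submfd M U)) c" if "c \<in> atlas (open_submfd M U)" for c
    using that manifoldD(2)[OF M] is_chart_open_submfd[OF U] by simp
  show "compatible c d" if "c \<in> atlas (open_submfd M U)" "d \<in> atlas (open_submfd M U)" for c d
    using that manifoldD(4)[OF M] by simp
  show "\<Union> (cdom ` atlas (open_submfd M U)) = pts (open_submfd M U)"
  proof (intro equalityI subsetI)
    fix z assume "z \<in> pts (open_submfd M U)"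
    then have z: "z \<in> U" "z \<in> pts M" using UM by auto
    then obtain c where c: "c \<in> atlas M" "z \<in> cdom c" using manifoldD(3)[OF M] by blast
    then have "chart_restrict c U \<in> atlas (open_submfd M U)" "z \<in> cdom (chart_restrict c U)"
      using chart_restrict_atlas[OF M c(1) U] z by (auto simp: chart_restrict_def)
    then show "z \<in> \<Union> (cdom ` atlas (open_submfd M U))" by blast
  qed (use UM in \<open>auto simp: Int_absorb1\<close>)
  show "c \<in> atlas (open_submfd M U)"
    if "is_chart (mtop (open_submfd M U)) c \<and> (\<forall>d\<in>atlas (open_submfd M U). compatible c d)" for c
  proof -
    have c: "is_chart (mtop M) c" "cdom c \<subseteq> U" using that is_chart_open_submfd[OF U] by auto
    have "compatible c d" if d: "d \<in> atlas M" for d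
    proof -
      have "chart_restrict d U \<in> atlas (open_submfd M U)"
        using chart_restrict_atlas[OF M d U] by (auto simp: chart_restrict_def)
      then show ?thesis
        using \<open>is_chart _ c \<and> _\<close> compatible_restrict[OF c(1) manifoldD(2)[OF M d] c(2) U] by blast
    qed
    then show ?thesis using manifoldD(5)[OF M c(1)] c(2) by simp
  qed
qed

lemma sfun_open_submfd:
  assumes M: "manifold M" and U: "openin (mtop M) U"
  shows "sfun (open_submfd M U) W g \<longleftrightarrow> W \<subseteq> U \<and> sfun M W g"
proof (intro iffI conjI)
  assume g: "sfun (open_submfd M U) W g"
  then have oW: "openin (mtop M) W" and WU: "W \<subseteq> U"
    using sfun_open[OF g] U by (auto simp: openin_open_subtopology)
  show "W \<subseteq> U" by (rule WU)
  show "sfun M W g"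
  proof (rule sfun_chartI[OF M oW])
    fix z assume z: "z \<in> W"
    then have "z \<in> pts (open_submfd M U)" using WU openin_subset[OF oW] by auto
    then obtain c where c: "c \<in> atlas (open_submfd M U)" "z \<in> cdom c"
      using manifoldD(3)[OF manifold_open_submfd[OF M U]] by blast
    then show "\<exists>c\<in>atlas M. z \<in> cdom c \<and> (\<exists>V. eopen (cdim c) V \<and> cmap c z \<in> V \<and>
        V \<subseteq> cmap c ` (cdom c \<inter> W) \<and> (\<forall>k. Ck_on (cdim c) k V (\<lambda>u. g (cinv c u))))"
      using z sfun_Ck[OF g c(1)] chart_openin_image[OF M _ oW, of c]
      by (intro bexI[of _ c] conjI exI[of _ "cmap c ` (cdom c \<inter> W)"]) auto
  qed
next
  assume "W \<subseteq> U \<and> sfun M W g"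
  then show "sfun (open_submfd M U) W g"
    using U by (simp add: sfun_def openin_open_subtopology)
qed

lemma pts_open_submfd: "openin (mtop M) U \<Longrightarrow> pts (open_submfd M U) = U"
  using openin_subset by (fastforce simp: Int_absorb1)

lemma smooth_map_open_incl:
  assumes M: "manifold M" and U: "openin (mtop M) U"
  shows "smooth_map (open_submfd M U) M (\<lambda>z. z)"
proof (rule smooth_mapI[OF manifold_open_submfd[OF M U] M])
  fix z assume "z \<in> pts (open_submfd M U)"
  then have z: "z \<in> U" "z \<in> pts M" by auto
  then obtain c where c: "c \<in> atlas M" "z \<in> cdom c" using manifoldD(3)[OF M] by blast
  have o: "openin (mtop M) (U \<inter> cdom c)" using U is_chartD(1)[OF manifoldD(2)[OF M c(1)]] by blast
  then show "\<exists>W. \<exists>d\<in>atlas M. z \<in> W \<and> openin (mtop (open_submfd M U)) W \<and> (\<lambda>z. z) ` W \<subseteq> cdom d \<and>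
      (\<forall>j<cdim d. sfun (open_submfd M U) W (\<lambda>z. cmap d z j))"
    using z c sfun_subset[OF M sfun_chart_coord[OF M c(1)] o]
    by (intro exI[of _ "U \<inter> cdom c"] bexI[of _ c]) (auto simp: sfun_open_submfd[OF M U] openin_open_subtopology U)
qed

lemma smooth_map_restrict:
  assumes "manifold M" "manifold N" "openin (mtop M) U" "smooth_map M N f"
  shows "smooth_map (open_submfd M U) N f"
  using smooth_map_compose[OF manifold_open_submfd[OF assms(1,3)] assms(1,2) smooth_map_open_incl[OF assms(1,3)] assms(4)] .

lemma smooth_map_into_open:
  assumes T: "manifold T" and M: "manifold M" and U: "openin (mtop M) U" and f: "smooth_map T M f"
    and im: "\<And>z. z \<in> pts T \<Longrightarrow> f z \<in> U"
  shows "smooth_map T (open_submfd M U) f"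
proof (rule smooth_mapI[OF T manifold_open_submfd[OF M U]])
  fix z assume z: "z \<in> pts T"
  have "f z \<in> pts (open_submfd M U)" using im[OF z] by (simp only: pts_open_submfd[OF U])
  then obtain d where d: "d \<in> atlas (open_submfd M U)" "f z \<in> cdom d"
    using manifoldD(3)[OF manifold_open_submfd[OF M U]] by blast
  then have dM: "d \<in> atlas M" by simp
  have "openin (mtop T) {z \<in> pts T. f z \<in> cdom d}"
    by (rule smooth_map_preimage[OF f is_chartD(1)[OF manifoldD(2)[OF M dM]]])
  then show "\<exists>W. \<exists>d\<in>atlas (open_submfd M U). z \<in> W \<and> openin (mtop T) W \<and> f ` W \<subseteq> cdom d \<and>
      (\<forall>j<cdim d. sfun T W (\<lambda>z. cmap d (f z) j))"
    using z d smooth_map_sfun[OF T M f dM] by (intro exI[of _ "{z \<in> pts T. f z \<in> cdom d}"] bexI[of _ d]) auto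
qed

lemma smooth_map_local:
  assumes T: "manifold T" and N: "manifold N"
    and loc: "\<And>z. z \<in> pts T \<Longrightarrow> \<exists>W. openin (mtop T) W \<and> z \<in> W \<and> smooth_map (open_submfd T W) N f"
  shows "smooth_map T N f"
proof (rule smooth_mapI[OF T N])
  fix z assume z: "z \<in> pts T"
  then obtain W where W: "openin (mtop T) W" "z \<in> W" and f: "smooth_map (open_submfd T W) N f"
    using loc by blast
  note TW = manifold_open_submfd[OF T W(1)]
  have "f z \<in> pts N" using smooth_map_pts[OF f, of z] W pts_open_submfd[OF W(1)] by blast
  then obtain d where d: "d \<in> atlas N" "f z \<in> cdom d" using manifoldD(3)[OF N] by blast
  let ?Y = "{z \<in> pts (open_submfd T W). f z \<in> cdom d}"
  have "openin (mtop (open_submfd T W)) ?Y"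
    by (rule smooth_map_preimage[OF f is_chartD(1)[OF manifoldD(2)[OF N d(1)]]])
  then have "openin (mtop T) ?Y" by (simp add: openin_open_subtopology W(1))
  moreover have "sfun T ?Y (\<lambda>z. cmap d (f z) j)" if "j < cdim d" for j
    using smooth_map_sfun[OF TW N f d(1) that] sfun_open_submfd[OF T W(1)] by blast
  moreover have "z \<in> ?Y" using W z d by auto
  ultimately show "\<exists>W. \<exists>d\<in>atlas N. z \<in> W \<and> openin (mtop T) W \<and> f ` W \<subseteq> cdom d \<and>
      (\<forall>j<cdim d. sfun T W (\<lambda>z. cmap d (f z) j))"
    using d by (intro exI[of _ ?Y] bexI[of _ d]) auto
qed

lemma smooth_map_cinv:
  assumes T: "manifold T" and N: "manifold N" and d: "d \<in> atlas N"
    and G: "\<And>j. j < cdim d \<Longrightarrow> sfun T (pts T) (\<lambda>z. G z j)" "\<And>z. z \<in> pts T \<Longrightarrow> G z \<in> cmap d ` cdom d"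
  shows "smooth_map T N (\<lambda>z. cinv d (G z))"
proof (rule smooth_mapI[OF T N])
  fix z assume z: "z \<in> pts T"
  have "sfun T (pts T) (\<lambda>z. cmap d (cinv d (G z)) j)" if "j < cdim d" for j
    using sfun_cong[OF T, of "pts T" "\<lambda>z. cmap d (cinv d (G z)) j" "\<lambda>z. G z j"] G(1)[OF that] cmap_cinv[OF G(2)]
    by simp
  then show "\<exists>W. \<exists>d'\<in>atlas N. z \<in> W \<and> openin (mtop T) W \<and> (\<lambda>z. cinv d (G z)) ` W \<subseteq> cdom d' \<and>
      (\<forall>j<cdim d'. sfun T W (\<lambda>z. cmap d' (cinv d (G z)) j))"
    using z d cmap_cinv[OF G(2)] by (intro exI[of _ "pts T"] bexI[of _ d]) auto
qed

subsection \<open>Open sets of Euclidean space as manifolds\<close>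

definition euclid_chart :: "((nat \<Rightarrow> real) \<Rightarrow> 'p) \<Rightarrow> nat \<Rightarrow> (nat \<Rightarrow> real) set \<Rightarrow> 'p chart" where
  "euclid_chart e n Y = \<lparr>cdom = e ` Y, cdim = n, cmap = restrict (inv_into Y e) (e ` Y)\<rparr>"

text \<open>A copy of \<open>Y\<close> inside the type \<open>'p\<close>, with the topology that
  makes \<open>e\<close> a homeomorphism onto it. It turns coordinate formulas into maps from a
  manifold, the kind of test map used in \<open>smooth_on_fibprod\<close>.\<close>

definition euclid_mfd :: "((nat \<Rightarrow> real) \<Rightarrow> 'p) \<Rightarrow> nat \<Rightarrow> (nat \<Rightarrow> real) set \<Rightarrow> 'p mfd" where
  "euclid_mfd e n Y =
    (let T = pullback_topology (e ` Y) (inv_into Y e) (Euclidean_space n)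
     in \<lparr>mtop = T, atlas = {c. is_chart T c \<and> compatible c (euclid_chart e n Y)}\<rparr>)"

context
  fixes e :: "(nat \<Rightarrow> real) \<Rightarrow> 'p" and n Y
  assumes inj: "inj e" and Y: "eopen n Y"
begin

private abbreviation "\<iota> \<equiv> inv_into Y e"
private abbreviation "T \<equiv> euclid_mfd e n Y"
private abbreviation "c0 \<equiv> euclid_chart e n Y"

lemma euclid_inv: "u \<in> Y \<Longrightarrow> \<iota> (e u) = u"
  using inj by (simp add: inj_on_subset)

lemma euclid_openin: "openin (mtop T) W \<longleftrightarrow> (\<exists>U. eopen n U \<and> U \<subseteq> Y \<and> W = e ` U)"
proof
  assume "openin (mtop T) W"
  then obtain U where U: "eopen n U" "W = \<iota> -` U \<inter> e ` Y"
    by (auto simp: euclid_mfd_def openin_pullback_topology)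
  have "W = e ` (U \<inter> Y)" using U(2) euclid_inv by auto
  then show "\<exists>U. eopen n U \<and> U \<subseteq> Y \<and> W = e ` U" using U(1) Y by blast
next
  assume "\<exists>U. eopen n U \<and> U \<subseteq> Y \<and> W = e ` U"
  then obtain U where U: "eopen n U" "U \<subseteq> Y" "W = e ` U" by blast
  have "W = \<iota> -` U \<inter> e ` Y" using U euclid_inv by auto
  then show "openin (mtop T) W" using U(1) by (auto simp: euclid_mfd_def openin_pullback_topology)
qed

lemma euclid_pts: "pts T = e ` Y"
proof (rule antisym)
  show "pts T \<subseteq> e ` Y" using euclid_openin[of "pts T"] by (metis image_mono openin_topspace)
  show "e ` Y \<subseteq> pts T" using euclid_openin[of "e ` Y"] openin_subset Y by blast
qed

lemma euclid_is_chart: "is_chart (mtop T) c0"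
proof -
  have st: "subtopology (mtop T) (e ` Y) = mtop T" using euclid_pts by (metis subtopology_topspace)
  have c: "cdom c0 = e ` Y" "cdim c0 = n" "cmap c0 = restrict \<iota> (e ` Y)" by (auto simp: euclid_chart_def)
  have im: "cmap c0 ` e ` U = U" if "U \<subseteq> Y" for U
  proof -
    have "cmap c0 ` e ` U = (\<lambda>u. u) ` U"
      unfolding image_image by (rule image_cong) (use that euclid_inv in \<open>auto simp: c(3)\<close>)
    then show ?thesis by simp
  qed
  have "continuous_map (mtop T) (Euclidean_space n) (cmap c0)"
    unfolding continuous_map_def
  proof (intro conjI allI impI)
    show "cmap c0 \<in> pts T \<rightarrow> espace n"
      using euclid_inv openin_espace_subset[OF Y] by (auto simp: euclid_pts c(3))
    fix U assume "eopen n U"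
    moreover have "{z \<in> pts T. cmap c0 z \<in> U} = e ` (U \<inter> Y)"
      using euclid_inv inj by (auto simp: euclid_pts c(3) inj_eq)
    ultimately show "openin (mtop T) {z \<in> pts T. cmap c0 z \<in> U}" using euclid_openin Y by blast
  qed
  moreover have "open_map (mtop T) (Euclidean_space n) (cmap c0)"
    unfolding open_map_def using euclid_openin im by metis
  moreover have "inj_on (cmap c0) (pts T)" using euclid_inv by (auto simp: inj_on_def euclid_pts c(3))
  ultimately have "embedding_map (mtop T) (Euclidean_space n) (cmap c0)"
    by (rule injective_open_imp_embedding_map)
  then show ?thesis
    using Y im[of Y] euclid_openin[of "e ` Y"] by (auto simp: is_chart_def c st)
qed

lemma euclid_chart_atlas: "c0 \<in> atlas T"
proof -
  have c: "cdim c0 = n" by (simp add: euclid_chart_def)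
  have o: "eopen n (cmap c0 ` cdom c0)" using is_chartD(3)[OF euclid_is_chart] c by simp
  have "smooth_coords n n (cmap c0 ` cdom c0) (\<lambda>u. cmap c0 (cinv c0 u))"
    by (rule smooth_coords_cong[OF o, THEN iffD2, OF _ smooth_coords_id[OF o]]) (simp add: cmap_cinv)
  then show ?thesis
    using euclid_is_chart c by (simp add: euclid_mfd_def Let_def compatible_def o_def)
qed

lemma euclid_second_countable: "second_countable (mtop T)"
proof -
  have "second_countable (top_of_set (espace n))"
    by (intro second_countable_subtopology) (simp add: second_countable_def open_openin[symmetric], metis ex_countable_basis topological_basisE topological_basis_open)
  then have "second_countable (Euclidean_space n)" by (subst Euclidean_space_eq)
  then obtain \<B> where B: "countable \<B> \<and> (\<forall>V\<in>\<B>. eopen n V) \<and>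
      (\<forall>U x. eopen n U \<and> x \<in> U \<longrightarrow> (\<exists>V\<in>\<B>. x \<in> V \<and> V \<subseteq> U))"
    unfolding second_countable_def by (rule exE)
  then have \<B>: "countable \<B>" "\<And>V. V \<in> \<B> \<Longrightarrow> eopen n V"
    "\<And>U x. eopen n U \<Longrightarrow> x \<in> U \<Longrightarrow> \<exists>V\<in>\<B>. x \<in> V \<and> V \<subseteq> U"
    by auto
  show ?thesis unfolding second_countable_def
  proof (intro exI conjI ballI allI impI)
    show "countable ((\<lambda>V. e ` (V \<inter> Y)) ` \<B>)" using \<B>(1) by simp
    show "openin (mtop T) V" if V: "V \<in> (\<lambda>V. e ` (V \<inter> Y)) ` \<B>" for V
    proof -
      obtain V' where "V' \<in> \<B>" "V = e ` (V' \<inter> Y)" using V by blast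
      then show ?thesis
        unfolding euclid_openin using \<B>(2) Y by (intro exI[of _ "V' \<inter> Y"]) (simp add: openin_Int)
    qed
    fix W x assume "openin (mtop T) W \<and> x \<in> W"
    then obtain U u where U: "eopen n U" "U \<subseteq> Y" "W = e ` U" "u \<in> U" "x = e u" using euclid_openin by auto
    obtain V where "V \<in> \<B>" "u \<in> V" "V \<subseteq> U" using \<B>(3)[OF U(1,4)] by blast
    then show "\<exists>V\<in>(\<lambda>V. e ` (V \<inter> Y)) ` \<B>. x \<in> V \<and> V \<subseteq> W"
      using U by (intro bexI[of _ "e ` (V \<inter> Y)"]) auto
  qed
qed

text \<open>Two charts compatible with the global chart are compatible with each other, because the
  change between them passes through it; so the charts compatible with it form a maximal
  atlas.\<close>

lemma euclid_manifold: "manifold T"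
  unfolding manifold_def
proof (intro conjI ballI allI impI)
  have atl: "c \<in> atlas T \<longleftrightarrow> is_chart (mtop T) c \<and> compatible c c0" for c
    by (simp add: euclid_mfd_def Let_def)
  show "second_countable (mtop T)" by (rule euclid_second_countable)
  show ch: "is_chart (mtop T) c" if "c \<in> atlas T" for c using that atl by blast
  show "\<Union> (cdom ` atlas T) = pts T"
  proof -
    have "cdom c0 = pts T" by (simp add: euclid_pts euclid_chart_def)
    then show ?thesis using euclid_chart_atlas is_chartD(5)[OF ch] by blast
  qed
  have comp: "smooth_coords (cdim c) (cdim d) (cmap c ` (cdom c \<inter> cdom d)) (\<lambda>u. cmap d (cinv c u))"
    if c: "c \<in> atlas T" and d: "d \<in> atlas T" for c d
  proof -
    have cd0: "cdom c \<subseteq> cdom c0" "cdom d \<subseteq> cdom c0"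
      using is_chartD(5)[OF ch] c d by (auto simp: euclid_pts euclid_chart_def)
    have c0d: "cdim c0 = n" by (simp add: euclid_chart_def)
    let ?W = "cmap c ` (cdom c \<inter> cdom d)"
    have od: "openin (mtop T) (cdom c \<inter> cdom d)" using is_chartD(1)[OF ch] c d by blast
    have oW: "eopen (cdim c) ?W" by (rule is_chartD(7)[OF ch[OF c] od]) auto
    have oc: "eopen (cdim c) (cmap c ` cdom c)" and od': "eopen n (cmap c0 ` cdom d)"
      using is_chartD(3)[OF ch[OF c]] is_chartD(7)[OF euclid_is_chart is_chartD(1)[OF ch[OF d]] cd0(2)] c0d by auto
    have s1: "smooth_coords (cdim c) n ?W (\<lambda>u. cmap c0 (cinv c u))"
      by (rule smooth_coords_subset[OF oc oW])
         (use c cd0 c0d in \<open>auto simp: atl compatible_def o_def Int_absorb2\<close>)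
    have s2: "smooth_coords n (cdim d) (cmap c0 ` cdom d) (\<lambda>u. cmap d (cinv c0 u))"
      using d cd0 c0d by (auto simp: atl compatible_def o_def Int_absorb2 Int_commute)
    have "smooth_coords (cdim c) (cdim d) ?W (\<lambda>u. cmap d (cinv c0 (cmap c0 (cinv c u))))"
      by (rule smooth_coords_comp[OF oW od' _ s2 s1]) (use cinv_cmap[OF ch[OF c]] in auto)
    moreover have "cinv c0 (cmap c0 (cinv c u)) = cinv c u" if "u \<in> ?W" for u
      using that cd0 cinv_cmap[OF ch[OF c]] cinv_cmap[OF euclid_is_chart] by auto
    ultimately show ?thesis
      using smooth_coords_cong[OF oW, of "cdim d" "\<lambda>u. cmap d (cinv c u)"
          "\<lambda>u. cmap d (cinv c0 (cmap c0 (cinv c u)))"] by simp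
  qed
  show "compatible c d" if "c \<in> atlas T" "d \<in> atlas T" for c d
    using comp[OF that] comp[OF that(2,1)] by (simp add: compatible_def o_def Int_commute)
  show "c \<in> atlas T" if "is_chart (mtop T) c \<and> (\<forall>d\<in>atlas T. compatible c d)" for c
    using that euclid_chart_atlas atl by blast
qed

lemma euclid_coord_sfun: "sfun T (pts T) (\<lambda>z. \<iota> z j)"
proof -
  have "sfun T (e ` Y) (\<lambda>z. cmap c0 z j)"
    using sfun_chart_coord[OF euclid_manifold euclid_chart_atlas] by (simp add: euclid_chart_def)
  then show ?thesis
    using sfun_cong[OF euclid_manifold, of "e ` Y" "\<lambda>z. cmap c0 z j" "\<lambda>z. \<iota> z j"]
    by (simp add: euclid_pts euclid_chart_def)
qed

text \<open>The way back from the transported manifold to calculus in the model space.\<close>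

lemma euclid_sfun_smooth_coords:
  assumes "\<And>j. j < m \<Longrightarrow> sfun T (e ` U) (\<lambda>z. G z j)" "eopen n U" "U \<subseteq> Y"
  shows "smooth_coords n m U (\<lambda>u. G (e u))"
proof -
  have c: "cdom c0 = e ` Y" "cdim c0 = n" "cmap c0 = restrict \<iota> (e ` Y)" by (auto simp: euclid_chart_def)
  have "openin (mtop T) (e ` U)" using assms(2,3) euclid_openin by blast
  then have "smooth_coords n m (cmap c0 ` (cdom c0 \<inter> e ` U)) (\<lambda>u. G (cinv c0 u))"
    using smooth_coords_sfun[OF euclid_manifold euclid_chart_atlas _ assms(1)] c(2) by simp
  moreover have "cmap c0 ` (cdom c0 \<inter> e ` U) = U"
    using assms(3) euclid_inv by (force simp: c image_iff)
  moreover have "cinv c0 u = e u" if "u \<in> U" for u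
    using cinv_cmap[OF euclid_is_chart, of "e u"] that assms(3) euclid_inv by (auto simp: c)
  ultimately show ?thesis
    using smooth_coords_cong[OF assms(2), of m "\<lambda>u. G (e u)" "\<lambda>u. G (cinv c0 u)"] by simp
qed

end

subsection \<open>Submersions\<close>

lemma submersion_smooth: "submersion M N f \<Longrightarrow> smooth_map M N f"
  by (simp add: submersion_def)

text \<open>The local representative is straightened to the projection onto the first coordinates,
  with the given chart kept on the target. Shrinking the image to a box makes the fibres visible:
  when the first coordinates are fixed, the others vary independently.\<close>

lemma submersion_chart:
  assumes M: "manifold M" and N: "manifold N" and f: "submersion M N f"
    and z: "z \<in> pts M" and d: "d \<in> atlas N" "f z \<in> cdom d" and Z: "openin (mtop M) Z" "z \<in> Z"
  obtains c r where "c \<in> atlas M" "r > 0" "z \<in> cdom c" "cdom c \<subseteq> Z" "cdim d \<le> cdim c" "f ` cdom c \<subseteq> cdom d"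
    "\<And>y j. y \<in> cdom c \<Longrightarrow> j < cdim d \<Longrightarrow> cmap c y j = cmap d (f y) j"
    "cmap c ` cdom c = nbox (cdim c) (cmap c z) r"
proof -
  obtain c0 where c0: "c0 \<in> atlas M" "z \<in> cdom c0" using manifoldD(3)[OF M z] by blast
  have ch0: "is_chart (mtop M) c0" using manifoldD(2)[OF M c0(1)] .
  have fs: "smooth_map M N f" using submersion_smooth[OF f] .
  let ?X = "{y \<in> pts M. f y \<in> cdom d} \<inter> Z"
  let ?W = "cmap c0 ` (cdom c0 \<inter> ?X)"
  have oX: "openin (mtop M) ?X"
    by (intro openin_Int smooth_map_preimage[OF fs] is_chartD(1)[OF manifoldD(2)[OF N d(1)]] Z)
  have oW: "eopen (cdim c0) ?W" by (rule chart_openin_image[OF M c0(1) oX])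
  have sm: "smooth_coords (cdim c0) (cdim d) ?W (local_rep c0 d f)"
    unfolding local_rep_def o_def
    by (rule smooth_coords_sfun[OF M c0(1) oX sfun_subset[OF M smooth_map_sfun[OF M N fs d(1)] oX]]) auto
  have zW: "cmap c0 z \<in> ?W" using z d c0 Z by auto
  have surj: "\<exists>v. \<forall>j<cdim d. (\<Sum>i<cdim c0. partial_deriv i (\<lambda>u. local_rep c0 d f u j) (cmap c0 z) * v i) = w j" for w
    using f z c0 d unfolding submersion_def by blast
  obtain U V F G where dn: "cdim d \<le> cdim c0" and D: "local_diffeo (cdim c0) U V F G" and U: "cmap c0 z \<in> U" "U \<subseteq> ?W"
    and F: "\<forall>u\<in>U. \<forall>l<cdim d. F u l = local_rep c0 d f u l"
    using submersion_straighten[OF oW sm zW surj] by auto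
  have "eopen (cdim c0) V" "F (cmap c0 z) \<in> V" using D U by (auto simp: local_diffeo_def)
  then obtain r where r: "r > 0" "nbox (cdim c0) (F (cmap c0 z)) r \<subseteq> V" using nbox_subset_open by blast
  let ?B = "nbox (cdim c0) (F (cmap c0 z)) r" let ?U = "{u \<in> U. F u \<in> ?B}"
  have D': "local_diffeo (cdim c0) ?U ?B F G" by (rule local_diffeo_restrict[OF D openin_nbox r(2)])
  have U': "?U \<subseteq> cmap c0 ` cdom c0" using U(2) by blast
  let ?c = "chart_change c0 ?U F"
  have c: "?c \<in> atlas M" "cmap ?c ` cdom ?c = ?B" using chart_change_atlas[OF M c0(1) U' D'] by auto
  have dom: "cdom ?c = {y \<in> cdom c0. cmap c0 y \<in> ?U}" "cdim ?c = cdim c0"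
    "\<And>y. y \<in> cdom ?c \<Longrightarrow> cmap ?c y = F (cmap c0 y)"
    by (auto simp: chart_change_def)
  have X: "y \<in> ?X" if "y \<in> cdom ?c" for y
  proof -
    have "cmap c0 y \<in> ?W" "y \<in> cdom c0" using that U(2) dom(1) by auto
    then show ?thesis using is_chartD(4)[OF ch0] by (auto dest: inj_onD)
  qed
  have "F (cmap c0 z) \<in> espace (cdim c0)" using \<open>F (cmap c0 z) \<in> V\<close> openin_espace_subset[OF \<open>eopen _ V\<close>] by blast
  then have zc: "z \<in> cdom ?c" using c0 U in_nbox_self r by (auto simp: dom(1))
  have crd: "cmap ?c y j = cmap d (f y) j" if "y \<in> cdom ?c" "j < cdim d" for y j
    using that F dom cinv_cmap[OF ch0] by (auto simp: local_rep_def)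
  show ?thesis
    by (rule that[OF c(1) r(1) zc _ _ _ crd]) (use X dn dom(2) c(2) dom(3)[OF zc] in auto)
qed

lemma submersion_section:
  assumes M: "manifold M" and N: "manifold N" and f: "submersion M N f" and z: "z \<in> pts M"
  obtains U \<sigma> where "openin (mtop N) U" "f z \<in> U" "smooth_map (open_submfd N U) M \<sigma>" "\<sigma> (f z) = z"
    "\<And>y. y \<in> U \<Longrightarrow> \<sigma> y \<in> pts M \<and> f (\<sigma> y) = y"
proof -
  obtain d where d: "d \<in> atlas N" "f z \<in> cdom d"
    using manifoldD(3)[OF N smooth_map_pts[OF submersion_smooth[OF f] z]] by blast
  obtain c r where c: "c \<in> atlas M" "r > 0" "z \<in> cdom c" "cdim d \<le> cdim c" "f ` cdom c \<subseteq> cdom d"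
    and crd: "\<And>y j. y \<in> cdom c \<Longrightarrow> j < cdim d \<Longrightarrow> cmap c y j = cmap d (f y) j"
    and im: "cmap c ` cdom c = nbox (cdim c) (cmap c z) r"
    by (rule submersion_chart[OF M N f z d openin_topspace z]) blast
  have chd: "is_chart (mtop N) d" and chc: "is_chart (mtop M) c" using manifoldD(2) M N d c by auto
  define U where "U = {y \<in> cdom d. cmap d y \<in> nbox (cdim d) (cmap d (f z)) r}"
  have oU: "openin (mtop N) U" unfolding U_def by (rule is_chart_preimage[OF chd openin_nbox])
  have fzU: "f z \<in> U" using d c(2) in_nbox_self chart_cmap_espace[OF chd] by (auto simp: U_def)
  \<comment> \<open>The section follows the base in the first coordinates and freezes the others at
    their values at \<open>z\<close>; such a point stays in the box.\<close>
  define G where "G y = (\<lambda>j. if j < cdim d then cmap d y j else cmap c z j)" for y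
  have Gim: "G y \<in> cmap c ` cdom c" if "y \<in> U" for y
    unfolding im using that crd[OF c(3)] chart_cmap_espace[OF chc c(3)] c(2,4)
    by (auto simp: nbox_def G_def U_def topspace_Euclidean_space)
  define \<sigma> where "\<sigma> y = cinv c (G y)" for y
  have NU: "manifold (open_submfd N U)" by (rule manifold_open_submfd[OF N oU])
  have ptsU: "pts (open_submfd N U) = U" by (rule pts_open_submfd[OF oU])
  have "smooth_map (open_submfd N U) M \<sigma>"
    unfolding \<sigma>_def
  proof (rule smooth_map_cinv[OF NU M c(1)])
    fix j
    have "sfun N U (\<lambda>y. cmap d y j)"
      by (rule sfun_subset[OF N sfun_chart_coord[OF N d(1)] oU]) (auto simp: U_def)
    then show "sfun (open_submfd N U) (pts (open_submfd N U)) (\<lambda>y. G y j)"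
      unfolding ptsU sfun_open_submfd[OF N oU] using sfun_const[OF N oU]
      by (cases "j < cdim d") (auto simp: G_def)
  qed (use Gim ptsU in blast)
  moreover have sec: "\<sigma> y \<in> pts M \<and> f (\<sigma> y) = y" if y: "y \<in> U" for y
  proof -
    have s: "\<sigma> y \<in> cdom c" "cmap c (\<sigma> y) = G y" using cmap_cinv[OF Gim[OF y]] by (auto simp: \<sigma>_def)
    have "cmap d (f (\<sigma> y)) = cmap d y"
    proof
      fix j show "cmap d (f (\<sigma> y)) j = cmap d y j"
      proof (cases "j < cdim d")
        case True
        then show ?thesis using crd[OF s(1) True] s(2) by (simp add: G_def)
      next
        case False
        moreover have "f (\<sigma> y) \<in> cdom d" "y \<in> cdom d" using s(1) c(5) y by (auto simp: U_def)
        ultimately show ?thesis using espaceD[OF chart_cmap_espace[OF chd]] by simp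
      qed
    qed
    then have "f (\<sigma> y) = y" using is_chartD(4)[OF chd] s(1) c(5) y by (auto simp: U_def dest: inj_onD)
    then show ?thesis using s(1) is_chartD(5)[OF chc] by blast
  qed
  moreover have "\<sigma> (f z) = z"
  proof -
    have "G (f z) = cmap c z" using crd[OF c(3)] by (auto simp: G_def fun_eq_iff)
    then show ?thesis using cinv_cmap[OF chc c(3)] by (simp add: \<sigma>_def)
  qed
  ultimately show ?thesis using that oU fzU by blast
qed

text \<open>The chain rule for \<open>f \<circ> \<sigma> = id\<close> exhibits a right inverse of the Jacobian.\<close>

lemma submersionI_sections:
  assumes M: "manifold M" and N: "manifold N" and f: "smooth_map M N f"
    and sec: "\<And>z. z \<in> pts M \<Longrightarrow> \<exists>U \<sigma>. openin (mtop N) U \<and> f z \<in> U \<and> smooth_map (open_submfd N U) M \<sigma> \<and>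
      \<sigma> (f z) = z \<and> (\<forall>y\<in>U. f (\<sigma> y) = y)"
  shows "submersion M N f"
  unfolding submersion_def
proof (intro conjI f ballI impI allI)
  fix z c d and w :: "nat \<Rightarrow> real"
  assume z: "z \<in> pts M" and c: "c \<in> atlas M" and d: "d \<in> atlas N" and zc: "z \<in> cdom c \<and> f z \<in> cdom d"
  obtain U \<sigma> where U: "openin (mtop N) U" "f z \<in> U" and \<sigma>: "smooth_map (open_submfd N U) M \<sigma>" "\<sigma> (f z) = z"
    and id: "\<And>y. y \<in> U \<Longrightarrow> f (\<sigma> y) = y" using sec[OF z] by blast
  note NU = manifold_open_submfd[OF N U(1)] and chd = manifoldD(2)[OF N d] and chc = manifoldD(2)[OF M c]
  let ?X = "{y \<in> U. \<sigma> y \<in> cdom c}" let ?Y = "{z \<in> pts M. f z \<in> cdom d}"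
  have sfX: "sfun N ?X (\<lambda>y. cmap c (\<sigma> y) j)" if "j < cdim c" for j
    using smooth_map_sfun[OF NU M \<sigma>(1) c that] sfun_open_submfd[OF N U(1)]
    unfolding pts_open_submfd[OF U(1)] by blast
  have oX: "openin (mtop N) ?X"
    using smooth_map_preimage[OF \<sigma>(1) is_chartD(1)[OF chc]] unfolding pts_open_submfd[OF U(1)]
    by (simp add: openin_open_subtopology U(1))
  let ?V = "cmap d ` (cdom d \<inter> ?X)" let ?W = "cmap c ` (cdom c \<inter> ?Y)"
  have oY: "openin (mtop M) ?Y" by (rule smooth_map_preimage[OF f is_chartD(1)[OF chd]])
  have oV: "eopen (cdim d) ?V" and oW: "eopen (cdim c) ?W"
    using chart_openin_image[OF N d oX] chart_openin_image[OF M c oY] by auto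
  define s where "s v = cmap c (\<sigma> (cinv d v))" for v
  define F where "F u = cmap d (f (cinv c u))" for u
  have ss: "smooth_coords (cdim d) (cdim c) ?V s"
    unfolding s_def by (rule smooth_coords_sfun[OF N d oX sfX])
  have sF: "smooth_coords (cdim c) (cdim d) ?W F"
    unfolding F_def by (rule smooth_coords_sfun[OF M c oY smooth_map_sfun[OF M N f d]])
  have sV: "s v \<in> ?W \<and> F (s v) = v" if "v \<in> ?V" for v
    using that cinv_cmap[OF chd] cinv_cmap[OF chc] id is_chartD(5)[OF chc] by (auto simp: s_def F_def)
  let ?v = "cmap d (f z)"
  have vV: "?v \<in> ?V" using zc U \<sigma>(2) by auto
  have sz: "s ?v = cmap c z" using zc \<sigma>(2) cinv_cmap[OF chd] by (simp add: s_def)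
  have spd: "has_pd i (\<lambda>v. s v l) (partial_deriv i (\<lambda>v. s v l) ?v) ?v" if "i < cdim d" "l < cdim c" for i l
    using smooth_coordsD[OF ss that(2), of "Suc 0"] that(1) vV unfolding Ck_Suc[OF oV] by blast
  have key: "(\<Sum>l<cdim c. partial_deriv l (\<lambda>u. F u j) (cmap c z) * partial_deriv i (\<lambda>v. s v l) ?v) = of_bool (i = j)"
    if i: "i < cdim d" and j: "j < cdim d" for i j
  proof -
    have 1: "has_pd i (\<lambda>v. F (s v) j) (\<Sum>l<cdim c. partial_deriv l (\<lambda>u. F u j) (s ?v) * partial_deriv i (\<lambda>v. s v l) ?v) ?v"
      by (rule has_pd_comp[OF oV vV i oW, where f = "\<lambda>u. F u j"])
         (use smooth_coordsD[OF sF j] sV spd[OF i] in auto)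
    have "has_pd i (\<lambda>v. F (s v) j) D ?v \<longleftrightarrow> has_pd i (\<lambda>v. v j) D ?v" for D
      by (rule has_pd_cong[OF oV vV i]) (use sV in auto)
    moreover have "has_pd i (\<lambda>v. v j) (of_bool (i = j)) ?v"
      by (cases "i = j") (auto simp: has_pd_def intro!: derivative_eq_intros)
    ultimately have "has_pd i (\<lambda>v. F (s v) j) (of_bool (i = j)) ?v" by simp
    from has_pd_partial_deriv[OF this] has_pd_partial_deriv[OF 1] show ?thesis unfolding sz by simp
  qed
  define a where "a l = (\<Sum>i<cdim d. partial_deriv i (\<lambda>v. s v l) ?v * w i)" for l
  have "(\<Sum>l<cdim c. partial_deriv l (\<lambda>u. F u j) (cmap c z) * a l) = w j" if j: "j < cdim d" for j
  proof -
    have "(\<Sum>l<cdim c. partial_deriv l (\<lambda>u. F u j) (cmap c z) * a l) =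
      (\<Sum>i<cdim d. (\<Sum>l<cdim c. partial_deriv l (\<lambda>u. F u j) (cmap c z) * partial_deriv i (\<lambda>v. s v l) ?v) * w i)"
      unfolding a_def sum_distrib_left sum_distrib_right by (subst sum.swap) (simp add: mult.assoc)
    also have "\<dots> = (\<Sum>i<cdim d. of_bool (i = j) * w i)" using key[OF _ j] by simp
    also have "\<dots> = w j" using j by simp
    finally show ?thesis .
  qed
  then show "\<exists>v. \<forall>j<cdim d. (\<Sum>i<cdim c. partial_deriv i (\<lambda>u. local_rep c d f u j) (cmap c z) * v i) = w j"
    by (intro exI[of _ a]) (simp add: local_rep_def o_def F_def)
qed

section \<open>Torsors under Lie groupoids\<close>

locale lie_gpd =
  fixes \<Gamma> :: "'p lgpd"
  assumes lie: "lie_groupoid \<Gamma>"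
begin

lemma lie_mfd: "manifold (base \<Gamma>)" "manifold (arrs \<Gamma>)"
  and lie_gs: "submersion (arrs \<Gamma>) (base \<Gamma>) (gs \<Gamma>)" "smooth_map (arrs \<Gamma>) (base \<Gamma>) (gs \<Gamma>)"
  and lie_gi: "smooth_map (arrs \<Gamma>) (arrs \<Gamma>) (gi \<Gamma>)"
  and lie_gu: "smooth_map (base \<Gamma>) (arrs \<Gamma>) (gu \<Gamma>)"
  using lie by (simp_all add: lie_groupoid_def surj_submersion_def submersion_smooth)

lemma gm_smooth:
  "manifold T \<Longrightarrow> smooth_map T (arrs \<Gamma>) p \<Longrightarrow> smooth_map T (arrs \<Gamma>) q \<Longrightarrow>
    (\<And>z. z \<in> pts T \<Longrightarrow> gt \<Gamma> (p z) = gs \<Gamma> (q z)) \<Longrightarrow> smooth_map T (arrs \<Gamma>) (\<lambda>z. gm \<Gamma> (p z) (q z))"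
  using lie by (simp add: lie_groupoid_def smooth_on_fibprod_def)

lemma gm_closed:
  "x \<in> pts (arrs \<Gamma>) \<Longrightarrow> y \<in> pts (arrs \<Gamma>) \<Longrightarrow> gt \<Gamma> x = gs \<Gamma> y \<Longrightarrow>
    gm \<Gamma> x y \<in> pts (arrs \<Gamma>) \<and> gs \<Gamma> (gm \<Gamma> x y) = gs \<Gamma> x \<and> gt \<Gamma> (gm \<Gamma> x y) = gt \<Gamma> y"
  using lie by (simp add: lie_groupoid_def)

lemma gi_closed:
  "x \<in> pts (arrs \<Gamma>) \<Longrightarrow> gi \<Gamma> x \<in> pts (arrs \<Gamma>) \<and> gs \<Gamma> (gi \<Gamma> x) = gt \<Gamma> x \<and> gt \<Gamma> (gi \<Gamma> x) = gs \<Gamma> x \<and>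
    gm \<Gamma> x (gi \<Gamma> x) = gu \<Gamma> (gs \<Gamma> x) \<and> gm \<Gamma> (gi \<Gamma> x) x = gu \<Gamma> (gt \<Gamma> x)"
  using lie smooth_map_pts[OF lie_gi] by (simp add: lie_groupoid_def)

end

locale lie_torsor = lie_gpd \<Gamma> for \<Gamma> :: "'p lgpd" +
  fixes P :: "'p tors"
  assumes tor: "torsor \<Gamma> P"
begin

abbreviation "Pm \<equiv> src (tproj P)"
abbreviation "Sm \<equiv> tgt (tproj P)"
abbreviation "pr \<equiv> fn (tproj P)"
abbreviation "an \<equiv> fn (tanch P)"
abbreviation "act \<equiv> tact P"
abbreviation "A \<equiv> arrs \<Gamma>"

lemma tor_mfd: "manifold Pm" "manifold Sm"
  and tor_pr: "submersion Pm Sm pr" "smooth_map Pm Sm pr" "pr ` pts Pm = pts Sm"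
  and tor_an: "smooth_map Pm (base \<Gamma>) an"
  using tor by (auto simp: torsor_def is_smap_def surj_submersion_def dest: submersion_smooth)

lemma act_smooth:
  "manifold T \<Longrightarrow> smooth_map T Pm p \<Longrightarrow> smooth_map T A q \<Longrightarrow>
    (\<And>z. z \<in> pts T \<Longrightarrow> an (p z) = gs \<Gamma> (q z)) \<Longrightarrow> smooth_map T Pm (\<lambda>z. act (p z) (q z))"
  using tor by (simp add: torsor_def smooth_on_fibprod_def)

lemma act_closed:
  "p \<in> pts Pm \<Longrightarrow> \<gamma> \<in> pts A \<Longrightarrow> an p = gs \<Gamma> \<gamma> \<Longrightarrow>
    act p \<gamma> \<in> pts Pm \<and> an (act p \<gamma>) = gt \<Gamma> \<gamma> \<and> pr (act p \<gamma>) = pr p"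
  using tor by (simp add: torsor_def)

lemma act_unit: "p \<in> pts Pm \<Longrightarrow> act p (gu \<Gamma> (an p)) = p"
  using tor unfolding torsor_def by blast

lemma act_assoc:
  "p \<in> pts Pm \<Longrightarrow> \<gamma> \<in> pts A \<Longrightarrow> \<delta> \<in> pts A \<Longrightarrow> an p = gs \<Gamma> \<gamma> \<Longrightarrow> gt \<Gamma> \<gamma> = gs \<Gamma> \<delta> \<Longrightarrow>
    act (act p \<gamma>) \<delta> = act p (gm \<Gamma> \<gamma> \<delta>)"
  using tor unfolding torsor_def by blast

lemma act_gi: "p \<in> pts Pm \<Longrightarrow> \<gamma> \<in> pts A \<Longrightarrow> an p = gs \<Gamma> \<gamma> \<Longrightarrow> act (act p \<gamma>) (gi \<Gamma> \<gamma>) = p"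
  using act_assoc[of p \<gamma> "gi \<Gamma> \<gamma>"] gi_closed[of \<gamma>] act_unit[of p] by simp

text \<open>Division within a fibre. The axioms provide it pointwise; its smoothness is the analytic
  core.\<close>

definition dv :: "'p \<Rightarrow> 'p \<Rightarrow> 'p" where
  "dv p p' = (THE \<gamma>. \<gamma> \<in> pts A \<and> an p = gs \<Gamma> \<gamma> \<and> act p \<gamma> = p')"

lemma dv_ex1: "p \<in> pts Pm \<Longrightarrow> p' \<in> pts Pm \<Longrightarrow> pr p = pr p' \<Longrightarrow>
    \<exists>!\<gamma>. \<gamma> \<in> pts A \<and> an p = gs \<Gamma> \<gamma> \<and> act p \<gamma> = p'"
  using tor unfolding torsor_def by blast

lemma dv: "p \<in> pts Pm \<Longrightarrow> p' \<in> pts Pm \<Longrightarrow> pr p = pr p' \<Longrightarrow>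
    dv p p' \<in> pts A \<and> gs \<Gamma> (dv p p') = an p \<and> gt \<Gamma> (dv p p') = an p' \<and> act p (dv p p') = p'"
proof -
  assume p: "p \<in> pts Pm" "p' \<in> pts Pm" "pr p = pr p'"
  from theI'[OF dv_ex1[OF p]] have "dv p p' \<in> pts A \<and> an p = gs \<Gamma> (dv p p') \<and> act p (dv p p') = p'"
    unfolding dv_def .
  then show ?thesis using act_closed[OF p(1), of "dv p p'"] by auto
qed

lemma dv_unique: "p \<in> pts Pm \<Longrightarrow> \<gamma> \<in> pts A \<Longrightarrow> an p = gs \<Gamma> \<gamma> \<Longrightarrow> dv p (act p \<gamma>) = \<gamma>"
  unfolding dv_def by (rule the1_equality[OF dv_ex1]) (use act_closed in auto)

end

text \<open>
  The data for studying the orbit map near an arrow \<open>\<gamma>0\<close> starting at the anchor of \<open>p0\<close>: a section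
  \<open>\<sigma>\<close> of the projection through \<open>p0\<close> and charts \<open>cP\<close>, \<open>cG\<close> adapted to the projection and to the
  source map.
\<close>

locale orbit_chart = lie_torsor \<Gamma> P for \<Gamma> :: "'p lgpd" and P +
  fixes e :: "(nat \<Rightarrow> real) \<Rightarrow> 'p" and p0 US \<sigma> dS cP dM cG rG \<gamma>0
  assumes inj_e: "inj e"
    and p0: "p0 \<in> pts (src (tproj P))"
    and US: "openin (mtop (tgt (tproj P))) US" "fn (tproj P) p0 \<in> US"
    and \<sigma>: "smooth_map (open_submfd (tgt (tproj P)) US) (src (tproj P)) \<sigma>" "\<sigma> (fn (tproj P) p0) = p0"
      "\<And>y. y \<in> US \<Longrightarrow> \<sigma> y \<in> pts (src (tproj P)) \<and> fn (tproj P) (\<sigma> y) = y"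
    and dS: "dS \<in> atlas (tgt (tproj P))" "fn (tproj P) p0 \<in> cdom dS"
    and cP: "cP \<in> atlas (src (tproj P))" "\<And>y. y \<in> cdom cP \<Longrightarrow> fn (tproj P) y \<in> cdom dS \<inter> US"
      "\<And>y j. y \<in> cdom cP \<Longrightarrow> j < cdim dS \<Longrightarrow> cmap cP y j = cmap dS (fn (tproj P) y) j"
    and \<gamma>0: "\<gamma>0 \<in> pts (arrs \<Gamma>)" "gs \<Gamma> \<gamma>0 = fn (tanch P) p0" "tact P p0 \<gamma>0 \<in> cdom cP"
    and dM: "dM \<in> atlas (base \<Gamma>)" "fn (tanch P) p0 \<in> cdom dM"
    and cG: "cG \<in> atlas (arrs \<Gamma>)" "rG > 0" "\<gamma>0 \<in> cdom cG" "cdim dM \<le> cdim cG" "gs \<Gamma> ` cdom cG \<subseteq> cdom dM"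
      "\<And>y j. y \<in> cdom cG \<Longrightarrow> j < cdim dM \<Longrightarrow> cmap cG y j = cmap dM (gs \<Gamma> y) j"
      "cmap cG ` cdom cG = nbox (cdim cG) (cmap cG \<gamma>0) rG"
begin

abbreviation "d \<equiv> cdim dS"
abbreviation "\<mu> \<equiv> cdim dM"
text \<open>Parameters of the orbit map: the first \<open>d\<close> coordinates give a base point,
  the other \<open>n - d\<close> the free coordinates of an arrow. The first \<open>\<mu>\<close>
  coordinates of the arrow, as \<open>G\<close> shows, are forced by matching its source with the
  anchor of the section.\<close>

definition "n = d + (cdim cG - \<mu>)"
definition sp :: "(nat \<Rightarrow> real) \<Rightarrow> nat \<Rightarrow> real" where "sp u = (\<lambda>i. if i < d then u i else 0)"
definition bs :: "(nat \<Rightarrow> real) \<Rightarrow> 'p" where "bs u = cinv dS (sp u)"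
definition G :: "(nat \<Rightarrow> real) \<Rightarrow> nat \<Rightarrow> real" where
  "G u = (\<lambda>i. if i < \<mu> then cmap dM (an (\<sigma> (bs u))) i else if i < cdim cG then u (i - \<mu> + d) else 0)"
definition "SX = {y \<in> pts (open_submfd Sm US). an (\<sigma> y) \<in> cdom dM}"
text \<open>Successive domains: on \<open>Y1\<close> the base point and the anchor of the section
  lie in their charts, on \<open>Y2\<close> the arrow does as well, and on \<open>Y\<close> also the
  translated point.\<close>

definition "Y1 = {u \<in> espace n. sp u \<in> cmap dS ` (cdom dS \<inter> SX)}"
definition "Y2 = {u \<in> Y1. G u \<in> cmap cG ` cdom cG}"
definition \<kappa> :: "(nat \<Rightarrow> real) \<Rightarrow> 'p" where "\<kappa> u = cinv cG (G u)"
definition \<psi> :: "(nat \<Rightarrow> real) \<Rightarrow> 'p" where "\<psi> u = act (\<sigma> (bs u)) (\<kappa> u)"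
definition "Y = {u \<in> Y2. \<psi> u \<in> cdom cP}"
definition F :: "(nat \<Rightarrow> real) \<Rightarrow> nat \<Rightarrow> real" where "F u = cmap cP (\<psi> u)"
text \<open>The parameter of an arrow \<open>\<gamma>\<close> acting on \<open>p0\<close> itself:
  the coordinates of the base point of \<open>p0\<close>, then the free coordinates of
  \<open>\<gamma>\<close>.\<close>

definition pt :: "'p \<Rightarrow> nat \<Rightarrow> real" where
  "pt \<gamma> = (\<lambda>i. if i < d then cmap dS (pr p0) i else if i < n then cmap cG \<gamma> (i - d + \<mu>) else 0)"

lemma mfdU: "manifold (open_submfd Sm US)" and ptsU: "pts (open_submfd Sm US) = US"
  using manifold_open_submfd[OF tor_mfd(2) US(1)] pts_open_submfd[OF US(1)] by auto

lemmas chS = manifoldD(2)[OF tor_mfd(2) dS(1)]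
lemmas chP = manifoldD(2)[OF tor_mfd(1) cP(1)]
lemmas chM = manifoldD(2)[OF lie_mfd(1) dM(1)]
lemmas chG = manifoldD(2)[OF lie_mfd(2) cG(1)]

lemma an_\<sigma>: "smooth_map (open_submfd Sm US) (base \<Gamma>) (\<lambda>y. an (\<sigma> y))"
  by (rule smooth_map_compose[OF mfdU tor_mfd(1) lie_mfd(1) \<sigma>(1) tor_an])

lemma oSX: "openin (mtop Sm) SX" and SX: "y \<in> SX \<Longrightarrow> y \<in> US \<and> an (\<sigma> y) \<in> cdom dM"
  using smooth_map_preimage[OF an_\<sigma> is_chartD(1)[OF chM]] US(1) unfolding SX_def ptsU
  by (auto simp: openin_open_subtopology)

lemma dn: "d \<le> n" by (simp add: n_def)

lemma sp_espace: "sp u \<in> espace d" by (rule espaceI) (simp add: sp_def)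

lemma smooth_coords_sp: "eopen m U \<Longrightarrow> smooth_coords m d U sp"
  by (simp add: smooth_coords_def sp_def Ck_coord)

lemma oY1: "eopen n Y1"
  unfolding Y1_def
  by (rule eopen_preimage[OF openin_topspace _ _ chart_openin_image[OF tor_mfd(2) dS(1) oSX]])
     (use sp_espace in \<open>auto simp: smooth_coords_sp\<close>)

lemma bs: "u \<in> Y1 \<Longrightarrow> bs u \<in> cdom dS \<and> bs u \<in> US \<and> cmap dS (bs u) = sp u \<and> an (\<sigma> (bs u)) \<in> cdom dM"
  using SX cinv_cmap[OF chS] by (auto simp: Y1_def bs_def)

abbreviation "T1 \<equiv> euclid_mfd e n Y1"
abbreviation "\<iota> \<equiv> inv_into Y1 e"

lemmas T1 = euclid_manifold[OF inj_e oY1] euclid_pts[OF inj_e oY1] euclid_inv[OF inj_e oY1]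

lemma bs_smooth: "smooth_map T1 (open_submfd Sm US) (\<lambda>z. bs (\<iota> z))"
proof (rule smooth_map_into_open[OF T1(1) tor_mfd(2) US(1)])
  show "smooth_map T1 Sm (\<lambda>z. bs (\<iota> z))"
    unfolding bs_def
  proof (rule smooth_map_cinv[OF T1(1) tor_mfd(2) dS(1)])
    show "sfun T1 (pts T1) (\<lambda>z. sp (\<iota> z) j)" if "j < d" for j
      using euclid_coord_sfun[OF inj_e oY1, of j] that by (simp add: sp_def)
  qed (use T1 in \<open>auto simp: Y1_def\<close>)
qed (use T1 bs in auto)

lemma P1_smooth: "smooth_map T1 Pm (\<lambda>z. \<sigma> (bs (\<iota> z)))"
  by (rule smooth_map_compose[OF T1(1) mfdU tor_mfd(1) bs_smooth \<sigma>(1)])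

lemma G_sfun: "sfun T1 (pts T1) (\<lambda>z. G (\<iota> z) j)" if j: "j < cdim cG"
proof (cases "j < \<mu>")
  case True
  have sm: "smooth_map T1 (base \<Gamma>) (\<lambda>z. an (\<sigma> (bs (\<iota> z))))"
    by (rule smooth_map_compose[OF T1(1) tor_mfd(1) lie_mfd(1) P1_smooth tor_an])
  have "{z \<in> pts T1. an (\<sigma> (bs (\<iota> z))) \<in> cdom dM} = pts T1" using T1 bs by auto
  then show ?thesis
    using smooth_map_sfun[OF T1(1) lie_mfd(1) sm dM(1) True] True by (simp add: G_def)
next
  case False
  then show ?thesis using euclid_coord_sfun[OF inj_e oY1] j by (simp add: G_def)
qed

lemma G_espace: "G u \<in> espace (cdim cG)"
  using cG(4) by (intro espaceI) (simp add: G_def)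

lemma oY2: "eopen n Y2"
  unfolding Y2_def
proof (rule eopen_preimage[OF oY1 _ _ is_chartD(3)[OF chG]])
  have "smooth_coords n (cdim cG) Y1 (\<lambda>u. G (\<iota> (e u)))"
    by (rule euclid_sfun_smooth_coords[OF inj_e oY1]) (use G_sfun T1 oY1 in auto)
  then show "smooth_coords n (cdim cG) Y1 G"
    using smooth_coords_cong[OF oY1, of "cdim cG" "\<lambda>u. G (\<iota> (e u))" G] T1 by simp
qed (use G_espace in auto)

lemma Y2_sub: "Y2 \<subseteq> Y1" by (auto simp: Y2_def)

lemma \<kappa>: "u \<in> Y2 \<Longrightarrow> \<kappa> u \<in> cdom cG \<and> cmap cG (\<kappa> u) = G u \<and> \<kappa> u \<in> pts A \<and> gs \<Gamma> (\<kappa> u) = an (\<sigma> (bs u))"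
proof -
  assume u: "u \<in> Y2"
  then have k: "\<kappa> u \<in> cdom cG" "cmap cG (\<kappa> u) = G u"
    using cmap_cinv[of "G u" cG] by (auto simp: Y2_def \<kappa>_def)
  have "cmap dM (gs \<Gamma> (\<kappa> u)) = cmap dM (an (\<sigma> (bs u)))"
  proof
    fix j show "cmap dM (gs \<Gamma> (\<kappa> u)) j = cmap dM (an (\<sigma> (bs u))) j"
    proof (cases "j < \<mu>")
      case True
      then show ?thesis using cG(6)[OF k(1) True] k(2) by (simp add: G_def)
    next
      case False
      then show ?thesis
        using espaceD[OF chart_cmap_espace[OF chM]] k(1) cG(5) bs[of u] u Y2_sub by (auto simp: image_subset_iff)
    qed
  qed
  then have "gs \<Gamma> (\<kappa> u) = an (\<sigma> (bs u))"
    using is_chartD(4)[OF chM] k(1) cG(5) bs[of u] u Y2_sub by (auto dest!: inj_onD)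
  then show ?thesis using k is_chartD(5)[OF chG] by blast
qed

lemma \<psi>: "u \<in> Y2 \<Longrightarrow> \<psi> u \<in> pts Pm \<and> pr (\<psi> u) = bs u"
  using act_closed[of "\<sigma> (bs u)" "\<kappa> u"] \<kappa>[of u] \<sigma>(3)[of "bs u"] bs[of u] Y2_sub by (auto simp: \<psi>_def)

abbreviation "T2 \<equiv> euclid_mfd e n Y2"
abbreviation "\<iota>2 \<equiv> inv_into Y2 e"
lemmas T2 = euclid_manifold[OF inj_e oY2] euclid_pts[OF inj_e oY2] euclid_inv[OF inj_e oY2]

text \<open>Stated for any parameter \<open>g\<close> depending on a test manifold, because it is
  applied twice: to the parameters themselves, for smoothness of \<open>\<psi>\<close>, and to a
  left inverse of the orbit map, for smoothness of division.\<close>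

lemma smooth_Y2:
  assumes T: "manifold T" and g: "\<And>j. j < n \<Longrightarrow> sfun T (pts T) (\<lambda>z. g z j)" "\<And>z. z \<in> pts T \<Longrightarrow> g z \<in> Y2"
  shows "smooth_map T Pm (\<lambda>z. \<sigma> (bs (g z)))" "smooth_map T A (\<lambda>z. \<kappa> (g z))"
proof -
  have g1: "g z \<in> Y1" if "z \<in> pts T" for z using g(2) Y2_sub that by blast
  have c0: "euclid_chart e n Y1 \<in> atlas T1" "cdim (euclid_chart e n Y1) = n"
    "cmap (euclid_chart e n Y1) ` cdom (euclid_chart e n Y1) = Y1"
    using euclid_chart_atlas[OF inj_e oY1] T1(3) by (auto simp: euclid_chart_def image_image)
  have "smooth_map T T1 (\<lambda>z. cinv (euclid_chart e n Y1) (g z))"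
    by (rule smooth_map_cinv[OF T T1(1) c0(1)]) (use g g1 c0 in auto)
  moreover have "cinv (euclid_chart e n Y1) (g z) = e (g z)" if "z \<in> pts T" for z
    using cinv_cmap[OF euclid_is_chart[OF inj_e oY1], of "e (g z)"] g1[OF that] T1(3)
    by (simp add: euclid_chart_def)
  ultimately have eg: "smooth_map T T1 (\<lambda>z. e (g z))"
    using smooth_map_cong[OF T T1(1)] by fastforce
  show "smooth_map T Pm (\<lambda>z. \<sigma> (bs (g z)))"
    by (rule smooth_map_cong[OF T tor_mfd(1) _ smooth_map_compose[OF T T1(1) tor_mfd(1) eg P1_smooth]])
       (simp add: g1 T1(3))
  show "smooth_map T A (\<lambda>z. \<kappa> (g z))"
    unfolding \<kappa>_def
  proof (rule smooth_map_cinv[OF T lie_mfd(2) cG(1)])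
    fix j assume j: "j < cdim cG"
    have "sfun T {z \<in> pts T. e (g z) \<in> pts T1} (\<lambda>z. G (\<iota> (e (g z))) j)"
      by (rule sfun_comp_smooth[OF T T1(1) eg G_sfun[OF j]])
    moreover have "{z \<in> pts T. e (g z) \<in> pts T1} = pts T" using g1 T1(2) by auto
    ultimately show "sfun T (pts T) (\<lambda>z. G (g z) j)"
      using sfun_cong[OF T, of "pts T" "\<lambda>z. G (\<iota> (e (g z))) j" "\<lambda>z. G (g z) j"] g1 T1(3) by simp
  qed (use g(2) in \<open>auto simp: Y2_def\<close>)
qed

lemma \<psi>_smooth: "smooth_map T2 Pm (\<lambda>z. \<psi> (\<iota>2 z))"
  unfolding \<psi>_def
proof (rule act_smooth[OF T2(1)])
  show "smooth_map T2 Pm (\<lambda>z. \<sigma> (bs (\<iota>2 z)))" "smooth_map T2 A (\<lambda>z. \<kappa> (\<iota>2 z))"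
    by (rule smooth_Y2[OF T2(1) euclid_coord_sfun[OF inj_e oY2]]; use T2 in auto)+
qed (use T2 \<kappa> in auto)

lemma oY: "eopen n Y"
  and F_smooth: "smooth_coords n (cdim cP) Y F"
proof -
  let ?W = "{z \<in> pts T2. \<psi> (\<iota>2 z) \<in> cdom cP}"
  have eq: "?W = e ` Y" using T2 by (auto simp: Y_def)
  have "openin (mtop T2) (e ` Y)"
    using smooth_map_preimage[OF \<psi>_smooth is_chartD(1)[OF chP]] eq by simp
  then obtain U where "eopen n U" "e ` Y = e ` U" using euclid_openin[OF inj_e oY2] by auto
  then show oY: "eopen n Y" using inj_e by (simp add: inj_image_eq_iff)
  have "smooth_coords n (cdim cP) Y (\<lambda>u. cmap cP (\<psi> (\<iota>2 (e u))))"
    by (rule euclid_sfun_smooth_coords[OF inj_e oY2])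
       (use smooth_map_sfun[OF T2(1) tor_mfd(1) \<psi>_smooth cP(1)] eq oY in \<open>auto simp: Y_def\<close>)
  then show "smooth_coords n (cdim cP) Y F"
    using smooth_coords_cong[OF oY, of "cdim cP" F "\<lambda>u. cmap cP (\<psi> (\<iota>2 (e u)))"] T2(3)
    by (simp add: F_def Y_def)
qed

lemma Y_sub: "Y \<subseteq> Y2" by (auto simp: Y_def)

lemma F_espace: "F ` Y \<subseteq> espace (cdim cP)"
  using chart_cmap_espace[OF chP] by (auto simp: F_def Y_def)

lemma F_fst: "u \<in> Y \<Longrightarrow> j < d \<Longrightarrow> F u j = u j"
  using cP(3)[of "\<psi> u" j] \<psi>[of u] bs[of u] Y_sub Y2_sub by (auto simp: F_def Y_def sp_def)

text \<open>The action is free on fibres: from \<open>\<psi> u\<close> the base point is recovered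
  by projection and the arrow by division, and these two determine \<open>u\<close>.\<close>

lemma F_inj: "inj_on F Y"
proof (rule inj_onI)
  fix u v assume uv: "u \<in> Y" "v \<in> Y" "F u = F v"
  have 2: "u \<in> Y2" "v \<in> Y2" "u \<in> Y1" "v \<in> Y1" using uv Y_sub Y2_sub by auto
  have ps: "\<psi> u = \<psi> v" using uv is_chartD(4)[OF chP] by (auto simp: F_def Y_def dest: inj_onD)
  then have b: "bs u = bs v" using \<psi>[OF 2(1)] \<psi>[OF 2(2)] by metis
  have "\<kappa> u = dv (\<sigma> (bs u)) (\<psi> u)" "\<kappa> v = dv (\<sigma> (bs v)) (\<psi> v)"
    unfolding \<psi>_def
    by (rule dv_unique[symmetric]; use \<kappa> 2 bs \<sigma>(3) in auto)+
  then have "G u = G v" using \<kappa>[OF 2(1)] \<kappa>[OF 2(2)] ps b by metis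
  moreover have "sp u = sp v" using bs[OF 2(3)] bs[OF 2(4)] b by metis
  ultimately have GG: "G u i = G v i" and ss: "sp u i = sp v i" for i by auto
  have E: "u \<in> espace n" "v \<in> espace n" using 2 by (auto simp: Y1_def)
  show "u = v"
  proof
    fix i
    consider "i < d" | "d \<le> i" "i < n" | "n \<le> i" by linarith
    then show "u i = v i"
    proof cases
      case 1 then show ?thesis using ss[of i] by (simp add: sp_def)
    next
      case 2
      define k where "k = i - d + \<mu>"
      have "\<not> k < \<mu>" "k < cdim cG" "k - \<mu> + d = i" using 2 by (auto simp: k_def n_def)
      then show ?thesis using GG[of k] by (simp add: G_def)
    next
      case 3 then show ?thesis using E by (simp add: espaceD)
    qed
  qed
qed

lemma pt: "pt \<gamma> \<in> Y2 \<and> \<kappa> (pt \<gamma>) = \<gamma> \<and> bs (pt \<gamma>) = pr p0"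
  if \<gamma>: "\<gamma> \<in> cdom cG" "gs \<Gamma> \<gamma> = an p0"
proof -
  have s: "sp (pt \<gamma>) = cmap dS (pr p0)"
    using espaceD[OF chart_cmap_espace[OF chS dS(2)]] by (auto simp: sp_def pt_def fun_eq_iff)
  then have b: "bs (pt \<gamma>) = pr p0" using cinv_cmap[OF chS dS(2)] by (simp add: bs_def)
  have "G (pt \<gamma>) = cmap cG \<gamma>"
  proof
    fix i
    consider "i < \<mu>" | "\<mu> \<le> i" "i < cdim cG" | "\<mu> \<le> i" "cdim cG \<le> i" by linarith
    then show "G (pt \<gamma>) i = cmap cG \<gamma> i"
    proof cases
      case 1
      then show ?thesis using cG(6)[OF \<gamma>(1) 1] \<gamma>(2) \<sigma>(2) by (simp add: G_def b)
    next
      case 2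
      define k where "k = i - \<mu> + d"
      have "\<not> k < d" "k < n" "k - d + \<mu> = i" using 2 by (auto simp: k_def n_def)
      then have "pt \<gamma> k = cmap cG \<gamma> i" by (simp add: pt_def)
      then show ?thesis using 2 by (simp add: G_def k_def)
    next
      case 3
      then show ?thesis using espaceD[OF chart_cmap_espace[OF chG \<gamma>(1)], of i] by (simp add: G_def)
    qed
  qed
  moreover have "pt \<gamma> \<in> espace n" by (rule espaceI) (use dn in \<open>auto simp: pt_def\<close>)
  moreover have "pr p0 \<in> SX" using US \<sigma>(2) dM(2) by (simp add: SX_def ptsU[simplified])
  ultimately show ?thesis
    using s b dS(2) \<gamma>(1) cinv_cmap[OF chG \<gamma>(1)] by (auto simp: Y2_def Y1_def \<kappa>_def)
qed

lemma pt_\<psi>: "\<psi> (pt \<gamma>) = act p0 \<gamma>" if \<gamma>: "\<gamma> \<in> cdom cG" "gs \<Gamma> \<gamma> = an p0"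
  using pt[OF that] \<sigma>(2) by (simp add: \<psi>_def)

lemma pt_Y: "pt \<gamma>0 \<in> Y"
  using pt[OF cG(3) \<gamma>0(2)] pt_\<psi>[OF cG(3) \<gamma>0(2)] \<gamma>0(3) by (simp add: Y_def)

text \<open>Compactness makes the image of the piece closed, as Baire's theorem requires; the open
  set \<open>W\<close> of arrows is what allows countably many pieces to suffice.\<close>

lemma compact_piece:
  obtains C W where "compact C" "C \<subseteq> Y" "\<And>u i. u \<in> C \<Longrightarrow> i < d \<Longrightarrow> u i = cmap dS (pr p0) i"
    "openin (mtop A) W" "\<gamma>0 \<in> W"
    "\<And>\<gamma>. \<gamma> \<in> W \<Longrightarrow> gs \<Gamma> \<gamma> = an p0 \<Longrightarrow> pt \<gamma> \<in> C \<and> \<psi> (pt \<gamma>) = act p0 \<gamma>"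
proof -
  obtain r where r: "r > 0" "nbox n (pt \<gamma>0) r \<subseteq> Y" using nbox_subset_open[OF oY pt_Y] by blast
  \<comment> \<open>Half the radius keeps the closed box inside the open one. Base coordinates and
    those from \<open>n\<close> on are single points, so the product stays over the base point of
    \<open>p0\<close> and inside the model space.\<close>
  define K where "K i = (if i < d \<or> n \<le> i then {pt \<gamma>0 i} else {pt \<gamma>0 i - r/2 .. pt \<gamma>0 i + r/2})" for i
  define C where "C = (\<Pi>\<^sub>E i\<in>UNIV. K i)"
  have "compactin (product_topology (\<lambda>_. euclidean) UNIV) C"
    unfolding C_def compactin_PiE by (auto simp: K_def)
  then have "compact C" by (simp add: euclidean_product_topology)
  moreover have "C \<subseteq> Y"
  proof
    fix u assume "u \<in> C"
    then have K: "u i \<in> K i" for i by (auto simp: C_def)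
    have ptE: "pt \<gamma>0 \<in> espace n" using pt_Y oY openin_espace_subset by blast
    have "u \<in> espace n"
    proof (rule espaceI)
      fix i assume "n \<le> i"
      then show "u i = 0" using K[of i] ptE by (simp add: K_def espaceD)
    qed
    moreover have "\<bar>u i - pt \<gamma>0 i\<bar> < r" if "i < n" for i
      using K[of i] that r(1) by (auto simp: K_def abs_if split: if_splits)
    ultimately show "u \<in> Y" using r(2) by (auto simp: nbox_def)
  qed
  moreover have "u i = cmap dS (pr p0) i" if "u \<in> C" "i < d" for u i
  proof -
    have "u i \<in> K i" using that(1) by (auto simp: C_def)
    then show ?thesis using that(2) by (simp add: K_def pt_def)
  qed
  moreover define W where "W = {\<gamma> \<in> cdom cG. cmap cG \<gamma> \<in> nbox (cdim cG) (cmap cG \<gamma>0) (r/2)}"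
  have "openin (mtop A) W" unfolding W_def by (rule is_chart_preimage[OF chG openin_nbox])
  moreover have "\<gamma>0 \<in> W" using cG(3) r(1) chart_cmap_espace[OF chG] by (auto simp: W_def intro: in_nbox_self)
  moreover have "pt \<gamma> \<in> C \<and> \<psi> (pt \<gamma>) = act p0 \<gamma>" if "\<gamma> \<in> W" "gs \<Gamma> \<gamma> = an p0" for \<gamma>
  proof -
    have "pt \<gamma> i \<in> K i" for i
    proof (cases "i < d \<or> n \<le> i")
      case True
      then show ?thesis using dn by (auto simp: K_def pt_def)
    next
      case False
      then have "i - d + \<mu> < cdim cG" by (auto simp: n_def)
      then have "\<bar>cmap cG \<gamma> (i - d + \<mu>) - cmap cG \<gamma>0 (i - d + \<mu>)\<bar> < r/2"
        using that(1) by (auto simp: W_def nbox_def)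
      then show ?thesis using False by (auto simp: K_def pt_def abs_if split: if_splits)
    qed
    then show ?thesis using pt_\<psi>[of \<gamma>] that by (auto simp: C_def W_def)
  qed
  ultimately show ?thesis using that by blast
qed

end

section \<open>Smoothness of division\<close>

context lie_torsor
begin

text \<open>The open set \<open>N\<close> has to meet the fibre of \<open>p0\<close> only somewhere,
  since Baire's theorem does not say where the good point lies. Division is measured from a
  reference point \<open>\<sigma> (pr x)\<close> common to a whole fibre, so that it cancels when
  two divisions are combined.\<close>

definition dv_smooth_near :: "'p \<Rightarrow> bool" where
  "dv_smooth_near p0 \<longleftrightarrow> (\<exists>N p' D \<sigma>. openin (mtop Pm) N \<and> p' \<in> N \<and> pr p' = pr p0 \<and>
     smooth_map (open_submfd Pm N) A D \<and>
     (\<forall>x\<in>N. \<sigma> (pr x) \<in> pts Pm \<and> pr (\<sigma> (pr x)) = pr x \<and> D x = dv (\<sigma> (pr x)) x))"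

end

context orbit_chart
begin

text \<open>The slice lemma gives the opposite inequality of dimensions and a smooth left inverse.
  Invariance of domain then makes the image of the orbit map open near some point, and there the
  arrow part of the left inverse is division.\<close>

lemma dv_smooth_nearI:
  assumes dP: "d \<le> cdim cP" and le: "cdim cP \<le> n"
  shows "dv_smooth_near p0"
proof -
  have "n \<le> cdim cP \<and> (\<exists>u0\<in>Y. (\<forall>j<d. u0 j = pt \<gamma>0 j) \<and> (\<exists>U V L. eopen n U \<and> u0 \<in> U \<and> U \<subseteq> Y \<and>
    eopen (cdim cP) V \<and> smooth_coords (cdim cP) n V L \<and> L ` V \<subseteq> espace n \<and> (\<forall>u\<in>U. F u \<in> V \<and> L (F u) = u)))"
    by (rule injective_slice_left_inverse[OF oY F_smooth F_espace dn dP F_fst pt_Y inj_on_subset[OF F_inj]]) auto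
  then obtain u0 U V L where nc: "n \<le> cdim cP" and u0: "u0 \<in> Y" "\<forall>j<d. u0 j = pt \<gamma>0 j"
    and U: "eopen n U" "u0 \<in> U" "U \<subseteq> Y" and V: "eopen (cdim cP) V"
    and L: "smooth_coords (cdim cP) n V L" "\<forall>u\<in>U. F u \<in> V \<and> L (F u) = u"
    by (elim conjE bexE exE) (rule that; assumption)
  have nn: "cdim cP = n" using nc le by simp
  have FU: "continuous_map (subtopology (Euclidean_space n) U) (Euclidean_space n) F"
    by (rule smooth_coords_continuous[OF U(1) smooth_coords_subset[OF oY U(1,3)]])
       (use F_smooth F_espace U(3) nn in auto)
  have oFU: "eopen n (F ` U)"
    by (rule invariance_of_domain_Euclidean_space[OF U(1) FU inj_on_subset[OF F_inj U(3)]])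
  define N where "N = {x \<in> cdom cP. cmap cP x \<in> F ` U}"
  have oN: "openin (mtop Pm) N"
    unfolding N_def by (rule is_chart_preimage[OF chP]) (use oFU nn in simp)
  have Nf: "\<sigma> (pr x) \<in> pts Pm \<and> pr (\<sigma> (pr x)) = pr x \<and> \<kappa> (L (cmap cP x)) = dv (\<sigma> (pr x)) x \<and> L (cmap cP x) \<in> Y2"
    if x: "x \<in> N" for x
  proof -
    obtain u where u: "u \<in> U" "cmap cP x = F u" "x \<in> cdom cP" using x by (auto simp: N_def)
    have uY: "u \<in> Y" "u \<in> Y2" "u \<in> Y1" using u U(3) Y_sub Y2_sub by auto
    have "\<psi> u \<in> cdom cP" using uY(1) by (simp add: Y_def)
    then have ps: "\<psi> u = x" using u is_chartD(4)[OF chP] by (auto simp: F_def dest: inj_onD)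
    have b: "bs u = pr x" using \<psi>[OF uY(2)] ps by simp
    have "dv (\<sigma> (bs u)) (\<psi> u) = \<kappa> u"
      unfolding \<psi>_def by (rule dv_unique) (use \<kappa>[OF uY(2)] bs[OF uY(3)] \<sigma>(3) in auto)
    then show ?thesis
      using ps b L(2) u uY bs[OF uY(3)] \<sigma>(3)[of "bs u"] by auto
  qed
  have PN: "manifold (open_submfd Pm N)" "pts (open_submfd Pm N) = N"
    using manifold_open_submfd[OF tor_mfd(1) oN] pts_open_submfd[OF oN] by auto
  have sm: "smooth_map (open_submfd Pm N) A (\<lambda>x. \<kappa> (L (cmap cP x)))"
  proof (rule smooth_Y2(2)[OF PN(1)])
    fix j assume j: "j < n"
    have "sfun Pm N (\<lambda>x. L (cmap cP x) j)"
    proof (rule sfun_comp_Ck[OF tor_mfd(1) oN V, where F = "\<lambda>w. L w j" and G = "cmap cP"])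
      show "sfun Pm N (\<lambda>z. cmap cP z j)" for j
        by (rule sfun_subset[OF tor_mfd(1) sfun_chart_coord[OF tor_mfd(1) cP(1)] oN]) (auto simp: N_def)
      show "Ck_on (cdim cP) k V (\<lambda>w. L w j)" for k using smooth_coordsD[OF L(1) j] .
    qed (use L(2) in \<open>auto simp: N_def\<close>)
    then show "sfun (open_submfd Pm N) (pts (open_submfd Pm N)) (\<lambda>x. L (cmap cP x) j)"
      unfolding PN(2) sfun_open_submfd[OF tor_mfd(1) oN] by simp
  qed (use Nf PN(2) in blast)
  have u0': "u0 \<in> Y2" using u0 Y_sub by blast
  have "sp u0 = sp (pt \<gamma>0)" using u0(2) by (auto simp: sp_def)
  then have b0: "bs u0 = pr p0" using pt[OF cG(3) \<gamma>0(2)] by (simp add: bs_def)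
  have m: "\<psi> u0 \<in> N" "pr (\<psi> u0) = pr p0"
    using u0(1) U(2) \<psi>[OF u0'] b0 by (auto simp: N_def Y_def F_def)
  show ?thesis
    unfolding dv_smooth_near_def
    by (intro exI[of _ N] exI[of _ "\<psi> u0"] exI[of _ "\<lambda>x. \<kappa> (L (cmap cP x))"] exI[of _ \<sigma>] conjI ballI oN m sm)
       (use Nf in auto)
qed

text \<open>\<open>l\<close> is the fibre dimension of the projection, and \<open>tl\<close> keeps
  the fibre coordinates alone, shifted to the front, so that the fibre of \<open>p0\<close> is
  studied in a model space of its own.\<close>

definition "l = cdim cP - d"
definition tl where "tl w = (\<lambda>i. if i < l then w (i + d) else 0)" for w :: "nat \<Rightarrow> real"

text \<open>
  If the fibres of the source map had smaller dimension than those of the projection, the image of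
  the compact piece could not contain an open set, by invariance of domain.
\<close>

lemma piece:
  assumes dP: "d \<le> cdim cP"
  obtains W Q where "openin (mtop A) W" "\<gamma>0 \<in> W" "closedin (Euclidean_space l) Q"
    "\<And>\<gamma>. \<gamma> \<in> W \<Longrightarrow> gs \<Gamma> \<gamma> = an p0 \<Longrightarrow> tl (cmap cP (act p0 \<gamma>)) \<in> Q"
    "Euclidean_space l interior_of Q \<noteq> {} \<Longrightarrow> dv_smooth_near p0"
proof -
  obtain C W where C: "compact C" "C \<subseteq> Y" "\<And>u i. u \<in> C \<Longrightarrow> i < d \<Longrightarrow> u i = cmap dS (pr p0) i"
    and W: "openin (mtop A) W" "\<gamma>0 \<in> W"
    "\<And>\<gamma>. \<gamma> \<in> W \<Longrightarrow> gs \<Gamma> \<gamma> = an p0 \<Longrightarrow> pt \<gamma> \<in> C \<and> \<psi> (pt \<gamma>) = act p0 \<gamma>"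
    using compact_piece by blast
  define f where "f u = tl (F u)" for u
  have tlE: "tl w \<in> espace l" for w by (rule espaceI) (simp add: tl_def)
  have fC: "continuous_on C f"
  proof (rule continuous_on_into_espace[where m = l])
    show "f u \<in> espace l" for u by (simp add: f_def tlE)
    fix j assume j: "j < l"
    then have "j + d < cdim cP" by (auto simp: l_def)
    then have "continuous_on C (\<lambda>u. F u (j + d))"
      using Ck_continuous[OF oY smooth_coordsD[OF F_smooth]] C(2) continuous_on_subset by blast
    then show "continuous_on C (\<lambda>u. f u j)" using j by (simp add: f_def tl_def)
  qed
  have finj: "inj_on f C"
  proof (rule inj_onI)
    fix u v assume uv: "u \<in> C" "v \<in> C" "f u = f v"
    have "F u = F v"
    proof
      fix i
      consider "i < d" | "d \<le> i" "i < cdim cP" | "cdim cP \<le> i" by linarith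
      then show "F u i = F v i"
      proof cases
        case 1
        then show ?thesis
          using F_fst[OF subsetD[OF C(2) uv(1)] 1] F_fst[OF subsetD[OF C(2) uv(2)] 1]
            C(3)[OF uv(1) 1] C(3)[OF uv(2) 1] by simp
      next
        case 2
        then have "i - d < l" "i - d + d = i" by (auto simp: l_def)
        then show ?thesis using fun_cong[OF uv(3), of "i - d"] by (simp add: f_def tl_def)
      next
        case 3
        have "F u \<in> espace (cdim cP)" "F v \<in> espace (cdim cP)" using F_espace C(2) uv by blast+
        then show ?thesis using 3 by (simp add: espaceD)
      qed
    qed
    then show "u = v" using F_inj C uv by (auto dest: inj_onD)
  qed
  have "compact (f ` C)" using compact_continuous_image[OF fC C(1)] .
  then have cl: "closedin (Euclidean_space l) (f ` C)"
    unfolding closedin_Euclidean_space_iff using compact_imp_closed tlE by (auto simp: f_def)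
  have "dv_smooth_near p0" if ne: "Euclidean_space l interior_of (f ` C) \<noteq> {}"
  proof (rule ccontr)
    assume "\<not> dv_smooth_near p0"
    then have lt: "n < cdim cP" using dv_smooth_nearI[OF dP] by linarith
    define k where "k = n - d"
    have kl: "k < l" using lt dn by (auto simp: k_def l_def)
    let ?U = "Euclidean_space l interior_of (f ` C)"
    have oU: "eopen l ?U" by (rule openin_interior_of)
    have Us: "?U \<subseteq> f ` C" by (rule interior_of_subset)
    let ?g = "inv_into C f"
    \<comment> \<open>The inverse of \<open>f\<close>, with the constant base coordinates dropped,
      followed by the inclusion of \<open>k\<close>-space into \<open>l\<close>-space by zeros:
      continuous and injective, yet with image in a coordinate hyperplane.\<close>
    define h where "h w = (\<lambda>i. if i < k then ?g w (i + d) else 0)" for w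
    have gC: "continuous_on (f ` C) ?g"
      by (rule continuous_on_inv[OF fC C(1)]) (use finj in auto)
    have hc: "continuous_on ?U h"
    proof (rule continuous_on_into_espace[where m = k])
      show "h w \<in> espace k" for w by (rule espaceI) (simp add: h_def)
      fix j assume "j < k"
      then have "continuous_on (f ` C) (\<lambda>w. h w j)"
        using continuous_on_compose2[OF continuous_on_coord[of UNIV "j + d"] gC] by (simp add: h_def)
      then show "continuous_on ?U (\<lambda>w. h w j)" using Us continuous_on_subset by blast
    qed
    have hE: "h w \<in> espace l" "i \<ge> k \<Longrightarrow> h w i = 0" for w i
      using kl by (auto simp: h_def intro: espaceI)
    have "topspace (subtopology (Euclidean_space l) ?U) = ?U"
      using openin_espace_subset[OF oU] by (simp add: Int_absorb1)
    then have hm: "continuous_map (subtopology (Euclidean_space l) ?U) (Euclidean_space l) h"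
      using hc hE by (simp add: cm_Euclidean_space_iff_continuous_on)
    have hi: "inj_on h ?U"
    proof (rule inj_onI)
      fix v w assume vw: "v \<in> ?U" "w \<in> ?U" "h v = h w"
      then have g: "?g v \<in> C" "?g w \<in> C" "f (?g v) = v" "f (?g w) = w"
        using Us by (auto simp: inv_into_into f_inv_into_f subset_iff)
      have E: "?g v \<in> espace n" "?g w \<in> espace n" using g(1,2) C(2) openin_espace_subset[OF oY] by auto
      have "?g v = ?g w"
      proof
        fix i
        consider "i < d" | "d \<le> i" "i < n" | "n \<le> i" by linarith
        then show "?g v i = ?g w i"
        proof cases
          case 1 then show ?thesis using C(3)[OF g(1) 1] C(3)[OF g(2) 1] by simp
        next
          case 2
          then have "i - d < k" "i - d + d = i" by (auto simp: k_def)
          then show ?thesis using fun_cong[OF vw(3), of "i - d"] by (simp add: h_def)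
        next
          case 3 then show ?thesis using E by (simp add: espaceD)
        qed
      qed
      then show "v = w" using g by metis
    qed
    have oh: "eopen l (h ` ?U)" by (rule invariance_of_domain_Euclidean_space[OF oU hm hi])
    obtain w where w: "w \<in> ?U" using ne by blast
    then obtain r where r: "r > 0" "nbox l (h w) r \<subseteq> h ` ?U"
      using nbox_subset_open[OF oh, of "h w"] by blast
    \<comment> \<open>An open image would contain a point whose \<open>k\<close>-th coordinate is
      nonzero.\<close>
    have "(h w)(k := r / 2) \<in> nbox l (h w) r"
      using r(1) kl hE by (auto simp: nbox_def espace_upd)
    then obtain w' where "(h w)(k := r / 2) = h w'" using r(2) by blast
    from fun_cong[OF this, of k] show False using hE(2)[of k w'] r(1) by simp
  qed
  moreover have "tl (cmap cP (act p0 \<gamma>)) \<in> f ` C" if "\<gamma> \<in> W" "gs \<Gamma> \<gamma> = an p0" for \<gamma>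
    using W(3)[OF that] by (metis F_def f_def image_eqI)
  ultimately show ?thesis using that[OF W(1,2) cl] by blast
qed

end

context lie_torsor
begin

text \<open>The section and the chart \<open>cP\<close> stay fixed while the arrow chart varies with
  \<open>\<gamma>0\<close>, so all the closed sets lie in one model space. Together they cover the
  fibre coordinates of the points of \<open>cdom cP\<close> over the base point of
  \<open>p0\<close>, and these fill a box.\<close>

lemma all_dv_smooth_near:
  assumes e: "inj (e :: (nat \<Rightarrow> real) \<Rightarrow> 'p)" and p0: "p0 \<in> pts Pm"
  shows "dv_smooth_near p0"
proof (rule ccontr)
  assume neg: "\<not> dv_smooth_near p0"
  obtain US \<sigma> where US: "openin (mtop Sm) US" "pr p0 \<in> US"
    and \<sigma>: "smooth_map (open_submfd Sm US) Pm \<sigma>" "\<sigma> (pr p0) = p0" "\<And>y. y \<in> US \<Longrightarrow> \<sigma> y \<in> pts Pm \<and> pr (\<sigma> y) = y"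
    by (rule submersion_section[OF tor_mfd tor_pr(1) p0]) blast
  obtain dS where dS: "dS \<in> atlas Sm" "pr p0 \<in> cdom dS"
    using manifoldD(3)[OF tor_mfd(2) smooth_map_pts[OF tor_pr(2) p0]] by blast
  obtain dM where dM: "dM \<in> atlas (base \<Gamma>)" "an p0 \<in> cdom dM"
    using manifoldD(3)[OF lie_mfd(1) smooth_map_pts[OF tor_an p0]] by blast
  have oZ: "openin (mtop Pm) {x \<in> pts Pm. pr x \<in> US}" by (rule smooth_map_preimage[OF tor_pr(2) US(1)])
  obtain cP rP where cP: "cP \<in> atlas Pm" "rP > 0" "p0 \<in> cdom cP" "cdom cP \<subseteq> {x \<in> pts Pm. pr x \<in> US}"
    "cdim dS \<le> cdim cP" "pr ` cdom cP \<subseteq> cdom dS"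
    and crd: "\<And>y j. y \<in> cdom cP \<Longrightarrow> j < cdim dS \<Longrightarrow> cmap cP y j = cmap dS (pr y) j"
    and im: "cmap cP ` cdom cP = nbox (cdim cP) (cmap cP p0) rP"
    by (rule submersion_chart[OF tor_mfd tor_pr(1) p0 dS oZ]) (use p0 US(2) in auto)
  define l where "l = cdim cP - cdim dS"
  define tl where "tl w = (\<lambda>i. if i < l then w (i + cdim dS) else 0)" for w :: "nat \<Rightarrow> real"
  define X where "X = {\<gamma> \<in> pts A. gs \<Gamma> \<gamma> = an p0 \<and> act p0 \<gamma> \<in> cdom cP}"
  have pieces: "\<exists>W Q. openin (mtop A) W \<and> \<gamma>0 \<in> W \<and> closedin (Euclidean_space l) Q \<and>
      (\<forall>\<gamma>\<in>W. gs \<Gamma> \<gamma> = an p0 \<longrightarrow> tl (cmap cP (act p0 \<gamma>)) \<in> Q) \<and> Euclidean_space l interior_of Q = {}"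
    if \<gamma>0: "\<gamma>0 \<in> X" for \<gamma>0
  proof -
    have g: "\<gamma>0 \<in> pts A" "gs \<Gamma> \<gamma>0 = an p0" "act p0 \<gamma>0 \<in> cdom cP" using \<gamma>0 by (auto simp: X_def)
    obtain cG rG where cG: "cG \<in> atlas A" "rG > 0" "\<gamma>0 \<in> cdom cG" "cdim dM \<le> cdim cG" "gs \<Gamma> ` cdom cG \<subseteq> cdom dM"
      "\<And>y j. y \<in> cdom cG \<Longrightarrow> j < cdim dM \<Longrightarrow> cmap cG y j = cmap dM (gs \<Gamma> y) j"
      "cmap cG ` cdom cG = nbox (cdim cG) (cmap cG \<gamma>0) rG"
      by (rule submersion_chart[OF lie_mfd(2,1) lie_gs(1) g(1) dM(1) _ openin_topspace g(1)]) (use g(2) dM(2) in auto)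
    interpret oc: orbit_chart \<Gamma> P e p0 US \<sigma> dS cP dM cG rG \<gamma>0
      by unfold_locales (use e p0 US \<sigma> dS cP crd g dM cG in auto)
    have eq: "oc.l = l" "oc.tl = tl" by (auto simp: oc.l_def l_def oc.tl_def tl_def fun_eq_iff)
    show ?thesis using oc.piece[OF cP(5)] neg unfolding eq by metis
  qed
  have "\<forall>\<gamma>0\<in>X. \<exists>WQ. openin (mtop A) (fst WQ) \<and> \<gamma>0 \<in> fst WQ \<and> closedin (Euclidean_space l) (snd WQ) \<and>
      (\<forall>\<gamma>\<in>fst WQ. gs \<Gamma> \<gamma> = an p0 \<longrightarrow> tl (cmap cP (act p0 \<gamma>)) \<in> snd WQ) \<and> Euclidean_space l interior_of (snd WQ) = {}"
    using pieces unfolding split_paired_Ex fst_conv snd_conv by (rule ballI)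
  from bchoice[OF this] obtain WQ where WQ: "\<forall>\<gamma>0\<in>X. openin (mtop A) (fst (WQ \<gamma>0)) \<and> \<gamma>0 \<in> fst (WQ \<gamma>0) \<and>
      closedin (Euclidean_space l) (snd (WQ \<gamma>0)) \<and>
      (\<forall>\<gamma>\<in>fst (WQ \<gamma>0). gs \<Gamma> \<gamma> = an p0 \<longrightarrow> tl (cmap cP (act p0 \<gamma>)) \<in> snd (WQ \<gamma>0)) \<and>
      Euclidean_space l interior_of (snd (WQ \<gamma>0)) = {}"
    by (rule exE)
  define W Q where "W \<gamma> = fst (WQ \<gamma>)" and "Q \<gamma> = snd (WQ \<gamma>)" for \<gamma>
  have W: "\<And>\<gamma>. \<gamma> \<in> X \<Longrightarrow> openin (mtop A) (W \<gamma>)" "\<And>\<gamma>. \<gamma> \<in> X \<Longrightarrow> \<gamma> \<in> W \<gamma>"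
    and Q: "\<And>\<gamma>. \<gamma> \<in> X \<Longrightarrow> closedin (Euclidean_space l) (Q \<gamma>)" "\<And>\<gamma>. \<gamma> \<in> X \<Longrightarrow> Euclidean_space l interior_of (Q \<gamma>) = {}"
    "\<And>\<gamma> \<delta>. \<gamma> \<in> X \<Longrightarrow> \<delta> \<in> W \<gamma> \<Longrightarrow> gs \<Gamma> \<delta> = an p0 \<Longrightarrow> tl (cmap cP (act p0 \<delta>)) \<in> Q \<gamma>"
    using WQ by (auto simp: W_def Q_def)
  obtain \<B> where B: "countable \<B> \<and> (\<forall>V\<in>\<B>. openin (mtop A) V) \<and>
      (\<forall>U x. openin (mtop A) U \<and> x \<in> U \<longrightarrow> (\<exists>V\<in>\<B>. x \<in> V \<and> V \<subseteq> U))"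
    using manifoldD(1)[OF lie_mfd(2)] unfolding second_countable_def by (rule exE)
  \<comment> \<open>A countable base makes a family indexed by all arrows countable: one arrow is
    chosen for each basic set contained in some \<open>W \<gamma>\<close>.\<close>
  define \<B>' where "\<B>' = {b \<in> \<B>. \<exists>\<gamma>\<in>X. b \<subseteq> W \<gamma>}"
  define ch where "ch b = (SOME \<gamma>. \<gamma> \<in> X \<and> b \<subseteq> W \<gamma>)" for b
  have ch: "ch b \<in> X \<and> b \<subseteq> W (ch b)" if "b \<in> \<B>'" for b
    unfolding ch_def by (rule someI_ex) (use that in \<open>auto simp: \<B>'_def\<close>)
  have cnt: "countable (Q ` ch ` \<B>')"
    using B by (auto simp: \<B>'_def intro: countable_subset[of _ \<B>])
  have "Euclidean_space l interior_of \<Union>(Q ` ch ` \<B>') = {}"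
    by (rule Baire_category_alt[OF disjI1[OF completely_metrizable_Euclidean_space] cnt])
       (use Q(1,2) ch in blast)
  moreover have "nbox l (tl (cmap cP p0)) rP \<subseteq> \<Union>(Q ` ch ` \<B>')"
  proof
    fix w assume w: "w \<in> nbox l (tl (cmap cP p0)) rP"
    \<comment> \<open>Base coordinates of \<open>p0\<close>, fibre coordinates prescribed by
      \<open>w\<close>. As the chart image is a box, \<open>u\<close> is attained at a point
      \<open>x\<close> in the fibre of \<open>p0\<close>, and division gives an arrow from
      \<open>p0\<close> to \<open>x\<close>.\<close>
    define u where "u = (\<lambda>i. if i < cdim dS then cmap cP p0 i else if i < cdim cP then w (i - cdim dS) else 0)"
    have "u \<in> nbox (cdim cP) (cmap cP p0) rP" unfolding nbox_def
    proof (intro CollectI conjI allI impI)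
      show "u \<in> espace (cdim cP)" by (rule espaceI) (use cP(5) in \<open>simp add: u_def\<close>)
      fix i assume i: "i < cdim cP"
      show "\<bar>u i - cmap cP p0 i\<bar> < rP"
      proof (cases "i < cdim dS")
        case False
        then have "i - cdim dS < l" "i - cdim dS + cdim dS = i" using i by (auto simp: l_def)
        then have "\<bar>w (i - cdim dS) - cmap cP p0 i\<bar> < rP"
          using w by (auto simp: nbox_def tl_def dest!: spec[of _ "i - cdim dS"])
        then show ?thesis using False i by (simp add: u_def)
      qed (use cP(2) in \<open>simp add: u_def\<close>)
    qed
    then obtain x where x: "x \<in> cdom cP" "cmap cP x = u" using im by (metis imageE)
    have xP: "x \<in> pts Pm" using x cP(4) by blast
    have "cmap dS (pr x) = cmap dS (pr p0)"
    proof
      fix j show "cmap dS (pr x) j = cmap dS (pr p0) j"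
      proof (cases "j < cdim dS")
        case True
        then show ?thesis using crd[OF x(1) True] crd[OF cP(3) True] x(2) by (simp add: u_def)
      next
        case False
        then show ?thesis
          using espaceD[OF chart_cmap_espace[OF manifoldD(2)[OF tor_mfd(2) dS(1)]]] x cP(6) dS(2) by auto
      qed
    qed
    then have prx: "pr p0 = pr x"
      using is_chartD(4)[OF manifoldD(2)[OF tor_mfd(2) dS(1)]] x cP(6) dS(2) by (auto dest!: inj_onD)
    have \<gamma>: "dv p0 x \<in> X" "act p0 (dv p0 x) = x" using dv[OF p0 xP prx] x by (auto simp: X_def)
    obtain b where b: "b \<in> \<B>" "dv p0 x \<in> b" "b \<subseteq> W (dv p0 x)" using B W[OF \<gamma>(1)] by meson
    then have bB: "b \<in> \<B>'" using \<gamma>(1) by (auto simp: \<B>'_def)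
    have "tl (cmap cP (act p0 (dv p0 x))) \<in> Q (ch b)"
      by (rule Q(3)) (use ch[OF bB] b \<gamma>(1) in \<open>auto simp: X_def\<close>)
    moreover have "tl u = w"
    proof
      fix i show "tl u i = w i"
        using w espaceD[of w l i] by (cases "i < l") (auto simp: tl_def u_def l_def nbox_def)
    qed
    ultimately show "w \<in> \<Union>(Q ` ch ` \<B>')" using \<gamma>(2) x(2) bB by auto
  qed
  moreover have "tl (cmap cP p0) \<in> nbox l (tl (cmap cP p0)) rP"
    using cP(2) by (auto intro!: in_nbox_self espaceI simp: tl_def)
  ultimately show False
    using interior_of_maximal[OF _ openin_nbox] by blast
qed

text \<open>
  Translating by local sections of the source map reduces division at arbitrary points to division
  near a good point of the same fibre.
\<close>

lemma dv_smooth: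
  assumes e: "inj (e :: (nat \<Rightarrow> real) \<Rightarrow> 'p)" and T: "manifold T"
    and p: "smooth_map T Pm p" "smooth_map T Pm q" "\<And>z. z \<in> pts T \<Longrightarrow> pr (p z) = pr (q z)"
  shows "smooth_map T A (\<lambda>z. dv (p z) (q z))"
proof (rule smooth_map_local[OF T lie_mfd(2)])
  fix z0 assume z0: "z0 \<in> pts T"
  note pP = smooth_map_pts[OF p(1)] and qP = smooth_map_pts[OF p(2)]
  obtain N p1 D \<sigma> where N: "openin (mtop Pm) N" "p1 \<in> N" "pr p1 = pr (p z0)" and D: "smooth_map (open_submfd Pm N) A D"
    and good: "\<And>x. x \<in> N \<Longrightarrow> \<sigma> (pr x) \<in> pts Pm \<and> pr (\<sigma> (pr x)) = pr x \<and> D x = dv (\<sigma> (pr x)) x"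
    using all_dv_smooth_near[OF e pP[OF z0]] unfolding dv_smooth_near_def by blast
  have NP: "x \<in> pts Pm" if "x \<in> N" for x using openin_subset[OF N(1)] that by blast
  \<comment> \<open>A local section of the source map through the arrow from \<open>r z0\<close> to
    \<open>p1\<close> moves \<open>r z\<close> into \<open>N\<close> for all \<open>z\<close> near
    \<open>z0\<close>, smoothly in \<open>z\<close>.\<close>
  have step: "\<exists>W g. openin (mtop T) W \<and> z0 \<in> W \<and> smooth_map (open_submfd T W) A g \<and>
      (\<forall>z\<in>W. g z \<in> pts A \<and> gs \<Gamma> (g z) = an (r z) \<and> act (r z) (g z) \<in> N)"
    if r: "smooth_map T Pm r" "pr (r z0) = pr p1" for r
  proof -
    note rP = smooth_map_pts[OF r(1)]
    define \<gamma> where "\<gamma> = dv (r z0) p1"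
    have \<gamma>: "\<gamma> \<in> pts A" "gs \<Gamma> \<gamma> = an (r z0)" "act (r z0) \<gamma> = p1"
      using dv[OF rP[OF z0] NP[OF N(2)] r(2)] by (auto simp: \<gamma>_def)
    obtain V \<tau> where V: "openin (mtop (base \<Gamma>)) V" "gs \<Gamma> \<gamma> \<in> V" and \<tau>: "smooth_map (open_submfd (base \<Gamma>) V) A \<tau>"
      "\<tau> (gs \<Gamma> \<gamma>) = \<gamma>" "\<And>y. y \<in> V \<Longrightarrow> \<tau> y \<in> pts A \<and> gs \<Gamma> (\<tau> y) = y"
      by (rule submersion_section[OF lie_mfd(2,1) lie_gs(1) \<gamma>(1)]) blast
    have anr: "smooth_map T (base \<Gamma>) (\<lambda>z. an (r z))" by (rule smooth_map_compose[OF T tor_mfd(1) lie_mfd(1) r(1) tor_an])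
    let ?W1 = "{z \<in> pts T. an (r z) \<in> V}"
    have o1: "openin (mtop T) ?W1" by (rule smooth_map_preimage[OF anr V(1)])
    note T1 = manifold_open_submfd[OF T o1] and ptsT1 = pts_open_submfd[OF o1]
    note MV = manifold_open_submfd[OF lie_mfd(1) V(1)]
    have "smooth_map (open_submfd T ?W1) (open_submfd (base \<Gamma>) V) (\<lambda>z. an (r z))"
      by (rule smooth_map_into_open[OF T1 lie_mfd(1) V(1) smooth_map_restrict[OF T lie_mfd(1) o1 anr]])
         (use ptsT1 in blast)
    then have g: "smooth_map (open_submfd T ?W1) A (\<lambda>z. \<tau> (an (r z)))"
      by (rule smooth_map_compose[OF T1 MV lie_mfd(2) _ \<tau>(1)])
    have rg: "smooth_map (open_submfd T ?W1) Pm (\<lambda>z. act (r z) (\<tau> (an (r z))))"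
      by (rule act_smooth[OF T1 smooth_map_restrict[OF T tor_mfd(1) o1 r(1)] g])
         (use \<tau>(3) ptsT1 in \<open>metis (no_types, lifting) mem_Collect_eq\<close>)
    let ?W = "{z \<in> pts (open_submfd T ?W1). act (r z) (\<tau> (an (r z))) \<in> N}"
    have "openin (mtop (open_submfd T ?W1)) ?W" by (rule smooth_map_preimage[OF rg N(1)])
    then have oW: "openin (mtop T) ?W" "?W \<subseteq> ?W1" by (auto simp: openin_open_subtopology o1)
    have "open_submfd (open_submfd T ?W1) ?W = open_submfd T ?W"
      using oW(2) by (auto simp: open_submfd_def subtopology_subtopology Int_absorb1)
    then have "smooth_map (open_submfd T ?W) A (\<lambda>z. \<tau> (an (r z)))"
      using smooth_map_restrict[OF T1 lie_mfd(2) \<open>openin (mtop (open_submfd T ?W1)) ?W\<close> g] by simp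
    moreover have "z0 \<in> ?W" using z0 \<gamma> V(2) \<tau>(2) N(2) unfolding ptsT1 by auto
    moreover have "\<forall>z\<in>?W. \<tau> (an (r z)) \<in> pts A \<and> gs \<Gamma> (\<tau> (an (r z))) = an (r z) \<and> act (r z) (\<tau> (an (r z))) \<in> N"
      using \<tau>(3) oW(2) by blast
    ultimately show ?thesis using oW(1) by blast
  qed
  obtain W1 g1 where W1: "openin (mtop T) W1" "z0 \<in> W1" "smooth_map (open_submfd T W1) A g1"
    and g1: "\<And>z. z \<in> W1 \<Longrightarrow> g1 z \<in> pts A \<and> gs \<Gamma> (g1 z) = an (p z) \<and> act (p z) (g1 z) \<in> N"
    using step[OF p(1)] N(3) by auto
  obtain W2 g2 where W2: "openin (mtop T) W2" "z0 \<in> W2" "smooth_map (open_submfd T W2) A g2"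
    and g2: "\<And>z. z \<in> W2 \<Longrightarrow> g2 z \<in> pts A \<and> gs \<Gamma> (g2 z) = an (q z) \<and> act (q z) (g2 z) \<in> N"
    using step[OF p(2)] N(3) p(3)[OF z0] by auto
  let ?W = "W1 \<inter> W2"
  have oW: "openin (mtop T) ?W" using W1(1) W2(1) by blast
  note TW = manifold_open_submfd[OF T oW] and ptsW = pts_open_submfd[OF oW]
  have sub: "smooth_map (open_submfd T ?W) M f" if "openin (mtop T) V" "?W \<subseteq> V" "smooth_map (open_submfd T V) M f" "manifold M" for V M f
  proof -
    have "open_submfd (open_submfd T V) ?W = open_submfd T ?W"
      using that(2) by (auto simp: open_submfd_def subtopology_subtopology Int_absorb1)
    moreover have "openin (mtop (open_submfd T V)) ?W" using oW that(1,2) by (simp add: openin_open_subtopology)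
    ultimately show ?thesis using smooth_map_restrict[OF manifold_open_submfd[OF T that(1)] that(4) _ that(3)] by metis
  qed
  note s1 = sub[OF W1(1) Int_lower1 W1(3) lie_mfd(2)] and s2 = sub[OF W2(1) Int_lower2 W2(3) lie_mfd(2)]
  have nD: "smooth_map (open_submfd T ?W) A (\<lambda>z. D (act (r z) (g z)))"
    if "smooth_map T Pm r" "smooth_map (open_submfd T ?W) A g" "\<And>z. z \<in> ?W \<Longrightarrow> gs \<Gamma> (g z) = an (r z) \<and> act (r z) (g z) \<in> N" for r g
  proof -
    have "smooth_map (open_submfd T ?W) Pm (\<lambda>z. act (r z) (g z))"
      by (rule act_smooth[OF TW smooth_map_restrict[OF T tor_mfd(1) oW that(1)] that(2)]) (use that(3) ptsW in metis)
    then have "smooth_map (open_submfd T ?W) (open_submfd Pm N) (\<lambda>z. act (r z) (g z))"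
      by (rule smooth_map_into_open[OF TW tor_mfd(1) N(1)]) (use that(3) ptsW in metis)
    then show ?thesis by (rule smooth_map_compose[OF TW manifold_open_submfd[OF tor_mfd(1) N(1)] lie_mfd(2) _ D])
  qed
  let ?a = "\<lambda>z. act (p z) (g1 z)" and ?b = "\<lambda>z. act (q z) (g2 z)"
  \<comment> \<open>Both points are moved into \<open>N\<close>, divided there relative to the
    common reference point, and moved back; in multiplicative notation the quotient is
    \<open>g1 D(a)^-1 D(b) g2^-1\<close>, with \<open>a\<close> and \<open>b\<close> the moved
    points.\<close>
  let ?r = "\<lambda>z. gm \<Gamma> (gm \<Gamma> (g1 z) (gm \<Gamma> (gi \<Gamma> (D (?a z))) (D (?b z)))) (gi \<Gamma> (g2 z))"
  have alg: "gt \<Gamma> (gi \<Gamma> (D (?a z))) = gs \<Gamma> (D (?b z)) \<and> gt \<Gamma> (g1 z) = gs \<Gamma> (gm \<Gamma> (gi \<Gamma> (D (?a z))) (D (?b z))) \<and>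
      gt \<Gamma> (gm \<Gamma> (g1 z) (gm \<Gamma> (gi \<Gamma> (D (?a z))) (D (?b z)))) = gs \<Gamma> (gi \<Gamma> (g2 z)) \<and> ?r z = dv (p z) (q z)"
    if z: "z \<in> ?W" for z
  proof -
    have zT: "z \<in> pts T" using openin_subset[OF oW] z by blast
    have P: "p z \<in> pts Pm" "q z \<in> pts Pm" using pP qP zT by auto
    have 1: "g1 z \<in> pts A" "gs \<Gamma> (g1 z) = an (p z)" "?a z \<in> N" and 2: "g2 z \<in> pts A" "gs \<Gamma> (g2 z) = an (q z)" "?b z \<in> N"
      using g1 g2 z by auto
    have a: "an (?a z) = gt \<Gamma> (g1 z)" "pr (?a z) = pr (p z)" and b: "an (?b z) = gt \<Gamma> (g2 z)" "pr (?b z) = pr (p z)"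
      using act_closed P 1 2 p(3)[OF zT] by auto
    let ?s = "\<sigma> (pr (p z))"
    have s: "?s \<in> pts Pm" "pr ?s = pr (p z)" and Da: "D (?a z) = dv ?s (?a z)" and Db: "D (?b z) = dv ?s (?b z)"
      using good[OF 1(3)] good[OF 2(3)] a b by auto
    have DA: "D (?a z) \<in> pts A" "gs \<Gamma> (D (?a z)) = an ?s" "gt \<Gamma> (D (?a z)) = an (?a z)" "act ?s (D (?a z)) = ?a z"
      using dv[OF s(1) NP[OF 1(3)]] s(2) a(2) Da by auto
    have DB: "D (?b z) \<in> pts A" "gs \<Gamma> (D (?b z)) = an ?s" "gt \<Gamma> (D (?b z)) = an (?b z)" "act ?s (D (?b z)) = ?b z"
      using dv[OF s(1) NP[OF 2(3)]] s(2) b(2) Db by auto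
    let ?m = "gm \<Gamma> (gi \<Gamma> (D (?a z))) (D (?b z))"
    have i: "gi \<Gamma> (D (?a z)) \<in> pts A" "gs \<Gamma> (gi \<Gamma> (D (?a z))) = gt \<Gamma> (g1 z)" "gt \<Gamma> (gi \<Gamma> (D (?a z))) = gs \<Gamma> (D (?b z))"
      using gi_closed[OF DA(1)] DA DB a(1) by auto
    have m: "?m \<in> pts A" "gs \<Gamma> ?m = gt \<Gamma> (g1 z)" "gt \<Gamma> ?m = gt \<Gamma> (g2 z)"
      using gm_closed[OF i(1) DB(1) i(3)] i DB b(1) by auto
    have am: "act (?a z) ?m = ?b z"
      using act_assoc[OF NP[OF 1(3)] i(1) DB(1) _ i(3)] a(1) i(2) act_gi[OF s(1) DA(1)] DA(2,4) DB(4) by simp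
    let ?k = "gm \<Gamma> (g1 z) ?m"
    have k: "?k \<in> pts A" "gs \<Gamma> ?k = an (p z)" "gt \<Gamma> ?k = gt \<Gamma> (g2 z)" using gm_closed[OF 1(1) m(1)] m 1 by auto
    have ak: "act (p z) ?k = ?b z" using act_assoc[OF P(1) 1(1) m(1)] 1(2) m(2) am by simp
    have j: "gi \<Gamma> (g2 z) \<in> pts A" "gs \<Gamma> (gi \<Gamma> (g2 z)) = gt \<Gamma> (g2 z)" using gi_closed[OF 2(1)] by auto
    have r: "?r z \<in> pts A" "gs \<Gamma> (?r z) = an (p z)" using gm_closed[OF k(1) j(1)] k j by auto
    have "act (p z) (?r z) = act (?b z) (gi \<Gamma> (g2 z))" using act_assoc[OF P(1) k(1) j(1)] k j ak by simp
    also have "\<dots> = q z" using act_gi[OF P(2) 2(1)] 2(2) by simp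
    finally have "?r z = dv (p z) (q z)" using dv_unique[OF P(1) r(1)] r(2) by metis
    then show ?thesis using i m k j by metis
  qed
  have D1: "smooth_map (open_submfd T ?W) A (\<lambda>z. D (?a z))" by (rule nD[OF p(1) s1]) (use g1 in blast)
  have D2: "smooth_map (open_submfd T ?W) A (\<lambda>z. D (?b z))" by (rule nD[OF p(2) s2]) (use g2 in blast)
  have inv: "smooth_map (open_submfd T ?W) A (\<lambda>z. gi \<Gamma> (h z))" if "smooth_map (open_submfd T ?W) A h" for h
    by (rule smooth_map_compose[OF TW lie_mfd(2) lie_mfd(2) that lie_gi])
  have "smooth_map (open_submfd T ?W) A ?r"
    by (intro gm_smooth[OF TW] s1 inv[OF s2] inv[OF D1] D2; unfold ptsW; use alg in blast)
  then have "smooth_map (open_submfd T ?W) A (\<lambda>z. dv (p z) (q z))"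
    by (rule smooth_map_cong[OF TW lie_mfd(2), rotated]) (unfold ptsW, use alg in blast)
  then show "\<exists>W. openin (mtop T) W \<and> z0 \<in> W \<and> smooth_map (open_submfd T W) A (\<lambda>z. dv (p z) (q z))"
    using oW W1(2) W2(2) by blast
qed

end

section \<open>Groupoid fibrations\<close>

definition maps :: "'p mfd \<Rightarrow> 'p mfd \<Rightarrow> 'p smap set" where
  "maps M N = {f. is_smap f \<and> src f = M \<and> tgt f = N}"

lemma mapsD: "f \<in> maps M N \<Longrightarrow> is_smap f \<and> src f = M \<and> tgt f = N \<and> manifold M \<and> manifold N \<and> smooth_map M N (fn f)"
  by (auto simp: maps_def is_smap_def)

lemma maps_pts: "f \<in> maps M N \<Longrightarrow> z \<in> pts M \<Longrightarrow> fn f z \<in> pts N"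
  using smooth_map_pts[of M N "fn f" z] mapsD[of f M N] by simp

definition mk_smap :: "'p mfd \<Rightarrow> 'p mfd \<Rightarrow> ('p \<Rightarrow> 'p) \<Rightarrow> 'p smap" where
  "mk_smap M N f = \<lparr>src = M, tgt = N, fn = restrict f (pts M)\<rparr>"

lemma mk_smap_maps: "manifold M \<Longrightarrow> manifold N \<Longrightarrow> smooth_map M N f \<Longrightarrow> mk_smap M N f \<in> maps M N"
  using smooth_map_cong[of M N f "restrict f (pts M)"] by (simp add: maps_def mk_smap_def is_smap_def)

lemma mk_smap_apply [simp]: "z \<in> pts M \<Longrightarrow> fn (mk_smap M N f) z = f z"
  by (simp add: mk_smap_def)

lemma maps_eqI:
  assumes "f \<in> maps M N" "g \<in> maps M N" "\<And>z. z \<in> pts M \<Longrightarrow> fn f z = fn g z"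
  shows "f = g"
proof -
  have "fn f = fn g"
    using assms by (intro extensionalityI[of _ "pts M"]) (auto simp: maps_def is_smap_def)
  then show ?thesis using assms by (intro smap.equality) (auto simp: maps_def)
qed

lemma maps_apply: "f \<in> maps L M \<Longrightarrow> z \<in> pts L \<Longrightarrow> fn (sm_comp g f) z = fn g (fn f z)"
  by (auto simp: maps_def sm_comp_def)

lemma maps_comp:
  assumes "f \<in> maps L M" "g \<in> maps M N" shows "sm_comp g f \<in> maps L N"
proof -
  have "smooth_map L N (\<lambda>z. fn g (fn f z))"
    using smooth_map_compose[of L M N "fn f" "fn g"] assms mapsD by blast
  then have "mk_smap L N (\<lambda>z. fn g (fn f z)) \<in> maps L N" using mk_smap_maps assms mapsD by blast
  moreover have "sm_comp g f = mk_smap L N (\<lambda>z. fn g (fn f z))"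
    using assms by (auto simp: maps_def sm_comp_def mk_smap_def)
  ultimately show ?thesis by simp
qed

lemma maps_assoc:
  assumes "f \<in> maps K L" "g \<in> maps L M" "h \<in> maps M N"
  shows "sm_comp h (sm_comp g f) = sm_comp (sm_comp h g) f"
proof (rule maps_eqI[OF maps_comp[OF maps_comp[OF assms(1,2)] assms(3)] maps_comp[OF assms(1) maps_comp[OF assms(2,3)]]])
  fix z assume z: "z \<in> pts K"
  show "fn (sm_comp h (sm_comp g f)) z = fn (sm_comp (sm_comp h g) f) z"
    by (simp add: maps_apply[OF maps_comp[OF assms(1,2)] z] maps_apply[OF assms(1) z]
        maps_apply[OF assms(2) maps_pts[OF assms(1) z]])
qed

lemma maps_id: "manifold M \<Longrightarrow> sm_id M \<in> maps M M"
  using mk_smap_maps[OF _ _ smooth_map_id] by (simp add: sm_id_def mk_smap_def)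

lemma sm_id_apply [simp]: "z \<in> pts M \<Longrightarrow> fn (sm_id M) z = z"
  by (simp add: sm_id_def)

lemma maps_id_right: assumes f: "f \<in> maps M N" shows "sm_comp f (sm_id M) = f"
proof -
  have i: "sm_id M \<in> maps M M" using maps_id mapsD[OF f] by blast
  show ?thesis by (rule maps_eqI[OF maps_comp[OF i f] f]) (simp add: maps_apply[OF i])
qed

lemma maps_id_left: assumes f: "f \<in> maps M N" shows "sm_comp (sm_id N) f = f"
proof -
  have i: "sm_id N \<in> maps N N" using maps_id mapsD[OF f] by blast
  show ?thesis by (rule maps_eqI[OF maps_comp[OF f i] f]) (simp add: maps_apply[OF f] maps_pts[OF f])
qed

lemma const_smap_maps: "manifold M \<Longrightarrow> manifold N \<Longrightarrow> r \<in> pts N \<Longrightarrow> const_smap M N r \<in> maps M N"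
  using mk_smap_maps[OF _ _ smooth_map_const] by (simp add: const_smap_def mk_smap_def)

lemma const_smap_apply [simp]: "z \<in> pts M \<Longrightarrow> fn (const_smap M N r) z = r"
  by (simp add: const_smap_def)

lemma comp_const_smap:
  assumes f: "f \<in> maps M N" and Q: "manifold Q" and r: "r \<in> pts M"
  shows "sm_comp f (const_smap Q M r) = const_smap Q N (fn f r)"
proof -
  have c: "const_smap Q M r \<in> maps Q M" and c': "const_smap Q N (fn f r) \<in> maps Q N"
    using const_smap_maps[OF Q] mapsD[OF f] r maps_pts[OF f r] by auto
  show ?thesis by (rule maps_eqI[OF maps_comp[OF c f] c']) (simp add: maps_apply[OF c])
qed

section \<open>Arrows of a groupoid fibration\<close>

locale gfib =
  fixes X :: "('o, 'm, 'p) gfib"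
  assumes gf: "groupoid_fibration X"
begin

abbreviation Ob where "Ob \<equiv> Obj (tot X)"
abbreviation ov where "ov \<equiv> over X"
abbreviation po' where "po' \<equiv> po X"
abbreviation cp (infixr "\<cdot>" 75) where "b \<cdot> a \<equiv> Cmp (tot X) b a"
abbreviation ide where "ide \<equiv> Ide (tot X)"

lemma gf_cat: "category (tot X)" and gf_fun: "is_functor (tot X) Man \<lparr>fo = po X, fa = pa X\<rparr>"
  using gf by (auto simp: groupoid_fibration_def)

lemma ovD: "ov a f y z \<Longrightarrow> f \<in> maps (po' y) (po' z) \<and> y \<in> Ob \<and> z \<in> Ob \<and> a \<in> Arr (tot X) \<and>
    pa X a = f \<and> Dom (tot X) a = y \<and> Cod (tot X) a = z"
  using gf_cat gf_fun by (auto simp: over_def category_def is_functor_def Man_def maps_def)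

lemma ov_self: "a \<in> Arr (tot X) \<Longrightarrow> ov a (pa X a) (Dom (tot X) a) (Cod (tot X) a)"
  by (simp add: over_def)

lemma po_manifold: "y \<in> Ob \<Longrightarrow> manifold (po' y)"
  using gf_fun by (auto simp: is_functor_def Man_def)

lemma ov_cmp: "ov b g y z \<Longrightarrow> ov a f w y \<Longrightarrow> ov (b \<cdot> a) (sm_comp g f) w z"
  using gf_cat gf_fun by (auto simp: over_def category_def is_functor_def Man_def)

lemma ov_ide: "y \<in> Ob \<Longrightarrow> ov (ide y) (sm_id (po' y)) y y"
  using gf_cat gf_fun by (auto simp: over_def category_def is_functor_def Man_def)

lemma cmp_assoc: "ov c h y z \<Longrightarrow> ov b g w y \<Longrightarrow> ov a f v w \<Longrightarrow> c \<cdot> (b \<cdot> a) = (c \<cdot> b) \<cdot> a"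
  using gf_cat by (auto simp: over_def category_def)

lemma ide_right: "ov a f y z \<Longrightarrow> a \<cdot> ide y = a" and ide_left: "ov a f y z \<Longrightarrow> ide z \<cdot> a = a"
  using gf_cat by (auto simp: over_def category_def)

lemma pull_ex: "z \<in> Ob \<Longrightarrow> f \<in> maps T (po' z) \<Longrightarrow> \<exists>a y. ov a f y z"
proof -
  assume z: "z \<in> Ob" "f \<in> maps T (po' z)"
  have K: "\<forall>f x. is_smap f \<and> x \<in> Ob \<and> po' x = tgt f \<longrightarrow> (\<exists>a\<in>Arr (tot X). Cod (tot X) a = x \<and> pa X a = f)"
    using gf unfolding groupoid_fibration_def by blast
  have "\<exists>a\<in>Arr (tot X). Cod (tot X) a = z \<and> pa X a = f"
    by (rule K[rule_format]) (use z in \<open>simp add: maps_def\<close>)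
  then obtain a where "a \<in> Arr (tot X)" "Cod (tot X) a = z" "pa X a = f" by blast
  then show ?thesis by (auto simp: over_def)
qed

lemma lift_ex1:
  assumes "ov a f y z" "ov b (sm_comp f h) w z" "h \<in> maps (po' w) (po' y)"
  shows "\<exists>!c. ov c h w y \<and> a \<cdot> c = b"
proof -
  have K: "\<forall>a\<in>Arr (tot X). \<forall>b\<in>Arr (tot X). \<forall>h.
        Cod (tot X) a = Cod (tot X) b \<and> is_smap h \<and>
        src h = src (pa X b) \<and> tgt h = src (pa X a) \<and> sm_comp (pa X a) h = pa X b \<longrightarrow>
        (\<exists>!c. c \<in> Arr (tot X) \<and> Dom (tot X) c = Dom (tot X) b \<and> Cod (tot X) c = Dom (tot X) a \<and>
              pa X c = h \<and> Cmp (tot X) a c = b)"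
    using gf unfolding groupoid_fibration_def by blast
  have "\<exists>!c. c \<in> Arr (tot X) \<and> Dom (tot X) c = Dom (tot X) b \<and> Cod (tot X) c = Dom (tot X) a \<and>
              pa X c = h \<and> Cmp (tot X) a c = b"
    by (rule K[rule_format])
       (use ovD[OF assms(1)] ovD[OF assms(2)] mapsD[OF assms(3)] in \<open>auto simp: maps_def\<close>)
  moreover have "(ov c h w y \<and> a \<cdot> c = b) = (c \<in> Arr (tot X) \<and> Dom (tot X) c = Dom (tot X) b \<and>
      Cod (tot X) c = Dom (tot X) a \<and> pa X c = h \<and> Cmp (tot X) a c = b)" for c
    using ovD[OF assms(1)] ovD[OF assms(2)] by (auto simp: over_def)
  ultimately show ?thesis by simp
qed

lemma lift: 
  assumes "ov a f y z" "ov b (sm_comp f h) w z" "h \<in> maps (po' w) (po' y)"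
  obtains c where "ov c h w y" "a \<cdot> c = b"
  using lift_ex1[OF assms] by blast

text \<open>The uniqueness half of the cartesian property, which every arrow has.\<close>

lemma cancel: "ov a f y z \<Longrightarrow> ov u h w y \<Longrightarrow> ov v h w y \<Longrightarrow> a \<cdot> u = a \<cdot> v \<Longrightarrow> u = v"
  using lift_ex1[of a f y z "a \<cdot> u" h w] ov_cmp ovD by metis

text \<open>Restrictions along the same map are isomorphic over the identity; this is the passage
  from an arbitrary restriction to the chosen one.\<close>

lemma lift_id:
  assumes "ov a f y z" "ov b f w z" obtains c where "ov c (sm_id (po' y)) w y" "a \<cdot> c = b" "po' w = po' y"
proof -
  have f: "f \<in> maps (po' y) (po' z)" and f': "f \<in> maps (po' w) (po' z)"
    using ovD[OF assms(1)] ovD[OF assms(2)] by auto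
  then have e: "po' w = po' y" by (simp add: maps_def)
  show ?thesis
    by (rule lift[OF assms(1), of b "sm_id (po' y)" w])
       (use assms(2) maps_id_right[OF f] maps_id[of "po' y"] mapsD[OF f] e that in auto)
qed

lemma inv_ex:
  assumes "ov a (sm_id (po' y)) w y"
  obtains b where "ov b (sm_id (po' y)) y w" "a \<cdot> b = ide y" "b \<cdot> a = ide w" "po' w = po' y"
proof -
  have y: "y \<in> Ob" "w \<in> Ob" "sm_id (po' y) \<in> maps (po' w) (po' y)" using ovD[OF assms] by auto
  then have e: "po' w = po' y" by (simp add: maps_def sm_id_def)
  obtain b where b: "ov b (sm_id (po' w)) y w" "a \<cdot> b = ide y"
    using lift_id[OF assms ov_ide[OF y(1)]] by blast
  have "b \<cdot> a = ide w"
  proof (rule cancel[OF assms])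
    show "ov (b \<cdot> a) (sm_id (po' y)) w w" "ov (ide w) (sm_id (po' y)) w w"
      using ov_cmp[OF b(1) assms] ov_ide[OF y(2)] e maps_id_right[OF y(3)] maps_id_left[OF y(3)] by auto
    show "a \<cdot> b \<cdot> a = a \<cdot> ide w"
      using cmp_assoc[OF assms b(1) assms] b(2) ide_left[OF assms] ide_right[OF assms] by simp
  qed
  then show ?thesis using that b e by auto
qed

subsection \<open>Families as morphisms\<close>

abbreviation "pl \<equiv> pull_arr X"
definition "xr x m = fo (fam_mor X x) m"
text \<open>The canonical arrow over \<open>h\<close> between chosen restrictions of
  \<open>x\<close>; it takes the place of an equality between restricting in one step and in
  two.\<close>

definition "cc x h m = fa (fam_mor X x) (h, m)"

lemma pl: "x \<in> Ob \<Longrightarrow> m \<in> maps T (po' x) \<Longrightarrow> ov (pl x m) m (xr x m) x"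
proof -
  assume x: "x \<in> Ob" "m \<in> maps T (po' x)"
  have "pl x m \<in> Arr (tot X) \<and> Cod (tot X) (pl x m) = x \<and> pa X (pl x m) = m"
    unfolding pull_arr_def by (rule someI_ex) (use pull_ex[OF x] in \<open>auto simp: over_def\<close>)
  then show ?thesis by (simp add: over_def xr_def fam_mor_def)
qed

lemma po_xr: "x \<in> Ob \<Longrightarrow> m \<in> maps T (po' x) \<Longrightarrow> po' (xr x m) = T \<and> xr x m \<in> Ob"
  using ovD[OF pl] mapsD by metis

lemma cc:
  assumes x: "x \<in> Ob" "m \<in> maps T (po' x)" "h \<in> maps T' T"
  shows "ov (cc x h m) h (xr x (sm_comp m h)) (xr x m) \<and> pl x m \<cdot> cc x h m = pl x (sm_comp m h)"
proof -
  have mh: "sm_comp m h \<in> maps T' (po' x)" using maps_comp[OF x(3,2)] .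
  have h': "h \<in> maps (po' (xr x (sm_comp m h))) (po' (xr x m))" using po_xr[OF x(1) mh] po_xr[OF x(1,2)] x(3) by simp
  have "\<exists>!c. ov c h (xr x (sm_comp m h)) (xr x m) \<and> pl x m \<cdot> c = pl x (sm_comp m h)"
    by (rule lift_ex1[OF pl[OF x(1,2)] pl[OF x(1) mh] h'])
  from theI'[OF this] show ?thesis
    by (simp add: cc_def fam_mor_def over_def xr_def conj_ac)
qed

lemma cc_unique:
  assumes x: "x \<in> Ob" "m \<in> maps T (po' x)" "h \<in> maps T' T"
    and c: "ov c h (xr x (sm_comp m h)) (xr x m)" "pl x m \<cdot> c = pl x (sm_comp m h)"
  shows "c = cc x h m"
  by (rule cancel[OF pl[OF x(1,2)] c(1) conjunct1[OF cc[OF x]]]) (use c cc[OF x] in simp)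

lemma cc_id:
  assumes x: "x \<in> Ob" "m \<in> maps T (po' x)"
  shows "cc x (sm_id T) m = ide (xr x m)"
proof (rule cc_unique[symmetric, OF x])
  show "sm_id T \<in> maps T T" using maps_id mapsD[OF x(2)] by blast
  show "ov (ide (xr x m)) (sm_id T) (xr x (sm_comp m (sm_id T))) (xr x m)"
    using ov_ide[of "xr x m"] po_xr[OF x] maps_id_right[OF x(2)] by simp
  show "pl x m \<cdot> ide (xr x m) = pl x (sm_comp m (sm_id T))"
    using ide_right[OF pl[OF x]] maps_id_right[OF x(2)] by simp
qed

lemma cc_comp:
  assumes x: "x \<in> Ob" "m \<in> maps T (po' x)" "h \<in> maps T' T" "k \<in> maps T'' T'"
  shows "cc x h m \<cdot> cc x k (sm_comp m h) = cc x (sm_comp h k) m"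
proof -
  have mh: "sm_comp m h \<in> maps T' (po' x)" using maps_comp[OF x(3,2)] .
  note c1 = cc[OF x(1-3)] and c2 = cc[OF x(1) mh x(4)]
  have e: "sm_comp (sm_comp m h) k = sm_comp m (sm_comp h k)" using maps_assoc[OF x(4,3,2)] by simp
  show ?thesis
  proof (rule cc_unique[OF x(1,2) maps_comp[OF x(4,3)]])
    show "ov (cc x h m \<cdot> cc x k (sm_comp m h)) (sm_comp h k) (xr x (sm_comp m (sm_comp h k))) (xr x m)"
      using ov_cmp[OF conjunct1[OF c1] conjunct1[OF c2]] e by simp
    show "pl x m \<cdot> cc x h m \<cdot> cc x k (sm_comp m h) = pl x (sm_comp m (sm_comp h k))"
      using cmp_assoc[OF pl[OF x(1,2)] conjunct1[OF c1] conjunct1[OF c2]] c1 c2 e by simp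
  qed
qed

lemma Rep_simps [simp]:
  "Obj (tot (Rep M)) = {f. is_smap f \<and> tgt f = M}"
  "Arr (tot (Rep M)) = {(h, f). is_smap h \<and> is_smap f \<and> tgt h = src f \<and> tgt f = M}"
  "Dom (tot (Rep M)) (h, f) = sm_comp f h" "Cod (tot (Rep M)) (h, f) = f"
  "Ide (tot (Rep M)) f = (sm_id (src f), f)" "Cmp (tot (Rep M)) (h', f') (h, f) = (sm_comp h' h, f')"
  "po (Rep M) = src" "pa (Rep M) (h, f) = h"
  by (simp_all add: Rep_def)

lemma fam_gf_mor:
  assumes x: "x \<in> Ob" shows "gf_mor (Rep (po' x)) X (fam_mor X x)"
proof -
  have m: "f \<in> maps (src f) (po' x)" if "is_smap f" "tgt f = po' x" for f using that by (simp add: maps_def)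
  have h: "h \<in> maps (src h) (src f)" if "is_smap h" "tgt h = src f" for h f :: "'p smap" using that by (simp add: maps_def)
  show ?thesis unfolding gf_mor_def is_functor_def
  proof (intro conjI ballI impI)
    fix f assume "f \<in> Obj (tot (Rep (po' x)))"
    then have f: "f \<in> maps (src f) (po' x)" using m by auto
    show "fo (fam_mor X x) f \<in> Ob" "po' (fo (fam_mor X x) f) = po (Rep (po' x)) f"
      using po_xr[OF x f] by (simp_all add: xr_def)
    show "fa (fam_mor X x) (Ide (tot (Rep (po' x))) f) = ide (fo (fam_mor X x) f)"
      using cc_id[OF x f] by (simp add: xr_def cc_def)
  next
    fix a assume "a \<in> Arr (tot (Rep (po' x)))"
    then obtain k f where a: "a = (k, f)" and kf: "is_smap k" "is_smap f" "tgt k = src f" "tgt f = po' x" by auto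
    note c = ovD[OF conjunct1[OF cc[OF x m[OF kf(2,4)] h[OF kf(1,3)]]]]
    show "fa (fam_mor X x) a \<in> Arr (tot X)"
      "Dom (tot X) (fa (fam_mor X x) a) = fo (fam_mor X x) (Dom (tot (Rep (po' x))) a)"
      "Cod (tot X) (fa (fam_mor X x) a) = fo (fam_mor X x) (Cod (tot (Rep (po' x))) a)"
      "pa X (fa (fam_mor X x) a) = pa (Rep (po' x)) a"
      using c by (simp_all add: a xr_def cc_def)
    fix b assume "b \<in> Arr (tot (Rep (po' x)))" and cod: "Cod (tot (Rep (po' x))) a = Dom (tot (Rep (po' x))) b"
    then obtain k' f' where b: "b = (k', f')" and kf': "is_smap k'" "is_smap f'" "tgt k' = src f'" "tgt f' = po' x" by auto
    have e: "f = sm_comp f' k'" using cod a b by simp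
    then have "k \<in> maps (src k) (src k')" using kf by (simp add: maps_def sm_comp_def)
    from cc_comp[OF x m[OF kf'(2,4)] h[OF kf'(1,3)] this]
    show "fa (fam_mor X x) (Cmp (tot (Rep (po' x))) b a) = fa (fam_mor X x) b \<cdot> fa (fam_mor X x) a"
      by (simp add: a b e cc_def)
  qed
qed

text \<open>
  \<open>univ x y V m \<xi>\<close>: the manifold \<open>V\<close> with the pair \<open>(m, \<xi>)\<close> represents the functor taking \<open>T\<close> to the
  pairs of a map \<open>m : T \<rightarrow> po x\<close> and an arrow from the restriction of \<open>x\<close> along \<open>m\<close> to \<open>y\<close>.
\<close>

definition univ :: "'o \<Rightarrow> 'o \<Rightarrow> 'p mfd \<Rightarrow> 'p smap \<Rightarrow> 'm \<Rightarrow> bool" where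
  "univ x y V m \<xi> \<longleftrightarrow> m \<in> maps V (po' x) \<and> ov \<xi> (pa X \<xi>) (xr x m) y \<and>
     (\<forall>T m' \<xi>'. m' \<in> maps T (po' x) \<and> ov \<xi>' (pa X \<xi>') (xr x m') y \<longrightarrow>
        (\<exists>!h. h \<in> maps T V \<and> sm_comp m h = m' \<and> \<xi> \<cdot> cc x h m = \<xi>'))"

text \<open>A Yoneda argument: the value of \<open>E\<close> at the identity is the universal pair,
  and its value at \<open>h\<close> is the restriction of this pair along \<open>h\<close>.
  Existence of a classifying map comes from \<open>\<epsilon>\<close>, uniqueness from
  \<open>\<eta>\<close>.\<close>

lemma univ_of_equivalence:
  assumes x: "x \<in> Ob" and y: "y \<in> Ob" and V: "manifold V"
    and E: "gf_equivalence (Rep V) (fibprod (Rep (po' x)) (Rep (po' y)) X (fam_mor X x) (fam_mor X y)) E"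
    and Eid: "fo E (sm_id V) = (m, s, \<phi>)"
  shows "univ x y V m (pl y s \<cdot> \<phi>)" and "m \<in> maps V (po' x)" and "s \<in> maps V (po' y)"
    and "ov \<phi> (sm_id V) (xr x m) (xr y s)"
    and "h \<in> maps T V \<Longrightarrow> \<exists>\<phi>h. fo E h = (sm_comp m h, sm_comp s h, \<phi>h) \<and>
      ov \<phi>h (sm_id T) (xr x (sm_comp m h)) (xr y (sm_comp s h)) \<and> \<phi> \<cdot> cc x h m = cc y h s \<cdot> \<phi>h"
proof -
  let ?Z = "fibprod (Rep (po' x)) (Rep (po' y)) X (fam_mor X x) (fam_mor X y)"
  obtain G \<eta> \<epsilon> where Em: "gf_mor (Rep V) ?Z E" and Gm: "gf_mor ?Z (Rep V) G"
    and \<eta>: "gf_2mor (Rep V) (Rep V) (ftr_comp G E) ftr_id \<eta>" and \<epsilon>: "gf_2mor ?Z ?Z (ftr_comp E G) ftr_id \<epsilon>"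
    using E unfolding gf_equivalence_def by blast
  have ZO: "Obj (tot ?Z) = fibprod_obj (Rep (po' x)) (Rep (po' y)) X (fam_mor X x) (fam_mor X y)"
    by (simp add: fibprod_def)
  have obj: "(m', s', \<phi>') \<in> Obj (tot ?Z) \<longleftrightarrow>
      (\<exists>T. m' \<in> maps T (po' x) \<and> s' \<in> maps T (po' y) \<and> ov \<phi>' (sm_id T) (xr x m') (xr y s'))" for m' s' \<phi>'
    unfolding ZO fibprod_obj_def by (auto simp: maps_def over_def xr_def)
  have poZ: "po ?Z (m', s', \<phi>') = src m'" for m' s' \<phi>' by (simp add: fibprod_def)
  have EO: "fo E h \<in> Obj (tot ?Z)" "po ?Z (fo E h) = src h" if "is_smap h" "tgt h = V" for h
    using Em that by (auto simp: gf_mor_def is_functor_def)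
  have idV: "sm_id V \<in> maps V V" using maps_id[OF V] .
  from EO[of "sm_id V"] idV have "(m, s, \<phi>) \<in> Obj (tot ?Z)" "src m = V"
    using Eid poZ by (auto simp: maps_def)
  then show m: "m \<in> maps V (po' x)" and s: "s \<in> maps V (po' y)" and \<phi>: "ov \<phi> (sm_id V) (xr x m) (xr y s)"
    unfolding obj by (auto simp: maps_def)
  let ?\<xi> = "pl y s \<cdot> \<phi>"
  have \<xi>: "ov ?\<xi> s (xr x m) y" using ov_cmp[OF pl[OF y s] \<phi>] maps_id_right[OF s] by simp
  have arrZ: "\<exists>f1 g1 f2 g2 h1 \<phi>1 \<phi>2. a = (\<phi>1, (h1, f2), (h1, g2), \<phi>2) \<and> Dom (tot ?Z) a = (sm_comp f2 h1, sm_comp g2 h1, \<phi>1) \<and>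
      Cod (tot ?Z) a = (f2, g2, \<phi>2) \<and> pa ?Z a = h1 \<and> \<phi>2 \<cdot> cc x h1 f2 = cc y h1 g2 \<cdot> \<phi>1"
    if "a \<in> Arr (tot ?Z)" for a
    using that by (auto simp: fibprod_def cc_def)
  have Eh: "\<exists>\<phi>h. fo E h = (sm_comp m h, sm_comp s h, \<phi>h) \<and>
      ov \<phi>h (sm_id T) (xr x (sm_comp m h)) (xr y (sm_comp s h)) \<and> \<phi> \<cdot> cc x h m = cc y h s \<cdot> \<phi>h"
    if h: "h \<in> maps T V" for h T
  proof -
    have a: "(h, sm_id V) \<in> Arr (tot (Rep V))" using h idV by (auto simp: maps_def)
    have hD: "sm_comp (sm_id V) h = h" using maps_id_left[OF h] .
    let ?a = "fa E (h, sm_id V)"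
    have 1: "?a \<in> Arr (tot ?Z)" "Dom (tot ?Z) ?a = fo E h" "Cod (tot ?Z) ?a = (m, s, \<phi>)" "pa ?Z ?a = h"
      using Em a hD Eid by (auto simp: gf_mor_def is_functor_def split_beta)
    obtain \<phi>1 where 2: "fo E h = (sm_comp m h, sm_comp s h, \<phi>1)" "\<phi> \<cdot> cc x h m = cc y h s \<cdot> \<phi>1"
      using arrZ[OF 1(1)] 1 by auto
    have "fo E h \<in> Obj (tot ?Z)" using EO(1)[of h] h by (auto simp: maps_def)
    then obtain T' where "sm_comp m h \<in> maps T' (po' x)" "ov \<phi>1 (sm_id T') (xr x (sm_comp m h)) (xr y (sm_comp s h))"
      unfolding 2(1) obj by blast
    moreover have "T' = T" using calculation(1) maps_comp[OF h m] by (simp add: maps_def)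
    ultimately show ?thesis using 2 by blast
  qed
  show "h \<in> maps T V \<Longrightarrow> \<exists>\<phi>h. fo E h = (sm_comp m h, sm_comp s h, \<phi>h) \<and>
      ov \<phi>h (sm_id T) (xr x (sm_comp m h)) (xr y (sm_comp s h)) \<and> \<phi> \<cdot> cc x h m = cc y h s \<cdot> \<phi>h"
    by (rule Eh)
  have xi_h: "?\<xi> \<cdot> cc x h m = pl y (sm_comp s h) \<cdot> \<phi>h"
    if h: "h \<in> maps T V" and \<phi>h: "ov \<phi>h (sm_id T) (xr x (sm_comp m h)) (xr y (sm_comp s h))" "\<phi> \<cdot> cc x h m = cc y h s \<cdot> \<phi>h" for h T \<phi>h
  proof -
    note cx = cc[OF x m h] and cy = cc[OF y s h]
    have "?\<xi> \<cdot> cc x h m = pl y s \<cdot> (cc y h s \<cdot> \<phi>h)"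
      using cmp_assoc[OF pl[OF y s] \<phi> conjunct1[OF cx]] \<phi>h(2) by simp
    also have "\<dots> = pl y (sm_comp s h) \<cdot> \<phi>h"
      using cmp_assoc[OF pl[OF y s] conjunct1[OF cy] \<phi>h(1)] cy by simp
    finally show ?thesis .
  qed
  \<comment> \<open>Arrows of \<open>Rep V\<close> over an identity are identities, so
    \<open>\<eta>\<close> forces an equality of objects.\<close>
  have GE: "fo G (fo E h) = h" if h: "h \<in> maps T V" for h T
  proof -
    have ho: "h \<in> Obj (tot (Rep V))" using h by (auto simp: maps_def)
    then have e: "\<eta> h \<in> Arr (tot (Rep V))" "Dom (tot (Rep V)) (\<eta> h) = fo G (fo E h)" "Cod (tot (Rep V)) (\<eta> h) = h"
      "pa (Rep V) (\<eta> h) = sm_id T"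
      using \<eta> h by (auto simp: gf_2mor_def ftr_comp_def ftr_id_def maps_def)
    then obtain k f where "\<eta> h = (k, f)" by (cases "\<eta> h")
    then show ?thesis using e maps_id_right[OF h] by simp
  qed
  show "univ x y V m ?\<xi>"
    unfolding univ_def
  proof (intro conjI allI impI)
    show "m \<in> maps V (po' x)" by (rule m)
    show "ov ?\<xi> (pa X ?\<xi>) (xr x m) y" using \<xi> by (simp add: over_def)
    fix T m' \<xi>' assume "m' \<in> maps T (po' x) \<and> ov \<xi>' (pa X \<xi>') (xr x m') y"
    then have m': "m' \<in> maps T (po' x)" and \<xi>': "ov \<xi>' (pa X \<xi>') (xr x m') y" by auto
    define s' where "s' = pa X \<xi>'"
    have s': "s' \<in> maps T (po' y)" using ovD[OF \<xi>'] po_xr[OF x m'] by (simp add: s'_def)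
    obtain \<phi>' where \<phi>': "ov \<phi>' (sm_id T) (xr x m') (xr y s')" "pl y s' \<cdot> \<phi>' = \<xi>'"
      using lift_id[OF pl[OF y s'] \<xi>'[folded s'_def]] po_xr[OF y s'] by metis
    let ?o = "(m', s', \<phi>')"
    have o: "?o \<in> Obj (tot ?Z)" unfolding obj using m' s' \<phi>' by blast
    define h where "h = fo G ?o"
    have h: "h \<in> maps T V"
      using Gm o m' poZ[of m' s' \<phi>'] by (auto simp: gf_mor_def is_functor_def h_def maps_def)
    have e: "\<epsilon> ?o \<in> Arr (tot ?Z)" "Dom (tot ?Z) (\<epsilon> ?o) = fo E h" "Cod (tot ?Z) (\<epsilon> ?o) = ?o" "pa ?Z (\<epsilon> ?o) = sm_id T"
      using \<epsilon> o m' poZ[of m' s' \<phi>'] by (auto simp: gf_2mor_def ftr_comp_def ftr_id_def h_def maps_def)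
    obtain \<phi>1 where p1: "fo E h = (sm_comp m' (sm_id T), sm_comp s' (sm_id T), \<phi>1)"
      "\<phi>' \<cdot> cc x (sm_id T) m' = cc y (sm_id T) s' \<cdot> \<phi>1"
      using arrZ[OF e(1)] e by auto
    obtain \<phi>h where ph: "fo E h = (sm_comp m h, sm_comp s h, \<phi>h)"
      "ov \<phi>h (sm_id T) (xr x (sm_comp m h)) (xr y (sm_comp s h))" "\<phi> \<cdot> cc x h m = cc y h s \<cdot> \<phi>h"
      using Eh[OF h] by blast
    have eq: "sm_comp m h = m'" "sm_comp s h = s'" "\<phi>h = \<phi>1"
      using p1 ph(1) maps_id_right[OF m'] maps_id_right[OF s'] by auto
    have "\<phi>' = \<phi>h"
      using p1(2) cc_id[OF x m'] cc_id[OF y s'] ide_right[OF \<phi>'(1)] ide_left[OF ph(2)] eq by simp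
    then have "?\<xi> \<cdot> cc x h m = \<xi>'" using xi_h[OF h ph(2,3)] eq \<phi>'(2) by simp
    then have good: "h \<in> maps T V \<and> sm_comp m h = m' \<and> ?\<xi> \<cdot> cc x h m = \<xi>'" using h eq by simp
    show "\<exists>!h. h \<in> maps T V \<and> sm_comp m h = m' \<and> ?\<xi> \<cdot> cc x h m = \<xi>'"
    proof (rule ex1I[where a = h], rule good)
      fix k assume k: "k \<in> maps T V \<and> sm_comp m k = m' \<and> ?\<xi> \<cdot> cc x k m = \<xi>'"
      then obtain \<phi>k where pk: "fo E k = (sm_comp m k, sm_comp s k, \<phi>k)"
        "ov \<phi>k (sm_id T) (xr x (sm_comp m k)) (xr y (sm_comp s k))" "\<phi> \<cdot> cc x k m = cc y k s \<cdot> \<phi>k"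
        using Eh by blast
      have kT: "k \<in> maps T V" using k by simp
      have "ov (?\<xi> \<cdot> cc x k m) (sm_comp s k) (xr x (sm_comp m k)) y"
        by (rule ov_cmp[OF \<xi> conjunct1[OF cc[OF x m kT]]])
      then have sk: "sm_comp s k = s'" using k by (simp add: s'_def over_def)
      have "pl y s' \<cdot> \<phi>k = \<xi>'" using xi_h[OF kT pk(2,3)] sk k by simp
      then have e: "pl y s' \<cdot> \<phi>k = pl y s' \<cdot> \<phi>'" by (simp only: \<phi>'(2))
      have "ov \<phi>k (sm_id T) (xr x m') (xr y s')" using pk(2) sk k by metis
      from cancel[OF pl[OF y s'] this \<phi>'(1) e] have "\<phi>k = \<phi>'" .
      then have "fo E k = fo E h" using pk(1) sk k ph(1) eq \<open>\<phi>' = \<phi>h\<close> by simp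
      then have "fo G (fo E k) = fo G (fo E h)" by (rule arg_cong)
      then show "k = h" by (simp only: GE[OF kT] GE[OF h])
    qed
  qed
qed

end

subsection \<open>The groupoid of automorphisms\<close>

text \<open>\<open>\<theta>\<close> is the universal isomorphism between the restrictions of
  \<open>x\<close> along \<open>s\<close> and \<open>t\<close>; the one-point manifold
  \<open>Q0\<close> turns points into maps.\<close>

locale isom_data = gfib X for X :: "('o, 'm, 'p) gfib" +
  fixes x :: 'o and Am :: "'p mfd" and s t :: "'p smap" and \<theta> :: 'm and Q0 :: "'p mfd" and q0 :: 'p
  assumes x: "x \<in> Obj (tot X)" and s: "s \<in> maps Am (po X x)" and t: "t \<in> maps Am (po X x)"
    and \<theta>: "over X \<theta> (sm_id Am) (xr x s) (xr x t)"
    and un: "univ x x Am s (Cmp (tot X) (pull_arr X x t) \<theta>)"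
    and Q0: "manifold Q0" "pts Q0 = {q0}"
begin

abbreviation "B0 \<equiv> po' x"

lemma st: "\<gamma> \<in> maps T Am \<Longrightarrow> sm_comp s \<gamma> \<in> maps T B0" "\<gamma> \<in> maps T Am \<Longrightarrow> sm_comp t \<gamma> \<in> maps T B0"
  using maps_comp[OF _ s] maps_comp[OF _ t] by auto

lemma Am: "manifold Am" "manifold B0"
  using mapsD[OF s] by auto

text \<open>The restriction of the universal isomorphism along \<open>\<gamma>\<close>. A
  \<open>T\<close>-point \<open>\<gamma>\<close> of \<open>Am\<close> amounts to the triple formed
  by its source, its target and \<open>th \<gamma>\<close>.\<close>

definition th :: "'p smap \<Rightarrow> 'm" where
  "th \<gamma> = (THE \<phi>. ov \<phi> (sm_id (src \<gamma>)) (xr x (sm_comp s \<gamma>)) (xr x (sm_comp t \<gamma>)) \<and> cc x \<gamma> t \<cdot> \<phi> = \<theta> \<cdot> cc x \<gamma> s)"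

lemma th_ex1:
  assumes \<gamma>: "\<gamma> \<in> maps T Am"
  shows "\<exists>!\<phi>. ov \<phi> (sm_id T) (xr x (sm_comp s \<gamma>)) (xr x (sm_comp t \<gamma>)) \<and> cc x \<gamma> t \<cdot> \<phi> = \<theta> \<cdot> cc x \<gamma> s"
proof -
  note ct = conjunct1[OF cc[OF x t \<gamma>]] and cs = conjunct1[OF cc[OF x s \<gamma>]]
  have b: "ov (\<theta> \<cdot> cc x \<gamma> s) \<gamma> (xr x (sm_comp s \<gamma>)) (xr x t)"
    using ov_cmp[OF \<theta> cs] maps_id_left[OF \<gamma>] by simp
  obtain c where c: "ov c (sm_id T) (xr x (sm_comp s \<gamma>)) (xr x (sm_comp t \<gamma>))" "cc x \<gamma> t \<cdot> c = \<theta> \<cdot> cc x \<gamma> s"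
    using lift_id[OF ct b] po_xr[OF x st(2)[OF \<gamma>]] by metis
  show ?thesis
    by (rule ex1I[where a = c]) (use c cancel[OF ct] in auto)
qed

lemma th: "\<gamma> \<in> maps T Am \<Longrightarrow> ov (th \<gamma>) (sm_id T) (xr x (sm_comp s \<gamma>)) (xr x (sm_comp t \<gamma>))"
  and th_cc: "\<gamma> \<in> maps T Am \<Longrightarrow> cc x \<gamma> t \<cdot> th \<gamma> = \<theta> \<cdot> cc x \<gamma> s"
proof -
  assume g: "\<gamma> \<in> maps T Am"
  have "src \<gamma> = T" using mapsD[OF g] by simp
  then show "ov (th \<gamma>) (sm_id T) (xr x (sm_comp s \<gamma>)) (xr x (sm_comp t \<gamma>))" "cc x \<gamma> t \<cdot> th \<gamma> = \<theta> \<cdot> cc x \<gamma> s"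
    using theI'[OF th_ex1[OF g]] unfolding th_def by auto
qed

lemma th_unique:
  assumes g: "\<gamma> \<in> maps T Am" and \<phi>: "ov \<phi> (sm_id T) (xr x (sm_comp s \<gamma>)) (xr x (sm_comp t \<gamma>))"
    and e: "cc x \<gamma> t \<cdot> \<phi> = \<theta> \<cdot> cc x \<gamma> s"
  shows "th \<gamma> = \<phi>"
  by (rule cancel[OF conjunct1[OF cc[OF x t g]] th[OF g] \<phi>]) (use th_cc[OF g] e in simp)

lemma xi_th: "\<gamma> \<in> maps T Am \<Longrightarrow> (pl x t \<cdot> \<theta>) \<cdot> cc x \<gamma> s = pl x (sm_comp t \<gamma>) \<cdot> th \<gamma>"
proof -
  assume g: "\<gamma> \<in> maps T Am"
  note ct = cc[OF x t g] and cs = cc[OF x s g]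
  have "(pl x t \<cdot> \<theta>) \<cdot> cc x \<gamma> s = pl x t \<cdot> (cc x \<gamma> t \<cdot> th \<gamma>)"
    using cmp_assoc[OF pl[OF x t] \<theta> conjunct1[OF cs]] th_cc[OF g] by simp
  also have "\<dots> = pl x (sm_comp t \<gamma>) \<cdot> th \<gamma>"
    using cmp_assoc[OF pl[OF x t] conjunct1[OF ct] th[OF g]] ct by simp
  finally show ?thesis .
qed

lemma th_ext:
  assumes g: "\<gamma> \<in> maps T Am" "\<delta> \<in> maps T Am" and e: "sm_comp s \<gamma> = sm_comp s \<delta>" "sm_comp t \<gamma> = sm_comp t \<delta>" "th \<gamma> = th \<delta>"
  shows "\<gamma> = \<delta>"
proof -
  let ?\<xi> = "pl x t \<cdot> \<theta>"
  have ov: "ov ?\<xi> (pa X ?\<xi>) (xr x s) x" using un by (simp add: univ_def)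
  have "ov (?\<xi> \<cdot> cc x \<gamma> s) (pa X (?\<xi> \<cdot> cc x \<gamma> s)) (xr x (sm_comp s \<gamma>)) x"
    using ov_cmp[OF ov conjunct1[OF cc[OF x s g(1)]]] by (simp add: over_def)
  then have "\<exists>!h. h \<in> maps T Am \<and> sm_comp s h = sm_comp s \<gamma> \<and> ?\<xi> \<cdot> cc x h s = ?\<xi> \<cdot> cc x \<gamma> s"
    using un st(1)[OF g(1)] unfolding univ_def by blast
  then show ?thesis using g e xi_th[OF g(1)] xi_th[OF g(2)] by metis
qed

text \<open>Composing with the chosen arrow to \<open>x\<close> over \<open>m'\<close> turns the
  isomorphism into an arrow of the kind that \<open>univ\<close> classifies; the target of the
  classifying map is read off from the map over which this arrow lies.\<close>

lemma th_ex:
  assumes m: "m \<in> maps T B0" "m' \<in> maps T B0" and \<phi>: "ov \<phi> (sm_id T) (xr x m) (xr x m')"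
  obtains \<gamma> where "\<gamma> \<in> maps T Am" "sm_comp s \<gamma> = m" "sm_comp t \<gamma> = m'" "th \<gamma> = \<phi>"
proof -
  let ?\<xi> = "pl x t \<cdot> \<theta>"
  have o: "ov (pl x m' \<cdot> \<phi>) m' (xr x m) x" using ov_cmp[OF pl[OF x m(2)] \<phi>] maps_id_right[OF m(2)] by simp
  then have "ov (pl x m' \<cdot> \<phi>) (pa X (pl x m' \<cdot> \<phi>)) (xr x m) x" by (simp add: over_def)
  then obtain \<gamma> where g: "\<gamma> \<in> maps T Am" "sm_comp s \<gamma> = m" "?\<xi> \<cdot> cc x \<gamma> s = pl x m' \<cdot> \<phi>"
    using un m(1) unfolding univ_def by blast
  have e: "pl x (sm_comp t \<gamma>) \<cdot> th \<gamma> = pl x m' \<cdot> \<phi>" using xi_th[OF g(1)] g(3) by simp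
  have "ov (pl x (sm_comp t \<gamma>) \<cdot> th \<gamma>) (sm_comp t \<gamma>) (xr x m) x"
    using ov_cmp[OF pl[OF x st(2)[OF g(1)]] th[OF g(1)]] maps_id_right[OF st(2)[OF g(1)]] g(2) by simp
  then have tm: "sm_comp t \<gamma> = m'" using e o by (simp add: over_def)
  have "th \<gamma> = \<phi>"
    by (rule cancel[OF pl[OF x m(2)] _ \<phi>]) (use th[OF g(1)] g(2) tm e in auto)
  then show ?thesis using that g tm by blast
qed

lemma th_nat:
  assumes g: "\<gamma> \<in> maps T Am" and h: "h \<in> maps T' T"
  shows "th \<gamma> \<cdot> cc x h (sm_comp s \<gamma>) = cc x h (sm_comp t \<gamma>) \<cdot> th (sm_comp \<gamma> h)"
proof (rule cancel[OF conjunct1[OF cc[OF x t g]]])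
  have gh: "sm_comp \<gamma> h \<in> maps T' Am" using maps_comp[OF h g] .
  note a = maps_assoc[OF h g s] maps_assoc[OF h g t]
  note cs = cc[OF x st(1)[OF g] h] and ct = cc[OF x st(2)[OF g] h]
  have hm: "sm_comp (sm_id T) h = h" "sm_comp h (sm_id T') = h" using maps_id_left[OF h] maps_id_right[OF h] .
  show "ov (th \<gamma> \<cdot> cc x h (sm_comp s \<gamma>)) h (xr x (sm_comp s (sm_comp \<gamma> h))) (xr x (sm_comp t \<gamma>))"
    using ov_cmp[OF th[OF g] conjunct1[OF cs]] hm a by simp
  have th': "ov (th (sm_comp \<gamma> h)) (sm_id T') (xr x (sm_comp s (sm_comp \<gamma> h))) (xr x (sm_comp (sm_comp t \<gamma>) h))"
    using th[OF gh] a by simp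
  show "ov (cc x h (sm_comp t \<gamma>) \<cdot> th (sm_comp \<gamma> h)) h (xr x (sm_comp s (sm_comp \<gamma> h))) (xr x (sm_comp t \<gamma>))"
    using ov_cmp[OF conjunct1[OF ct] th'] hm by simp
  have "cc x \<gamma> t \<cdot> th \<gamma> \<cdot> cc x h (sm_comp s \<gamma>) = \<theta> \<cdot> cc x (sm_comp \<gamma> h) s"
    using cmp_assoc[OF conjunct1[OF cc[OF x t g]] th[OF g] conjunct1[OF cs]] th_cc[OF g]
      cmp_assoc[OF \<theta> conjunct1[OF cc[OF x s g]] conjunct1[OF cs]] cc_comp[OF x s g h] by simp
  also have "\<dots> = cc x (sm_comp \<gamma> h) t \<cdot> th (sm_comp \<gamma> h)" using th_cc[OF gh] by simp
  also have "\<dots> = cc x \<gamma> t \<cdot> cc x h (sm_comp t \<gamma>) \<cdot> th (sm_comp \<gamma> h)"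
    using cmp_assoc[OF conjunct1[OF cc[OF x t g]] conjunct1[OF ct] th'] cc_comp[OF x t g h] by simp
  finally show "cc x \<gamma> t \<cdot> th \<gamma> \<cdot> cc x h (sm_comp s \<gamma>) = cc x \<gamma> t \<cdot> cc x h (sm_comp t \<gamma>) \<cdot> th (sm_comp \<gamma> h)" .
qed

text \<open>Used to restrict composites from families to points.\<close>

lemma th_comp_nat:
  assumes g: "\<gamma> \<in> maps T Am" "\<delta> \<in> maps T Am" "\<nu> \<in> maps T Am" and h: "h \<in> maps T' T"
    and e: "sm_comp t \<gamma> = sm_comp s \<delta>" "sm_comp s \<nu> = sm_comp s \<gamma>" "sm_comp t \<nu> = sm_comp t \<delta>" "th \<nu> = th \<delta> \<cdot> th \<gamma>"
  shows "th (sm_comp \<nu> h) = th (sm_comp \<delta> h) \<cdot> th (sm_comp \<gamma> h)"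
proof (rule cancel[OF conjunct1[OF cc[OF x st(2)[OF g(3)] h]]])
  have gh: "sm_comp \<gamma> h \<in> maps T' Am" "sm_comp \<delta> h \<in> maps T' Am" "sm_comp \<nu> h \<in> maps T' Am" using maps_comp[OF h] g by auto
  have a: "sm_comp s (sm_comp f h) = sm_comp (sm_comp s f) h" "sm_comp t (sm_comp f h) = sm_comp (sm_comp t f) h"
    if "f \<in> maps T Am" for f using maps_assoc[OF h that] s t by auto
  have id: "sm_comp (sm_id T') (sm_id T') = sm_id T'" using maps_id_left[OF maps_id] mapsD[OF h] by blast
  note tn = th[OF gh(3), unfolded a[OF g(3)]] and td = th[OF gh(2), unfolded a[OF g(2)]] and tg = th[OF gh(1), unfolded a[OF g(1)]]
  show "ov (th (sm_comp \<nu> h)) (sm_id T') (xr x (sm_comp (sm_comp s \<gamma>) h)) (xr x (sm_comp (sm_comp t \<nu>) h))"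
    using tn e by simp
  have tg': "ov (th (sm_comp \<gamma> h)) (sm_id T') (xr x (sm_comp (sm_comp s \<gamma>) h)) (xr x (sm_comp (sm_comp s \<delta>) h))"
    using tg e by simp
  show "ov (th (sm_comp \<delta> h) \<cdot> th (sm_comp \<gamma> h)) (sm_id T') (xr x (sm_comp (sm_comp s \<gamma>) h)) (xr x (sm_comp (sm_comp t \<nu>) h))"
    using ov_cmp[OF td tg'] e id by simp
  note cs = conjunct1[OF cc[OF x st(1)[OF g(1)] h]]
  note cd = conjunct1[OF cc[OF x st(1)[OF g(2)] h]] and ce = conjunct1[OF cc[OF x st(2)[OF g(2)] h]]
  have tg0: "ov (th \<gamma>) (sm_id T) (xr x (sm_comp s \<gamma>)) (xr x (sm_comp s \<delta>))" using th[OF g(1)] e by simp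
  have "cc x h (sm_comp t \<nu>) \<cdot> th (sm_comp \<nu> h) = (th \<delta> \<cdot> th \<gamma>) \<cdot> cc x h (sm_comp s \<gamma>)"
    using th_nat[OF g(3) h] e by simp
  also have "\<dots> = th \<delta> \<cdot> cc x h (sm_comp s \<delta>) \<cdot> th (sm_comp \<gamma> h)"
    using cmp_assoc[OF th[OF g(2)] tg0 cs] th_nat[OF g(1) h] e by simp
  also have "\<dots> = (cc x h (sm_comp t \<delta>) \<cdot> th (sm_comp \<delta> h)) \<cdot> th (sm_comp \<gamma> h)"
    using cmp_assoc[OF th[OF g(2)] cd tg'] th_nat[OF g(2) h] by simp
  also have "\<dots> = cc x h (sm_comp t \<delta>) \<cdot> th (sm_comp \<delta> h) \<cdot> th (sm_comp \<gamma> h)"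
    using cmp_assoc[OF ce td tg'] by simp
  finally show "cc x h (sm_comp t \<nu>) \<cdot> th (sm_comp \<nu> h) = cc x h (sm_comp t \<nu>) \<cdot> th (sm_comp \<delta> h) \<cdot> th (sm_comp \<gamma> h)"
    using e by simp
qed

section \<open>Points as families over the one-point manifold\<close>

abbreviation "K M \<equiv> const_smap Q0 M"

lemma K: "manifold M \<Longrightarrow> r \<in> pts M \<Longrightarrow> K M r \<in> maps Q0 M"
  using const_smap_maps[OF Q0(1)] .

lemma K_inj: "K M r = K M r' \<Longrightarrow> r = r'"
  using const_smap_apply[of q0 Q0 M r] const_smap_apply[of q0 Q0 M r'] Q0(2) by (metis singletonI)

lemma K_of: "f \<in> maps Q0 M \<Longrightarrow> f = K M (fn f q0) \<and> fn f q0 \<in> pts M"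
proof -
  assume f: "f \<in> maps Q0 M"
  have q: "fn f q0 \<in> pts M" using maps_pts[OF f] Q0(2) by simp
  then show ?thesis
    using maps_eqI[OF f K] mapsD[OF f] Q0(2) by auto
qed

lemma comp_K: "f \<in> maps M N \<Longrightarrow> r \<in> pts M \<Longrightarrow> sm_comp f (K M r) = K N (fn f r)"
  using comp_const_smap[OF _ Q0(1)] .

lemma cmp_ex:
  assumes g: "\<gamma> \<in> maps T Am" "\<delta> \<in> maps T Am" and e: "sm_comp t \<gamma> = sm_comp s \<delta>"
  obtains \<nu> where "\<nu> \<in> maps T Am" "sm_comp s \<nu> = sm_comp s \<gamma>" "sm_comp t \<nu> = sm_comp t \<delta>" "th \<nu> = th \<delta> \<cdot> th \<gamma>"
proof -
  have "ov (th \<delta> \<cdot> th \<gamma>) (sm_comp (sm_id T) (sm_id T)) (xr x (sm_comp s \<gamma>)) (xr x (sm_comp t \<delta>))"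
    by (rule ov_cmp[OF th[OF g(2)]]) (use th[OF g(1)] e in simp)
  moreover have "sm_comp (sm_id T) (sm_id T) = sm_id T" using maps_id_left[OF maps_id] mapsD[OF g(1)] by blast
  ultimately have "ov (th \<delta> \<cdot> th \<gamma>) (sm_id T) (xr x (sm_comp s \<gamma>)) (xr x (sm_comp t \<delta>))" by simp
  from th_ex[OF st(1)[OF g(1)] st(2)[OF g(2)] this] that show ?thesis by blast
qed

text \<open>The composite isomorphism is classified by a map from the one-point manifold, whose
  value is the product. The composite is written in the opposite order because the left factor is
  applied first.\<close>

definition gmp :: "'p \<Rightarrow> 'p \<Rightarrow> 'p" where
  "gmp r r' = fn (SOME \<nu>. \<nu> \<in> maps Q0 Am \<and> sm_comp s \<nu> = sm_comp s (K Am r) \<and>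
     sm_comp t \<nu> = sm_comp t (K Am r') \<and> th \<nu> = th (K Am r') \<cdot> th (K Am r)) q0"

lemma gmp:
  assumes r: "r \<in> pts Am" "r' \<in> pts Am" "fn t r = fn s r'"
  shows "gmp r r' \<in> pts Am" "fn s (gmp r r') = fn s r" "fn t (gmp r r') = fn t r'"
    "th (K Am (gmp r r')) = th (K Am r') \<cdot> th (K Am r)"
proof -
  have k: "K Am r \<in> maps Q0 Am" "K Am r' \<in> maps Q0 Am" using K Am(1) r by auto
  have e: "sm_comp t (K Am r) = sm_comp s (K Am r')" using comp_K[OF t r(1)] comp_K[OF s r(2)] r(3) by simp
  define \<nu> where "\<nu> = (SOME \<nu>. \<nu> \<in> maps Q0 Am \<and> sm_comp s \<nu> = sm_comp s (K Am r) \<and>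
     sm_comp t \<nu> = sm_comp t (K Am r') \<and> th \<nu> = th (K Am r') \<cdot> th (K Am r))"
  have \<nu>: "\<nu> \<in> maps Q0 Am \<and> sm_comp s \<nu> = sm_comp s (K Am r) \<and>
     sm_comp t \<nu> = sm_comp t (K Am r') \<and> th \<nu> = th (K Am r') \<cdot> th (K Am r)"
    unfolding \<nu>_def by (rule someI_ex) (use cmp_ex[OF k e] in blast)
  have g: "gmp r r' = fn \<nu> q0" by (simp add: gmp_def \<nu>_def)
  have kn: "\<nu> = K Am (gmp r r')" "gmp r r' \<in> pts Am" using K_of \<nu> unfolding g by auto
  show "gmp r r' \<in> pts Am" by (rule kn)
  show "th (K Am (gmp r r')) = th (K Am r') \<cdot> th (K Am r)" using \<nu> kn by simp
  have "K B0 (fn s (gmp r r')) = K B0 (fn s r)" "K B0 (fn t (gmp r r')) = K B0 (fn t r')"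
    using \<nu> kn comp_K[OF s] comp_K[OF t] r by auto
  then show "fn s (gmp r r') = fn s r" "fn t (gmp r r') = fn t r'" using K_inj by auto
qed

lemma pt_ext:
  assumes "r \<in> pts Am" "r' \<in> pts Am" "fn s r = fn s r'" "fn t r = fn t r'" "th (K Am r) = th (K Am r')"
  shows "r = r'"
  using K_inj[OF th_ext[OF K[OF Am(1) assms(1)] K[OF Am(1) assms(2)]]] comp_K[OF s] comp_K[OF t] assms by simp

text \<open>Restriction to a point preserves composites, and a point of \<open>Am\<close> is
  determined by its source, its target and its isomorphism.\<close>

lemma cmp_pointwise:
  assumes g: "\<gamma> \<in> maps T Am" "\<delta> \<in> maps T Am" "\<nu> \<in> maps T Am"
    and e: "sm_comp t \<gamma> = sm_comp s \<delta>" "sm_comp s \<nu> = sm_comp s \<gamma>" "sm_comp t \<nu> = sm_comp t \<delta>" "th \<nu> = th \<delta> \<cdot> th \<gamma>"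
    and z: "z \<in> pts T"
  shows "fn \<nu> z = gmp (fn \<gamma> z) (fn \<delta> z)"
proof -
  have k: "K T z \<in> maps Q0 T" using K mapsD[OF g(1)] z by blast
  have p: "fn \<gamma> z \<in> pts Am" "fn \<delta> z \<in> pts Am" "fn \<nu> z \<in> pts Am"
    using maps_pts[OF g(1) z] maps_pts[OF g(2) z] maps_pts[OF g(3) z] by auto
  have q: "fn t (fn \<gamma> z) = fn s (fn \<delta> z)" "fn s (fn \<nu> z) = fn s (fn \<gamma> z)" "fn t (fn \<nu> z) = fn t (fn \<delta> z)"
    using e maps_apply[OF g(1) z] maps_apply[OF g(2) z] maps_apply[OF g(3) z] by metis+
  have "th (sm_comp \<nu> (K T z)) = th (sm_comp \<delta> (K T z)) \<cdot> th (sm_comp \<gamma> (K T z))"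
    by (rule th_comp_nat[OF g k e])
  then have "th (K Am (fn \<nu> z)) = th (K Am (gmp (fn \<gamma> z) (fn \<delta> z)))"
    using comp_K[OF g(1) z] comp_K[OF g(2) z] comp_K[OF g(3) z] gmp(4)[OF p(1,2) q(1)] by simp
  then show ?thesis
    using pt_ext[OF p(3) gmp(1)[OF p(1,2) q(1)]] gmp(2,3)[OF p(1,2) q(1)] q by simp
qed

text \<open>A composite of the two families exists by representability; it agrees with
  \<open>\<nu>\<close> at every point and hence is \<open>\<nu>\<close>.\<close>

lemma cmp_pointwise_conv:
  assumes g: "\<gamma> \<in> maps T Am" "\<delta> \<in> maps T Am" "\<nu> \<in> maps T Am" and e: "sm_comp t \<gamma> = sm_comp s \<delta>"
    and pw: "\<And>z. z \<in> pts T \<Longrightarrow> fn \<nu> z = gmp (fn \<gamma> z) (fn \<delta> z)"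
  shows "sm_comp s \<nu> = sm_comp s \<gamma> \<and> sm_comp t \<nu> = sm_comp t \<delta> \<and> th \<nu> = th \<delta> \<cdot> th \<gamma>"
proof -
  obtain \<mu> where \<mu>: "\<mu> \<in> maps T Am" "sm_comp s \<mu> = sm_comp s \<gamma>" "sm_comp t \<mu> = sm_comp t \<delta>" "th \<mu> = th \<delta> \<cdot> th \<gamma>"
    using cmp_ex[OF g(1,2) e] by blast
  have "\<mu> = \<nu>"
    by (rule maps_eqI[OF \<mu>(1) g(3)]) (use cmp_pointwise[OF g(1,2) \<mu>(1) e \<mu>(2-4)] pw in simp)
  then show ?thesis using \<mu> by simp
qed

lemma id_id: "manifold T \<Longrightarrow> sm_comp (sm_id T) (sm_id T) = sm_id T"
  using maps_id_left[OF maps_id] .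

text \<open>The structure maps are smooth because they classify isomorphisms: identities for the
  units, the inverse of the universal isomorphism for inversion, composites for products. Inversion
  transfers the submersion property from the target map to the source map.\<close>

lemma isom_lie_groupoid:
  assumes sub: "surj_submersion Am B0 (fn t)"
  obtains \<Gamma> where "lie_groupoid \<Gamma>" "base \<Gamma> = B0" "arrs \<Gamma> = Am" "gs \<Gamma> = fn s" "gt \<Gamma> = fn t" "gm \<Gamma> = gmp"
proof -
  have idB: "sm_id B0 \<in> maps B0 B0" "sm_id Am \<in> maps Am Am" using maps_id Am by auto
  have oid: "ov (ide (xr x (sm_id B0))) (sm_id B0) (xr x (sm_id B0)) (xr x (sm_id B0))"
    using ov_ide[of "xr x (sm_id B0)"] po_xr[OF x idB(1)] by simp
  obtain u where u: "u \<in> maps B0 Am" "sm_comp s u = sm_id B0" "sm_comp t u = sm_id B0" "th u = ide (xr x (sm_id B0))"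
    by (rule th_ex[OF idB(1) idB(1) oid]) blast
  have st_id: "sm_comp s (sm_id Am) = s" "sm_comp t (sm_id Am) = t" using maps_id_right s t by auto
  have tid: "ov (th (sm_id Am)) (sm_id Am) (xr x s) (xr x t)" using th[OF idB(2)] st_id by simp
  then obtain \<phi> where \<phi>: "ov \<phi> (sm_id Am) (xr x t) (xr x s)" "th (sm_id Am) \<cdot> \<phi> = ide (xr x t)" "\<phi> \<cdot> th (sm_id Am) = ide (xr x s)"
    using inv_ex[of "th (sm_id Am)" "xr x t" "xr x s"] po_xr[OF x t] by auto
  obtain i where i: "i \<in> maps Am Am" "sm_comp s i = t" "sm_comp t i = s" "th i = \<phi>"
    by (rule th_ex[OF t s \<phi>(1)]) blast
  have up: "fn u m \<in> pts Am" "fn s (fn u m) = m" "fn t (fn u m) = m" if "m \<in> pts B0" for m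
    using maps_pts[OF u(1) that] maps_apply[OF u(1) that, of s] maps_apply[OF u(1) that, of t] u(2,3) that by auto
  have ip: "fn i r \<in> pts Am" "fn s (fn i r) = fn t r" "fn t (fn i r) = fn s r" if "r \<in> pts Am" for r
    using maps_pts[OF i(1) that] maps_apply[OF i(1) that, of s] maps_apply[OF i(1) that, of t] i(2,3) by auto
  have sp: "fn s r \<in> pts B0" "fn t r \<in> pts B0" if "r \<in> pts Am" for r
    using maps_pts[OF s that] maps_pts[OF t that] by auto
  have thK: "ov (th (K Am r)) (sm_id Q0) (xr x (K B0 (fn s r))) (xr x (K B0 (fn t r)))" if "r \<in> pts Am" for r
    using th[OF K[OF Am(1) that]] comp_K[OF s that] comp_K[OF t that] by simp
  have thu: "th (K Am (fn u m)) = ide (xr x (K B0 m))" if m: "m \<in> pts B0" for m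
  proof -
    have kb: "K B0 m \<in> maps Q0 B0" using K Am(2) m by blast
    have l: "sm_comp (sm_id B0) (K B0 m) = K B0 m" using maps_id_left[OF kb] .
    note c = conjunct1[OF cc[OF x idB(1) kb], unfolded l]
    have "th u \<cdot> cc x (K B0 m) (sm_id B0) = cc x (K B0 m) (sm_id B0) \<cdot> th (K Am (fn u m))"
      using th_nat[OF u(1) kb] u comp_K[OF u(1) m] by simp
    then have e: "cc x (K B0 m) (sm_id B0) \<cdot> th (K Am (fn u m)) = cc x (K B0 m) (sm_id B0) \<cdot> ide (xr x (K B0 m))"
      using u(4) ide_left[OF c] ide_right[OF c] by simp
    have o1: "ov (th (K Am (fn u m))) (sm_id Q0) (xr x (K B0 m)) (xr x (K B0 m))"
      using thK[OF up(1)[OF m]] up[OF m] by simp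
    have o2: "ov (ide (xr x (K B0 m))) (sm_id Q0) (xr x (K B0 m)) (xr x (K B0 m))"
      using ov_ide[of "xr x (K B0 m)"] po_xr[OF x kb] by simp
    show ?thesis by (rule cancel[OF c o1 o2 e])
  qed
  have inv1: "gmp r (fn i r) = fn u (fn s r)" and inv2: "gmp (fn i r) r = fn u (fn t r)" if r: "r \<in> pts Am" for r
  proof -
    \<comment> \<open>The inverse laws are proved as identities between families over
      \<open>Am\<close> itself and evaluated at \<open>r\<close> afterwards.\<close>
    obtain \<nu> where \<nu>: "\<nu> \<in> maps Am Am" "sm_comp s \<nu> = sm_comp s (sm_id Am)" "sm_comp t \<nu> = sm_comp t i" "th \<nu> = th i \<cdot> th (sm_id Am)"
      by (rule cmp_ex[OF idB(2) i(1)]) (use st_id i in auto)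
    obtain \<mu> where \<mu>: "\<mu> \<in> maps Am Am" "sm_comp s \<mu> = sm_comp s i" "sm_comp t \<mu> = sm_comp t (sm_id Am)" "th \<mu> = th (sm_id Am) \<cdot> th i"
      by (rule cmp_ex[OF i(1) idB(2)]) (use st_id i in auto)
    have us: "sm_comp u f \<in> maps Am Am \<and> sm_comp s (sm_comp u f) = f \<and> sm_comp t (sm_comp u f) = f \<and> th (sm_comp u f) = ide (xr x f)"
      if f: "f \<in> maps Am B0" for f
    proof -
      have uf: "sm_comp u f \<in> maps Am Am" using maps_comp[OF f u(1)] .
      have ss: "sm_comp s (sm_comp u f) = f" "sm_comp t (sm_comp u f) = f"
        using maps_assoc[OF f u(1) s] maps_assoc[OF f u(1) t] u(2,3) maps_id_left[OF f] by auto
      note c = conjunct1[OF cc[OF x idB(1) f], unfolded maps_id_left[OF f]]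
      have e: "cc x f (sm_id B0) \<cdot> th (sm_comp u f) = cc x f (sm_id B0) \<cdot> ide (xr x f)"
        using th_nat[OF u(1) f] u ide_left[OF c] ide_right[OF c] by simp
      have o1: "ov (th (sm_comp u f)) (sm_id Am) (xr x f) (xr x f)" using th[OF uf] ss by simp
      have o2: "ov (ide (xr x f)) (sm_id Am) (xr x f) (xr x f)" using ov_ide[of "xr x f"] po_xr[OF x f] by simp
      show ?thesis using uf ss cancel[OF c o1 o2 e] by simp
    qed
    have "\<nu> = sm_comp u s"
      by (rule th_ext[OF \<nu>(1)]) (use us[OF s] \<nu> st_id i \<phi> in auto)
    moreover have "fn \<nu> r = gmp (fn (sm_id Am) r) (fn i r)"
      by (rule cmp_pointwise[OF idB(2) i(1) \<nu>(1) _ \<nu>(2-4) r]) (use st_id i in auto)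
    ultimately show "gmp r (fn i r) = fn u (fn s r)" using r maps_apply[OF s r] by simp
    have "\<mu> = sm_comp u t"
      by (rule th_ext[OF \<mu>(1)]) (use us[OF t] \<mu> st_id i \<phi> in auto)
    moreover have "fn \<mu> r = gmp (fn i r) (fn (sm_id Am) r)"
      by (rule cmp_pointwise[OF i(1) idB(2) \<mu>(1) _ \<mu>(2-4) r]) (use st_id i in auto)
    ultimately show "gmp (fn i r) r = fn u (fn t r)" using r maps_apply[OF t r] by simp
  qed
  have ii: "fn i (fn i r) = r" if r: "r \<in> pts Am" for r
  proof -
    note p = ip[OF r] and pp = ip[OF ip(1)[OF r]]
    have e: "th (K Am (fn i r)) \<cdot> th (K Am r) = ide (xr x (K B0 (fn s r)))"
      using gmp(4)[OF r p(1)] p inv1[OF r] thu[OF sp(1)[OF r]] by simp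
    have e': "th (K Am (fn i r)) \<cdot> th (K Am (fn i (fn i r))) = ide (xr x (K B0 (fn t (fn i r))))"
      using gmp(4)[OF pp(1) p(1)] pp inv2[OF p(1)] thu[OF sp(2)[OF p(1)]] by simp
    have "th (K Am (fn i (fn i r))) = th (K Am r)"
      by (rule cancel[OF thK[OF p(1)]]) (use thK[OF r] thK[OF pp(1)] p pp e e' in auto)
    then show ?thesis using pt_ext[OF pp(1) r] p pp by simp
  qed
  define \<Gamma> where "\<Gamma> = \<lparr>base = B0, arrs = Am, gs = fn s, gt = fn t, gu = fn u, gi = fn i, gm = gmp\<rparr>"
  have G: "base \<Gamma> = B0" "arrs \<Gamma> = Am" "gs \<Gamma> = fn s" "gt \<Gamma> = fn t" "gu \<Gamma> = fn u" "gi \<Gamma> = fn i" "gm \<Gamma> = gmp"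
    by (simp_all add: \<Gamma>_def)
  have tsub: "submersion Am B0 (fn t)" using sub by (simp add: surj_submersion_def)
  \<comment> \<open>A local section of the target map through the inverse of \<open>z\<close>,
    followed by inversion, is a local section of the source map through \<open>z\<close>.\<close>
  have ssub: "submersion Am B0 (fn s)"
  proof (rule submersionI_sections[OF Am])
    show "smooth_map Am B0 (fn s)" using mapsD[OF s] by simp
    fix z assume z: "z \<in> pts Am"
    obtain U \<sigma> where U: "openin (mtop B0) U" "fn t (fn i z) \<in> U" "smooth_map (open_submfd B0 U) Am \<sigma>"
      "\<sigma> (fn t (fn i z)) = fn i z" "\<And>y. y \<in> U \<Longrightarrow> \<sigma> y \<in> pts Am \<and> fn t (\<sigma> y) = y"
      by (rule submersion_section[OF Am tsub ip(1)[OF z]]) blast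
    have "smooth_map (open_submfd B0 U) Am (\<lambda>y. fn i (\<sigma> y))"
      using smooth_map_compose[OF manifold_open_submfd[OF Am(2) U(1)] Am(1) Am(1) U(3)] mapsD[OF i(1)] by simp
    then show "\<exists>U \<sigma>. openin (mtop B0) U \<and> fn s z \<in> U \<and> smooth_map (open_submfd B0 U) Am \<sigma> \<and>
      \<sigma> (fn s z) = z \<and> (\<forall>y\<in>U. fn s (\<sigma> y) = y)"
      using U ip[OF z] ip(2) ii[OF z] by (intro exI[of _ U] exI[of _ "\<lambda>y. fn i (\<sigma> y)"]) auto
  qed
  have "fn s ` pts Am = pts B0" using sp up by (auto simp: image_iff) (metis up)
  then have ssurj: "surj_submersion Am B0 (fn s)" using ssub by (simp add: surj_submersion_def)
  have "smooth_on_fibprod Am Am Am (fn t) (fn s) gmp"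
    unfolding smooth_on_fibprod_def
  proof (intro allI impI)
    fix T p q assume a: "manifold T \<and> smooth_map T Am p \<and> smooth_map T Am q \<and> (\<forall>z\<in>pts T. fn t (p z) = fn s (q z))"
    let ?p = "mk_smap T Am p" and ?q = "mk_smap T Am q"
    have pq: "?p \<in> maps T Am" "?q \<in> maps T Am" using mk_smap_maps a Am by auto
    have e: "sm_comp t ?p = sm_comp s ?q"
      by (rule maps_eqI[OF st(2)[OF pq(1)] st(1)[OF pq(2)]]) (use a in \<open>simp add: maps_apply[OF pq(1)] maps_apply[OF pq(2)]\<close>)
    obtain \<nu> where \<nu>: "\<nu> \<in> maps T Am" "sm_comp s \<nu> = sm_comp s ?p" "sm_comp t \<nu> = sm_comp t ?q" "th \<nu> = th ?q \<cdot> th ?p"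
      by (rule cmp_ex[OF pq e]) blast
    have "smooth_map T Am (fn \<nu>)" using mapsD[OF \<nu>(1)] by simp
    then show "smooth_map T Am (\<lambda>z. gmp (p z) (q z))"
      by (rule smooth_map_cong[OF _ Am(1), rotated 2]) (use a cmp_pointwise[OF pq \<nu>(1) e \<nu>(2-4)] in auto)
  qed
  moreover have "gmp (gmp p q) r = gmp p (gmp q r)"
    if p: "p \<in> pts Am" "q \<in> pts Am" "r \<in> pts Am" "fn t p = fn s q" "fn t q = fn s r" for p q r
  proof -
    note a = gmp[OF p(1,2,4)] and b = gmp[OF p(2,3,5)]
    have c: "fn t (gmp p q) = fn s r" "fn t p = fn s (gmp q r)" using a b p by auto
    note d = gmp[OF a(1) p(3) c(1)] and f = gmp[OF p(1) b(1) c(2)]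
    have "th (K Am r) \<cdot> (th (K Am q) \<cdot> th (K Am p)) = (th (K Am r) \<cdot> th (K Am q)) \<cdot> th (K Am p)"
      by (rule cmp_assoc[OF thK[OF p(3)]]) (use thK[OF p(2)] thK[OF p(1)] p in auto)
    then show ?thesis using pt_ext[OF d(1) f(1)] a b d f by simp
  qed
  moreover have "gmp (fn u (fn s r)) r = r \<and> gmp r (fn u (fn t r)) = r" if r: "r \<in> pts Am" for r
  proof -
    note us = up[OF sp(1)[OF r]] and ut = up[OF sp(2)[OF r]]
    have c: "fn t (fn u (fn s r)) = fn s r" "fn t r = fn s (fn u (fn t r))" using us ut by auto
    note g1 = gmp[OF us(1) r c(1)] and g2 = gmp[OF r ut(1) c(2)]
    show ?thesis
      using pt_ext[OF g1(1) r] pt_ext[OF g2(1) r] g1 g2 us ut thu[OF sp(1)[OF r]] thu[OF sp(2)[OF r]]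
        ide_left[OF thK[OF r]] ide_right[OF thK[OF r]] by simp
  qed
  ultimately have "lie_groupoid \<Gamma>"
    unfolding lie_groupoid_def G
    using Am ssurj sub mapsD[OF u(1)] mapsD[OF i(1)] gmp(1-3) up(2,3) ip(2,3) inv1 inv2 by simp
  then show ?thesis using that G by blast
qed

end

subsection \<open>Covers by open sets\<close>

definition incl :: "'p mfd \<Rightarrow> 'p set \<Rightarrow> 'p smap" where
  "incl S U = mk_smap (open_submfd S U) S (\<lambda>z. z)"

lemma incl_simps [simp]: "src (incl S U) = open_submfd S U" "tgt (incl S U) = S"
  by (simp_all add: incl_def mk_smap_def)

lemma incl_maps: "manifold S \<Longrightarrow> openin (mtop S) U \<Longrightarrow> incl S U \<in> maps (open_submfd S U) S"
  unfolding incl_def by (intro mk_smap_maps manifold_open_submfd smooth_map_open_incl)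

lemma incl_apply: "openin (mtop S) U \<Longrightarrow> z \<in> U \<Longrightarrow> fn (incl S U) z = z"
  unfolding incl_def by (rule mk_smap_apply) (simp only: pts_open_submfd)

lemma etale_incl:
  assumes S: "manifold S" and U: "openin (mtop S) U"
  shows "etale_map (open_submfd S U) S (fn (incl S U))"
proof -
  let ?f = "fn (incl S U)" and ?M = "open_submfd S U"
  note M = manifold_open_submfd[OF S U] and ptsM = pts_open_submfd[OF U]
  have MM: "open_submfd ?M U = ?M" by (auto simp: open_submfd_def subtopology_subtopology)
  have im: "?f ` U = U" using incl_apply[OF U] by force
  have "diffeomorphism ?M ?M ?f"
    unfolding diffeomorphism_def ptsM
  proof (intro conjI)
    show b: "bij_betw ?f U U" using incl_apply[OF U] im by (simp add: bij_betw_def inj_on_def)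
    show "smooth_map ?M ?M ?f"
      by (rule smooth_map_cong[OF M M _ smooth_map_id[OF M]]) (use ptsM incl_apply[OF U] in auto)
    have "inv_into U ?f z = z" if "z \<in> U" for z
      using inv_into_f_f[of ?f U z] b that incl_apply[OF U] by (simp add: bij_betw_def)
    then show "smooth_map ?M ?M (inv_into U ?f)"
      by (intro smooth_map_cong[OF M M _ smooth_map_id[OF M]]) (use ptsM in auto)
  qed
  moreover have "openin (mtop ?M) U" using U by (simp add: openin_open_subtopology)
  ultimately show ?thesis
    unfolding etale_map_def using mapsD[OF incl_maps[OF S U]] ptsM MM im U by (metis (no_types, lifting))
qed

lemma covering_incl:
  assumes S: "manifold S" and U: "\<And>U. U \<in> \<U> \<Longrightarrow> openin (mtop S) U" "\<Union>\<U> = pts S"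
  shows "covering S (incl S ` \<U>)"
proof -
  have "fn (incl S U) ` pts (open_submfd S U) = U" if "U \<in> \<U>" for U
    unfolding pts_open_submfd[OF U(1)[OF that]] using incl_apply[OF U(1)[OF that]] by force
  then show ?thesis
    unfolding covering_def using S U etale_incl[OF S U(1)] mapsD[OF incl_maps[OF S U(1)]] by auto
qed

lemma coveringD: "covering S C \<Longrightarrow> i \<in> C \<Longrightarrow> i \<in> maps (src i) S"
  by (auto simp: covering_def maps_def)

lemma pullback_square_incl:
  assumes S: "manifold S" and U: "openin (mtop S) U" and V: "openin (mtop S) V"
  defines "p \<equiv> mk_smap (open_submfd S (U \<inter> V)) (open_submfd S U) (\<lambda>z. z)"
    and "q \<equiv> mk_smap (open_submfd S (U \<inter> V)) (open_submfd S V) (\<lambda>z. z)"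
  shows "pullback_square (incl S U) (incl S V) p q"
proof -
  have UV: "openin (mtop S) (U \<inter> V)" using U V by blast
  note MU = manifold_open_submfd[OF S U] and MV = manifold_open_submfd[OF S V] and MW = manifold_open_submfd[OF S UV]
  note pU = pts_open_submfd[OF U] and pV = pts_open_submfd[OF V] and pW = pts_open_submfd[OF UV]
  note iW = smooth_map_open_incl[OF S UV]
  have p: "p \<in> maps (open_submfd S (U \<inter> V)) (open_submfd S U)"
    unfolding p_def by (intro mk_smap_maps MW MU smooth_map_into_open[OF MW S U iW]) (unfold pW, blast)
  have q: "q \<in> maps (open_submfd S (U \<inter> V)) (open_submfd S V)"
    unfolding q_def by (intro mk_smap_maps MW MV smooth_map_into_open[OF MW S V iW]) (unfold pW, blast)
  note iU = incl_maps[OF S U] and iV = incl_maps[OF S V]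
  have pa: "fn p z = z" "fn q z = z" if "z \<in> U \<inter> V" for z
    using that pW by (simp_all only: p_def q_def mk_smap_apply)
  have "sm_comp (incl S U) p = sm_comp (incl S V) q"
    by (rule maps_eqI[OF maps_comp[OF p iU] maps_comp[OF q iV]])
       (use pW maps_apply[OF p] maps_apply[OF q] pa incl_apply[OF U] incl_apply[OF V] in auto)
  moreover have "\<exists>!h. is_smap h \<and> src h = src p' \<and> tgt h = src p \<and> sm_comp p h = p' \<and> sm_comp q h = q'"
    if a: "is_smap p'" "is_smap q'" "src p' = src q'" "tgt p' = src (incl S U)" "tgt q' = src (incl S V)"
      "sm_comp (incl S U) p' = sm_comp (incl S V) q'" for p' q'
  proof -
    let ?T = "src p'"
    have p': "p' \<in> maps ?T (open_submfd S U)" and q': "q' \<in> maps ?T (open_submfd S V)" using a by (auto simp: maps_def)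
    have T: "manifold ?T" using mapsD[OF p'] by simp
    have eq: "fn p' z = fn q' z \<and> fn p' z \<in> U \<inter> V" if z: "z \<in> pts ?T" for z
    proof -
      have zU: "fn p' z \<in> U" "fn q' z \<in> V" using maps_pts[OF p' z] maps_pts[OF q' z] pU pV by blast+
      have "fn (incl S U) (fn p' z) = fn (incl S V) (fn q' z)" using a(6) maps_apply[OF p' z] maps_apply[OF q' z] by metis
      then show ?thesis using zU incl_apply[OF U zU(1)] incl_apply[OF V zU(2)] by auto
    qed
    have "smooth_map ?T S (\<lambda>z. fn (incl S U) (fn p' z))"
      using smooth_map_compose[OF T MU S] mapsD[OF p'] mapsD[OF iU] by blast
    then have "smooth_map ?T S (fn p')"
      by (rule smooth_map_cong[OF T S, rotated]) (rule incl_apply[OF U], use eq in blast)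
    then have "smooth_map ?T (open_submfd S (U \<inter> V)) (fn p')"
      by (rule smooth_map_into_open[OF T S UV]) (use eq in blast)
    then have h: "mk_smap ?T (open_submfd S (U \<inter> V)) (fn p') \<in> maps ?T (open_submfd S (U \<inter> V))"
      by (rule mk_smap_maps[OF T MW])
    let ?h = "mk_smap ?T (open_submfd S (U \<inter> V)) (fn p')"
    have sp: "src p = open_submfd S (U \<inter> V)" by (simp add: p_def mk_smap_def)
    show ?thesis
    proof (rule ex1I[where a = ?h])
      have fx: "fn p (fn q' z) = fn q' z \<and> fn q (fn q' z) = fn q' z" if "z \<in> pts ?T" for z
        using eq[OF that] pa[of "fn q' z"] by auto
      have "sm_comp p ?h = p'"
        by (rule maps_eqI[OF maps_comp[OF h p] p']) (use maps_apply[OF h] eq fx in simp)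
      moreover have "sm_comp q ?h = q'"
        by (rule maps_eqI[OF maps_comp[OF h q] q']) (use maps_apply[OF h] eq fx in simp)
      ultimately show "is_smap ?h \<and> src ?h = src p' \<and> tgt ?h = src p \<and> sm_comp p ?h = p' \<and> sm_comp q ?h = q'"
        using mapsD[OF h] sp by simp
      fix k assume k: "is_smap k \<and> src k = src p' \<and> tgt k = src p \<and> sm_comp p k = p' \<and> sm_comp q k = q'"
      then have km: "k \<in> maps ?T (open_submfd S (U \<inter> V))" using sp by (simp add: maps_def)
      show "k = ?h"
      proof (rule maps_eqI[OF km h])
        fix z assume z: "z \<in> pts ?T"
        have "fn k z \<in> U \<inter> V" using maps_pts[OF km z] pW by blast
        then have "fn k z = fn (sm_comp p k) z" using pa maps_apply[OF km z] by simp
        then show "fn k z = fn ?h z" using k z by simp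
      qed
    qed
  qed
  ultimately show ?thesis
    unfolding pullback_square_def using mapsD[OF p] mapsD[OF q] mapsD[OF iU] mapsD[OF iV] by simp
qed

text \<open>The open sets carrying a local section of the submersion form an etale cover of its
  base; this is how descent, which is formulated for etale covers, reaches submersions.\<close>

lemma section_cover:
  assumes \<pi>: "\<pi> \<in> maps V S" and sub: "surj_submersion V S (fn \<pi>)"
  obtains \<U> \<sigma> where "\<And>U. U \<in> \<U> \<Longrightarrow> openin (mtop S) U" "\<Union>\<U> = pts S" "covering S (incl S ` \<U>)"
    "\<And>U. U \<in> \<U> \<Longrightarrow> \<sigma> U \<in> maps (open_submfd S U) V" "\<And>U. U \<in> \<U> \<Longrightarrow> sm_comp \<pi> (\<sigma> U) = incl S U"
proof -
  have M: "manifold V" "manifold S" using mapsD[OF \<pi>] by auto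
  define sec where "sec U f \<longleftrightarrow> smooth_map (open_submfd S U) V f \<and> (\<forall>y\<in>U. fn \<pi> (f y) = y)" for U f
  have secD: "smooth_map (open_submfd S U) V f" "\<And>y. y \<in> U \<Longrightarrow> fn \<pi> (f y) = y" if "sec U f" for U f
    using that by (auto simp: sec_def)
  define \<U> where "\<U> = {U. openin (mtop S) U \<and> (\<exists>f. sec U f)}"
  have op: "openin (mtop S) U" if "U \<in> \<U>" for U using that by (simp add: \<U>_def)
  have un: "\<Union>\<U> = pts S"
  proof (intro equalityI subsetI)
    fix y assume "y \<in> pts S"
    then obtain v where v: "v \<in> pts V" "y = fn \<pi> v" using sub by (auto simp: surj_submersion_def)
    obtain U f where "openin (mtop S) U" "fn \<pi> v \<in> U" "smooth_map (open_submfd S U) V f"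
      "\<And>y. y \<in> U \<Longrightarrow> f y \<in> pts V \<and> fn \<pi> (f y) = y"
      by (rule submersion_section[OF M _ v(1)]) (use sub in \<open>auto simp: surj_submersion_def\<close>)
    then show "y \<in> \<Union>\<U>" using v by (auto simp: \<U>_def sec_def)
  qed (use op openin_subset in blast)
  define \<sigma> where "\<sigma> U = mk_smap (open_submfd S U) V (SOME f. sec U f)" for U
  have s: "\<sigma> U \<in> maps (open_submfd S U) V" "sm_comp \<pi> (\<sigma> U) = incl S U" if U: "U \<in> \<U>" for U
  proof -
    have "\<exists>f. sec U f" using U by (simp add: \<U>_def)
    then have f: "sec U (SOME f. sec U f)" by (rule someI_ex[of "sec U"])
    note MU = manifold_open_submfd[OF M(2) op[OF U]] and pU = pts_open_submfd[OF op[OF U]]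
    show sm: "\<sigma> U \<in> maps (open_submfd S U) V"
      unfolding \<sigma>_def by (rule mk_smap_maps[OF MU M(1) secD(1)[OF f]])
    show "sm_comp \<pi> (\<sigma> U) = incl S U"
    proof (rule maps_eqI[OF maps_comp[OF sm \<pi>] incl_maps[OF M(2) op[OF U]]])
      fix z assume z: "z \<in> pts (open_submfd S U)"
      then have "z \<in> U" by (simp only: pU)
      then show "fn (sm_comp \<pi> (\<sigma> U)) z = fn (incl S U) z"
        using maps_apply[OF sm z, of \<pi>] z secD(2)[OF f] incl_apply[OF op[OF U]] by (simp add: \<sigma>_def)
    qed
  qed
  show ?thesis by (rule that[OF op un covering_incl[OF M(2) op un] s])
qed

text \<open>\<open>\<rho> U\<close> is \<open>\<pi>\<close> restricted over \<open>U\<close>;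
  through it the pulled back cover maps to the given one.\<close>

lemma preimage_cover:
  assumes \<pi>: "\<pi> \<in> maps V S" and U: "\<forall>U\<in>\<U>. openin (mtop S) U" "\<Union>\<U> = pts S"
  defines "pre U \<equiv> {v \<in> pts V. fn \<pi> v \<in> U}"
    and "\<rho> U \<equiv> mk_smap (open_submfd V {v \<in> pts V. fn \<pi> v \<in> U}) (open_submfd S U) (fn \<pi>)"
  shows "covering V (incl V ` pre ` \<U>)"
    and "\<And>U. U \<in> \<U> \<Longrightarrow> openin (mtop V) (pre U)"
    and "\<And>U. U \<in> \<U> \<Longrightarrow> \<rho> U \<in> maps (open_submfd V (pre U)) (open_submfd S U)"
    and "\<And>U. U \<in> \<U> \<Longrightarrow> sm_comp \<pi> (incl V (pre U)) = sm_comp (incl S U) (\<rho> U)"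
proof -
  have M: "manifold V" "manifold S" "smooth_map V S (fn \<pi>)" using mapsD[OF \<pi>] by auto
  have op: "openin (mtop V) (pre U)" if "U \<in> \<U>" for U
    unfolding pre_def by (rule smooth_map_preimage[OF M(3) bspec[OF U(1) that]])
  then show "\<And>U. U \<in> \<U> \<Longrightarrow> openin (mtop V) (pre U)" .
  have "\<Union>(pre ` \<U>) = pts V" using U(2) maps_pts[OF \<pi>] by (auto simp: pre_def)
  then show "covering V (incl V ` pre ` \<U>)" by (intro covering_incl M) (use op in auto)
  fix U assume UU: "U \<in> \<U>"
  note oV = op[OF UU] and oS = bspec[OF U(1) UU]
  have \<rho>: "\<rho> U = mk_smap (open_submfd V (pre U)) (open_submfd S U) (fn \<pi>)" by (simp add: \<rho>_def pre_def)
  have ptsV: "pts (open_submfd V (pre U)) = pre U" by (rule pts_open_submfd[OF oV])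
  show r: "\<rho> U \<in> maps (open_submfd V (pre U)) (open_submfd S U)"
    unfolding \<rho>
    by (intro mk_smap_maps manifold_open_submfd M oV oS smooth_map_into_open[OF manifold_open_submfd[OF M(1) oV] M(2) oS]
          smooth_map_restrict[OF M(1,2) oV M(3)]) (unfold ptsV, simp add: pre_def)
  show "sm_comp \<pi> (incl V (pre U)) = sm_comp (incl S U) (\<rho> U)"
  proof (rule maps_eqI[OF maps_comp[OF incl_maps[OF M(1) oV] \<pi>] maps_comp[OF r incl_maps[OF M(2) oS]]])
    fix z assume z: "z \<in> pts (open_submfd V (pre U))"
    then have zp: "z \<in> pre U" by (simp only: ptsV)
    then show "fn (sm_comp \<pi> (incl V (pre U))) z = fn (sm_comp (incl S U) (\<rho> U)) z"
      using maps_apply[OF incl_maps[OF M(1) oV] z, of \<pi>] maps_apply[OF r z, of "incl S U"] z incl_apply[OF oV zp]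
        incl_apply[OF oS, of "fn \<pi> z"] by (simp add: \<rho> pre_def)
  qed
qed

subsection \<open>Descent for arrows\<close>

context gfib
begin

text \<open>\<open>iso_descent\<close> treats isomorphisms over the identity; an arrow over
  \<open>f\<close> is reduced to these by factoring through a restriction \<open>\<beta>\<close> of
  \<open>y\<close> along \<open>f\<close>. Compatibility is formulated for all pairs of arrows that
  agree in \<open>w\<close>, which avoids naming overlaps.\<close>

lemma glue:
  assumes iso: "iso_descent X" and C: "covering (po' w) C" and f: "f \<in> maps (po' w) (po' y)"
    and w: "w \<in> Ob" and y: "y \<in> Ob"
    and \<kappa>: "\<And>j. j \<in> C \<Longrightarrow> ov (\<kappa> j) j (wr j) w" and \<zeta>: "\<And>j. j \<in> C \<Longrightarrow> ov (\<zeta> j) (sm_comp f j) (wr j) y"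
    and comp: "\<And>i j z u v p q. i \<in> C \<Longrightarrow> j \<in> C \<Longrightarrow> ov u p z (wr i) \<Longrightarrow> ov v q z (wr j) \<Longrightarrow> \<kappa> i \<cdot> u = \<kappa> j \<cdot> v \<Longrightarrow>
      \<zeta> i \<cdot> u = \<zeta> j \<cdot> v"
  shows "\<exists>!a. ov a f w y \<and> (\<forall>j\<in>C. a \<cdot> \<kappa> j = \<zeta> j)"
proof -
  let ?S = "po' w"
  obtain \<beta> y' where \<beta>: "ov \<beta> f y' y" using pull_ex[OF y f] by blast
  have y': "y' \<in> Ob" "po' y' = ?S" using ovD[OF \<beta>] f by (auto simp: maps_def)
  have jm: "j \<in> maps (src j) ?S" if "j \<in> C" for j using coveringD[OF C that] .
  have pow: "po' (wr j) = src j" if "j \<in> C" for j using ovD[OF \<kappa>[OF that]] by (simp add: maps_def)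
  have "\<exists>\<zeta>'. ov \<zeta>' j (wr j) y' \<and> \<beta> \<cdot> \<zeta>' = \<zeta> j" if j: "j \<in> C" for j
    by (rule lift[OF \<beta> \<zeta>[OF j]]) (use jm[OF j] pow[OF j] y' in auto)
  then obtain \<zeta>' where \<zeta>': "\<And>j. j \<in> C \<Longrightarrow> ov (\<zeta>' j) j (wr j) y' \<and> \<beta> \<cdot> \<zeta>' j = \<zeta> j" by metis
  have pj: "ov (pl y' j) j (xr y' j) y'" if "j \<in> C" for j by (rule pl[OF y'(1)]) (use jm[OF that] y' in simp)
  have "\<exists>\<phi>. ov \<phi> (sm_id (src j)) (wr j) (xr y' j) \<and> pl y' j \<cdot> \<phi> = \<zeta>' j" if j: "j \<in> C" for j
  proof -
    have "po' (xr y' j) = src j" using po_xr[OF y'(1), of j] jm[OF j] y' by simp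
    then show ?thesis using lift_id[OF pj[OF j] conjunct1[OF \<zeta>'[OF j]]] by metis
  qed
  then obtain \<phi> where \<phi>: "\<And>j. j \<in> C \<Longrightarrow> ov (\<phi> j) (sm_id (src j)) (wr j) (xr y' j) \<and> pl y' j \<cdot> \<phi> j = \<zeta>' j" by metis
  have "\<exists>!\<psi>. ov \<psi> (sm_id ?S) w y' \<and> (\<forall>j\<in>C. \<psi> \<cdot> \<kappa> j = pl y' j \<cdot> \<phi> j)"
  proof (rule iso[unfolded iso_descent_def, rule_format], intro conjI ballI allI impI)
    show "covering ?S C" "w \<in> Ob" "po' w = ?S" "y' \<in> Ob" "po' y' = ?S" using C w y' by auto
    show "ov (\<kappa> j) j (wr j) w" "ov (pl y' j) j (xr y' j) y'" "ov (\<phi> j) (sm_id (src j)) (wr j) (xr y' j)" if "j \<in> C" for j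
      using \<kappa> pj \<phi> that by auto
    fix i j p q z u v assume i: "i \<in> C" and j: "j \<in> C"
      and a: "pullback_square i j p q \<and> ov u p z (wr i) \<and> ov v q z (wr j) \<and> \<kappa> i \<cdot> u = \<kappa> j \<cdot> v"
    then have u: "ov u p z (wr i)" and v: "ov v q z (wr j)" and e: "\<kappa> i \<cdot> u = \<kappa> j \<cdot> v" by auto
    have pq: "sm_comp i p = sm_comp j q" using ov_cmp[OF \<kappa>[OF i] u] ov_cmp[OF \<kappa>[OF j] v] e by (simp add: over_def)
    have zi: "ov (\<zeta>' i \<cdot> u) (sm_comp i p) z y'" and zj: "ov (\<zeta>' j \<cdot> v) (sm_comp i p) z y'"
      using ov_cmp[OF conjunct1[OF \<zeta>'[OF i]] u] ov_cmp[OF conjunct1[OF \<zeta>'[OF j]] v] pq by auto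
    have "\<beta> \<cdot> \<zeta>' i \<cdot> u = \<beta> \<cdot> \<zeta>' j \<cdot> v"
      using comp[OF i j u v e] cmp_assoc[OF \<beta> conjunct1[OF \<zeta>'[OF i]] u] cmp_assoc[OF \<beta> conjunct1[OF \<zeta>'[OF j]] v]
        \<zeta>'[OF i] \<zeta>'[OF j] by simp
    then have "\<zeta>' i \<cdot> u = \<zeta>' j \<cdot> v" by (rule cancel[OF \<beta> zi zj])
    then show "pl y' i \<cdot> \<phi> i \<cdot> u = pl y' j \<cdot> \<phi> j \<cdot> v"
      using cmp_assoc[OF pj[OF i] conjunct1[OF \<phi>[OF i]] u] cmp_assoc[OF pj[OF j] conjunct1[OF \<phi>[OF j]] v]
        \<phi>[OF i] \<phi>[OF j] by simp
  qed
  then obtain \<psi> where \<psi>: "ov \<psi> (sm_id ?S) w y'" "\<And>j. j \<in> C \<Longrightarrow> \<psi> \<cdot> \<kappa> j = \<zeta>' j"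
    and uq: "\<And>\<psi>'. ov \<psi>' (sm_id ?S) w y' \<Longrightarrow> (\<And>j. j \<in> C \<Longrightarrow> \<psi>' \<cdot> \<kappa> j = \<zeta>' j) \<Longrightarrow> \<psi>' = \<psi>"
    using \<phi> by (auto simp: ex1_iff_ex_Uniq Uniq_def)
  show ?thesis
  proof (rule ex1I[where a = "\<beta> \<cdot> \<psi>"])
    show "ov (\<beta> \<cdot> \<psi>) f w y \<and> (\<forall>j\<in>C. (\<beta> \<cdot> \<psi>) \<cdot> \<kappa> j = \<zeta> j)"
      using ov_cmp[OF \<beta> \<psi>(1)] maps_id_right[OF f] cmp_assoc[OF \<beta> \<psi>(1) \<kappa>] \<psi>(2) \<zeta>' by simp
    fix a assume a: "ov a f w y \<and> (\<forall>j\<in>C. a \<cdot> \<kappa> j = \<zeta> j)"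
    obtain \<psi>' where p: "ov \<psi>' (sm_id ?S) w y'" "\<beta> \<cdot> \<psi>' = a"
      using lift_id[OF \<beta> conjunct1[OF a]] y' by metis
    have "\<psi>' \<cdot> \<kappa> j = \<zeta>' j" if j: "j \<in> C" for j
    proof (rule cancel[OF \<beta>])
      show "ov (\<psi>' \<cdot> \<kappa> j) j (wr j) y'" using ov_cmp[OF p(1) \<kappa>[OF j]] maps_id_left[OF jm[OF j]] by simp
      show "ov (\<zeta>' j) j (wr j) y'" using \<zeta>'[OF j] by simp
      show "\<beta> \<cdot> \<psi>' \<cdot> \<kappa> j = \<beta> \<cdot> \<zeta>' j" using cmp_assoc[OF \<beta> p(1) \<kappa>[OF j]] p(2) a j \<zeta>'[OF j] by simp
    qed
    then show "a = \<beta> \<cdot> \<psi>" using uq[OF p(1)] p(2) by simp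
  qed
qed

lemma cover_separated:
  assumes iso: "iso_descent X" and C: "covering (po' w) C"
    and a: "ov a f w y" and b: "ov b f w y" and \<kappa>: "\<And>j. j \<in> C \<Longrightarrow> ov (\<kappa> j) j (wr j) w"
    and e: "\<And>j. j \<in> C \<Longrightarrow> a \<cdot> \<kappa> j = b \<cdot> \<kappa> j"
  shows "a = b"
proof -
  have f: "f \<in> maps (po' w) (po' y)" "w \<in> Ob" "y \<in> Ob" using ovD[OF a] by auto
  have "\<exists>!c. ov c f w y \<and> (\<forall>j\<in>C. c \<cdot> \<kappa> j = a \<cdot> \<kappa> j)"
  proof (rule glue[OF iso C f \<kappa>])
    show "ov (a \<cdot> \<kappa> j) (sm_comp f j) (wr j) y" if "j \<in> C" for j using ov_cmp[OF a \<kappa>[OF that]] .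
    fix i j z u v p q assume "i \<in> C" "j \<in> C" "ov u p z (wr i)" "ov v q z (wr j)" "\<kappa> i \<cdot> u = \<kappa> j \<cdot> v"
    then show "(a \<cdot> \<kappa> i) \<cdot> u = (a \<cdot> \<kappa> j) \<cdot> v" using cmp_assoc[OF a \<kappa>] by metis
  qed
  then show ?thesis using a b e by metis
qed

text \<open>Local sections of \<open>\<pi>\<close> lift restrictions of \<open>y\<close> to
  \<open>w\<close>; followed by \<open>\<zeta>\<close> they give local arrows to \<open>y'\<close>,
  which glue by \<open>H\<close>. The sections see only part of \<open>w\<close>, so the final
  equation is verified on the preimages of the cover.\<close>

lemma descend_submersion:
  assumes iso: "iso_descent X" and \<xi>: "ov \<xi> \<pi> w y" and sub: "surj_submersion (po' w) (po' y) (fn \<pi>)"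
    and f: "f \<in> maps (po' y) (po' y')" and \<zeta>: "ov \<zeta> (sm_comp f \<pi>) w y'"
    and H: "\<And>z u v p q. ov u p z w \<Longrightarrow> ov v q z w \<Longrightarrow> \<xi> \<cdot> u = \<xi> \<cdot> v \<Longrightarrow> \<zeta> \<cdot> u = \<zeta> \<cdot> v"
  shows "\<exists>!a. ov a f y y' \<and> a \<cdot> \<xi> = \<zeta>"
proof -
  let ?S = "po' y" and ?V = "po' w"
  have \<pi>: "\<pi> \<in> maps ?V ?S" "w \<in> Ob" "y \<in> Ob" and y': "y' \<in> Ob" using ovD[OF \<xi>] ovD[OF \<zeta>] by auto
  show ?thesis
  proof (rule section_cover[OF \<pi>(1) sub])
  fix \<U> \<sigma>
  assume U: "\<And>U. U \<in> \<U> \<Longrightarrow> openin (mtop ?S) U" "\<Union>\<U> = pts ?S" and C: "covering ?S (incl ?S ` \<U>)"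
    and \<sigma>: "\<And>U. U \<in> \<U> \<Longrightarrow> \<sigma> U \<in> maps (open_submfd ?S U) ?V" "\<And>U. U \<in> \<U> \<Longrightarrow> sm_comp \<pi> (\<sigma> U) = incl ?S U"
  let ?i = "\<lambda>U. incl ?S U"
  have iM: "?i U \<in> maps (open_submfd ?S U) ?S" if "U \<in> \<U>" for U by (rule incl_maps[OF po_manifold[OF \<pi>(3)] U(1)[OF that]])
  have k: "ov (pl y (?i U)) (?i U) (xr y (?i U)) y" if "U \<in> \<U>" for U by (rule pl[OF \<pi>(3) iM[OF that]])
  have "\<exists>u. ov u (\<sigma> U) (xr y (?i U)) w \<and> \<xi> \<cdot> u = pl y (?i U)" if UU: "U \<in> \<U>" for U
  proof -
    have b: "ov (pl y (?i U)) (sm_comp \<pi> (\<sigma> U)) (xr y (?i U)) y" using k[OF UU] \<sigma>(2)[OF UU] by simp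
    show ?thesis by (rule lift[OF \<xi> b]) (use \<sigma>(1)[OF UU] po_xr[OF \<pi>(3) iM[OF UU]] in auto)
  qed
  then obtain u where u: "\<And>U. U \<in> \<U> \<Longrightarrow> ov (u U) (\<sigma> U) (xr y (?i U)) w \<and> \<xi> \<cdot> u U = pl y (?i U)" by metis
  define iv where "iv j = (SOME U. U \<in> \<U> \<and> j = ?i U)" for j
  have iv': "iv j \<in> \<U> \<and> j = ?i (iv j)" if "j \<in> ?i ` \<U>" for j
  proof -
    have "\<exists>U. U \<in> \<U> \<and> j = ?i U" using that by blast
    then show ?thesis unfolding iv_def by (rule someI_ex)
  qed
  have iv: "iv j \<in> \<U>" "?i (iv j) = j" if "j \<in> ?i ` \<U>" for j
    using iv'[OF that] by auto
  have uj: "ov (u (iv j)) (\<sigma> (iv j)) (xr y j) w" "\<xi> \<cdot> u (iv j) = pl y j" "sm_comp \<pi> (\<sigma> (iv j)) = j" if "j \<in> ?i ` \<U>" for j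
    using u[OF iv(1)[OF that]] \<sigma>(2)[OF iv(1)[OF that]] iv(2)[OF that] by auto
  have kj: "ov (pl y j) j (xr y j) y" if "j \<in> ?i ` \<U>" for j using k that by auto
  have sj: "\<sigma> (iv j) \<in> maps (src j) ?V" if "j \<in> ?i ` \<U>" for j using \<sigma>(1)[OF iv(1)[OF that]] iv(2)[OF that] incl_simps(1) by metis
  have ex: "\<exists>!a. ov a f y y' \<and> (\<forall>j\<in>?i ` \<U>. a \<cdot> pl y j = \<zeta> \<cdot> u (iv j))"
  proof (rule glue[OF iso C f \<pi>(3) y' kj])
    fix j assume j: "j \<in> ?i ` \<U>"
    show "ov (\<zeta> \<cdot> u (iv j)) (sm_comp f j) (xr y j) y'"
      using ov_cmp[OF \<zeta> uj(1)[OF j]] maps_assoc[OF sj[OF j] \<pi>(1) f] uj(3)[OF j] by simp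
  next
    fix i j z v v' p q assume i: "i \<in> ?i ` \<U>" and j: "j \<in> ?i ` \<U>" and v: "ov v p z (xr y i)" "ov v' q z (xr y j)"
      and e: "pl y i \<cdot> v = pl y j \<cdot> v'"
    have "\<zeta> \<cdot> u (iv i) \<cdot> v = \<zeta> \<cdot> u (iv j) \<cdot> v'"
    proof (rule H[OF ov_cmp[OF uj(1)[OF i] v(1)] ov_cmp[OF uj(1)[OF j] v(2)]])
      show "\<xi> \<cdot> u (iv i) \<cdot> v = \<xi> \<cdot> u (iv j) \<cdot> v'"
        using cmp_assoc[OF \<xi> uj(1)[OF i] v(1)] cmp_assoc[OF \<xi> uj(1)[OF j] v(2)] uj(2)[OF i] uj(2)[OF j] e by simp
    qed
    then show "(\<zeta> \<cdot> u (iv i)) \<cdot> v = (\<zeta> \<cdot> u (iv j)) \<cdot> v'"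
      using cmp_assoc[OF \<zeta> uj(1)[OF i] v(1)] cmp_assoc[OF \<zeta> uj(1)[OF j] v(2)] by simp
  qed
  then obtain a where a: "ov a f y y'" "\<And>j. j \<in> ?i ` \<U> \<Longrightarrow> a \<cdot> pl y j = \<zeta> \<cdot> u (iv j)" by blast
  let ?pre = "\<lambda>U. {v \<in> pts ?V. fn \<pi> v \<in> U}"
  let ?\<rho> = "\<lambda>U. mk_smap (open_submfd ?V (?pre U)) (open_submfd ?S U) (fn \<pi>)"
  have "\<forall>U\<in>\<U>. openin (mtop ?S) U" using U(1) by blast
  note pc = preimage_cover[OF \<pi>(1) this U(2)]
  have "a \<cdot> \<xi> = \<zeta>"
  proof (rule cover_separated[OF iso pc(1) ov_cmp[OF a(1) \<xi>] \<zeta>])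
    fix j assume "j \<in> incl ?V ` ?pre ` \<U>"
    then obtain U where UU: "U \<in> \<U>" "j = incl ?V (?pre U)" by blast
    let ?k = "?i U"
    have kU: "?k \<in> ?i ` \<U>" using UU by blast
    have jm: "j \<in> maps (open_submfd ?V (?pre U)) ?V" using incl_maps[OF po_manifold[OF \<pi>(2)] pc(2)[OF UU(1)]] UU(2) by simp
    show pj: "ov (pl w j) j (xr w j) w" by (rule pl[OF \<pi>(2) jm])
    note \<rho> = pc(3)[OF UU(1)]
    have b: "ov (\<xi> \<cdot> pl w j) (sm_comp ?k (?\<rho> U)) (xr w j) y" using ov_cmp[OF \<xi> pj] pc(4)[OF UU(1)] UU(2) by simp
    \<comment> \<open>Over the preimage of \<open>U\<close> there are two arrows into
      \<open>w\<close>, the restriction and the one passing through the section. They agree after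
      \<open>\<xi>\<close>, hence after \<open>\<zeta>\<close> by \<open>H\<close>.\<close>
    obtain \<tau> where \<tau>: "ov \<tau> (?\<rho> U) (xr w j) (xr y ?k)" "pl y ?k \<cdot> \<tau> = \<xi> \<cdot> pl w j"
      by (rule lift[OF kj[OF kU] b]) (use \<rho> po_xr[OF \<pi>(2) jm] po_xr[OF \<pi>(3) iM[OF UU(1)]] in auto)
    have "\<xi> \<cdot> pl w j = \<xi> \<cdot> u (iv ?k) \<cdot> \<tau>" using cmp_assoc[OF \<xi> uj(1)[OF kU] \<tau>(1)] uj(2)[OF kU] \<tau>(2) by simp
    then have "\<zeta> \<cdot> pl w j = \<zeta> \<cdot> u (iv ?k) \<cdot> \<tau>" by (rule H[OF pj ov_cmp[OF uj(1)[OF kU] \<tau>(1)]])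
    also have "\<dots> = a \<cdot> pl y ?k \<cdot> \<tau>"
      using cmp_assoc[OF \<zeta> uj(1)[OF kU] \<tau>(1)] cmp_assoc[OF a(1) kj[OF kU] \<tau>(1)] a(2)[OF kU] by simp
    also have "\<dots> = (a \<cdot> \<xi>) \<cdot> pl w j" using \<tau>(2) cmp_assoc[OF a(1) \<xi> pj] by simp
    finally show "(a \<cdot> \<xi>) \<cdot> pl w j = \<zeta> \<cdot> pl w j" by simp
  qed
  moreover have "a' = a" if a': "ov a' f y y' \<and> a' \<cdot> \<xi> = \<zeta>" for a'
  proof -
    have "a' \<cdot> pl y j = \<zeta> \<cdot> u (iv j)" if j: "j \<in> ?i ` \<U>" for j
      using cmp_assoc[OF conjunct1[OF a'] \<xi> uj(1)[OF j]] uj(2)[OF j] a' by simp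
    then show ?thesis using ex a a' by blast
  qed
  ultimately show ?thesis using a(1) by blast
  qed
qed

end

section \<open>The torsor of a family\<close>

text \<open>\<open>V y\<close>, \<open>m y\<close> and \<open>\<xi> y\<close> are a chosen
  representation of the arrows from restrictions of \<open>x\<close> to \<open>y\<close>. The
  groupoid is tied to \<open>s\<close>, \<open>t\<close> and \<open>gmp\<close> on points, the form
  in which \<open>isom_groupoid\<close> delivers this information.\<close>

locale vgpd = isom_data X x Am s t \<theta> Q0 q0
  for X :: "('o, 'm, 'p) gfib" and x Am s t \<theta> Q0 q0 +
  fixes \<Gamma> :: "'p lgpd" and V :: "'o \<Rightarrow> 'p mfd" and m :: "'o \<Rightarrow> 'p smap" and \<xi> :: "'o \<Rightarrow> 'm"
    and e :: "(nat \<Rightarrow> real) \<Rightarrow> 'p"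
  assumes iso_desc: "iso_descent X" and obj_desc: "obj_descent X"
    and lieG: "lie_groupoid \<Gamma>" and G: "base \<Gamma> = po X x" "arrs \<Gamma> = Am"
    and gsG: "\<And>r. r \<in> pts Am \<Longrightarrow> gs \<Gamma> r = fn s r" and gtG: "\<And>r. r \<in> pts Am \<Longrightarrow> gt \<Gamma> r = fn t r"
    and gmG: "\<And>r r'. r \<in> pts Am \<Longrightarrow> r' \<in> pts Am \<Longrightarrow> fn t r = fn s r' \<Longrightarrow> gm \<Gamma> r r' = gmp r r'"
    and univV: "\<And>y. y \<in> Obj (tot X) \<Longrightarrow> univ x y (V y) (m y) (\<xi> y)"
    and surjV: "\<And>y. y \<in> Obj (tot X) \<Longrightarrow> surj_submersion (V y) (po X y) (fn (pa X (\<xi> y)))"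
    and inj_e: "inj e"
begin

sublocale lie_gpd \<Gamma> by unfold_locales (rule lieG)

lemma thK: "r \<in> pts Am \<Longrightarrow> ov (th (K Am r)) (sm_id Q0) (xr x (K B0 (fn s r))) (xr x (K B0 (fn t r)))"
  using th[OF K[OF Am(1)]] comp_K[OF s] comp_K[OF t] by metis

text \<open>A unit multiplied by itself is itself, and an idempotent isomorphism is an
  identity.\<close>

lemma gu: "b \<in> pts B0 \<Longrightarrow> gu \<Gamma> b \<in> pts Am \<and> fn s (gu \<Gamma> b) = b \<and> fn t (gu \<Gamma> b) = b \<and>
    th (K Am (gu \<Gamma> b)) = ide (xr x (K B0 b))"
proof -
  assume b: "b \<in> pts B0"
  have u: "gu \<Gamma> b \<in> pts Am" using smooth_map_pts[OF lie_gu] b G by simp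
  have st: "fn s (gu \<Gamma> b) = b" "fn t (gu \<Gamma> b) = b"
    using lieG b G gsG[OF u] gtG[OF u] by (auto simp: lie_groupoid_def)
  have "gm \<Gamma> (gu \<Gamma> (gs \<Gamma> (gu \<Gamma> b))) (gu \<Gamma> b) = gu \<Gamma> b" using lieG u G by (simp add: lie_groupoid_def)
  then have "gmp (gu \<Gamma> b) (gu \<Gamma> b) = gu \<Gamma> b" using gsG[OF u] gmG[OF u u] st by simp
  then have e: "th (K Am (gu \<Gamma> b)) \<cdot> th (K Am (gu \<Gamma> b)) = th (K Am (gu \<Gamma> b))"
    using gmp(4)[OF u u] st by simp
  have o: "ov (th (K Am (gu \<Gamma> b))) (sm_id Q0) (xr x (K B0 b)) (xr x (K B0 b))" using thK[OF u] st by simp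
  have o': "ov (ide (xr x (K B0 b))) (sm_id Q0) (xr x (K B0 b)) (xr x (K B0 b))"
    using ov_ide[of "xr x (K B0 b)"] po_xr[OF x K[OF Am(2) b]] by simp
  have "th (K Am (gu \<Gamma> b)) = ide (xr x (K B0 b))" by (rule cancel[OF o o o']) (use e ide_right[OF o] in simp)
  then show ?thesis using u st by simp
qed

definition "pY y = pa X (\<xi> y)"
text \<open>A \<open>T\<close>-point \<open>p\<close> of \<open>V y\<close>, read as an arrow to
  \<open>y\<close> from the restriction of \<open>x\<close> along its anchor.\<close>

definition "xi y p = \<xi> y \<cdot> cc x p (m y)"

context
  fixes y assumes y: "y \<in> Ob"
begin

lemma VD: "m y \<in> maps (V y) B0" "ov (\<xi> y) (pY y) (xr x (m y)) y" "pY y \<in> maps (V y) (po' y)"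
proof -
  show a: "m y \<in> maps (V y) B0" "ov (\<xi> y) (pY y) (xr x (m y)) y" using univV[OF y] by (auto simp: univ_def pY_def)
  show "pY y \<in> maps (V y) (po' y)" using ovD[OF a(2)] po_xr[OF x a(1)] by simp
qed

lemma VM: "manifold (V y)" "manifold (po' y)" using mapsD[OF VD(3)] by auto

lemma mp: "p \<in> maps T (V y) \<Longrightarrow> sm_comp (m y) p \<in> maps T B0" "p \<in> maps T (V y) \<Longrightarrow> sm_comp (pY y) p \<in> maps T (po' y)"
  using maps_comp[OF _ VD(1)] maps_comp[OF _ VD(3)] by auto

lemma xi: "p \<in> maps T (V y) \<Longrightarrow> ov (xi y p) (sm_comp (pY y) p) (xr x (sm_comp (m y) p)) y"
  unfolding xi_def using ov_cmp[OF VD(2)] cc[OF x VD(1)] by blast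

lemma xi_nat: "p \<in> maps T (V y) \<Longrightarrow> h \<in> maps T' T \<Longrightarrow> xi y p \<cdot> cc x h (sm_comp (m y) p) = xi y (sm_comp p h)"
  unfolding xi_def
  using cmp_assoc[OF VD(2) conjunct1[OF cc[OF x VD(1), of p T]] conjunct1[OF cc[OF x mp(1), of p T h T']]]
    cc_comp[OF x VD(1), of p T h T'] by simp

lemma xi_ext:
  assumes p: "p \<in> maps T (V y)" "p' \<in> maps T (V y)" "sm_comp (m y) p = sm_comp (m y) p'" "xi y p = xi y p'"
  shows "p = p'"
proof -
  have "ov (xi y p) (pa X (xi y p)) (xr x (sm_comp (m y) p)) y" using xi[OF p(1)] by (simp add: over_def)
  then have "\<exists>!h. h \<in> maps T (V y) \<and> sm_comp (m y) h = sm_comp (m y) p \<and> \<xi> y \<cdot> cc x h (m y) = xi y p"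
    using univV[OF y] mp(1)[OF p(1)] unfolding univ_def by blast
  then show ?thesis using p unfolding xi_def by metis
qed

lemma xi_ex:
  assumes "n \<in> maps T B0" "ov \<zeta> f (xr x n) y"
  obtains p where "p \<in> maps T (V y)" "sm_comp (m y) p = n" "sm_comp (pY y) p = f" "xi y p = \<zeta>"
proof -
  have "ov \<zeta> (pa X \<zeta>) (xr x n) y" using assms(2) by (simp add: over_def)
  then obtain p where p: "p \<in> maps T (V y)" "sm_comp (m y) p = n" "xi y p = \<zeta>"
    using univV[OF y] assms(1) unfolding univ_def xi_def by blast
  have "sm_comp (pY y) p = f" using xi[OF p(1)] p(3) assms(2) by (simp add: over_def)
  then show ?thesis using that p by blast
qed

text \<open>The action in terms of families: \<open>p \<gamma> = p'\<close>.\<close>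

definition "AcR T p \<gamma> p' \<longleftrightarrow> p \<in> maps T (V y) \<and> \<gamma> \<in> maps T Am \<and> p' \<in> maps T (V y) \<and>
  sm_comp (m y) p = sm_comp s \<gamma> \<and> sm_comp (m y) p' = sm_comp t \<gamma> \<and> xi y p' \<cdot> th \<gamma> = xi y p"

lemma AR_pi: "AcR T p \<gamma> p' \<Longrightarrow> sm_comp (pY y) p = sm_comp (pY y) p'"
proof -
  assume a: "AcR T p \<gamma> p'"
  then have p: "p \<in> maps T (V y)" "p' \<in> maps T (V y)" and g: "\<gamma> \<in> maps T Am" by (auto simp: AcR_def)
  have "ov (xi y p' \<cdot> th \<gamma>) (sm_comp (sm_comp (pY y) p') (sm_id T)) (xr x (sm_comp s \<gamma>)) y"
    by (rule ov_cmp[OF xi[OF p(2)]]) (use a th[OF g] in \<open>simp add: AcR_def\<close>)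
  then show ?thesis using a xi[OF p(1)] maps_id_right[OF mp(2)[OF p(2)]] by (simp add: AcR_def over_def)
qed

lemma AR_nat:
  assumes a: "AcR T p \<gamma> p'" and h: "h \<in> maps T' T"
  shows "AcR T' (sm_comp p h) (sm_comp \<gamma> h) (sm_comp p' h)"
proof -
  have p: "p \<in> maps T (V y)" "p' \<in> maps T (V y)" and g: "\<gamma> \<in> maps T Am"
    and e: "sm_comp (m y) p = sm_comp s \<gamma>" "sm_comp (m y) p' = sm_comp t \<gamma>" "xi y p' \<cdot> th \<gamma> = xi y p"
    using a by (auto simp: AcR_def)
  note gh = maps_comp[OF h g]
  have as: "sm_comp (m y) (sm_comp p h) = sm_comp s (sm_comp \<gamma> h)" "sm_comp (m y) (sm_comp p' h) = sm_comp t (sm_comp \<gamma> h)"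
    using maps_assoc[OF h p(1) VD(1)] maps_assoc[OF h p(2) VD(1)] maps_assoc[OF h g s] maps_assoc[OF h g t] e by auto
  note cs = conjunct1[OF cc[OF x st(1)[OF g] h]] and ct = conjunct1[OF cc[OF x st(2)[OF g] h]]
  have xp': "ov (xi y p') (sm_comp (pY y) p') (xr x (sm_comp t \<gamma>)) y" using xi[OF p(2)] e by simp
  have tg: "ov (th (sm_comp \<gamma> h)) (sm_id T') (xr x (sm_comp s (sm_comp \<gamma> h))) (xr x (sm_comp (sm_comp t \<gamma>) h))"
    using th[OF gh] maps_assoc[OF h g t] by simp
  have "xi y (sm_comp p' h) \<cdot> th (sm_comp \<gamma> h) = xi y p' \<cdot> cc x h (sm_comp t \<gamma>) \<cdot> th (sm_comp \<gamma> h)"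
    using xi_nat[OF p(2) h] e cmp_assoc[OF xp' ct tg] by simp
  also have "\<dots> = (xi y p' \<cdot> th \<gamma>) \<cdot> cc x h (sm_comp s \<gamma>)"
    using th_nat[OF g h] cmp_assoc[OF xp' th[OF g] cs] by simp
  also have "\<dots> = xi y (sm_comp p h)" using e xi_nat[OF p(1) h] by simp
  finally show ?thesis unfolding AcR_def using maps_comp[OF h] p gh as by blast
qed

text \<open>The translate is the old arrow preceded by the inverse of \<open>th \<gamma>\<close>;
  taking the inverse is what makes this a right action.\<close>

lemma AR_ex:
  assumes p: "p \<in> maps T (V y)" and g: "\<gamma> \<in> maps T Am" and e: "sm_comp (m y) p = sm_comp s \<gamma>"
  obtains p' where "AcR T p \<gamma> p'"
proof -
  have T: "po' (xr x (sm_comp t \<gamma>)) = T" using po_xr[OF x st(2)[OF g]] by simp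
  obtain b where b: "ov b (sm_id T) (xr x (sm_comp t \<gamma>)) (xr x (sm_comp s \<gamma>))" "b \<cdot> th \<gamma> = ide (xr x (sm_comp s \<gamma>))"
    using inv_ex[of "th \<gamma>" "xr x (sm_comp t \<gamma>)" "xr x (sm_comp s \<gamma>)"] th[OF g] T by auto
  have xp: "ov (xi y p) (sm_comp (pY y) p) (xr x (sm_comp s \<gamma>)) y" using xi[OF p] e by simp
  obtain p' where p': "p' \<in> maps T (V y)" "sm_comp (m y) p' = sm_comp t \<gamma>" "xi y p' = xi y p \<cdot> b"
    by (rule xi_ex[OF st(2)[OF g] ov_cmp[OF xp b(1)]])
  have "xi y p' \<cdot> th \<gamma> = xi y p" using p'(3) cmp_assoc[OF xp b(1) th[OF g]] b(2) ide_right[OF xp] by simp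
  then have "AcR T p \<gamma> p'" unfolding AcR_def using p g p'(1,2) e by blast
  then show ?thesis by (rule that)
qed

lemma right_cancel:
  assumes "ov a f v z" "ov b f v z" "ov c (sm_id (po' v)) w v" "a \<cdot> c = b \<cdot> c"
  shows "a = b"
proof -
  obtain d where d: "ov d (sm_id (po' v)) v w" "c \<cdot> d = ide v" using inv_ex[OF assms(3)] by blast
  have "a = (a \<cdot> c) \<cdot> d" using cmp_assoc[OF assms(1,3) d(1)] d(2) ide_right[OF assms(1)] by simp
  also have "\<dots> = b" using assms(4) cmp_assoc[OF assms(2,3) d(1)] d(2) ide_right[OF assms(2)] by simp
  finally show ?thesis .
qed

lemma AR_unique: assumes "AcR T p \<gamma> p'" "AcR T p \<gamma> p''" shows "p' = p''"
proof -
  have p: "p' \<in> maps T (V y)" "p'' \<in> maps T (V y)" and g: "\<gamma> \<in> maps T Am"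
    and e: "sm_comp (m y) p' = sm_comp t \<gamma>" "sm_comp (m y) p'' = sm_comp t \<gamma>" "xi y p' \<cdot> th \<gamma> = xi y p''\<cdot> th \<gamma>"
    using assms by (auto simp: AcR_def)
  have "xi y p' = xi y p''"
    by (rule right_cancel[OF _ _ _ e(3), where f = "sm_comp (pY y) p'" and v = "xr x (sm_comp t \<gamma>)"])
       (use xi[OF p(1)] xi[OF p(2)] e th[OF g] po_xr[OF x st(2)[OF g]] AR_pi[OF assms(1)] AR_pi[OF assms(2)] in auto)
  then show ?thesis using xi_ext[OF p] e by simp
qed

lemma AR_unique_arrow: assumes "AcR T p \<gamma> p'" "AcR T p \<delta> p'" shows "\<gamma> = \<delta>"
proof -
  have p: "p' \<in> maps T (V y)" and g: "\<gamma> \<in> maps T Am" "\<delta> \<in> maps T Am"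
    and e: "sm_comp s \<gamma> = sm_comp s \<delta>" "sm_comp t \<gamma> = sm_comp t \<delta>" "xi y p' \<cdot> th \<gamma> = xi y p' \<cdot> th \<delta>" "sm_comp (m y) p' = sm_comp t \<gamma>"
    using assms by (auto simp: AcR_def)
  have "th \<gamma> = th \<delta>" by (rule cancel[OF xi[OF p] _ _ e(3)]) (use th[OF g(1)] th[OF g(2)] e in auto)
  then show ?thesis using th_ext[OF g] e by simp
qed

lemma AR_ex_arrow:
  assumes p: "p \<in> maps T (V y)" "p' \<in> maps T (V y)" and e: "sm_comp (pY y) p = sm_comp (pY y) p'"
  obtains \<gamma> where "AcR T p \<gamma> p'"
proof -
  have o: "ov (xi y p) (sm_comp (pY y) p') (xr x (sm_comp (m y) p)) y" using xi[OF p(1)] e by simp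
  obtain c where c: "ov c (sm_id T) (xr x (sm_comp (m y) p)) (xr x (sm_comp (m y) p'))" "xi y p' \<cdot> c = xi y p"
    using lift_id[OF xi[OF p(2)] o] po_xr[OF x mp(1)[OF p(2)]] by metis
  obtain \<gamma> where g: "\<gamma> \<in> maps T Am" "sm_comp s \<gamma> = sm_comp (m y) p" "sm_comp t \<gamma> = sm_comp (m y) p'" "th \<gamma> = c"
    by (rule th_ex[OF mp(1)[OF p(1)] mp(1)[OF p(2)] c(1)])
  then have "AcR T p \<gamma> p'" unfolding AcR_def using p c(2) by auto
  then show ?thesis by (rule that)
qed

abbreviation "KV \<equiv> K (V y)"

text \<open>The action on points, computed with one-point families; the value
  \<open>undefined\<close> outside the domain is the one that \<open>torsor\<close>
  prescribes.\<close>

definition "ac v \<gamma> = (if v \<in> pts (V y) \<and> \<gamma> \<in> pts Am \<and> fn (m y) v = gs \<Gamma> \<gamma>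
  then fn (SOME p'. AcR Q0 (KV v) (K Am \<gamma>) p') q0 else undefined)"

lemma ac:
  assumes v: "v \<in> pts (V y)" "\<gamma> \<in> pts Am" "fn (m y) v = fn s \<gamma>"
  shows "ac v \<gamma> \<in> pts (V y)" "AcR Q0 (KV v) (K Am \<gamma>) (KV (ac v \<gamma>))"
proof -
  have kv: "KV v \<in> maps Q0 (V y)" "K Am \<gamma> \<in> maps Q0 Am" using K VM Am v by auto
  have e: "sm_comp (m y) (KV v) = sm_comp s (K Am \<gamma>)" using comp_K[OF VD(1) v(1)] comp_K[OF s v(2)] v(3) by simp
  define p' where "p' = (SOME p'. AcR Q0 (KV v) (K Am \<gamma>) p')"
  have p': "AcR Q0 (KV v) (K Am \<gamma>) p'" unfolding p'_def by (rule someI_ex) (use AR_ex[OF kv e] in blast)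
  have a: "ac v \<gamma> = fn p' q0" using v gsG[OF v(2)] by (simp add: ac_def p'_def)
  have "p' \<in> maps Q0 (V y)" using p' by (simp add: AcR_def)
  then have "p' = KV (ac v \<gamma>)" "ac v \<gamma> \<in> pts (V y)" using K_of unfolding a by auto
  then show "ac v \<gamma> \<in> pts (V y)" "AcR Q0 (KV v) (K Am \<gamma>) (KV (ac v \<gamma>))" using p' by auto
qed

lemma AR_points:
  assumes v: "v \<in> pts (V y)" "\<gamma> \<in> pts Am" "w \<in> pts (V y)"
  shows "AcR Q0 (KV v) (K Am \<gamma>) (KV w) \<longleftrightarrow> fn (m y) v = fn s \<gamma> \<and> ac v \<gamma> = w"
proof
  assume a: "AcR Q0 (KV v) (K Am \<gamma>) (KV w)"
  then have "K B0 (fn (m y) v) = K B0 (fn s \<gamma>)" using comp_K[OF VD(1) v(1)] comp_K[OF s v(2)] by (simp add: AcR_def)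
  then have e: "fn (m y) v = fn s \<gamma>" by (rule K_inj)
  show "fn (m y) v = fn s \<gamma> \<and> ac v \<gamma> = w" using e K_inj[OF AR_unique[OF ac(2)[OF v(1,2) e] a]] by simp
qed (use ac(2)[OF v(1,2)] in auto)

lemma ac_fn:
  assumes v: "v \<in> pts (V y)" "\<gamma> \<in> pts Am" "fn (m y) v = fn s \<gamma>"
  shows "fn (m y) (ac v \<gamma>) = fn t \<gamma>" "fn (pY y) (ac v \<gamma>) = fn (pY y) v"
proof -
  note a = ac[OF v]
  have "K B0 (fn (m y) (ac v \<gamma>)) = K B0 (fn t \<gamma>)"
    using a(2) comp_K[OF VD(1) a(1)] comp_K[OF t v(2)] by (simp add: AcR_def)
  then show "fn (m y) (ac v \<gamma>) = fn t \<gamma>" by (rule K_inj)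
  have "K (po' y) (fn (pY y) (ac v \<gamma>)) = K (po' y) (fn (pY y) v)"
    using AR_pi[OF a(2)] comp_K[OF VD(3) a(1)] comp_K[OF VD(3) v(1)] by simp
  then show "fn (pY y) (ac v \<gamma>) = fn (pY y) v" by (rule K_inj)
qed

lemma AR_pointwise:
  assumes a: "AcR T p \<gamma> p'" and z: "z \<in> pts T"
  shows "fn (m y) (fn p z) = fn s (fn \<gamma> z)" "fn p' z = ac (fn p z) (fn \<gamma> z)"
proof -
  have p: "p \<in> maps T (V y)" "p' \<in> maps T (V y)" and g: "\<gamma> \<in> maps T Am" using a by (auto simp: AcR_def)
  have k: "K T z \<in> maps Q0 T" using K[OF _ z] mapsD[OF p(1)] by blast
  have "AcR Q0 (KV (fn p z)) (K Am (fn \<gamma> z)) (KV (fn p' z))"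
    using AR_nat[OF a k] comp_K[OF p(1) z] comp_K[OF p(2) z] comp_K[OF g z] by simp
  then have "fn (m y) (fn p z) = fn s (fn \<gamma> z) \<and> ac (fn p z) (fn \<gamma> z) = fn p' z"
    using AR_points[OF maps_pts[OF p(1) z] maps_pts[OF g z] maps_pts[OF p(2) z]] by blast
  then show "fn (m y) (fn p z) = fn s (fn \<gamma> z)" "fn p' z = ac (fn p z) (fn \<gamma> z)" by auto
qed

text \<open>The translate of \<open>p\<close> by \<open>\<gamma>\<close> exists as a family and
  agrees with \<open>p'\<close> at every point.\<close>

lemma ARI:
  assumes p: "p \<in> maps T (V y)" "\<gamma> \<in> maps T Am" "p' \<in> maps T (V y)"
    and a: "\<And>z. z \<in> pts T \<Longrightarrow> fn (m y) (fn p z) = fn s (fn \<gamma> z) \<and> fn p' z = ac (fn p z) (fn \<gamma> z)"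
  shows "AcR T p \<gamma> p'"
proof -
  have "sm_comp (m y) p = sm_comp s \<gamma>"
    by (rule maps_eqI[OF mp(1)[OF p(1)] st(1)[OF p(2)]]) (simp add: maps_apply[OF p(1)] maps_apply[OF p(2)] a)
  then obtain q where q: "AcR T p \<gamma> q" using AR_ex[OF p(1,2)] by blast
  then have "q \<in> maps T (V y)" by (simp add: AcR_def)
  then have "q = p'" by (rule maps_eqI[OF _ p(3)]) (use AR_pointwise(2)[OF q] a in simp)
  then show ?thesis using q by simp
qed

definition "Tor = \<lparr>tproj = pY y, tanch = m y, tact = ac\<rparr>"

lemma Tor_simps [simp]: "tproj Tor = pY y" "tanch Tor = m y" "tact Tor = ac"
  by (simp_all add: Tor_def)

lemma Tor_src [simp]: "src (pY y) = V y" "tgt (pY y) = po' y" "src (m y) = V y" "tgt (m y) = B0"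
  using mapsD[OF VD(3)] mapsD[OF VD(1)] by auto

text \<open>Smoothness of the action is automatic: for given test maps the translate is a
  classifying map, and it has the right values at points. Division exists because two arrows to
  \<open>y\<close> over the same map differ by an isomorphism of their domains; it is unique by
  cancellation.\<close>

lemma torsor_Tor: "torsor \<Gamma> Tor"
proof -
  have smooth: "smooth_on_fibprod (V y) Am (V y) (fn (m y)) (gs \<Gamma>) ac"
    unfolding smooth_on_fibprod_def
  proof (intro allI impI)
    fix T p q assume a: "manifold T \<and> smooth_map T (V y) p \<and> smooth_map T Am q \<and> (\<forall>z\<in>pts T. fn (m y) (p z) = gs \<Gamma> (q z))"
    let ?p = "mk_smap T (V y) p" and ?q = "mk_smap T Am q"
    have pq: "?p \<in> maps T (V y)" "?q \<in> maps T Am" using mk_smap_maps a Am VM by auto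
    have "fn (m y) (p z) = fn s (q z)" if "z \<in> pts T" for z
      using a that gsG[of "q z"] smooth_map_pts[of T Am q z] by auto
    then have e: "sm_comp (m y) ?p = sm_comp s ?q"
      by (intro maps_eqI[OF mp(1)[OF pq(1)] st(1)[OF pq(2)]]) (simp add: maps_apply[OF pq(1)] maps_apply[OF pq(2)])
    obtain p' where p': "AcR T ?p ?q p'" by (rule AR_ex[OF pq e])
    then have "smooth_map T (V y) (fn p')" using mapsD[of p' T "V y"] by (simp add: AcR_def)
    then show "smooth_map T (V y) (\<lambda>z. ac (p z) (q z))"
      by (rule smooth_map_cong[OF _ VM(1), rotated 2]) (use a AR_pointwise(2)[OF p'] in auto)
  qed
  have unit: "ac v (gu \<Gamma> (fn (m y) v)) = v" if v: "v \<in> pts (V y)" for v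
  proof -
    note u = gu[OF maps_pts[OF VD(1) v]]
    have kv: "KV v \<in> maps Q0 (V y)" using K[OF VM(1) v] .
    have "AcR Q0 (KV v) (K Am (gu \<Gamma> (fn (m y) v))) (KV v)"
      unfolding AcR_def using kv K[OF Am(1)] u comp_K[OF VD(1) v] comp_K[OF s] comp_K[OF t] ide_right[OF xi[OF kv]] by auto
    then show ?thesis using AR_points[OF v _ v] u by blast
  qed
  have assoc: "ac (ac v \<gamma>) \<delta> = ac v (gm \<Gamma> \<gamma> \<delta>)"
    if v: "v \<in> pts (V y)" "\<gamma> \<in> pts Am" "\<delta> \<in> pts Am" "fn (m y) v = fn s \<gamma>" "fn t \<gamma> = fn s \<delta>" for v \<gamma> \<delta>
  proof -
    note a1 = ac[OF v(1,2,4)] and f1 = ac_fn[OF v(1,2,4)]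
    have c: "fn (m y) (ac v \<gamma>) = fn s \<delta>" using f1 v by simp
    note a2 = ac[OF a1(1) v(3) c]
    note g = gmp[OF v(2,3,5)]
    have k: "KV v \<in> maps Q0 (V y)" "KV (ac (ac v \<gamma>) \<delta>) \<in> maps Q0 (V y)" "K Am (gmp \<gamma> \<delta>) \<in> maps Q0 Am"
      using K VM Am v a2 g by auto
    have xw: "ov (xi y (KV (ac (ac v \<gamma>) \<delta>))) (sm_comp (pY y) (KV (ac (ac v \<gamma>) \<delta>))) (xr x (K B0 (fn t \<delta>))) y"
      using xi[OF k(2)] a2(2) comp_K[OF t v(3)] by (simp add: AcR_def)
    have td: "ov (th (K Am \<delta>)) (sm_id Q0) (xr x (K B0 (fn t \<gamma>))) (xr x (K B0 (fn t \<delta>)))" using thK[OF v(3)] v(5) by simp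
    have "xi y (KV (ac (ac v \<gamma>) \<delta>)) \<cdot> th (K Am (gmp \<gamma> \<delta>)) = xi y (KV v)"
      using g(4) cmp_assoc[OF xw td thK[OF v(2)]] a1(2) a2(2) by (simp add: AcR_def)
    then have "AcR Q0 (KV v) (K Am (gmp \<gamma> \<delta>)) (KV (ac (ac v \<gamma>) \<delta>))"
      unfolding AcR_def using k a1(2) a2(2) g(2,3) comp_K[OF s] comp_K[OF t] v g(1) by (simp add: AcR_def)
    then show ?thesis using AR_points[OF v(1) g(1) a2(1)] gmG[OF v(2,3,5)] by simp
  qed
  have free: "\<exists>!\<gamma>. \<gamma> \<in> pts Am \<and> fn (m y) v = gs \<Gamma> \<gamma> \<and> ac v \<gamma> = w"
    if v: "v \<in> pts (V y)" "w \<in> pts (V y)" "fn (pY y) v = fn (pY y) w" for v w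
  proof -
    have k: "KV v \<in> maps Q0 (V y)" "KV w \<in> maps Q0 (V y)" using K VM v by auto
    have "sm_comp (pY y) (KV v) = sm_comp (pY y) (KV w)" using comp_K[OF VD(3)] v by simp
    then obtain \<gamma> where g: "AcR Q0 (KV v) \<gamma> (KV w)" using AR_ex_arrow[OF k] by blast
    then have "\<gamma> \<in> maps Q0 Am" by (simp add: AcR_def)
    then have gk: "\<gamma> = K Am (fn \<gamma> q0)" "fn \<gamma> q0 \<in> pts Am" using K_of by auto
    show ?thesis
    proof (rule ex1I[where a = "fn \<gamma> q0"])
      show "fn \<gamma> q0 \<in> pts Am \<and> fn (m y) v = gs \<Gamma> (fn \<gamma> q0) \<and> ac v (fn \<gamma> q0) = w"
        using AR_points[OF v(1) gk(2) v(2)] g gk gsG by metis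
      fix \<delta> assume d: "\<delta> \<in> pts Am \<and> fn (m y) v = gs \<Gamma> \<delta> \<and> ac v \<delta> = w"
      then have "AcR Q0 (KV v) (K Am \<delta>) (KV w)" using AR_points[OF v(1) _ v(2)] gsG by metis
      then show "\<delta> = fn \<gamma> q0" using AR_unique_arrow[OF g] gk(1) K_inj by metis
    qed
  qed
  show ?thesis
    unfolding torsor_def Tor_simps Tor_src G
    using mapsD[OF VD(1)] mapsD[OF VD(3)] surjV[OF y, folded pY_def] smooth ac(1) ac_fn gsG gtG unit assoc free
    by (simp add: ac_def[abs_def] del: split_paired_All)
qed

end

section \<open>Functoriality and full faithfulness\<close>

lemma po_w: "y \<in> Ob \<Longrightarrow> po' (xr x (m y)) = V y \<and> xr x (m y) \<in> Ob"
  using po_xr[OF x VD(1)] by simp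

text \<open>The map of representing manifolds that classifies composition with
  \<open>a\<close>.\<close>

definition "ka a = (SOME k. k \<in> maps (V (Dom (tot X) a)) (V (Cod (tot X) a)) \<and>
  sm_comp (m (Cod (tot X) a)) k = m (Dom (tot X) a) \<and> xi (Cod (tot X) a) k = a \<cdot> \<xi> (Dom (tot X) a))"

lemma ka:
  assumes a: "ov a f y y'"
  shows "ka a \<in> maps (V y) (V y')" "sm_comp (m y') (ka a) = m y" "sm_comp (pY y') (ka a) = sm_comp f (pY y)"
    "xi y' (ka a) = a \<cdot> \<xi> y"
proof -
  have y: "y \<in> Ob" "y' \<in> Ob" "Dom (tot X) a = y" "Cod (tot X) a = y'" using ovD[OF a] by auto
  have o: "ov (a \<cdot> \<xi> y) (sm_comp f (pY y)) (xr x (m y)) y'" by (rule ov_cmp[OF a VD(2)[OF y(1)]])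
  have "\<exists>k. k \<in> maps (V y) (V y') \<and> sm_comp (m y') k = m y \<and> xi y' k = a \<cdot> \<xi> y"
    using xi_ex[OF y(2) VD(1)[OF y(1)] o] by metis
  from someI_ex[OF this] show k: "ka a \<in> maps (V y) (V y')" "sm_comp (m y') (ka a) = m y" "xi y' (ka a) = a \<cdot> \<xi> y"
    unfolding ka_def y by auto
  show "sm_comp (pY y') (ka a) = sm_comp f (pY y)"
    using xi[OF y(2) k(1)] k(3) o by (simp add: over_def)
qed

lemma ka_unique:
  assumes a: "ov a f y y'" and k: "k \<in> maps (V y) (V y')" "sm_comp (m y') k = m y" "xi y' k = a \<cdot> \<xi> y"
  shows "ka a = k"
  by (rule xi_ext[of y' _ "V y"]) (use ka[OF a] k ovD[OF a] in auto)

lemma ka_xi: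
  assumes a: "ov a f y y'" and p: "p \<in> maps T (V y)"
  shows "xi y' (sm_comp (ka a) p) = a \<cdot> xi y p"
proof -
  have y: "y \<in> Ob" "y' \<in> Ob" using ovD[OF a] by auto
  have "xi y' (sm_comp (ka a) p) = xi y' (ka a) \<cdot> cc x p (m y)"
    using xi_nat[OF y(2) ka(1)[OF a] p] ka(2)[OF a] by simp
  also have "\<dots> = a \<cdot> xi y p"
    unfolding ka(4)[OF a] xi_def[of y]
    using cmp_assoc[OF a VD(2)[OF y(1)] conjunct1[OF cc[OF x VD(1)[OF y(1)] p]]] by simp
  finally show ?thesis .
qed

lemma xi_id: "y \<in> Ob \<Longrightarrow> xi y (sm_id (V y)) = \<xi> y"
  unfolding xi_def using cc_id[OF x VD(1)] ide_right[OF VD(2)] by simp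

lemma ka_ide: "y \<in> Ob \<Longrightarrow> ka (ide y) = sm_id (V y)"
  by (rule ka_unique[OF ov_ide])
     (use maps_id[OF VM(1)] maps_id_right[OF VD(1)] xi_id ide_left[OF VD(2)] in auto)

lemma ka_cmp:
  assumes a: "ov a f y y'" and b: "ov b g y' y''"
  shows "ka (b \<cdot> a) = sm_comp (ka b) (ka a)"
proof (rule ka_unique[OF ov_cmp[OF b a]])
  have y: "y \<in> Ob" "y' \<in> Ob" "y'' \<in> Ob" using ovD[OF a] ovD[OF b] by auto
  show "sm_comp (ka b) (ka a) \<in> maps (V y) (V y'')" by (rule maps_comp[OF ka(1)[OF a] ka(1)[OF b]])
  show "sm_comp (m y'') (sm_comp (ka b) (ka a)) = m y"
    using maps_assoc[OF ka(1)[OF a] ka(1)[OF b] VD(1)[OF y(3)]] ka(2)[OF b] ka(2)[OF a] by simp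
  show "xi y'' (sm_comp (ka b) (ka a)) = (b \<cdot> a) \<cdot> \<xi> y"
    using ka_xi[OF b ka(1)[OF a]] ka(4)[OF a] cmp_assoc[OF b a VD(2)[OF y(1)]] by simp
qed

lemma AcR_ka:
  assumes a: "ov a f y y'" and r: "AcR y T p \<gamma> p'"
  shows "AcR y' T (sm_comp (ka a) p) \<gamma> (sm_comp (ka a) p')"
proof -
  have y: "y \<in> Ob" "y' \<in> Ob" using ovD[OF a] by auto
  have p: "p \<in> maps T (V y)" "p' \<in> maps T (V y)" and g: "\<gamma> \<in> maps T Am"
    and e: "sm_comp (m y) p = sm_comp s \<gamma>" "sm_comp (m y) p' = sm_comp t \<gamma>" "xi y p' \<cdot> th \<gamma> = xi y p"
    using r y(1) by (auto simp: AcR_def)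
  have o: "ov (xi y p') (sm_comp (pY y) p') (xr x (sm_comp t \<gamma>)) y" using xi[OF y(1) p(2)] e by simp
  show ?thesis
    unfolding AcR_def[OF y(2)]
    using maps_comp[OF p(1) ka(1)[OF a]] maps_comp[OF p(2) ka(1)[OF a]] g
      maps_assoc[OF p(1) ka(1)[OF a] VD(1)[OF y(2)]] maps_assoc[OF p(2) ka(1)[OF a] VD(1)[OF y(2)]] ka(2)[OF a] e
      ka_xi[OF a p(1)] ka_xi[OF a p(2)] cmp_assoc[OF a o th[OF g]] by simp
qed

lemma ac_ka:
  assumes a: "ov a f y y'" and v: "v \<in> pts (V y)" "\<gamma> \<in> pts Am" "fn (m y) v = fn s \<gamma>"
  shows "fn (ka a) (ac y v \<gamma>) = ac y' (fn (ka a) v) \<gamma>"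
proof -
  have y: "y \<in> Ob" "y' \<in> Ob" using ovD[OF a] by auto
  note w = ac[OF y(1) v]
  have "AcR y' Q0 (K (V y') (fn (ka a) v)) (K Am \<gamma>) (K (V y') (fn (ka a) (ac y v \<gamma>)))"
    using AcR_ka[OF a w(2)] comp_K[OF ka(1)[OF a] v(1)] comp_K[OF ka(1)[OF a] w(1)] by simp
  then show ?thesis
    using AR_points[OF y(2) maps_pts[OF ka(1)[OF a] v(1)] v(2) maps_pts[OF ka(1)[OF a] w(1)]] by simp
qed

lemma Tor_s [simp]: "y \<in> Ob \<Longrightarrow> tproj (Tor y) = pY y" "y \<in> Ob \<Longrightarrow> tanch (Tor y) = m y" "y \<in> Ob \<Longrightarrow> tact (Tor y) = ac y"
  "y \<in> Ob \<Longrightarrow> src (pY y) = V y" "y \<in> Ob \<Longrightarrow> tgt (pY y) = po' y" "y \<in> Ob \<Longrightarrow> src (m y) = V y" "y \<in> Ob \<Longrightarrow> tgt (m y) = B0"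
  using Tor_simps Tor_src by auto

lemma torsor_mor_Tor_iff:
  assumes y: "y \<in> Ob" "y' \<in> Ob"
  shows "torsor_mor \<Gamma> (Tor y) k f (Tor y') \<longleftrightarrow> k \<in> maps (V y) (V y') \<and> f \<in> maps (po' y) (po' y') \<and>
    sm_comp (pY y') k = sm_comp f (pY y) \<and> sm_comp (m y') k = m y \<and>
    (\<forall>v\<in>pts (V y). \<forall>\<gamma>\<in>pts Am. fn (m y) v = fn s \<gamma> \<longrightarrow> fn k (ac y v \<gamma>) = ac y' (fn k v) \<gamma>)"
  unfolding torsor_mor_def using torsor_Tor[OF y(1)] torsor_Tor[OF y(2)] y G gsG by (auto simp: maps_def)

lemma torsor_mor_ka:
  assumes a: "ov a f y y'" shows "torsor_mor \<Gamma> (Tor y) (ka a) f (Tor y')"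
proof -
  have y: "y \<in> Ob" "y' \<in> Ob" "f \<in> maps (po' y) (po' y')" using ovD[OF a] by auto
  show ?thesis unfolding torsor_mor_Tor_iff[OF y(1,2)] using y ka[OF a] ac_ka[OF a] by blast
qed

definition "FT = \<lparr>fo = Tor, fa = (\<lambda>a. (Tor (Dom (tot X) a), ka a, pa X a, Tor (Cod (tot X) a)))\<rparr>"

lemma B_simps:
  "Obj (tot (B \<Gamma>)) = {P. torsor \<Gamma> P}" "Arr (tot (B \<Gamma>)) = {(P, k, f, Q). torsor_mor \<Gamma> P k f Q}"
  "Dom (tot (B \<Gamma>)) (P, k, f, Q) = P" "Cod (tot (B \<Gamma>)) (P, k, f, Q) = Q"
  "Ide (tot (B \<Gamma>)) P = (P, sm_id (src (tproj P)), sm_id (tgt (tproj P)), P)"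
  "Cmp (tot (B \<Gamma>)) (P', k', f', Q') (P, k, f, Q) = (P, sm_comp k' k, sm_comp f' f, Q')"
  "po (B \<Gamma>) P = tgt (tproj P)" "pa (B \<Gamma>) (P, k, f, Q) = f"
  by (simp_all add: B_def)

lemma FT_gf_mor: "gf_mor X (B \<Gamma>) FT"
  unfolding gf_mor_def is_functor_def
proof (intro conjI ballI impI)
  fix y assume y: "y \<in> Ob"
  show "fo FT y \<in> Obj (tot (B \<Gamma>))" "po (B \<Gamma>) (fo FT y) = po' y"
    "fa FT (ide y) = Ide (tot (B \<Gamma>)) (fo FT y)"
    using torsor_Tor[OF y] y ka_ide[OF y] ovD[OF ov_ide[OF y]] by (simp_all add: B_simps FT_def)
next
  fix a assume a: "a \<in> Arr (tot X)"
  note oa = ov_self[OF a]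
  show "fa FT a \<in> Arr (tot (B \<Gamma>))" "Dom (tot (B \<Gamma>)) (fa FT a) = fo FT (Dom (tot X) a)"
    "Cod (tot (B \<Gamma>)) (fa FT a) = fo FT (Cod (tot X) a)" "pa (B \<Gamma>) (fa FT a) = pa X a"
    using torsor_mor_ka[OF oa] by (simp_all add: B_simps FT_def)
  fix b assume b: "b \<in> Arr (tot X)" and c: "Cod (tot X) a = Dom (tot X) b"
  have ob: "ov b (pa X b) (Cod (tot X) a) (Cod (tot X) b)" using ov_self[OF b] c by simp
  show "fa FT (b \<cdot> a) = Cmp (tot (B \<Gamma>)) (fa FT b) (fa FT a)"
    using ka_cmp[OF oa ob] ovD[OF ov_cmp[OF ob oa]] by (simp add: B_simps FT_def)
qed

text \<open>Arrows out of \<open>y\<close> correspond to arrows out of the restriction of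
  \<open>x\<close> over \<open>V y\<close> that take the same value on any two arrows identified by
  \<open>\<xi> y\<close>; equivariance of \<open>k\<close> supplies this compatibility.\<close>

lemma full_faithful:
  assumes y: "y \<in> Ob" "y' \<in> Ob" and k: "torsor_mor \<Gamma> (Tor y) k f (Tor y')"
  shows "\<exists>!a. ov a f y y' \<and> ka a = k"
proof -
  have km: "k \<in> maps (V y) (V y')" and f: "f \<in> maps (po' y) (po' y')"
    and kp: "sm_comp (pY y') k = sm_comp f (pY y)" "sm_comp (m y') k = m y"
    and kac: "\<And>v \<gamma>. v \<in> pts (V y) \<Longrightarrow> \<gamma> \<in> pts Am \<Longrightarrow> fn (m y) v = fn s \<gamma> \<Longrightarrow> fn k (ac y v \<gamma>) = ac y' (fn k v) \<gamma>"
    using k unfolding torsor_mor_Tor_iff[OF y] by auto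
  note X1 = VD(2)[OF y(1)] and w = po_w[OF y(1)]
  have z: "ov (xi y' k) (sm_comp f (pY y)) (xr x (m y)) y'" using xi[OF y(2) km] kp by simp
  have "\<exists>!a. ov a f y y' \<and> a \<cdot> \<xi> y = xi y' k"
  proof (rule descend_submersion[OF iso_desc X1 _ f z])
    show "surj_submersion (po' (xr x (m y))) (po' y) (fn (pY y))" using surjV[OF y(1)] w by (simp add: pY_def)
    fix c u v p q assume u: "ov u p c (xr x (m y))" and v: "ov v q c (xr x (m y))" and e: "\<xi> y \<cdot> u = \<xi> y \<cdot> v"
    let ?T = "po' c"
    have p: "p \<in> maps ?T (V y)" and q: "q \<in> maps ?T (V y)" using ovD[OF u] ovD[OF v] w by auto
    note cp = conjunct1[OF cc[OF x VD(1)[OF y(1)] p]] and cq = conjunct1[OF cc[OF x VD(1)[OF y(1)] q]]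
    \<comment> \<open>Both arrows are split into a canonical part, over \<open>p\<close> or
      \<open>q\<close>, and a part over the identity; the points \<open>p\<close> and
      \<open>q\<close> of \<open>V y\<close> are then related by an arrow
      \<open>\<gamma>\<close>.\<close>
    obtain u0 where u0: "ov u0 (sm_id ?T) c (xr x (sm_comp (m y) p))" "cc x p (m y) \<cdot> u0 = u"
      using lift_id[OF cp u] po_xr[OF x mp(1)[OF y(1) p]] by metis
    obtain v0 where v0: "ov v0 (sm_id ?T) c (xr x (sm_comp (m y) q))" "cc x q (m y) \<cdot> v0 = v"
      using lift_id[OF cq v] po_xr[OF x mp(1)[OF y(1) q]] by metis
    have xu: "\<xi> y \<cdot> u = xi y p \<cdot> u0" and xv: "\<xi> y \<cdot> v = xi y q \<cdot> v0"
      using cmp_assoc[OF X1 cp u0(1)] cmp_assoc[OF X1 cq v0(1)] u0 v0 by (auto simp: xi_def)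
    have "sm_comp (pY y) p = sm_comp (pY y) q" using ov_cmp[OF X1 u] ov_cmp[OF X1 v] e by (simp add: over_def)
    then obtain \<gamma> where g: "AcR y ?T p \<gamma> q" using AR_ex_arrow[OF y(1) p q] by blast
    then have gm: "\<gamma> \<in> maps ?T Am" and ge: "sm_comp (m y) p = sm_comp s \<gamma>" "sm_comp (m y) q = sm_comp t \<gamma>" "xi y q \<cdot> th \<gamma> = xi y p"
      by (auto simp: AcR_def[OF y(1)])
    have tg: "ov (th \<gamma>) (sm_id ?T) (xr x (sm_comp (m y) p)) (xr x (sm_comp (m y) q))" using th[OF gm] ge by simp
    have uv: "th \<gamma> \<cdot> u0 = v0"
    proof (rule cancel[OF xi[OF y(1) q]])
      show "ov (th \<gamma> \<cdot> u0) (sm_id ?T) c (xr x (sm_comp (m y) q))"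
        using ov_cmp[OF tg u0(1)] id_id[of ?T] mapsD[OF p] by simp
      show "xi y q \<cdot> th \<gamma> \<cdot> u0 = xi y q \<cdot> v0"
        using cmp_assoc[OF xi[OF y(1) q] tg u0(1)] ge xu xv e by simp
    qed (rule v0)
    have kpq: "sm_comp k p \<in> maps ?T (V y')" "sm_comp k q \<in> maps ?T (V y')" using maps_comp[OF p km] maps_comp[OF q km] by auto
    have r: "AcR y' ?T (sm_comp k p) \<gamma> (sm_comp k q)"
    proof (rule ARI[OF y(2) kpq(1) gm kpq(2)])
      fix z assume z: "z \<in> pts ?T"
      note pz = maps_pts[OF p z]
      have "fn (m y') (fn k (fn p z)) = fn (m y) (fn p z)" using maps_apply[OF km pz, of "m y'"] kp by simp
      then show "fn (m y') (fn (sm_comp k p) z) = fn s (fn \<gamma> z) \<and> fn (sm_comp k q) z = ac y' (fn (sm_comp k p) z) (fn \<gamma> z)"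
        using AR_pointwise[OF y(1) g z] kac[OF pz maps_pts[OF gm z]] maps_apply[OF p z] maps_apply[OF q z] by simp
    qed
    have kn: "xi y' k \<cdot> cc x h (m y) = xi y' (sm_comp k h)" if "h \<in> maps ?T (V y)" for h
      using xi_nat[OF y(2) km that] kp by simp
    have oq: "ov (xi y' (sm_comp k q)) (sm_comp (pY y') (sm_comp k q)) (xr x (sm_comp (m y) q)) y'"
      using xi[OF y(2) kpq(2)] maps_assoc[OF q km VD(1)[OF y(2)]] kp by simp
    have "xi y' k \<cdot> u = xi y' (sm_comp k p) \<cdot> u0" using cmp_assoc[OF z cp u0(1)] u0 kn[OF p] by simp
    also have "\<dots> = xi y' (sm_comp k q) \<cdot> th \<gamma> \<cdot> u0" using r cmp_assoc[OF oq tg u0(1)] by (simp add: AcR_def[OF y(2)])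
    also have "\<dots> = xi y' k \<cdot> v" using uv cmp_assoc[OF z cq v0(1)] v0 kn[OF q] by simp
    finally show "xi y' k \<cdot> u = xi y' k \<cdot> v" .
  qed
  moreover have "ka a = k \<longleftrightarrow> a \<cdot> \<xi> y = xi y' k" if a: "ov a f y y'" for a
    using ka(4)[OF a] ka_unique[OF a km kp(2)] by auto
  ultimately show ?thesis by (metis (no_types, lifting))
qed

end

text \<open>Maps of torsors are bijective on fibres; inverses are smooth because division is.\<close>

lemma (in lie_gpd) torsor_lift:
  fixes e :: "(nat \<Rightarrow> real) \<Rightarrow> 'p"
  assumes e: "inj e" and k: "torsor_mor \<Gamma> P k f R" and l: "torsor_mor \<Gamma> Q l (sm_comp f h) R"
    and h: "h \<in> maps (tgt (tproj Q)) (tgt (tproj P))"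
  shows "\<exists>!c. torsor_mor \<Gamma> Q c h P \<and> sm_comp k c = l"
proof -
  interpret P: lie_torsor \<Gamma> P by unfold_locales (use k in \<open>simp add: torsor_mor_def\<close>)
  interpret R: lie_torsor \<Gamma> R by unfold_locales (use k in \<open>simp add: torsor_mor_def\<close>)
  interpret Q: lie_torsor \<Gamma> Q by unfold_locales (use l in \<open>simp add: torsor_mor_def\<close>)
  have km: "k \<in> maps P.Pm R.Pm" and fm: "f \<in> maps P.Sm R.Sm" and lm: "l \<in> maps Q.Pm R.Pm"
    using k l by (auto simp: torsor_mor_def maps_def)
  have pm: "tproj P \<in> maps P.Pm P.Sm" "tproj R \<in> maps R.Pm R.Sm" "tproj Q \<in> maps Q.Pm Q.Sm"
    "tanch P \<in> maps P.Pm (base \<Gamma>)" "tanch R \<in> maps R.Pm (base \<Gamma>)" "tanch Q \<in> maps Q.Pm (base \<Gamma>)"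
    using P.tor R.tor Q.tor by (auto simp: torsor_def maps_def)
  have ke: "sm_comp (tproj R) k = sm_comp f (tproj P)" "sm_comp (tanch R) k = tanch P"
    "\<And>p \<gamma>. p \<in> pts P.Pm \<Longrightarrow> \<gamma> \<in> pts P.A \<Longrightarrow> P.an p = gs \<Gamma> \<gamma> \<Longrightarrow> fn k (P.act p \<gamma>) = R.act (fn k p) \<gamma>"
    using k by (auto simp: torsor_mor_def)
  have le: "sm_comp (tproj R) l = sm_comp (sm_comp f h) (tproj Q)" "sm_comp (tanch R) l = tanch Q"
    "\<And>p \<gamma>. p \<in> pts Q.Pm \<Longrightarrow> \<gamma> \<in> pts P.A \<Longrightarrow> Q.an p = gs \<Gamma> \<gamma> \<Longrightarrow> fn l (Q.act p \<gamma>) = R.act (fn l p) \<gamma>"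
    using l by (auto simp: torsor_mor_def)
  have kp: "fn k p \<in> pts R.Pm" "R.pr (fn k p) = fn f (P.pr p)" "R.an (fn k p) = P.an p" if "p \<in> pts P.Pm" for p
    using maps_pts[OF km that] maps_apply[OF km that] maps_apply[OF pm(1) that] ke(1,2) by metis+
  have lq: "fn l q \<in> pts R.Pm" "R.pr (fn l q) = fn f (fn h (Q.pr q))" "R.an (fn l q) = Q.an q" if q: "q \<in> pts Q.Pm" for q
    using maps_pts[OF lm q] maps_apply[OF lm q] maps_apply[OF pm(3) q] maps_apply[OF h maps_pts[OF pm(3) q]] le(1,2) by metis+
  have hq: "fn h (Q.pr q) \<in> pts P.Sm" if "q \<in> pts Q.Pm" for q using maps_pts[OF h maps_pts[OF pm(3) that]] .
  \<comment> \<open>From any point \<open>p\<close> of the right fibre, the displacement is computed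
    by division in \<open>R\<close> and carried out in \<open>P\<close>.\<close>
  have solve: "P.act p (R.dv (fn k p) (fn l q)) \<in> pts P.Pm \<and> P.pr (P.act p (R.dv (fn k p) (fn l q))) = fn h (Q.pr q) \<and>
      fn k (P.act p (R.dv (fn k p) (fn l q))) = fn l q \<and> P.an p = gs \<Gamma> (R.dv (fn k p) (fn l q))"
    if p: "p \<in> pts P.Pm" "P.pr p = fn h (Q.pr q)" and q: "q \<in> pts Q.Pm" for p q
  proof -
    have "R.pr (fn k p) = R.pr (fn l q)" using kp[OF p(1)] lq[OF q] p(2) by simp
    from R.dv[OF kp(1)[OF p(1)] lq(1)[OF q] this] show ?thesis
      using P.act_closed[OF p(1), of "R.dv (fn k p) (fn l q)"] ke(3)[OF p(1)] kp(3)[OF p(1)] p(2) by simp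
  qed
  have uniq: "p = p'" if p: "p \<in> pts P.Pm" "p' \<in> pts P.Pm" "P.pr p = P.pr p'" "fn k p = fn k p'" for p p'
  proof -
    note d = P.dv[OF p(1-3)]
    have "R.act (fn k p) (P.dv p p') = fn k p" using ke(3)[OF p(1), of "P.dv p p'"] d p(4) by metis
    then have "P.dv p p' = R.dv (fn k p) (fn k p)" using R.dv_unique[OF kp(1)[OF p(1)]] d kp(3)[OF p(1)] by metis
    moreover have "gu \<Gamma> (P.an p) \<in> pts P.A" "gs \<Gamma> (gu \<Gamma> (P.an p)) = P.an p"
      using smooth_map_pts[OF lie_gu] maps_pts[OF pm(4) p(1)] lie by (auto simp: lie_groupoid_def)
    then have "gu \<Gamma> (P.an p) = R.dv (fn k p) (fn k p)"
      using R.dv_unique[OF kp(1)[OF p(1)], of "gu \<Gamma> (P.an p)"] R.act_unit[OF kp(1)[OF p(1)]] kp(3)[OF p(1)] by simp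
    ultimately show ?thesis using P.act_unit[OF p(1)] d by metis
  qed
  define cf where "cf q = (THE p. p \<in> pts P.Pm \<and> P.pr p = fn h (Q.pr q) \<and> fn k p = fn l q)" for q
  have ex1: "\<exists>!p. p \<in> pts P.Pm \<and> P.pr p = fn h (Q.pr q) \<and> fn k p = fn l q" if q: "q \<in> pts Q.Pm" for q
  proof -
    obtain p0 where p0: "p0 \<in> pts P.Pm" "P.pr p0 = fn h (Q.pr q)" using hq[OF q] P.tor_pr(3) by (metis imageE)
    show ?thesis
      by (rule ex1I[where a = "P.act p0 (R.dv (fn k p0) (fn l q))"]) (use solve[OF p0 q] uniq in auto)
  qed
  have cf: "cf q \<in> pts P.Pm" "P.pr (cf q) = fn h (Q.pr q)" "fn k (cf q) = fn l q" if "q \<in> pts Q.Pm" for q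
    using theI'[OF ex1[OF that]] unfolding cf_def by auto
  have cfeq: "p = cf q" if "q \<in> pts Q.Pm" "p \<in> pts P.Pm" "P.pr p = fn h (Q.pr q)" "fn k p = fn l q" for p q
    using uniq[OF that(2) cf(1)[OF that(1)]] cf[OF that(1)] that by simp
  have smooth: "smooth_map Q.Pm P.Pm cf"
  proof (rule smooth_map_local[OF Q.tor_mfd(1) P.tor_mfd(1)])
    fix q0 assume q0: "q0 \<in> pts Q.Pm"
    \<comment> \<open>Locally the starting point is taken from a section of \<open>P\<close>, so
      that the solution is an expression in smooth maps.\<close>
    obtain U \<sigma> where U: "openin (mtop P.Sm) U" "P.pr (cf q0) \<in> U" and \<sigma>: "smooth_map (open_submfd P.Sm U) P.Pm \<sigma>"
      "\<And>y. y \<in> U \<Longrightarrow> \<sigma> y \<in> pts P.Pm \<and> P.pr (\<sigma> y) = y"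
      by (rule submersion_section[OF P.tor_mfd P.tor_pr(1) cf(1)[OF q0]]) blast
    have hp: "smooth_map Q.Pm P.Sm (\<lambda>q. fn h (Q.pr q))"
      by (rule smooth_map_compose[OF Q.tor_mfd P.tor_mfd(2) Q.tor_pr(2)]) (use mapsD[OF h] in simp)
    let ?W = "{q \<in> pts Q.Pm. fn h (Q.pr q) \<in> U}"
    have oW: "openin (mtop Q.Pm) ?W" by (rule smooth_map_preimage[OF hp U(1)])
    note T = manifold_open_submfd[OF Q.tor_mfd(1) oW] and ptsT = pts_open_submfd[OF oW]
    note MU = manifold_open_submfd[OF P.tor_mfd(2) U(1)]
    let ?T = "open_submfd Q.Pm ?W"
    have "smooth_map ?T (open_submfd P.Sm U) (\<lambda>q. fn h (Q.pr q))"
      by (rule smooth_map_into_open[OF T P.tor_mfd(2) U(1) smooth_map_restrict[OF Q.tor_mfd(1) P.tor_mfd(2) oW hp]])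
         (use ptsT in blast)
    then have s: "smooth_map ?T P.Pm (\<lambda>q. \<sigma> (fn h (Q.pr q)))"
      by (rule smooth_map_compose[OF T MU P.tor_mfd(1) _ \<sigma>(1)])
    have ks: "smooth_map ?T R.Pm (\<lambda>q. fn k (\<sigma> (fn h (Q.pr q))))"
      by (rule smooth_map_compose[OF T P.tor_mfd(1) R.tor_mfd(1) s]) (use mapsD[OF km] in simp)
    have ls: "smooth_map ?T R.Pm (fn l)"
      by (rule smooth_map_restrict[OF Q.tor_mfd(1) R.tor_mfd(1) oW]) (use mapsD[OF lm] in simp)
    have in_W: "q \<in> pts Q.Pm \<and> \<sigma> (fn h (Q.pr q)) \<in> pts P.Pm \<and> P.pr (\<sigma> (fn h (Q.pr q))) = fn h (Q.pr q)" if "q \<in> pts ?T" for q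
    proof -
      have "q \<in> ?W" using that by (simp only: ptsT)
      then show ?thesis using \<sigma>(2) by blast
    qed
    have d: "smooth_map ?T P.A (\<lambda>q. R.dv (fn k (\<sigma> (fn h (Q.pr q)))) (fn l q))"
    proof (rule R.dv_smooth[OF e T ks ls])
      fix q assume "q \<in> pts ?T"
      note i = in_W[OF this]
      show "R.pr (fn k (\<sigma> (fn h (Q.pr q)))) = R.pr (fn l q)"
        using kp(2)[OF conjunct1[OF conjunct2[OF i]]] lq(2)[OF conjunct1[OF i]] i by simp
    qed
    have "smooth_map ?T P.Pm (\<lambda>q. P.act (\<sigma> (fn h (Q.pr q))) (R.dv (fn k (\<sigma> (fn h (Q.pr q)))) (fn l q)))"
    proof (rule P.act_smooth[OF T s d])
      fix q assume "q \<in> pts ?T"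
      note i = in_W[OF this]
      show "P.an (\<sigma> (fn h (Q.pr q))) = gs \<Gamma> (R.dv (fn k (\<sigma> (fn h (Q.pr q)))) (fn l q))"
        using solve[OF conjunct1[OF conjunct2[OF i]] conjunct2[OF conjunct2[OF i]] conjunct1[OF i]] by blast
    qed
    then have "smooth_map ?T P.Pm cf"
    proof (rule smooth_map_cong[OF T P.tor_mfd(1), rotated])
      fix q assume "q \<in> pts ?T"
      note i = in_W[OF this]
      then show "P.act (\<sigma> (fn h (Q.pr q))) (R.dv (fn k (\<sigma> (fn h (Q.pr q)))) (fn l q)) = cf q"
        using solve[of "\<sigma> (fn h (Q.pr q))" q] by (intro cfeq) auto
    qed
    moreover have "q0 \<in> ?W" using q0 U(2) cf(2)[OF q0] by simp
    ultimately show "\<exists>W. openin (mtop Q.Pm) W \<and> q0 \<in> W \<and> smooth_map (open_submfd Q.Pm W) P.Pm cf"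
      using oW by blast
  qed
  define c where "c = mk_smap Q.Pm P.Pm cf"
  have c: "c \<in> maps Q.Pm P.Pm" unfolding c_def by (rule mk_smap_maps[OF Q.tor_mfd(1) P.tor_mfd(1) smooth])
  have cq: "fn c q = cf q" if "q \<in> pts Q.Pm" for q using that by (simp add: c_def)
  have can: "P.an (cf q) = Q.an q" if "q \<in> pts Q.Pm" for q
    using kp(3)[OF cf(1)[OF that]] lq(3)[OF that] cf(3)[OF that] by simp
  have "torsor_mor \<Gamma> Q c h P"
    unfolding torsor_mor_def
  proof (intro conjI ballI impI)
    show "sm_comp (tproj P) c = sm_comp h (tproj Q)"
      by (rule maps_eqI[OF maps_comp[OF c pm(1)] maps_comp[OF pm(3) h]])
         (simp add: maps_apply[OF c] maps_apply[OF pm(3)] cq cf)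
    show "sm_comp (tanch P) c = tanch Q"
      by (rule maps_eqI[OF maps_comp[OF c pm(4)] pm(6)]) (simp add: maps_apply[OF c] cq can)
    fix q \<gamma> assume q: "q \<in> pts Q.Pm" and g: "\<gamma> \<in> pts P.A" "Q.an q = gs \<Gamma> \<gamma>"
    note a = Q.act_closed[OF q g] and b = P.act_closed[OF cf(1)[OF q] g(1)]
    have "P.act (cf q) \<gamma> = cf (Q.act q \<gamma>)"
      by (rule cfeq) (use a b can[OF q] g cf[OF q] ke(3)[OF cf(1)[OF q] g(1)] le(3)[OF q g] in auto)
    then show "fn c (Q.act q \<gamma>) = P.act (fn c q) \<gamma>" using cq q a by simp
  qed (use P.tor Q.tor mapsD[OF c] mapsD[OF h] in auto)
  moreover have "sm_comp k c = l"
    by (rule maps_eqI[OF maps_comp[OF c km] lm]) (simp add: maps_apply[OF c] cq cf)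
  moreover have "c' = c" if c': "torsor_mor \<Gamma> Q c' h P \<and> sm_comp k c' = l" for c'
  proof -
    have m: "c' \<in> maps Q.Pm P.Pm" and e: "sm_comp (tproj P) c' = sm_comp h (tproj Q)"
      using c' by (auto simp: torsor_mor_def maps_def)
    show ?thesis
    proof (rule maps_eqI[OF m c])
      fix q assume q: "q \<in> pts Q.Pm"
      have "P.pr (fn c' q) = fn h (Q.pr q)" "fn k (fn c' q) = fn l q"
        using maps_apply[OF m q] maps_apply[OF pm(3) q] e c' by metis+
      then show "fn c' q = fn c q" using cfeq[OF q maps_pts[OF m q]] cq[OF q] by simp
    qed
  qed
  ultimately show ?thesis by blast
qed

subsection \<open>Every torsor comes from a family\<close>

context vgpd
begin

context
  fixes P assumes P: "torsor \<Gamma> P"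
begin

interpretation P: lie_torsor \<Gamma> P by unfold_locales (rule P)

lemma Pmaps: "tproj P \<in> maps P.Pm P.Sm" "tanch P \<in> maps P.Pm B0"
  using P G by (auto simp: torsor_def maps_def)

text \<open>Division of \<open>T\<close>-points of \<open>P\<close>. By \<open>dv_smooth\<close> it
  is a \<open>T\<close>-point of \<open>Am\<close>, so \<open>th\<close> makes it an isomorphism
  between restrictions of \<open>x\<close>.\<close>

definition "dvm p p' = mk_smap (src p) Am (\<lambda>z. P.dv (fn p z) (fn p' z))"
definition "wP p = xr x (sm_comp (tanch P) p)"

lemma dvm:
  assumes p: "p \<in> maps T P.Pm" "p' \<in> maps T P.Pm" and e: "sm_comp (tproj P) p = sm_comp (tproj P) p'"
  shows "dvm p p' \<in> maps T Am" "sm_comp s (dvm p p') = sm_comp (tanch P) p" "sm_comp t (dvm p p') = sm_comp (tanch P) p'"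
    "\<And>z. z \<in> pts T \<Longrightarrow> fn (dvm p p') z = P.dv (fn p z) (fn p' z) \<and> fn p z \<in> tpts P \<and> fn p' z \<in> tpts P \<and> P.pr (fn p z) = P.pr (fn p' z)"
proof -
  have T: "manifold T" "src p = T" "smooth_map T P.Pm (fn p)" "smooth_map T P.Pm (fn p')" using mapsD[OF p(1)] mapsD[OF p(2)] by auto
  have pw: "fn p z \<in> tpts P \<and> fn p' z \<in> tpts P \<and> P.pr (fn p z) = P.pr (fn p' z)" if z: "z \<in> pts T" for z
    using maps_pts[OF p(1) z] maps_pts[OF p(2) z] maps_apply[OF p(1) z, of "tproj P"] maps_apply[OF p(2) z, of "tproj P"] e by simp
  have "smooth_map T P.A (\<lambda>z. P.dv (fn p z) (fn p' z))"
    by (rule P.dv_smooth[OF inj_e T(1,3,4)]) (use pw in blast)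
  then show d: "dvm p p' \<in> maps T Am" unfolding dvm_def T(2) G by (rule mk_smap_maps[OF T(1) Am(1)])
  show ap: "fn (dvm p p') z = P.dv (fn p z) (fn p' z) \<and> fn p z \<in> tpts P \<and> fn p' z \<in> tpts P \<and> P.pr (fn p z) = P.pr (fn p' z)" if "z \<in> pts T" for z
    using that pw T(2) by (simp add: dvm_def)
  note q = maps_comp[OF p(1) Pmaps(2)] maps_comp[OF p(2) Pmaps(2)]
  have dp: "fn s (fn (dvm p p') z) = P.an (fn p z) \<and> fn t (fn (dvm p p') z) = P.an (fn p' z)" if z: "z \<in> pts T" for z
    using P.dv[of "fn p z" "fn p' z"] ap[OF z] gsG gtG G by metis
  show "sm_comp s (dvm p p') = sm_comp (tanch P) p"
    by (rule maps_eqI[OF st(1)[OF d] q(1)]) (simp add: maps_apply[OF d] maps_apply[OF p(1)] dp)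
  show "sm_comp t (dvm p p') = sm_comp (tanch P) p'"
    by (rule maps_eqI[OF st(2)[OF d] q(2)]) (simp add: maps_apply[OF d] maps_apply[OF p(2)] dp)
qed

lemma po_wP: "p \<in> maps T P.Pm \<Longrightarrow> po' (wP p) = T \<and> wP p \<in> Ob"
  unfolding wP_def by (rule po_xr[OF x maps_comp[OF _ Pmaps(2)]])

lemma th_dvm: "p \<in> maps T P.Pm \<Longrightarrow> p' \<in> maps T P.Pm \<Longrightarrow> sm_comp (tproj P) p = sm_comp (tproj P) p' \<Longrightarrow>
    ov (th (dvm p p')) (sm_id T) (wP p) (wP p')"
  using th[OF dvm(1)] dvm(2,3) by (simp add: wP_def)

text \<open>Division is multiplicative at each point, and products of points control composites of
  families.\<close>

lemma dvm_cocycle: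
  assumes p: "p \<in> maps T P.Pm" "p' \<in> maps T P.Pm" "p'' \<in> maps T P.Pm"
    and e: "sm_comp (tproj P) p = sm_comp (tproj P) p'" "sm_comp (tproj P) p' = sm_comp (tproj P) p''"
  shows "th (dvm p' p'') \<cdot> th (dvm p p') = th (dvm p p'')"
proof -
  have e': "sm_comp (tproj P) p = sm_comp (tproj P) p''" using e by simp
  note d = dvm[OF p(1,2) e(1)] and d' = dvm[OF p(2,3) e(2)] and d'' = dvm[OF p(1,3) e']
  have c: "sm_comp t (dvm p p') = sm_comp s (dvm p' p'')" using d d' by simp
  have "th (dvm p p'') = th (dvm p' p'') \<cdot> th (dvm p p')"
  proof (rule conjunct2[OF conjunct2[OF cmp_pointwise_conv[OF d(1) d'(1) d''(1) c]]])
    fix z assume z: "z \<in> pts T"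
    note a = d(4)[OF z] and a' = d'(4)[OF z] and a'' = d''(4)[OF z]
    let ?u = "P.dv (fn p z) (fn p' z)" and ?v = "P.dv (fn p' z) (fn p'' z)"
    have v: "?u \<in> pts P.A" "gs \<Gamma> ?u = P.an (fn p z)" "gt \<Gamma> ?u = P.an (fn p' z)" "P.act (fn p z) ?u = fn p' z"
      "?v \<in> pts P.A" "gs \<Gamma> ?v = P.an (fn p' z)" "P.act (fn p' z) ?v = fn p'' z"
      using P.dv[of "fn p z" "fn p' z"] P.dv[of "fn p' z" "fn p'' z"] a a' by auto
    have c: "gt \<Gamma> ?u = gs \<Gamma> ?v" using v by simp
    have g: "gm \<Gamma> ?u ?v \<in> pts P.A" "gs \<Gamma> (gm \<Gamma> ?u ?v) = P.an (fn p z)" using gm_closed[OF v(1,5) c] v(2) by auto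
    have "P.act (fn p z) (gm \<Gamma> ?u ?v) = fn p'' z" using P.act_assoc[of "fn p z" ?u ?v] a v c by simp
    then have "P.dv (fn p z) (fn p'' z) = gm \<Gamma> ?u ?v" using P.dv_unique[of "fn p z" "gm \<Gamma> ?u ?v"] g a by simp
    then show "fn (dvm p p'') z = gmp (fn (dvm p p') z) (fn (dvm p' p'') z)"
      using a a' a'' gmG[of ?u ?v] gsG[of ?v] gtG[of ?u] v c G by simp
  qed
  then show ?thesis by simp
qed

lemma dvm_nat:
  assumes p: "p \<in> maps T P.Pm" "p' \<in> maps T P.Pm" and e: "sm_comp (tproj P) p = sm_comp (tproj P) p'" and h: "h \<in> maps T' T"
  shows "th (dvm p p') \<cdot> cc x h (sm_comp (tanch P) p) = cc x h (sm_comp (tanch P) p') \<cdot> th (dvm (sm_comp p h) (sm_comp p' h))"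
proof -
  note d = dvm[OF p e]
  have ph: "sm_comp p h \<in> maps T' P.Pm" "sm_comp p' h \<in> maps T' P.Pm" using maps_comp[OF h] p by auto
  have e': "sm_comp (tproj P) (sm_comp p h) = sm_comp (tproj P) (sm_comp p' h)"
    using maps_assoc[OF h p(1) Pmaps(1)] maps_assoc[OF h p(2) Pmaps(1)] e by simp
  note d' = dvm[OF ph e']
  have "sm_comp (dvm p p') h = dvm (sm_comp p h) (sm_comp p' h)"
    by (rule maps_eqI[OF maps_comp[OF h d(1)] d'(1)])
       (simp add: maps_apply[OF h] d'(4) d(4)[OF maps_pts[OF h]])
  then show ?thesis using th_nat[OF d(1) h] d by simp
qed

text \<open>By the cocycle identity this isomorphism is idempotent.\<close>

lemma dvm_self:
  assumes p: "p \<in> maps T P.Pm" shows "th (dvm p p) = ide (wP p)"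
proof -
  note o = th_dvm[OF p p refl]
  show ?thesis
    by (rule cancel[OF o o]) (use ov_ide[of "wP p"] po_wP[OF p] dvm_cocycle[OF p p p refl refl] ide_right[OF o] in auto)
qed

text \<open>
  The restrictions of \<open>x\<close> along the anchors of local points of \<open>P\<close> form a functor: for local points
  \<open>\<sigma>\<close>, \<open>\<tau>\<close> of \<open>P\<close> and \<open>h\<close> with \<open>\<sigma>\<close>, \<open>\<tau> h\<close> in the same fibres, division gives an arrow over \<open>h\<close>.
\<close>

definition "JJ T \<sigma> h T' \<tau> \<longleftrightarrow> \<sigma> \<in> maps T P.Pm \<and> h \<in> maps T T' \<and> \<tau> \<in> maps T' P.Pm \<and>
  sm_comp (tproj P) \<sigma> = sm_comp (tproj P) (sm_comp \<tau> h)"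

definition "J \<sigma> h \<tau> = cc x h (sm_comp (tanch P) \<tau>) \<cdot> th (dvm \<sigma> (sm_comp \<tau> h))"

lemma JJ_self: "\<tau> \<in> maps T' P.Pm \<Longrightarrow> h \<in> maps T T' \<Longrightarrow> JJ T (sm_comp \<tau> h) h T' \<tau>"
  using maps_comp by (auto simp: JJ_def)

lemma J_parts:
  assumes "JJ T \<sigma> h T' \<tau>"
  shows "ov (cc x h (sm_comp (tanch P) \<tau>)) h (wP (sm_comp \<tau> h)) (wP \<tau>)"
    "ov (th (dvm \<sigma> (sm_comp \<tau> h))) (sm_id T) (wP \<sigma>) (wP (sm_comp \<tau> h))"
    "ov (J \<sigma> h \<tau>) h (wP \<sigma>) (wP \<tau>)"
proof -
  have a: "\<sigma> \<in> maps T P.Pm" "h \<in> maps T T'" "\<tau> \<in> maps T' P.Pm" "sm_comp (tproj P) \<sigma> = sm_comp (tproj P) (sm_comp \<tau> h)"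
    using assms by (auto simp: JJ_def)
  show c: "ov (cc x h (sm_comp (tanch P) \<tau>)) h (wP (sm_comp \<tau> h)) (wP \<tau>)"
    using conjunct1[OF cc[OF x maps_comp[OF a(3) Pmaps(2)] a(2)]] maps_assoc[OF a(2,3) Pmaps(2)] by (simp add: wP_def)
  show d: "ov (th (dvm \<sigma> (sm_comp \<tau> h))) (sm_id T) (wP \<sigma>) (wP (sm_comp \<tau> h))"
    by (rule th_dvm[OF a(1) maps_comp[OF a(2,3)] a(4)])
  show "ov (J \<sigma> h \<tau>) h (wP \<sigma>) (wP \<tau>)"
    unfolding J_def using ov_cmp[OF c d] maps_id_right[OF a(2)] by simp
qed

text \<open>The cocycle identity combined with naturality of division under restriction. It carries
  the cocycle checks that follow.\<close>

lemma J_cmp: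
  assumes j: "JJ T \<sigma> h T' \<tau>" and j': "JJ T' \<tau> k T'' \<rho>"
  shows "JJ T \<sigma> (sm_comp k h) T'' \<rho>" "J \<tau> k \<rho> \<cdot> J \<sigma> h \<tau> = J \<sigma> (sm_comp k h) \<rho>"
proof -
  have a: "\<sigma> \<in> maps T P.Pm" "h \<in> maps T T'" "\<tau> \<in> maps T' P.Pm" "sm_comp (tproj P) \<sigma> = sm_comp (tproj P) (sm_comp \<tau> h)"
    and b: "k \<in> maps T' T''" "\<rho> \<in> maps T'' P.Pm" "sm_comp (tproj P) \<tau> = sm_comp (tproj P) (sm_comp \<rho> k)"
    using j j' by (auto simp: JJ_def)
  note rk = maps_comp[OF b(1,2)] and th = maps_comp[OF a(2,3)]
  have rkh: "sm_comp (sm_comp \<rho> k) h = sm_comp \<rho> (sm_comp k h)" using maps_assoc[OF a(2) b(1,2)] by simp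
  have e: "sm_comp (tproj P) (sm_comp \<tau> h) = sm_comp (tproj P) (sm_comp \<rho> (sm_comp k h))"
    using maps_assoc[OF a(2,3) Pmaps(1)] maps_assoc[OF a(2) rk Pmaps(1)] b(3) rkh by simp
  show jj: "JJ T \<sigma> (sm_comp k h) T'' \<rho>" using a b e maps_comp[OF a(2) b(1)] by (simp add: JJ_def)
  note p = J_parts[OF j] and q = J_parts[OF j'] and r = J_parts[OF jj]
  note rkhm = maps_comp[OF maps_comp[OF a(2) b(1)] b(2)]
  have o1: "ov (cc x h (sm_comp (tanch P) (sm_comp \<rho> k))) h (wP (sm_comp \<rho> (sm_comp k h))) (wP (sm_comp \<rho> k))"
    using J_parts(1)[OF JJ_self[OF rk a(2)]] rkh by simp
  have o2: "ov (th (dvm (sm_comp \<tau> h) (sm_comp \<rho> (sm_comp k h)))) (sm_id T) (wP (sm_comp \<tau> h)) (wP (sm_comp \<rho> (sm_comp k h)))"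
    by (rule th_dvm[OF th rkhm e])
  have "J \<tau> k \<rho> \<cdot> J \<sigma> h \<tau> = cc x k (sm_comp (tanch P) \<rho>) \<cdot> (th (dvm \<tau> (sm_comp \<rho> k)) \<cdot> cc x h (sm_comp (tanch P) \<tau>)) \<cdot> th (dvm \<sigma> (sm_comp \<tau> h))"
    unfolding J_def[of \<tau> k] using cmp_assoc[OF q(1,2) p(3)] cmp_assoc[OF q(2) p(1,2)] by (simp add: J_def)
  also have "\<dots> = cc x k (sm_comp (tanch P) \<rho>) \<cdot> (cc x h (sm_comp (tanch P) (sm_comp \<rho> k)) \<cdot>
      th (dvm (sm_comp \<tau> h) (sm_comp \<rho> (sm_comp k h)))) \<cdot> th (dvm \<sigma> (sm_comp \<tau> h))"
    using dvm_nat[OF a(3) rk b(3) a(2)] rkh by simp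
  also have "\<dots> = cc x k (sm_comp (tanch P) \<rho>) \<cdot> cc x h (sm_comp (tanch P) (sm_comp \<rho> k)) \<cdot> th (dvm \<sigma> (sm_comp \<rho> (sm_comp k h)))"
    using cmp_assoc[OF o1 o2 p(2)] dvm_cocycle[OF a(1) th rkhm a(4) e] by simp
  also have "\<dots> = cc x (sm_comp k h) (sm_comp (tanch P) \<rho>) \<cdot> th (dvm \<sigma> (sm_comp \<rho> (sm_comp k h)))"
    using cmp_assoc[OF q(1) o1 r(2)] cc_comp[OF x maps_comp[OF b(2) Pmaps(2)] b(1) a(2)]
      maps_assoc[OF b(1,2) Pmaps(2)] by simp
  finally show "J \<tau> k \<rho> \<cdot> J \<sigma> h \<tau> = J \<sigma> (sm_comp k h) \<rho>" by (simp add: J_def)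
qed

text \<open>Descent conditions speak of arbitrary arrows into the local pieces; writing each as a
  \<open>J\<close> preceded by an arrow over the identity reduces them to
  \<open>J_cmp\<close>.\<close>

lemma J_factor:
  assumes \<tau>: "\<tau> \<in> maps T' P.Pm" and u: "ov u h z (wP \<tau>)"
  obtains u0 where "h \<in> maps (po' z) T'" "JJ (po' z) (sm_comp \<tau> h) h T' \<tau>"
    "ov u0 (sm_id (po' z)) z (wP (sm_comp \<tau> h))" "J (sm_comp \<tau> h) h \<tau> \<cdot> u0 = u"
proof -
  have h: "h \<in> maps (po' z) T'" using ovD[OF u] po_wP[OF \<tau>] by simp
  note j = JJ_self[OF \<tau> h]
  show ?thesis
    using lift_id[OF J_parts(3)[OF j] u] po_wP[OF maps_comp[OF h \<tau>]] that[OF h j] by metis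
qed

section \<open>The descent datum of a torsor\<close>

context
  fixes C \<sigma> pp qq
  assumes C: "covering P.Sm C" and \<sigma>: "\<forall>f\<in>C. \<sigma> f \<in> maps (src f) P.Pm \<and> sm_comp (tproj P) (\<sigma> f) = f"
    and pb: "\<forall>f\<in>C. \<forall>g\<in>C. pullback_square f g (pp f g) (qq f g)"
begin

lemma pb_JJ:
  assumes f: "f \<in> C" and g: "g \<in> C"
  shows "JJ (src (pp f g)) (sm_comp (\<sigma> f) (pp f g)) (pp f g) (src f) (\<sigma> f)"
    "JJ (src (pp f g)) (sm_comp (\<sigma> g) (qq f g)) (qq f g) (src g) (\<sigma> g)"
    "JJ (src (pp f g)) (sm_comp (\<sigma> f) (pp f g)) (sm_id (src (pp f g))) (src (pp f g)) (sm_comp (\<sigma> g) (qq f g))"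
    "JJ (src (pp f g)) (sm_comp (\<sigma> f) (pp f g)) (qq f g) (src g) (\<sigma> g)"
proof -
  note sf = bspec[OF \<sigma> f] and sg = bspec[OF \<sigma> g]
  have p: "pp f g \<in> maps (src (pp f g)) (src f)" and q: "qq f g \<in> maps (src (pp f g)) (src g)"
    and e: "sm_comp f (pp f g) = sm_comp g (qq f g)"
    using pb f g by (auto simp: pullback_square_def maps_def)
  note p' = maps_comp[OF p conjunct1[OF sf]] and q' = maps_comp[OF q conjunct1[OF sg]]
  have e': "sm_comp (tproj P) (sm_comp (\<sigma> f) (pp f g)) = sm_comp (tproj P) (sm_comp (\<sigma> g) (qq f g))"
    using maps_assoc[OF p conjunct1[OF sf] Pmaps(1)] maps_assoc[OF q conjunct1[OF sg] Pmaps(1)] sf sg e by simp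
  show "JJ (src (pp f g)) (sm_comp (\<sigma> f) (pp f g)) (pp f g) (src f) (\<sigma> f)"
    "JJ (src (pp f g)) (sm_comp (\<sigma> g) (qq f g)) (qq f g) (src g) (\<sigma> g)"
    using JJ_self p q sf sg by auto
  show "JJ (src (pp f g)) (sm_comp (\<sigma> f) (pp f g)) (sm_id (src (pp f g))) (src (pp f g)) (sm_comp (\<sigma> g) (qq f g))"
    "JJ (src (pp f g)) (sm_comp (\<sigma> f) (pp f g)) (qq f g) (src g) (\<sigma> g)"
    using p q p' q' e' maps_id[of "src (pp f g)"] mapsD[OF p] maps_id_right[OF q'] sg by (auto simp: JJ_def)
qed

text \<open>The transition isomorphism on an overlap is division of the two local sections. The
  cocycle condition becomes functoriality of \<open>J\<close> once \<open>u\<close>,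
  \<open>v\<close> and \<open>w\<close> are traced back to common local points of
  \<open>P\<close>.\<close>

lemma datum: "descent_datum X C (\<lambda>f. wP (\<sigma> f)) pp qq
   (\<lambda>f g. wP (sm_comp (\<sigma> f) (pp f g))) (\<lambda>f g. wP (sm_comp (\<sigma> g) (qq f g)))
   (\<lambda>f g. J (sm_comp (\<sigma> f) (pp f g)) (pp f g) (\<sigma> f)) (\<lambda>f g. J (sm_comp (\<sigma> g) (qq f g)) (qq f g) (\<sigma> g))
   (\<lambda>f g. J (sm_comp (\<sigma> f) (pp f g)) (sm_id (src (pp f g))) (sm_comp (\<sigma> g) (qq f g)))"
  unfolding descent_datum_def
proof (intro conjI ballI allI impI)
  show "wP (\<sigma> f) \<in> Ob" "po' (wP (\<sigma> f)) = src f" if "f \<in> C" for f using po_wP[of "\<sigma> f"] \<sigma> that by auto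
  fix f g assume f: "f \<in> C" and g: "g \<in> C"
  note j = pb_JJ[OF f g]
  show "pullback_square f g (pp f g) (qq f g)" using pb f g by blast
  show "ov (J (sm_comp (\<sigma> f) (pp f g)) (pp f g) (\<sigma> f)) (pp f g) (wP (sm_comp (\<sigma> f) (pp f g))) (wP (\<sigma> f))"
    "ov (J (sm_comp (\<sigma> g) (qq f g)) (qq f g) (\<sigma> g)) (qq f g) (wP (sm_comp (\<sigma> g) (qq f g))) (wP (\<sigma> g))"
    "ov (J (sm_comp (\<sigma> f) (pp f g)) (sm_id (src (pp f g))) (sm_comp (\<sigma> g) (qq f g))) (sm_id (src (pp f g)))
      (wP (sm_comp (\<sigma> f) (pp f g))) (wP (sm_comp (\<sigma> g) (qq f g)))"
    using J_parts(3)[OF j(1)] J_parts(3)[OF j(2)] J_parts(3)[OF j(3)] .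
  have bphi: "J (sm_comp (\<sigma> g) (qq f g)) (qq f g) (\<sigma> g) \<cdot> J (sm_comp (\<sigma> f) (pp f g)) (sm_id (src (pp f g))) (sm_comp (\<sigma> g) (qq f g)) \<cdot> u =
      J (sm_comp (\<sigma> f) (pp f g)) (qq f g) (\<sigma> g) \<cdot> u" if "f \<in> C" "g \<in> C" "ov u k z (wP (sm_comp (\<sigma> f) (pp f g)))" for f g u k z
  proof -
    note j = pb_JJ[OF that(1,2)]
    have "qq f g \<in> maps (src (pp f g)) (src g)" using j(2) by (simp add: JJ_def)
    then show ?thesis using J_cmp(2)[OF j(3,2)] cmp_assoc[OF J_parts(3)[OF j(2)] J_parts(3)[OF j(3)] that(3)] maps_id_right by metis
  qed
  fix h z u v w assume h: "h \<in> C" and a: "ov u (pa X u) z (wP (sm_comp (\<sigma> f) (pp f g))) \<and> ov v (pa X v) z (wP (sm_comp (\<sigma> g) (pp g h))) \<and>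
      ov w (pa X w) z (wP (sm_comp (\<sigma> f) (pp f h))) \<and>
      J (sm_comp (\<sigma> f) (pp f g)) (pp f g) (\<sigma> f) \<cdot> u = J (sm_comp (\<sigma> f) (pp f h)) (pp f h) (\<sigma> f) \<cdot> w \<and>
      J (sm_comp (\<sigma> g) (qq f g)) (qq f g) (\<sigma> g) \<cdot> J (sm_comp (\<sigma> f) (pp f g)) (sm_id (src (pp f g))) (sm_comp (\<sigma> g) (qq f g)) \<cdot> u =
        J (sm_comp (\<sigma> g) (pp g h)) (pp g h) (\<sigma> g) \<cdot> v \<and>
      sm_comp (qq g h) (pa X v) = sm_comp (qq f h) (pa X w)"
  define u' v' w' where "u' = pa X u" "v' = pa X v" "w' = pa X w"
  have u: "ov u u' z (wP (sm_comp (\<sigma> f) (pp f g)))" and v: "ov v v' z (wP (sm_comp (\<sigma> g) (pp g h)))"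
    and w: "ov w w' z (wP (sm_comp (\<sigma> f) (pp f h)))"
    and e: "J (sm_comp (\<sigma> f) (pp f g)) (pp f g) (\<sigma> f) \<cdot> u = J (sm_comp (\<sigma> f) (pp f h)) (pp f h) (\<sigma> f) \<cdot> w"
      "J (sm_comp (\<sigma> f) (pp f g)) (qq f g) (\<sigma> g) \<cdot> u = J (sm_comp (\<sigma> g) (pp g h)) (pp g h) (\<sigma> g) \<cdot> v"
      "sm_comp (qq g h) v' = sm_comp (qq f h) w'"
    using a bphi[OF f g] unfolding u'_v'_w'_def by auto
  note jgh = pb_JJ[OF g h] and jfh = pb_JJ[OF f h]
  have mm: "sm_comp (\<sigma> f) (pp f g) \<in> maps (src (pp f g)) P.Pm" "sm_comp (\<sigma> g) (pp g h) \<in> maps (src (pp g h)) P.Pm"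
    "sm_comp (\<sigma> f) (pp f h) \<in> maps (src (pp f h)) P.Pm" "pp f g \<in> maps (src (pp f g)) (src f)"
    "pp f h \<in> maps (src (pp f h)) (src f)" "pp g h \<in> maps (src (pp g h)) (src g)"
    "\<sigma> f \<in> maps (src f) P.Pm" "\<sigma> g \<in> maps (src g) P.Pm"
    using j(1) jgh(1) jfh(1) by (auto simp: JJ_def)
  let ?T = "po' z"
  \<comment> \<open>\<open>al\<close>, and \<open>be\<close> below, are local points of
    \<open>P\<close> over the base of \<open>z\<close>, obtained from the sections for
    \<open>f\<close> and \<open>g\<close>.\<close>
  define al where "al = sm_comp (\<sigma> f) (sm_comp (pp f g) u')"
  obtain u0 where u0: "u' \<in> maps ?T (src (pp f g))" "JJ ?T (sm_comp (sm_comp (\<sigma> f) (pp f g)) u') u' (src (pp f g)) (sm_comp (\<sigma> f) (pp f g))"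
    "ov u0 (sm_id ?T) z (wP (sm_comp (sm_comp (\<sigma> f) (pp f g)) u'))" "J (sm_comp (sm_comp (\<sigma> f) (pp f g)) u') u' (sm_comp (\<sigma> f) (pp f g)) \<cdot> u0 = u"
    by (rule J_factor[OF mm(1) u])
  obtain v0 where v0: "v' \<in> maps ?T (src (pp g h))" "JJ ?T (sm_comp (sm_comp (\<sigma> g) (pp g h)) v') v' (src (pp g h)) (sm_comp (\<sigma> g) (pp g h))"
    "ov v0 (sm_id ?T) z (wP (sm_comp (sm_comp (\<sigma> g) (pp g h)) v'))" "J (sm_comp (sm_comp (\<sigma> g) (pp g h)) v') v' (sm_comp (\<sigma> g) (pp g h)) \<cdot> v0 = v"
    by (rule J_factor[OF mm(2) v])
  obtain w0 where w0: "w' \<in> maps ?T (src (pp f h))" "JJ ?T (sm_comp (sm_comp (\<sigma> f) (pp f h)) w') w' (src (pp f h)) (sm_comp (\<sigma> f) (pp f h))"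
    "ov w0 (sm_id ?T) z (wP (sm_comp (sm_comp (\<sigma> f) (pp f h)) w'))" "J (sm_comp (sm_comp (\<sigma> f) (pp f h)) w') w' (sm_comp (\<sigma> f) (pp f h)) \<cdot> w0 = w"
    by (rule J_factor[OF mm(3) w])
  have base: "sm_comp (pp f g) u' = sm_comp (pp f h) w'" "sm_comp (qq f g) u' = sm_comp (pp g h) v'"
    using ov_cmp[OF J_parts(3)[OF j(1)] u] ov_cmp[OF J_parts(3)[OF jfh(1)] w] e(1)
      ov_cmp[OF J_parts(3)[OF j(4)] u] ov_cmp[OF J_parts(3)[OF jgh(1)] v] e(2) by (simp_all add: over_def)
  have A: "sm_comp (sm_comp (\<sigma> f) (pp f g)) u' = al" "sm_comp (sm_comp (\<sigma> f) (pp f h)) w' = al"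
    using maps_assoc[OF u0(1) mm(4,7)] maps_assoc[OF w0(1) mm(5,7)] base by (auto simp: al_def)
  define be where "be = sm_comp (\<sigma> g) (sm_comp (pp g h) v')"
  have A': "sm_comp (sm_comp (\<sigma> g) (pp g h)) v' = be" using maps_assoc[OF v0(1) mm(6,8)] by (simp add: be_def)
  note u0 = u0[unfolded A] and v0 = v0[unfolded A'] and w0 = w0[unfolded A]
  note Ju = J_parts(3)[OF u0(2)] and Jv = J_parts(3)[OF v0(2)] and Jw = J_parts(3)[OF w0(2)]
  have E: "J \<tau> k \<tau>' \<cdot> u = J al (sm_comp k u') \<tau>' \<cdot> u0" if "JJ T \<tau> k T' \<tau>'" "\<tau> = sm_comp (\<sigma> f) (pp f g)" "T = src (pp f g)" for T \<tau> k T' \<tau>'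
    using cmp_assoc[OF J_parts(3)[OF that(1)[unfolded that(2,3)]] Ju u0(3)] J_cmp(2)[OF u0(2) that(1)[unfolded that(2,3)]] u0(4) that(2) by simp
  have E': "J \<tau> k \<tau>' \<cdot> v = J be (sm_comp k v') \<tau>' \<cdot> v0" if "JJ T \<tau> k T' \<tau>'" "\<tau> = sm_comp (\<sigma> g) (pp g h)" "T = src (pp g h)" for T \<tau> k T' \<tau>'
    using cmp_assoc[OF J_parts(3)[OF that(1)[unfolded that(2,3)]] Jv v0(3)] J_cmp(2)[OF v0(2) that(1)[unfolded that(2,3)]] v0(4) that(2) by simp
  have E'': "J \<tau> k \<tau>' \<cdot> w = J al (sm_comp k w') \<tau>' \<cdot> w0" if "JJ T \<tau> k T' \<tau>'" "\<tau> = sm_comp (\<sigma> f) (pp f h)" "T = src (pp f h)" for T \<tau> k T' \<tau>'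
    using cmp_assoc[OF J_parts(3)[OF that(1)[unfolded that(2,3)]] Jw w0(3)] J_cmp(2)[OF w0(2) that(1)[unfolded that(2,3)]] w0(4) that(2) by simp
  \<comment> \<open>Freed of their canonical parts, the hypotheses of the cocycle condition say that
    \<open>u0 = w0\<close> and that \<open>v0\<close> is \<open>u0\<close> followed by the
    transition from \<open>al\<close> to \<open>be\<close>.\<close>
  have uw: "u0 = w0"
    by (rule cancel[OF J_parts(3)[OF J_cmp(1)[OF u0(2) j(1)]] u0(3) w0(3)])
       (use E[OF j(1)] E''[OF jfh(1)] e(1) base in simp)
  have be: "be \<in> maps ?T P.Pm" and al: "al \<in> maps ?T P.Pm" using u0(2) v0(2) by (auto simp: JJ_def)
  have idT: "sm_id ?T \<in> maps ?T ?T" using maps_id mapsD[OF al] by blast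
  note j1 = J_cmp(1)[OF u0(2) j(4)] and j2 = J_cmp(1)[OF v0(2) jgh(1)]
  have jab: "JJ ?T al (sm_id ?T) ?T be"
    using j1 al be idT maps_id_right[OF be] base(2) by (simp add: JJ_def be_def)
  have bm: "sm_comp (pp g h) v' \<in> maps ?T (src g)" using maps_comp[OF v0(1) mm(6)] .
  have o: "ov (J al (sm_id ?T) be \<cdot> u0) (sm_id ?T) z (wP be)"
    using ov_cmp[OF J_parts(3)[OF jab] u0(3)] maps_id_left[OF idT] by simp
  have vu: "v0 = J al (sm_id ?T) be \<cdot> u0"
  proof (rule cancel[OF J_parts(3)[OF j2] v0(3) o])
    have "J be (sm_comp (pp g h) v') (\<sigma> g) \<cdot> v0 = J al (sm_comp (qq f g) u') (\<sigma> g) \<cdot> u0"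
      using E[OF j(4)] E'[OF jgh(1)] e(2) by simp
    also have "\<dots> = J be (sm_comp (pp g h) v') (\<sigma> g) \<cdot> J al (sm_id ?T) be \<cdot> u0"
      using J_cmp(2)[OF jab j2] cmp_assoc[OF J_parts(3)[OF j2] J_parts(3)[OF jab] u0(3)] base(2) maps_id_right[OF bm] by simp
    finally show "J be (sm_comp (pp g h) v') (\<sigma> g) \<cdot> v0 = J be (sm_comp (pp g h) v') (\<sigma> g) \<cdot> J al (sm_id ?T) be \<cdot> u0" .
  qed
  note j3 = J_cmp(1)[OF v0(2) jgh(4)]
  have qm: "sm_comp (qq g h) v' \<in> maps ?T (src h)" using j3 by (simp add: JJ_def)
  have "J (sm_comp (\<sigma> g) (pp g h)) (qq g h) (\<sigma> h) \<cdot> v = J be (sm_comp (qq g h) v') (\<sigma> h) \<cdot> J al (sm_id ?T) be \<cdot> u0"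
    using E'[OF jgh(4)] vu by simp
  also have "\<dots> = J al (sm_comp (qq g h) v') (\<sigma> h) \<cdot> u0"
    using J_cmp(2)[OF jab j3] cmp_assoc[OF J_parts(3)[OF j3] J_parts(3)[OF jab] u0(3)] maps_id_right[OF qm] by simp
  also have "\<dots> = J (sm_comp (\<sigma> f) (pp f h)) (qq f h) (\<sigma> h) \<cdot> w" using E''[OF jfh(4)] uw e(3) by simp
  finally show "J (sm_comp (\<sigma> h) (qq g h)) (qq g h) (\<sigma> h) \<cdot> J (sm_comp (\<sigma> g) (pp g h)) (sm_id (src (pp g h))) (sm_comp (\<sigma> h) (qq g h)) \<cdot> v =
      J (sm_comp (\<sigma> h) (qq f h)) (qq f h) (\<sigma> h) \<cdot> J (sm_comp (\<sigma> f) (pp f h)) (sm_id (src (pp f h))) (sm_comp (\<sigma> h) (qq f h)) \<cdot> w"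
    using bphi[OF g h v] bphi[OF f h w] by simp
qed

text \<open>Restates the gluing identities without the chosen overlaps: two routes from the same
  local point of \<open>P\<close> through different pieces give the same arrow to \<open>y\<close>.
  The universal property of the pullback square supplies the map to the overlap.\<close>

lemma descended:
  obtains y ee where "y \<in> Ob" "po' y = P.Sm" "\<forall>f\<in>C. ov (ee f) f (wP (\<sigma> f)) y"
    "\<forall>f\<in>C. \<forall>g\<in>C. \<forall>T p h h'. JJ T p h (src f) (\<sigma> f) \<and> JJ T p h' (src g) (\<sigma> g) \<longrightarrow> ee f \<cdot> J p h (\<sigma> f) = ee g \<cdot> J p h' (\<sigma> g)"
proof -
  obtain y ee where y: "y \<in> Ob" "po' y = P.Sm" and ee: "\<forall>f\<in>C. ov (ee f) f (wP (\<sigma> f)) y"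
    and c: "\<forall>f\<in>C. \<forall>g\<in>C. ee f \<cdot> J (sm_comp (\<sigma> f) (pp f g)) (pp f g) (\<sigma> f) =
      ee g \<cdot> J (sm_comp (\<sigma> g) (qq f g)) (qq f g) (\<sigma> g) \<cdot> J (sm_comp (\<sigma> f) (pp f g)) (sm_id (src (pp f g))) (sm_comp (\<sigma> g) (qq f g))"
    using obj_desc[unfolded obj_descent_def, rule_format, OF conjI[OF C datum]] by blast
  have "ee f \<cdot> J p h (\<sigma> f) = ee g \<cdot> J p h' (\<sigma> g)"
    if f: "f \<in> C" and g: "g \<in> C" and a: "JJ T p h (src f) (\<sigma> f)" and b: "JJ T p h' (src g) (\<sigma> g)" for f g T p h h'
  proof -
    note j = pb_JJ[OF f g] and sf = bspec[OF \<sigma> f] and sg = bspec[OF \<sigma> g]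
    have hm: "h \<in> maps T (src f)" "h' \<in> maps T (src g)" and pm: "p \<in> maps T P.Pm"
      and e1: "sm_comp (tproj P) p = sm_comp (tproj P) (sm_comp (\<sigma> f) h)" "sm_comp (tproj P) p = sm_comp (tproj P) (sm_comp (\<sigma> g) h')"
      using a b by (auto simp: JJ_def)
    have fh: "sm_comp (tproj P) p = sm_comp f h" "sm_comp (tproj P) p = sm_comp g h'"
      using e1 maps_assoc[OF hm(1) conjunct1[OF sf] Pmaps(1)] maps_assoc[OF hm(2) conjunct1[OF sg] Pmaps(1)] sf sg by auto
    have "pullback_square f g (pp f g) (qq f g)" using pb f g by blast
    then obtain k where k: "is_smap k" "src k = src h" "tgt k = src (pp f g)" "sm_comp (pp f g) k = h" "sm_comp (qq f g) k = h'"
      unfolding pullback_square_def using hm fh by (metis (no_types, lifting) mapsD)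
    have km: "k \<in> maps T (src (pp f g))" using k hm by (simp add: maps_def)
    have ppm: "pp f g \<in> maps (src (pp f g)) (src f)" "sm_comp (\<sigma> f) (pp f g) \<in> maps (src (pp f g)) P.Pm" using j(1) by (auto simp: JJ_def)
    have jk: "JJ T p k (src (pp f g)) (sm_comp (\<sigma> f) (pp f g))"
      using pm km ppm e1 maps_assoc[OF km ppm(1) conjunct1[OF sf]] k(4) by (simp add: JJ_def)
    have qm: "qq f g \<in> maps (src (pp f g)) (src g)" using j(2) by (simp add: JJ_def)
    note ef = bspec[OF ee f] and eg = bspec[OF ee g]
    have "ee f \<cdot> J p h (\<sigma> f) = (ee f \<cdot> J (sm_comp (\<sigma> f) (pp f g)) (pp f g) (\<sigma> f)) \<cdot> J p k (sm_comp (\<sigma> f) (pp f g))"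
      using J_cmp(2)[OF jk j(1)] k(4) cmp_assoc[OF ef J_parts(3)[OF j(1)] J_parts(3)[OF jk]] by simp
    also have "\<dots> = (ee g \<cdot> J (sm_comp (\<sigma> f) (pp f g)) (qq f g) (\<sigma> g)) \<cdot> J p k (sm_comp (\<sigma> f) (pp f g))"
      using c f g J_cmp(2)[OF j(3,2)] maps_id_right[OF qm] by simp
    also have "\<dots> = ee g \<cdot> J p h' (\<sigma> g)"
      using J_cmp(2)[OF jk j(4)] k(5) cmp_assoc[OF eg J_parts(3)[OF j(4)] J_parts(3)[OF jk]] by simp
    finally show ?thesis .
  qed
  then show ?thesis using that y ee by blast
qed

end

text \<open>A map from \<open>P\<close> to \<open>V y\<close> amounts to an arrow to
  \<open>y\<close> from the restriction of \<open>x\<close> along the anchor of \<open>P\<close>.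
  Such an arrow is glued over the preimages of the cover, where a point of \<open>P\<close> can be
  compared with the local section over its base point.\<close>

lemma torsor_from_family:
  obtains y k where "y \<in> Ob" "po' y = P.Sm" "torsor_mor \<Gamma> P k (sm_id P.Sm) (Tor y)"
proof (rule section_cover[OF Pmaps(1)])
  show "surj_submersion P.Pm P.Sm P.pr" using P by (simp add: torsor_def)
  fix \<U> \<sigma>0
  assume U: "\<And>U. U \<in> \<U> \<Longrightarrow> openin (mtop P.Sm) U" "\<Union>\<U> = pts P.Sm" and C: "covering P.Sm (incl P.Sm ` \<U>)"
    and \<sigma>0: "\<And>U. U \<in> \<U> \<Longrightarrow> \<sigma>0 U \<in> maps (open_submfd P.Sm U) P.Pm" "\<And>U. U \<in> \<U> \<Longrightarrow> sm_comp (tproj P) (\<sigma>0 U) = incl P.Sm U"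
  let ?C = "incl P.Sm ` \<U>"
  define iv where "iv f = (SOME U. U \<in> \<U> \<and> incl P.Sm U = f)" for f
  have iv: "iv f \<in> \<U> \<and> incl P.Sm (iv f) = f" if "f \<in> ?C" for f
    unfolding iv_def by (rule someI_ex) (use that in blast)
  have srcC: "src f = open_submfd P.Sm (iv f)" if "f \<in> ?C" for f using iv[OF that] incl_simps(1) by metis
  define \<sigma> where "\<sigma> f = \<sigma>0 (iv f)" for f
  have \<sigma>: "\<forall>f\<in>?C. \<sigma> f \<in> maps (src f) P.Pm \<and> sm_comp (tproj P) (\<sigma> f) = f"
    using \<sigma>0 iv srcC unfolding \<sigma>_def by metis
  define pp qq where "pp f g = mk_smap (open_submfd P.Sm (iv f \<inter> iv g)) (open_submfd P.Sm (iv f)) (\<lambda>z. z)"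
    and "qq f g = mk_smap (open_submfd P.Sm (iv f \<inter> iv g)) (open_submfd P.Sm (iv g)) (\<lambda>z. z)" for f g
  have pb: "\<forall>f\<in>?C. \<forall>g\<in>?C. pullback_square f g (pp f g) (qq f g)"
  proof (intro ballI)
    fix f g assume f: "f \<in> ?C" and g: "g \<in> ?C"
    show "pullback_square f g (pp f g) (qq f g)"
      using pullback_square_incl[OF P.tor_mfd(2) U(1)[OF conjunct1[OF iv[OF f]]] U(1)[OF conjunct1[OF iv[OF g]]]] iv[OF f] iv[OF g]
      by (simp add: pp_def qq_def)
  qed
  obtain y ee where y: "y \<in> Ob" "po' y = P.Sm" and e: "\<forall>f\<in>?C. ov (ee f) f (wP (\<sigma> f)) y"
    and ej: "\<forall>f\<in>?C. \<forall>g\<in>?C. \<forall>T p h h'. JJ T p h (src f) (\<sigma> f) \<and> JJ T p h' (src g) (\<sigma> g) \<longrightarrow> ee f \<cdot> J p h (\<sigma> f) = ee g \<cdot> J p h' (\<sigma> g)"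
    by (rule descended[OF C \<sigma> pb])
  have "\<forall>U\<in>\<U>. openin (mtop P.Sm) U" using U(1) by blast
  note pc = preimage_cover[OF Pmaps(1) this U(2)]
  let ?pre = "\<lambda>U. {v \<in> pts P.Pm. P.pr v \<in> U}"
  let ?C' = "incl P.Pm ` ?pre ` \<U>"
  define jv where "jv j = (SOME U. U \<in> \<U> \<and> incl P.Pm (?pre U) = j)" for j
  have jv: "jv j \<in> \<U> \<and> incl P.Pm (?pre (jv j)) = j" if "j \<in> ?C'" for j
    unfolding jv_def by (rule someI_ex) (use that in blast)
  define \<phi> where "\<phi> j = incl P.Sm (jv j)" for j
  define r where "r j = mk_smap (open_submfd P.Pm (?pre (jv j))) (open_submfd P.Sm (jv j)) P.pr" for j
  have \<phi>: "\<phi> j \<in> ?C" if "j \<in> ?C'" for j using jv[OF that] by (simp add: \<phi>_def)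
  have jm: "j \<in> maps (src j) P.Pm" and rm: "r j \<in> maps (src j) (src (\<phi> j))"
    and jr: "sm_comp (tproj P) j = sm_comp (\<phi> j) (r j)" if j: "j \<in> ?C'" for j
  proof -
    note v = jv[OF j]
    have sj: "src j = open_submfd P.Pm (?pre (jv j))" using v incl_simps(1) by metis
    show "j \<in> maps (src j) P.Pm" by (rule coveringD[OF pc(1) j])
    show "r j \<in> maps (src j) (src (\<phi> j))" using pc(3)[OF conjunct1[OF v]] sj by (simp add: r_def \<phi>_def)
    show "sm_comp (tproj P) j = sm_comp (\<phi> j) (r j)" using pc(4)[OF conjunct1[OF v]] v by (simp add: r_def \<phi>_def)
  qed
  have rap: "fn (r j) v = P.pr v" if j: "j \<in> ?C'" and v: "v \<in> pts (src j)" for j v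
  proof -
    have "src j = open_submfd P.Pm (?pre (jv j))" using jv[OF j] incl_simps(1) by metis
    then show ?thesis using v by (simp add: r_def)
  qed
  have idP: "sm_id P.Pm \<in> maps P.Pm P.Pm" by (rule maps_id[OF P.tor_mfd(1)])
  have JI: "JJ T h h P.Pm (sm_id P.Pm)" if "h \<in> maps T P.Pm" for T h
    using JJ_self[OF idP that] maps_id_left[OF that] by simp
  have jj: "JJ (src j) j (r j) (src (\<phi> j)) (\<sigma> (\<phi> j))" if j: "j \<in> ?C'" for j
    using jm[OF j] rm[OF j] bspec[OF \<sigma> \<phi>[OF j]] jr[OF j] maps_assoc[OF rm[OF j] conjunct1[OF bspec[OF \<sigma> \<phi>[OF j]]] Pmaps(1)]
    by (simp add: JJ_def)
  have wI: "wP (sm_id P.Pm) = xr x (tanch P)" using maps_id_right[OF Pmaps(2)] by (simp add: wP_def)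
  have pw: "po' (xr x (tanch P)) = P.Pm" "xr x (tanch P) \<in> Ob" using po_wP[OF idP] wI by auto
  \<comment> \<open>\<open>\<kappa> j\<close> is the restriction to the open piece \<open>j\<close>
    of \<open>P\<close>; \<open>\<zeta>' j\<close> passes by division from a point of
    \<open>P\<close> to the section over its base point and then to \<open>y\<close>.\<close>
  define \<kappa> \<zeta>' where "\<kappa> j = J j j (sm_id P.Pm)" and "\<zeta>' j = ee (\<phi> j) \<cdot> J j (r j) (\<sigma> (\<phi> j))" for j
  have \<kappa>: "ov (\<kappa> j) j (wP j) (xr x (tanch P))" if "j \<in> ?C'" for j
    using J_parts(3)[OF JI[OF jm[OF that]]] wI by (simp add: \<kappa>_def)
  have f\<zeta>: "\<zeta>' j \<cdot> J p k j = ee (\<phi> j) \<cdot> J p (sm_comp (r j) k) (\<sigma> (\<phi> j)) \<and> JJ T p (sm_comp (r j) k) (src (\<phi> j)) (\<sigma> (\<phi> j))"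
    if j: "j \<in> ?C'" and k: "JJ T p k (src j) j" for j p k T
    using cmp_assoc[OF bspec[OF e \<phi>[OF j]] J_parts(3)[OF jj[OF j]] J_parts(3)[OF k]] J_cmp[OF k jj[OF j]] by (simp add: \<zeta>'_def)
  have f\<kappa>: "\<kappa> j \<cdot> J p k j = J p (sm_comp j k) (sm_id P.Pm) \<and> JJ T p (sm_comp j k) P.Pm (sm_id P.Pm)"
    if j: "j \<in> ?C'" and k: "JJ T p k (src j) j" for j p k T
    using J_cmp[OF k JI[OF jm[OF j]]] by (simp add: \<kappa>_def)
  have o\<zeta>: "ov (\<zeta>' j) (sm_comp (tproj P) j) (wP j) y" if j: "j \<in> ?C'" for j
    using ov_cmp[OF bspec[OF e \<phi>[OF j]] J_parts(3)[OF jj[OF j]]] jr[OF j] by (simp add: \<zeta>'_def)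
  have ex: "\<exists>!a. ov a (tproj P) (xr x (tanch P)) y \<and> (\<forall>j\<in>?C'. a \<cdot> \<kappa> j = \<zeta>' j)"
  proof (rule glue[OF iso_desc _ _ pw(2) y(1) \<kappa> o\<zeta>])
    show "covering (po' (xr x (tanch P))) ?C'" unfolding pw by (rule pc(1))
    show "tproj P \<in> maps (po' (xr x (tanch P))) (po' y)" unfolding pw y by (rule Pmaps(1))
    fix i j z u v u1 v1
    assume i: "i \<in> ?C'" and j: "j \<in> ?C'" and u: "ov u u1 z (wP i)" and v: "ov v v1 z (wP j)" and eq: "\<kappa> i \<cdot> u = \<kappa> j \<cdot> v"
    let ?T = "po' z"
    obtain u0 where u0: "JJ ?T (sm_comp i u1) u1 (src i) i" "ov u0 (sm_id ?T) z (wP (sm_comp i u1))" "J (sm_comp i u1) u1 i \<cdot> u0 = u"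
      by (rule J_factor[OF jm[OF i] u])
    obtain v0 where v0: "JJ ?T (sm_comp j v1) v1 (src j) j" "ov v0 (sm_id ?T) z (wP (sm_comp j v1))" "J (sm_comp j v1) v1 j \<cdot> v0 = v"
      by (rule J_factor[OF jm[OF j] v])
    have b: "sm_comp i u1 = sm_comp j v1" using ov_cmp[OF \<kappa>[OF i] u] ov_cmp[OF \<kappa>[OF j] v] eq by (simp add: over_def)
    note v0 = v0[folded b]
    note Ju = J_parts(3)[OF u0(1)] and Jv = J_parts(3)[OF v0(1)]
    have "J (sm_comp i u1) (sm_comp i u1) (sm_id P.Pm) \<cdot> u0 = J (sm_comp i u1) (sm_comp i u1) (sm_id P.Pm) \<cdot> v0"
      using eq f\<kappa>[OF i u0(1)] f\<kappa>[OF j v0(1)] cmp_assoc[OF \<kappa>[OF i] Ju u0(2)] cmp_assoc[OF \<kappa>[OF j] Jv v0(2)] u0(3) v0(3) b by simp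
    then have uv: "u0 = v0"
      by (rule cancel[OF J_parts(3)[OF conjunct2[OF f\<kappa>[OF i u0(1)]]] u0(2) v0(2)])
    have "\<zeta>' i \<cdot> J (sm_comp i u1) u1 i = \<zeta>' j \<cdot> J (sm_comp i u1) v1 j"
      using f\<zeta>[OF i u0(1)] f\<zeta>[OF j v0(1)] ej \<phi>[OF i] \<phi>[OF j] by metis
    then show "\<zeta>' i \<cdot> u = \<zeta>' j \<cdot> v"
      using cmp_assoc[OF o\<zeta>[OF i] Ju u0(2)] cmp_assoc[OF o\<zeta>[OF j] Jv v0(2)] u0(3) v0(3) uv by simp
  qed
  obtain \<zeta> where z: "ov \<zeta> (tproj P) (xr x (tanch P)) y \<and> (\<forall>j\<in>?C'. \<zeta> \<cdot> \<kappa> j = \<zeta>' j)"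
    using ex1_implies_ex[OF ex] by (rule exE)
  note \<zeta> = conjunct1[OF z] and \<zeta>\<kappa> = bspec[OF conjunct2[OF z]]
  obtain k where k: "k \<in> maps P.Pm (V y)" "sm_comp (m y) k = tanch P" "sm_comp (pY y) k = tproj P" "xi y k = \<zeta>"
    by (rule xi_ex[OF y(1) Pmaps(2) \<zeta>])
  have equi: "fn k (P.act p \<gamma>) = ac y (fn k p) \<gamma>" if p: "p \<in> tpts P" and g: "\<gamma> \<in> pts P.A" "P.an p = gs \<Gamma> \<gamma>" for p \<gamma>
  proof -
    let ?p' = "P.act p \<gamma>"
    note a = P.act_closed[OF p g] and gA = g(1)[unfolded G]
    \<comment> \<open>Equivariance concerns single points, so \<open>p\<close> and its translate are
      viewed as families over \<open>Q0\<close>; their quotient is the constant family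
      \<open>\<gamma>\<close>.\<close>
    define h h' where "h = K P.Pm p" and "h' = K P.Pm ?p'"
    have hm: "h \<in> maps Q0 P.Pm" "h' \<in> maps Q0 P.Pm" unfolding h_def h'_def using K[OF P.tor_mfd(1)] p a by auto
    have he: "sm_comp (tproj P) h = sm_comp (tproj P) h'"
      unfolding h_def h'_def using comp_K[OF Pmaps(1) p] comp_K[OF Pmaps(1) conjunct1[OF a]] a by simp
    have dK: "dvm h h' = K Am \<gamma>"
    proof -
      note d = dvm[OF hm he]
      have "fn (dvm h h') q0 = \<gamma>"
        using d(4)[of q0] Q0(2) P.dv_unique[OF p g] by (simp add: h_def h'_def)
      then show ?thesis using K_of[OF d(1)] by simp
    qed
    obtain U where UU: "U \<in> \<U>" "P.pr p \<in> U" using U(2) maps_pts[OF Pmaps(1) p] by blast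
    let ?j = "incl P.Pm (?pre U)"
    have j: "?j \<in> ?C'" using UU(1) by blast
    have pj: "p \<in> pts (src ?j)" "?p' \<in> pts (src ?j)"
      using pts_open_submfd[OF pc(2)[OF UU(1)]] UU p a by auto
    have kj: "K (src ?j) p \<in> maps Q0 (src ?j)" "K (src ?j) ?p' \<in> maps Q0 (src ?j)" using K mapsD[OF jm[OF j]] pj by auto
    have jk: "sm_comp ?j (K (src ?j) p) = h" "sm_comp ?j (K (src ?j) ?p') = h'"
      using comp_K[OF jm[OF j] pj(1)] comp_K[OF jm[OF j] pj(2)] incl_apply[OF pc(2)[OF UU(1)]] UU p a by (auto simp: h_def h'_def)
    have J1: "JJ Q0 h (K (src ?j) p) (src ?j) ?j" and J2: "JJ Q0 h (K (src ?j) ?p') (src ?j) ?j"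
      using hm kj jm[OF j] jk he by (auto simp: JJ_def)
    \<comment> \<open>The translate has the same projection as \<open>p\<close>, so both routes pass
      through the same point of the local section.\<close>
    have rr: "sm_comp (r ?j) (K (src ?j) p) = sm_comp (r ?j) (K (src ?j) ?p')"
      using comp_K[OF rm[OF j] pj(1)] comp_K[OF rm[OF j] pj(2)] rap[OF j pj(1)] rap[OF j pj(2)] a by simp
    have "\<zeta> \<cdot> J h h (sm_id P.Pm) = \<zeta>' ?j \<cdot> J h (K (src ?j) p) ?j"
      using f\<kappa>[OF j J1] jk cmp_assoc[OF \<zeta> \<kappa>[OF j] J_parts(3)[OF J1]] \<zeta>\<kappa>[OF j] by simp
    also have "\<dots> = \<zeta>' ?j \<cdot> J h (K (src ?j) ?p') ?j" using f\<zeta>[OF j J1] f\<zeta>[OF j J2] rr by simp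
    also have "\<dots> = \<zeta> \<cdot> J h h' (sm_id P.Pm)"
      using f\<kappa>[OF j J2] jk cmp_assoc[OF \<zeta> \<kappa>[OF j] J_parts(3)[OF J2]] \<zeta>\<kappa>[OF j] by simp
    finally have star: "\<zeta> \<cdot> J h h (sm_id P.Pm) = \<zeta> \<cdot> J h h' (sm_id P.Pm)" .
    have tI: "sm_comp (tanch P) (sm_id P.Pm) = tanch P" by (rule maps_id_right[OF Pmaps(2)])
    note c = conjunct1[OF cc[OF x Pmaps(2) hm(1)]] and c' = conjunct1[OF cc[OF x Pmaps(2) hm(2)]]
    have j1: "J h h (sm_id P.Pm) = cc x h (tanch P)"
      using tI dvm_self[OF hm(1)] maps_id_left[OF hm(1)] ide_right[OF c] by (simp add: J_def wP_def)
    have j2: "J h h' (sm_id P.Pm) = cc x h' (tanch P) \<cdot> th (K Am \<gamma>)"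
      using tI maps_id_left[OF hm(2)] dK by (simp add: J_def)
    have xk: "xi y (sm_comp k h) = \<zeta> \<cdot> cc x h (tanch P)" "xi y (sm_comp k h') = \<zeta> \<cdot> cc x h' (tanch P)"
      using xi_nat[OF y(1) k(1) hm(1)] xi_nat[OF y(1) k(1) hm(2)] k by auto
    have od: "ov (th (K Am \<gamma>)) (sm_id Q0) (xr x (sm_comp (tanch P) h)) (xr x (sm_comp (tanch P) h'))"
      using th_dvm[OF hm he] dK by (simp add: wP_def)
    have st': "sm_comp (tanch P) h = sm_comp s (K Am \<gamma>)" "sm_comp (tanch P) h' = sm_comp t (K Am \<gamma>)"
      using dvm(2,3)[OF hm he] dK by auto
    have "AcR y Q0 (sm_comp k h) (K Am \<gamma>) (sm_comp k h')"
      unfolding AcR_def[OF y(1)]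
      using maps_comp[OF hm(1) k(1)] maps_comp[OF hm(2) k(1)] K[OF Am(1) gA] st'
        maps_assoc[OF hm(1) k(1) VD(1)[OF y(1)]] maps_assoc[OF hm(2) k(1) VD(1)[OF y(1)]] k(2)
        xk star j1 j2 cmp_assoc[OF \<zeta> c' od] by simp
    then have "AcR y Q0 (K (V y) (fn k p)) (K Am \<gamma>) (K (V y) (fn k ?p'))"
      using comp_K[OF k(1) p] comp_K[OF k(1) conjunct1[OF a]] by (simp add: h_def h'_def)
    then show ?thesis
      using AR_points[OF y(1) maps_pts[OF k(1) p] gA maps_pts[OF k(1) conjunct1[OF a]]] by simp
  qed
  have "torsor_mor \<Gamma> P k (sm_id P.Sm) (Tor y)"
    unfolding torsor_mor_def
    using P torsor_Tor[OF y(1)] Tor_s[OF y(1)] y mapsD[OF k(1)] k(2,3) mapsD[OF maps_id[OF P.tor_mfd(2)]]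
      maps_id_left[OF Pmaps(1)] equi by simp
  then show ?thesis by (rule that[OF y])
qed

end

end

subsection \<open>The fibration of torsors\<close>

lemma (in lie_gpd) torsor_mor_id: "torsor \<Gamma> P \<Longrightarrow> torsor_mor \<Gamma> P (sm_id (src (tproj P))) (sm_id (tgt (tproj P))) P"
proof -
  assume P: "torsor \<Gamma> P"
  interpret P: lie_torsor \<Gamma> P by unfold_locales (rule P)
  have p: "tproj P \<in> maps P.Pm P.Sm" "tanch P \<in> maps P.Pm (base \<Gamma>)" using P by (auto simp: torsor_def maps_def)
  show ?thesis
    unfolding torsor_mor_def
    using P mapsD[OF maps_id[OF P.tor_mfd(1)]] mapsD[OF maps_id[OF P.tor_mfd(2)]]
      maps_id_left[OF p(1)] maps_id_right[OF p(1)] maps_id_right[OF p(2)] P.act_closed by simp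
qed

lemma (in lie_gpd) torsor_mor_comp:
  assumes k: "torsor_mor \<Gamma> P k f Q" and l: "torsor_mor \<Gamma> Q l g R"
  shows "torsor_mor \<Gamma> P (sm_comp l k) (sm_comp g f) R"
proof -
  interpret P: lie_torsor \<Gamma> P by unfold_locales (use k in \<open>simp add: torsor_mor_def\<close>)
  interpret Q: lie_torsor \<Gamma> Q by unfold_locales (use k in \<open>simp add: torsor_mor_def\<close>)
  interpret R: lie_torsor \<Gamma> R by unfold_locales (use l in \<open>simp add: torsor_mor_def\<close>)
  have km: "k \<in> maps P.Pm Q.Pm" "f \<in> maps P.Sm Q.Sm" and lm: "l \<in> maps Q.Pm R.Pm" "g \<in> maps Q.Sm R.Sm"
    using k l by (auto simp: torsor_mor_def maps_def)
  have pm: "tproj P \<in> maps P.Pm P.Sm" "tproj Q \<in> maps Q.Pm Q.Sm" "tproj R \<in> maps R.Pm R.Sm" "tanch R \<in> maps R.Pm (base \<Gamma>)"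
    using P.tor Q.tor R.tor by (auto simp: torsor_def maps_def)
  have ke: "sm_comp (tproj Q) k = sm_comp f (tproj P)" "sm_comp (tanch Q) k = tanch P"
    "\<And>p \<gamma>. p \<in> pts P.Pm \<Longrightarrow> \<gamma> \<in> pts P.A \<Longrightarrow> P.an p = gs \<Gamma> \<gamma> \<Longrightarrow> fn k (P.act p \<gamma>) = Q.act (fn k p) \<gamma>"
    using k by (auto simp: torsor_mor_def)
  have le: "sm_comp (tproj R) l = sm_comp g (tproj Q)" "sm_comp (tanch R) l = tanch Q"
    "\<And>p \<gamma>. p \<in> pts Q.Pm \<Longrightarrow> \<gamma> \<in> pts P.A \<Longrightarrow> Q.an p = gs \<Gamma> \<gamma> \<Longrightarrow> fn l (Q.act p \<gamma>) = R.act (fn l p) \<gamma>"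
    using l by (auto simp: torsor_mor_def)
  show ?thesis
    unfolding torsor_mor_def
  proof (intro conjI ballI impI)
    show "sm_comp (tproj R) (sm_comp l k) = sm_comp (sm_comp g f) (tproj P)"
      using maps_assoc[OF km(1) lm(1) pm(3)] maps_assoc[OF km(1) pm(2) lm(2)] maps_assoc[OF pm(1) km(2) lm(2)] ke le by simp
    show "sm_comp (tanch R) (sm_comp l k) = tanch P"
      using maps_assoc[OF km(1) lm(1) pm(4)] ke le by simp
    fix p \<gamma> assume p: "p \<in> tpts P" and g: "\<gamma> \<in> pts P.A" "P.an p = gs \<Gamma> \<gamma>"
    have "Q.an (fn k p) = P.an p" using ke(2) maps_apply[OF km(1) p] by metis
    then show "fn (sm_comp l k) (P.act p \<gamma>) = R.act (fn (sm_comp l k) p) \<gamma>"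
      using P.act_closed[OF p g] maps_apply[OF km(1)] p g ke(3)[OF p g] le(3)[OF maps_pts[OF km(1) p] g(1)] by simp
  qed (use P.tor R.tor mapsD[OF maps_comp[OF km(1) lm(1)]] mapsD[OF maps_comp[OF km(2) lm(2)]] in auto)
qed

context vgpd
begin

lemma torsor_mor_maps:
  assumes "torsor_mor \<Gamma> P k f Q"
  shows "k \<in> maps (src (tproj P)) (src (tproj Q))" "f \<in> maps (tgt (tproj P)) (tgt (tproj Q))" "torsor \<Gamma> P" "torsor \<Gamma> Q"
  using assms by (auto simp: torsor_mor_def maps_def)

text \<open>The comparison map from \<open>P\<close> is inverted by applying
  \<open>torsor_lift\<close> to the identity of \<open>Tor y\<close>.\<close>

lemma family_to_torsor:
  assumes P: "torsor \<Gamma> P"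
  obtains y c where "y \<in> Ob" "po' y = tgt (tproj P)" "torsor_mor \<Gamma> (Tor y) c (sm_id (tgt (tproj P))) P"
proof -
  let ?S = "tgt (tproj P)"
  obtain y k where y: "y \<in> Ob" "po' y = ?S" and k: "torsor_mor \<Gamma> P k (sm_id ?S) (Tor y)"
    by (rule torsor_from_family[OF P])
  have idS: "sm_id ?S \<in> maps ?S ?S" using maps_id po_manifold[OF y(1)] y(2) by metis
  have l: "torsor_mor \<Gamma> (Tor y) (sm_id (V y)) (sm_comp (sm_id ?S) (sm_id ?S)) (Tor y)"
    using torsor_mor_ka[OF ov_ide[OF y(1)]] ka_ide[OF y(1)] y(2) maps_id_left[OF idS] by simp
  have h: "sm_id ?S \<in> maps (tgt (tproj (Tor y))) (tgt (tproj P))" using idS y by simp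
  have "\<exists>c. torsor_mor \<Gamma> (Tor y) c (sm_id ?S) P"
    using ex1_implies_ex[OF torsor_lift[OF inj_e k l h]] by blast
  then show ?thesis using that[OF y] by blast
qed

text \<open>The restricted family has a torsor over \<open>T\<close>; it maps to the torsor of the
  family and from there to \<open>P\<close>.\<close>

lemma torsor_pull:
  assumes P: "torsor \<Gamma> P" and f: "f \<in> maps T (tgt (tproj P))"
  shows "\<exists>Q k. torsor_mor \<Gamma> Q k f P"
proof -
  obtain y c where y: "y \<in> Ob" "po' y = tgt (tproj P)" and c: "torsor_mor \<Gamma> (Tor y) c (sm_id (tgt (tproj P))) P"
    by (rule family_to_torsor[OF P])
  have f': "f \<in> maps T (po' y)" using f y by simp
  have "torsor_mor \<Gamma> (Tor (xr y f)) (ka (pl y f)) f (Tor y)" by (rule torsor_mor_ka[OF pl[OF y(1) f']])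
  from torsor_mor_comp[OF this c] show ?thesis using maps_id_left[OF f] by auto
qed

lemma B_category: "category (tot (B \<Gamma>))"
  unfolding category_def
proof (intro conjI ballI impI)
  fix a assume a: "a \<in> Arr (tot (B \<Gamma>))"
  obtain P k f Q where A: "a = (P, k, f, Q)" by (cases a) auto
  have k: "torsor_mor \<Gamma> P k f Q" using a by (simp add: A B_simps)
  note km = torsor_mor_maps[OF k]
  show "Dom (tot (B \<Gamma>)) a \<in> Obj (tot (B \<Gamma>))" "Cod (tot (B \<Gamma>)) a \<in> Obj (tot (B \<Gamma>))" using km by (simp_all add: A B_simps)
  show "Cmp (tot (B \<Gamma>)) a (Ide (tot (B \<Gamma>)) (Dom (tot (B \<Gamma>)) a)) = a" "Cmp (tot (B \<Gamma>)) (Ide (tot (B \<Gamma>)) (Cod (tot (B \<Gamma>)) a)) a = a"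
    using maps_id_left[OF km(1)] maps_id_left[OF km(2)] maps_id_right[OF km(1)] maps_id_right[OF km(2)] by (simp_all add: A B_simps)
  fix b assume b: "b \<in> Arr (tot (B \<Gamma>))"
  obtain P' k' f' Q' where B: "b = (P', k', f', Q')" by (cases b) auto
  have k': "torsor_mor \<Gamma> P' k' f' Q'" using b by (simp add: B B_simps)
  note km' = torsor_mor_maps[OF k']
  { assume "Cod (tot (B \<Gamma>)) a = Dom (tot (B \<Gamma>)) b"
    then have e: "P' = Q" by (simp add: A B B_simps)
    show "Cmp (tot (B \<Gamma>)) b a \<in> Arr (tot (B \<Gamma>))" "Dom (tot (B \<Gamma>)) (Cmp (tot (B \<Gamma>)) b a) = Dom (tot (B \<Gamma>)) a"
      "Cod (tot (B \<Gamma>)) (Cmp (tot (B \<Gamma>)) b a) = Cod (tot (B \<Gamma>)) b"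
      using torsor_mor_comp[OF k] k' by (simp_all add: A B e B_simps) }
  fix c assume c: "c \<in> Arr (tot (B \<Gamma>))" and e: "Cod (tot (B \<Gamma>)) a = Dom (tot (B \<Gamma>)) b \<and> Cod (tot (B \<Gamma>)) b = Dom (tot (B \<Gamma>)) c"
  obtain P'' k'' f'' Q'' where C: "c = (P'', k'', f'', Q'')" by (cases c) auto
  have k'': "torsor_mor \<Gamma> P'' k'' f'' Q''" using c by (simp add: C B_simps)
  note km'' = torsor_mor_maps[OF k'']
  have e': "P' = Q" "P'' = Q'" using e by (auto simp: A B C B_simps)
  show "Cmp (tot (B \<Gamma>)) c (Cmp (tot (B \<Gamma>)) b a) = Cmp (tot (B \<Gamma>)) (Cmp (tot (B \<Gamma>)) c b) a"
    using maps_assoc[OF km(1) km'(1)[unfolded e'] km''(1)[unfolded e']] maps_assoc[OF km(2) km'(2)[unfolded e'] km''(2)[unfolded e']]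
    by (simp add: A B C B_simps)
next
  fix P assume "P \<in> Obj (tot (B \<Gamma>))"
  then show "Ide (tot (B \<Gamma>)) P \<in> Arr (tot (B \<Gamma>))" "Dom (tot (B \<Gamma>)) (Ide (tot (B \<Gamma>)) P) = P" "Cod (tot (B \<Gamma>)) (Ide (tot (B \<Gamma>)) P) = P"
    using torsor_mor_id by (simp_all add: B_simps)
qed

lemma B_functor: "is_functor (tot (B \<Gamma>)) Man \<lparr>fo = po (B \<Gamma>), fa = pa (B \<Gamma>)\<rparr>"
  unfolding is_functor_def
proof (intro conjI ballI impI)
  fix P assume "P \<in> Obj (tot (B \<Gamma>))"
  then show "fo \<lparr>fo = po (B \<Gamma>), fa = pa (B \<Gamma>)\<rparr> P \<in> Obj Man"
    "fa \<lparr>fo = po (B \<Gamma>), fa = pa (B \<Gamma>)\<rparr> (Ide (tot (B \<Gamma>)) P) = Ide Man (fo \<lparr>fo = po (B \<Gamma>), fa = pa (B \<Gamma>)\<rparr> P)"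
    by (simp_all add: B_simps Man_def torsor_def is_smap_def)
next
  fix a assume a: "a \<in> Arr (tot (B \<Gamma>))"
  obtain P k f Q where A: "a = (P, k, f, Q)" by (cases a) auto
  have k: "torsor_mor \<Gamma> P k f Q" using a by (simp add: A B_simps)
  show "fa \<lparr>fo = po (B \<Gamma>), fa = pa (B \<Gamma>)\<rparr> a \<in> Arr Man"
    "Dom Man (fa \<lparr>fo = po (B \<Gamma>), fa = pa (B \<Gamma>)\<rparr> a) = fo \<lparr>fo = po (B \<Gamma>), fa = pa (B \<Gamma>)\<rparr> (Dom (tot (B \<Gamma>)) a)"
    "Cod Man (fa \<lparr>fo = po (B \<Gamma>), fa = pa (B \<Gamma>)\<rparr> a) = fo \<lparr>fo = po (B \<Gamma>), fa = pa (B \<Gamma>)\<rparr> (Cod (tot (B \<Gamma>)) a)"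
    using k by (simp_all add: A B_simps Man_def torsor_mor_def)
  fix b assume "b \<in> Arr (tot (B \<Gamma>))"
  show "fa \<lparr>fo = po (B \<Gamma>), fa = pa (B \<Gamma>)\<rparr> (Cmp (tot (B \<Gamma>)) b a) = Cmp Man (fa \<lparr>fo = po (B \<Gamma>), fa = pa (B \<Gamma>)\<rparr> b) (fa \<lparr>fo = po (B \<Gamma>), fa = pa (B \<Gamma>)\<rparr> a)"
    by (cases b) (simp add: A B_simps Man_def)
qed

lemma B_groupoid_fibration: "groupoid_fibration (B \<Gamma>)"
  unfolding groupoid_fibration_def
proof (intro conjI B_category B_functor allI ballI impI)
  fix f P assume a: "is_smap f \<and> P \<in> Obj (tot (B \<Gamma>)) \<and> po (B \<Gamma>) P = tgt f"
  then have "f \<in> maps (src f) (tgt (tproj P))" "torsor \<Gamma> P" by (simp_all add: maps_def B_simps)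
  then obtain Q k where "torsor_mor \<Gamma> Q k f P" using torsor_pull by blast
  then show "\<exists>a\<in>Arr (tot (B \<Gamma>)). Cod (tot (B \<Gamma>)) a = P \<and> pa (B \<Gamma>) a = f"
    by (intro bexI[of _ "(Q, k, f, P)"]) (simp_all add: B_simps)
next
  fix a b h assume ab: "a \<in> Arr (tot (B \<Gamma>))" "b \<in> Arr (tot (B \<Gamma>))"
    and hyp: "Cod (tot (B \<Gamma>)) a = Cod (tot (B \<Gamma>)) b \<and> is_smap h \<and> src h = src (pa (B \<Gamma>) b) \<and>
      tgt h = src (pa (B \<Gamma>) a) \<and> sm_comp (pa (B \<Gamma>) a) h = pa (B \<Gamma>) b"
  obtain P k f R where A: "a = (P, k, f, R)" by (cases a) auto
  obtain Q l g R' where B: "b = (Q, l, g, R')" by (cases b) auto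
  have k: "torsor_mor \<Gamma> P k f R" and l0: "torsor_mor \<Gamma> Q l g R'" using ab by (simp_all add: A B B_simps)
  have R: "R' = R" and h: "is_smap h" "src h = src g" "tgt h = src f" "sm_comp f h = g" using hyp by (simp_all add: A B B_simps)
  have l: "torsor_mor \<Gamma> Q l (sm_comp f h) R" using l0 R h by simp
  have hm: "h \<in> maps (tgt (tproj Q)) (tgt (tproj P))"
    using h torsor_mor_maps(2)[OF k] torsor_mor_maps(2)[OF l0] by (simp add: maps_def)
  obtain c where c: "torsor_mor \<Gamma> Q c h P" "sm_comp k c = l"
    and u: "\<And>c'. torsor_mor \<Gamma> Q c' h P \<and> sm_comp k c' = l \<Longrightarrow> c' = c"
    using torsor_lift[OF inj_e k l hm] by (elim ex1E conjE) blast
  show "\<exists>!c. c \<in> Arr (tot (B \<Gamma>)) \<and> Dom (tot (B \<Gamma>)) c = Dom (tot (B \<Gamma>)) b \<and> Cod (tot (B \<Gamma>)) c = Dom (tot (B \<Gamma>)) a \<and>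
      pa (B \<Gamma>) c = h \<and> Cmp (tot (B \<Gamma>)) a c = b"
  proof (rule ex1I[where a = "(Q, c, h, P)"])
    show "(Q, c, h, P) \<in> Arr (tot (B \<Gamma>)) \<and> Dom (tot (B \<Gamma>)) (Q, c, h, P) = Dom (tot (B \<Gamma>)) b \<and>
      Cod (tot (B \<Gamma>)) (Q, c, h, P) = Dom (tot (B \<Gamma>)) a \<and> pa (B \<Gamma>) (Q, c, h, P) = h \<and> Cmp (tot (B \<Gamma>)) a (Q, c, h, P) = b"
      using c R h by (simp add: A B B_simps)
    fix d assume d: "d \<in> Arr (tot (B \<Gamma>)) \<and> Dom (tot (B \<Gamma>)) d = Dom (tot (B \<Gamma>)) b \<and> Cod (tot (B \<Gamma>)) d = Dom (tot (B \<Gamma>)) a \<and>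
      pa (B \<Gamma>) d = h \<and> Cmp (tot (B \<Gamma>)) a d = b"
    obtain Q1 c1 h1 P1 where D: "d = (Q1, c1, h1, P1)" by (cases d) auto
    show "d = (Q, c, h, P)" using d u[of c1] by (auto simp: A B D B_simps)
  qed
qed

end

subsection \<open>Equivalences\<close>

text \<open>The quasi-inverse is built by choosing preimages. Since the comparison arrows lie over
  identities, it preserves base manifolds on the nose, and the comparisons are 2-morphisms.\<close>

lemma gf_equivalenceI:
  assumes gX: "groupoid_fibration X" and gY: "groupoid_fibration Y" and F: "gf_mor X Y F"
    and ff: "\<forall>y\<in>Obj (tot X). \<forall>y'\<in>Obj (tot X). \<forall>b f. over Y b f (fo F y) (fo F y') \<longrightarrow> (\<exists>!a. over X a f y y' \<and> fa F a = b)"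
    and es: "\<forall>P\<in>Obj (tot Y). \<exists>y b. y \<in> Obj (tot X) \<and> over Y b (sm_id (po Y P)) (fo F y) P"
  shows "gf_equivalence X Y F"
proof -
  interpret X: gfib X by unfold_locales (rule gX)
  interpret Y: gfib Y by unfold_locales (rule gY)
  note [simp del] = sm_id_def
  have Fo: "fo F y \<in> Obj (tot Y)" "po Y (fo F y) = po X y" "fa F (Ide (tot X) y) = Ide (tot Y) (fo F y)" if "y \<in> Obj (tot X)" for y
    using F that by (auto simp: gf_mor_def is_functor_def)
  have Fa: "over Y (fa F a) f (fo F y) (fo F y')" if "over X a f y y'" for a f y y'
    using F that by (auto simp: gf_mor_def is_functor_def over_def)
  have Fc: "fa F (Cmp (tot X) b a) = Cmp (tot Y) (fa F b) (fa F a)" if "over X b g y' y''" "over X a f y y'" for a b f g y y' y''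
    using F that by (auto simp: gf_mor_def is_functor_def over_def)
  have faithful: "a = a'" if "over X a f y y'" "over X a' f y y'" "fa F a = fa F a'" for a a' f y y'
  proof -
    have "y \<in> Obj (tot X)" "y' \<in> Obj (tot X)" using X.ovD[OF that(1)] by auto
    then have "\<exists>!b. over X b f y y' \<and> fa F b = fa F a" using ff Fa[OF that(1)] by blast
    then show ?thesis using that by metis
  qed
  obtain g \<epsilon> where g: "\<And>P. P \<in> Obj (tot Y) \<Longrightarrow> g P \<in> Obj (tot X)"
    and \<epsilon>: "\<And>P. P \<in> Obj (tot Y) \<Longrightarrow> over Y (\<epsilon> P) (sm_id (po Y P)) (fo F (g P)) P"
    using es by metis
  have pg: "po X (g P) = po Y P" if P: "P \<in> Obj (tot Y)" for P
  proof -
    have "sm_id (po Y P) \<in> maps (po Y (fo F (g P))) (po Y P)" using Y.ovD[OF \<epsilon>[OF P]] by simp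
    then show ?thesis using Fo(2)[OF g[OF P]] by (simp add: maps_def sm_id_def)
  qed
  have "\<exists>i. over Y i (sm_id (po Y P)) P (fo F (g P)) \<and> Cmp (tot Y) (\<epsilon> P) i = Ide (tot Y) P \<and> Cmp (tot Y) i (\<epsilon> P) = Ide (tot Y) (fo F (g P))"
    if P: "P \<in> Obj (tot Y)" for P
    using Y.inv_ex[OF \<epsilon>[OF P]] by metis
  then obtain \<iota> where \<iota>: "\<And>P. P \<in> Obj (tot Y) \<Longrightarrow> over Y (\<iota> P) (sm_id (po Y P)) P (fo F (g P))"
    and \<epsilon>\<iota>: "\<And>P. P \<in> Obj (tot Y) \<Longrightarrow> Cmp (tot Y) (\<epsilon> P) (\<iota> P) = Ide (tot Y) P"
    and \<iota>\<epsilon>: "\<And>P. P \<in> Obj (tot Y) \<Longrightarrow> Cmp (tot Y) (\<iota> P) (\<epsilon> P) = Ide (tot Y) (fo F (g P))" by metis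
  \<comment> \<open>Conjugation by the comparison isomorphisms, carried back through full
    faithfulness; functoriality then follows from faithfulness.\<close>
  define ga where "ga b = (THE a. over X a (pa Y b) (g (Dom (tot Y) b)) (g (Cod (tot Y) b)) \<and>
    fa F a = Cmp (tot Y) (Cmp (tot Y) (\<iota> (Cod (tot Y) b)) b) (\<epsilon> (Dom (tot Y) b)))" for b
  define \<eta> where "\<eta> y = (THE a. over X a (sm_id (po X y)) (g (fo F y)) y \<and> fa F a = \<epsilon> (fo F y))" for y
  have conj: "over Y (Cmp (tot Y) (Cmp (tot Y) (\<iota> Q) b) (\<epsilon> P)) f (fo F (g P)) (fo F (g Q))" if b: "over Y b f P Q" for b f P Q
  proof -
    have PQ: "P \<in> Obj (tot Y)" "Q \<in> Obj (tot Y)" "f \<in> maps (po Y P) (po Y Q)" using Y.ovD[OF b] by auto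
    show ?thesis
      using Y.ov_cmp[OF Y.ov_cmp[OF \<iota>[OF PQ(2)] b] \<epsilon>[OF PQ(1)]] maps_id_left[OF PQ(3)] maps_id_right[OF PQ(3)] by simp
  qed
  have ga: "over X (ga b) f (g P) (g Q) \<and> fa F (ga b) = Cmp (tot Y) (Cmp (tot Y) (\<iota> Q) b) (\<epsilon> P)" if b: "over Y b f P Q" for b f P Q
  proof -
    have PQ: "P \<in> Obj (tot Y)" "Q \<in> Obj (tot Y)" "pa Y b = f" "Dom (tot Y) b = P" "Cod (tot Y) b = Q" using Y.ovD[OF b] by auto
    have "\<exists>!a. over X a f (g P) (g Q) \<and> fa F a = Cmp (tot Y) (Cmp (tot Y) (\<iota> Q) b) (\<epsilon> P)"
      using ff g[OF PQ(1)] g[OF PQ(2)] conj[OF b] by blast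
    from theI'[OF this] show ?thesis by (simp add: ga_def PQ)
  qed
  have \<eta>: "over X (\<eta> y) (sm_id (po X y)) (g (fo F y)) y \<and> fa F (\<eta> y) = \<epsilon> (fo F y)" if y: "y \<in> Obj (tot X)" for y
  proof -
    have "\<exists>!a. over X a (sm_id (po X y)) (g (fo F y)) y \<and> fa F a = \<epsilon> (fo F y)"
      using ff g[OF Fo(1)[OF y]] y \<epsilon>[OF Fo(1)[OF y]] Fo(2)[OF y] by simp
    from theI'[OF this] show ?thesis by (simp add: \<eta>_def)
  qed
  define G where "G = \<lparr>fo = g, fa = ga\<rparr>"
  have Gs [simp]: "fo G = g" "fa G = ga" by (simp_all add: G_def)
  have Gid: "ga (Ide (tot Y) P) = Ide (tot X) (g P)" if P: "P \<in> Obj (tot Y)" for P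
  proof (rule faithful[OF conjunct1[OF ga[OF Y.ov_ide[OF P]]]])
    show "over X (Ide (tot X) (g P)) (sm_id (po Y P)) (g P) (g P)" using X.ov_ide[OF g[OF P]] pg[OF P] by simp
    show "fa F (ga (Ide (tot Y) P)) = fa F (Ide (tot X) (g P))"
      using ga[OF Y.ov_ide[OF P]] Y.ide_right[OF \<iota>[OF P]] \<iota>\<epsilon>[OF P] Fo(3)[OF g[OF P]] by simp
  qed
  have Gcmp: "ga (Cmp (tot Y) c b) = Cmp (tot X) (ga c) (ga b)" if b: "over Y b f P Q" and c: "over Y c h Q R" for b c f h P Q R
  proof (rule faithful[OF conjunct1[OF ga[OF Y.ov_cmp[OF c b]]]])
    note gb = conjunct1[OF ga[OF b]] and gc = conjunct1[OF ga[OF c]]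
    show "over X (Cmp (tot X) (ga c) (ga b)) (sm_comp h f) (g P) (g R)" by (rule X.ov_cmp[OF gc gb])
    have O: "P \<in> Obj (tot Y)" "Q \<in> Obj (tot Y)" "R \<in> Obj (tot Y)" using Y.ovD[OF b] Y.ovD[OF c] by auto
    note ib = Y.ov_cmp[OF \<iota>[OF O(2)] b] and ic = Y.ov_cmp[OF \<iota>[OF O(3)] c] and be = Y.ov_cmp[OF b \<epsilon>[OF O(1)]]
    have "Cmp (tot Y) (Cmp (tot Y) (Cmp (tot Y) (\<iota> R) c) (\<epsilon> Q)) (Cmp (tot Y) (Cmp (tot Y) (\<iota> Q) b) (\<epsilon> P)) =
      Cmp (tot Y) (Cmp (tot Y) (\<iota> R) c) (Cmp (tot Y) (\<epsilon> Q) (Cmp (tot Y) (\<iota> Q) (Cmp (tot Y) b (\<epsilon> P))))"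
      using Y.cmp_assoc[OF \<iota>[OF O(2)] b \<epsilon>[OF O(1)]] Y.cmp_assoc[OF ic \<epsilon>[OF O(2)] Y.ov_cmp[OF \<iota>[OF O(2)] be]] by simp
    also have "\<dots> = Cmp (tot Y) (Cmp (tot Y) (\<iota> R) c) (Cmp (tot Y) b (\<epsilon> P))"
      using Y.cmp_assoc[OF \<epsilon>[OF O(2)] \<iota>[OF O(2)] be] \<epsilon>\<iota>[OF O(2)] Y.ide_left[OF be] by simp
    also have "\<dots> = Cmp (tot Y) (Cmp (tot Y) (\<iota> R) (Cmp (tot Y) c b)) (\<epsilon> P)"
      using Y.cmp_assoc[OF ic b \<epsilon>[OF O(1)]] Y.cmp_assoc[OF \<iota>[OF O(3)] c b] by simp
    finally show "fa F (ga (Cmp (tot Y) c b)) = fa F (Cmp (tot X) (ga c) (ga b))"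
      using ga[OF Y.ov_cmp[OF c b]] ga[OF b] ga[OF c] Fc[OF gc gb] by simp
  qed
  have "gf_mor Y X G"
    unfolding gf_mor_def is_functor_def Gs
  proof (intro conjI ballI impI)
    fix b assume b: "b \<in> Arr (tot Y)"
    note o = ga[OF Y.ov_self[OF b]]
    show "ga b \<in> Arr (tot X)" "Dom (tot X) (ga b) = g (Dom (tot Y) b)" "Cod (tot X) (ga b) = g (Cod (tot Y) b)" "pa X (ga b) = pa Y b"
      using o by (auto simp: over_def)
    fix c assume c: "c \<in> Arr (tot Y)" "Cod (tot Y) b = Dom (tot Y) c"
    show "ga (Cmp (tot Y) c b) = Cmp (tot X) (ga c) (ga b)"
      by (rule Gcmp[OF Y.ov_self[OF b]]) (use Y.ov_self[OF c(1)] c(2) in simp)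
  qed (use g pg Gid in auto)
  moreover have "gf_2mor X X (ftr_comp G F) ftr_id \<eta>"
    unfolding gf_2mor_def ftr_comp_def ftr_id_def
  proof (intro conjI ballI)
    fix y assume y: "y \<in> Obj (tot X)"
    show "\<eta> y \<in> Arr (tot X)" "Dom (tot X) (\<eta> y) = fo \<lparr>fo = fo G \<circ> fo F, fa = fa G \<circ> fa F\<rparr> y"
      "Cod (tot X) (\<eta> y) = fo \<lparr>fo = \<lambda>x. x, fa = \<lambda>a. a\<rparr> y" "pa X (\<eta> y) = sm_id (po X y)"
      using \<eta>[OF y] by (auto simp: over_def)
  next
    fix a assume "a \<in> Arr (tot X)"
    then obtain f y y' where a: "over X a f y y'" using X.ov_self by blast
    then have y: "y \<in> Obj (tot X)" "y' \<in> Obj (tot X)" "f \<in> maps (po X y) (po X y')" "Dom (tot X) a = y" "Cod (tot X) a = y'"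
      using X.ovD[OF a] by auto
    note Fa' = Fa[OF a] and e = \<eta>[OF y(1)] and e' = \<eta>[OF y(2)]
    note ga' = ga[OF Fa']
    note P = Fo(1)[OF y(1)] and Q = Fo(1)[OF y(2)]
    have "Cmp (tot X) (\<eta> y') (ga (fa F a)) = Cmp (tot X) a (\<eta> y)"
    proof (rule faithful)
      show "over X (Cmp (tot X) (\<eta> y') (ga (fa F a))) f (g (fo F y)) y'"
        using X.ov_cmp[OF conjunct1[OF e'] conjunct1[OF ga']] maps_id_left[OF y(3)] by simp
      show "over X (Cmp (tot X) a (\<eta> y)) f (g (fo F y)) y'"
        using X.ov_cmp[OF a conjunct1[OF e]] maps_id_right[OF y(3)] by simp
      have "Cmp (tot Y) (\<epsilon> (fo F y')) (Cmp (tot Y) (Cmp (tot Y) (\<iota> (fo F y')) (fa F a)) (\<epsilon> (fo F y))) = Cmp (tot Y) (fa F a) (\<epsilon> (fo F y))"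
        using Y.cmp_assoc[OF \<iota>[OF Q] Fa' \<epsilon>[OF P]] Y.cmp_assoc[OF \<epsilon>[OF Q] \<iota>[OF Q] Y.ov_cmp[OF Fa' \<epsilon>[OF P]]]
          \<epsilon>\<iota>[OF Q] Y.ide_left[OF Y.ov_cmp[OF Fa' \<epsilon>[OF P]]] by simp
      then show "fa F (Cmp (tot X) (\<eta> y') (ga (fa F a))) = fa F (Cmp (tot X) a (\<eta> y))"
        using Fc[OF conjunct1[OF e'] conjunct1[OF ga']] Fc[OF a conjunct1[OF e]] e e' ga' by simp
    qed
    then show "Cmp (tot X) (\<eta> (Cod (tot X) a)) (fa \<lparr>fo = fo G \<circ> fo F, fa = fa G \<circ> fa F\<rparr> a) =
        Cmp (tot X) (fa \<lparr>fo = \<lambda>x. x, fa = \<lambda>a. a\<rparr> a) (\<eta> (Dom (tot X) a))"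
      by (simp add: y)
  qed
  moreover have "gf_2mor Y Y (ftr_comp F G) ftr_id \<epsilon>"
    unfolding gf_2mor_def ftr_comp_def ftr_id_def
  proof (intro conjI ballI)
    fix P assume P: "P \<in> Obj (tot Y)"
    show "\<epsilon> P \<in> Arr (tot Y)" "Dom (tot Y) (\<epsilon> P) = fo \<lparr>fo = fo F \<circ> fo G, fa = fa F \<circ> fa G\<rparr> P"
      "Cod (tot Y) (\<epsilon> P) = fo \<lparr>fo = \<lambda>x. x, fa = \<lambda>a. a\<rparr> P" "pa Y (\<epsilon> P) = sm_id (po Y P)"
      using \<epsilon>[OF P] by (auto simp: over_def)
  next
    fix b assume "b \<in> Arr (tot Y)"
    then obtain f P Q where b: "over Y b f P Q" using Y.ov_self by blast
    then have P: "P \<in> Obj (tot Y)" "Q \<in> Obj (tot Y)" "Dom (tot Y) b = P" "Cod (tot Y) b = Q"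
      using Y.ovD[OF b] by auto
    have "Cmp (tot Y) (\<epsilon> Q) (Cmp (tot Y) (Cmp (tot Y) (\<iota> Q) b) (\<epsilon> P)) = Cmp (tot Y) b (\<epsilon> P)"
      using Y.cmp_assoc[OF \<iota>[OF P(2)] b \<epsilon>[OF P(1)]] Y.cmp_assoc[OF \<epsilon>[OF P(2)] \<iota>[OF P(2)] Y.ov_cmp[OF b \<epsilon>[OF P(1)]]]
        \<epsilon>\<iota>[OF P(2)] Y.ide_left[OF Y.ov_cmp[OF b \<epsilon>[OF P(1)]]] by simp
    then show "Cmp (tot Y) (\<epsilon> (Cod (tot Y) b)) (fa \<lparr>fo = fo F \<circ> fo G, fa = fa F \<circ> fa G\<rparr> b) =
        Cmp (tot Y) (fa \<lparr>fo = \<lambda>x. x, fa = \<lambda>a. a\<rparr> b) (\<epsilon> (Dom (tot Y) b))"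
      using ga[OF b] by (simp add: P)
  qed
  ultimately show ?thesis unfolding gf_equivalence_def using gX gY F by blast
qed

context vgpd
begin

lemma FT_equivalence: "gf_equivalence X (B \<Gamma>) FT"
proof (rule gf_equivalenceI[OF gf B_groupoid_fibration FT_gf_mor])
  show "\<forall>y\<in>Ob. \<forall>y'\<in>Ob. \<forall>b f. over (B \<Gamma>) b f (fo FT y) (fo FT y') \<longrightarrow> (\<exists>!a. ov a f y y' \<and> fa FT a = b)"
  proof (intro ballI allI impI)
    fix y y' b f assume y: "y \<in> Ob" "y' \<in> Ob" and b: "over (B \<Gamma>) b f (fo FT y) (fo FT y')"
    obtain P k g Q where bb: "b = (P, k, g, Q)" by (cases b) auto
    have B: "b = (Tor y, k, f, Tor y')" and k: "torsor_mor \<Gamma> (Tor y) k f (Tor y')"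
      using b by (auto simp: bb over_def B_simps FT_def)
    have "ov a f y y' \<and> fa FT a = b \<longleftrightarrow> ov a f y y' \<and> ka a = k" for a by (auto simp: B FT_def over_def)
    then show "\<exists>!a. ov a f y y' \<and> fa FT a = b" using full_faithful[OF y k] by simp
  qed
  show "\<forall>P\<in>Obj (tot (B \<Gamma>)). \<exists>y b. y \<in> Ob \<and> over (B \<Gamma>) b (sm_id (po (B \<Gamma>) P)) (fo FT y) P"
  proof
    fix P assume "P \<in> Obj (tot (B \<Gamma>))"
    then have P: "torsor \<Gamma> P" by (simp add: B_simps)
    obtain y c where y: "y \<in> Ob" and c: "torsor_mor \<Gamma> (Tor y) c (sm_id (tgt (tproj P))) P"
      by (rule family_to_torsor[OF P])
    have "over (B \<Gamma>) (Tor y, c, sm_id (tgt (tproj P)), P) (sm_id (po (B \<Gamma>) P)) (fo FT y) P"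
      using c by (simp add: over_def B_simps FT_def)
    then show "\<exists>y b. y \<in> Ob \<and> over (B \<Gamma>) b (sm_id (po (B \<Gamma>) P)) (fo FT y) P" using y by blast
  qed
qed

end

section \<open>Versal families\<close>

text \<open>Through a bijection between reals and sets of naturals, a sequence of reals is coded as
  a single set of encoded pairs, hence as one real.\<close>

lemma large_universe_sequences:
  assumes "large_universe TYPE('p)"
  obtains e :: "(nat \<Rightarrow> real) \<Rightarrow> 'p" where "inj e"
proof -
  obtain e0 :: "real \<Rightarrow> 'p" where e0: "inj e0" using assms by (auto simp: large_universe_def)
  obtain f :: "nat set \<Rightarrow> real" where f: "bij f" using nat_sets_eqpoll_reals unfolding eqpoll_def by blast
  define c where "c u = {n. snd (prod_decode n) \<in> inv_into UNIV f (u (fst (prod_decode n)))}" for u :: "nat \<Rightarrow> real"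
  have "inj c"
  proof (rule injI, rule ext)
    fix u v i assume "c u = c v"
    then have "prod_encode (i, k) \<in> c u \<longleftrightarrow> prod_encode (i, k) \<in> c v" for k by simp
    then have "inv_into UNIV f (u i) = inv_into UNIV f (v i)" by (auto simp: c_def)
    then show "u i = v i" using f by (metis bij_inv_eq_iff)
  qed
  then have "inj (e0 \<circ> f \<circ> c)" using e0 f by (intro inj_compose) (auto simp: bij_is_inj)
  then show ?thesis by (rule that)
qed

text \<open>The model space of dimension zero consists of the zero sequence.\<close>

lemma point_manifold:
  fixes e :: "(nat \<Rightarrow> real) \<Rightarrow> 'p"
  assumes e: "inj e"
  obtains Q :: "'p mfd" and q where "manifold Q" "pts Q = {q}"
proof -
  have o: "openin (Euclidean_space 0) (espace 0)" by simp
  have "u = (\<lambda>_. 0)" if "u \<in> espace 0" for u using espaceD[OF that] by (intro ext) simp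
  moreover have "(\<lambda>_. 0) \<in> espace 0" by (rule espaceI) simp
  ultimately have "espace 0 = {\<lambda>_. 0}" by blast
  then have "pts (euclid_mfd e 0 (espace 0)) = {e (\<lambda>_. 0)}" using euclid_pts[OF e o] by simp
  then show ?thesis by (rule that[OF euclid_manifold[OF e o]])
qed

context gfib
begin

text \<open>Representability yields \<open>V\<close> and makes \<open>s\<close> a submersion.
  Surjectivity comes from the epimorphism condition: along some surjective submersion
  \<open>v\<close> the family \<open>y\<close> becomes isomorphic to a restriction of
  \<open>x\<close>, so \<open>v\<close> factors through \<open>s\<close>.\<close>

lemma versal_family_univ:
  assumes v: "versal_family X x" and y: "y \<in> Ob"
  obtains V E m s \<phi> where "manifold V"
    "gf_equivalence (Rep V) (fibprod (Rep (po' x)) (Rep (po' y)) X (fam_mor X x) (fam_mor X y)) E"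
    "fo E (sm_id V) = (m, s, \<phi>)" "univ x y V m (pl y s \<cdot> \<phi>)" "pa X (pl y s \<cdot> \<phi>) = s" "surj_submersion V (po' y) (fn s)"
proof -
  have x: "x \<in> Ob" and rep: "representable_submersion (Rep (po' x)) X (fam_mor X x)"
    and epi: "epimorphism (Rep (po' x)) X (fam_mor X x)"
    using v by (auto simp: versal_family_def surj_representable_submersion_def)
  note fm = fam_gf_mor[OF y] and My = po_manifold[OF y]
  obtain V E where V: "manifold V" and E: "gf_equivalence (Rep V) (fibprod (Rep (po' x)) (Rep (po' y)) X (fam_mor X x) (fam_mor X y)) E"
    and sub: "submersion V (po' y) (fn (fst (snd (fo E (sm_id V)))))"
    using rep My fm unfolding representable_submersion_def by blast
  obtain m s \<phi> where ms: "fo E (sm_id V) = (m, s, \<phi>)" by (cases "fo E (sm_id V)") auto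
  note u = univ_of_equivalence[OF x y V E ms]
  have o: "ov (pl y s \<cdot> \<phi>) s (xr x m) y" using ov_cmp[OF pl[OF y u(3)] u(4)] maps_id_right[OF u(3)] by simp
  have "pts (po' y) \<subseteq> fn s ` pts V"
  proof
    fix b assume b: "b \<in> pts (po' y)"
    obtain v H \<eta> where v: "is_smap v" "tgt v = po' y" "surj_submersion (src v) (po' y) (fn v)"
      and H: "gf_mor (Rep (src v)) (Rep (po' x)) H"
      and \<eta>: "gf_2mor (Rep (src v)) X (ftr_comp (fam_mor X x) H) (ftr_comp (fam_mor X y) (Rep_map v)) \<eta>"
      using epi My fm unfolding epimorphism_def by blast
    let ?W = "src v"
    have vm: "v \<in> maps ?W (po' y)" using v by (simp add: maps_def)
    have idW: "sm_id ?W \<in> maps ?W ?W" using maps_id mapsD[OF vm] by blast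
    then have idO: "sm_id ?W \<in> Obj (tot (Rep ?W))" by (simp add: maps_def)
    define n where "n = fo H (sm_id ?W)"
    have n: "n \<in> maps ?W (po' x)"
      using H idO mapsD[OF idW] by (auto simp: gf_mor_def is_functor_def maps_def n_def)
    have a: "ov (\<eta> (sm_id ?W)) (sm_id ?W) (xr x n) (xr y v)"
      using \<eta> idO mapsD[OF idW] maps_id_right[OF vm]
      by (simp add: gf_2mor_def ftr_comp_def Rep_map_def over_def xr_def n_def del: Rep_simps(1))
    have \<xi>: "ov (pl y v \<cdot> \<eta> (sm_id ?W)) v (xr x n) y" using ov_cmp[OF pl[OF y vm] a] maps_id_right[OF vm] by simp
    then have "ov (pl y v \<cdot> \<eta> (sm_id ?W)) (pa X (pl y v \<cdot> \<eta> (sm_id ?W))) (xr x n) y" by (simp add: over_def)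
    then obtain h where h: "h \<in> maps ?W V" "(pl y s \<cdot> \<phi>) \<cdot> cc x h m = pl y v \<cdot> \<eta> (sm_id ?W)"
      using u(1) n unfolding univ_def by blast
    have sh: "sm_comp s h = v" using ov_cmp[OF o conjunct1[OF cc[OF x u(2) h(1)]]] h(2) \<xi> by (simp add: over_def)
    have "b \<in> fn v ` pts ?W" using v(3) b by (simp add: surj_submersion_def)
    then obtain w where w: "w \<in> pts ?W" "fn v w = b" by blast
    have "fn s (fn h w) = b" using maps_apply[OF h(1) w(1), of s] sh w(2) by simp
    then show "b \<in> fn s ` pts V" using maps_pts[OF h(1) w(1)] by blast
  qed
  then have "fn s ` pts V = pts (po' y)" using maps_pts[OF u(3)] by blast
  then have "surj_submersion V (po' y) (fn s)" using sub ms by (simp add: surj_submersion_def)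
  then show ?thesis using that[OF V E ms u(1)] o by (simp add: over_def)
qed

text \<open>The second part recognises \<open>th\<close> in the isomorphism component of
  \<open>E h\<close>, the quantity that \<open>isom_groupoid\<close> speaks of.\<close>

lemma isom_dataI:
  fixes Q :: "'p mfd"
  assumes x: "x \<in> Ob" and A: "manifold Am" and E: "gf_equivalence (Rep Am) (Isom X x x) E"
    and Eid: "fo E (sm_id Am) = (s, t, \<theta>)" and Q: "manifold Q" "pts Q = {q}"
  shows "isom_data X x Am s t \<theta> Q q"
    and "h \<in> maps T Am \<Longrightarrow> fo E h = (sm_comp s h, sm_comp t h, isom_data.th X x s t \<theta> h)"
proof -
  note u = univ_of_equivalence[OF x x A E[unfolded Isom_def] Eid]
  show I: "isom_data X x Am s t \<theta> Q q"
    by unfold_locales (use x u Q in auto)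
  interpret isom_data X x Am s t \<theta> Q q by (rule I)
  show "fo E h = (sm_comp s h, sm_comp t h, th h)" if h: "h \<in> maps T Am"
    using u(5)[OF h] th_unique[OF h] by auto
qed

lemma isom_groupoid_exists:
  fixes Q0 :: "'p mfd"
  assumes v: "versal_family X x" and Q0: "manifold Q0" "pts Q0 = {q0}"
  shows "\<exists>\<Gamma>. isom_groupoid X x \<Gamma>"
proof -
  have x: "x \<in> Ob" using v by (simp add: versal_family_def)
  obtain Am E s t \<theta> where A: "manifold Am"
    and E: "gf_equivalence (Rep Am) (fibprod (Rep (po' x)) (Rep (po' x)) X (fam_mor X x) (fam_mor X x)) E"
    and Eid: "fo E (sm_id Am) = (s, t, \<theta>)" and sub: "surj_submersion Am (po' x) (fn t)"
    by (rule versal_family_univ[OF v x])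
  note E' = E[folded Isom_def]
  interpret isom_data X x Am s t \<theta> Q0 q0 by (rule isom_dataI(1)[OF x A E' Eid Q0])
  note Eh = isom_dataI(2)[OF x A E' Eid Q0]
  obtain \<Gamma> where \<Gamma>: "lie_groupoid \<Gamma>" "base \<Gamma> = B0" "arrs \<Gamma> = Am" "gs \<Gamma> = fn s" "gt \<Gamma> = fn t" "gm \<Gamma> = gmp"
    by (rule isom_lie_groupoid[OF sub])
  have Er: "fo E (const_smap Q Am r) = (const_smap Q B0 (fn s r), const_smap Q B0 (fn t r), th (const_smap Q Am r))"
    if "manifold Q" "r \<in> pts Am" for Q r
    using Eh[OF const_smap_maps[OF that(1) A that(2)]] comp_const_smap[OF s that] comp_const_smap[OF t that] by simp
  have "th (const_smap Q Am (gmp r r')) = th (const_smap Q Am r') \<cdot> th (const_smap Q Am r)"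
    if Q: "manifold Q" and r: "r \<in> pts Am" "r' \<in> pts Am" "fn t r = fn s r'" for Q r r'
  proof -
    have c: "const_smap Q Am r \<in> maps Q Am" "const_smap Q Am r' \<in> maps Q Am" "const_smap Q Am (gmp r r') \<in> maps Q Am"
      using const_smap_maps[OF Q A] r gmp(1)[OF r] by auto
    have "sm_comp t (const_smap Q Am r) = sm_comp s (const_smap Q Am r')"
      using comp_const_smap[OF t Q r(1)] comp_const_smap[OF s Q r(2)] r(3) by simp
    from cmp_pointwise_conv[OF c this] show ?thesis by simp
  qed
  then have "isom_groupoid X x \<Gamma>"
    unfolding isom_groupoid_def Let_def \<Gamma> using \<Gamma>(1) E' Er gmp(1) by (intro conjI exI[of _ E]) auto
  then show ?thesis ..
qed

text \<open>The representing manifold and the equivalence \<open>E\<close> are those supplied with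
  \<open>\<Gamma>\<close>, so every groupoid meeting the specification is treated and not only a
  constructed one. Evaluation on the one-point manifold identifies its source, target and
  multiplication with \<open>s\<close>, \<open>t\<close> and \<open>gmp\<close> at points.\<close>

lemma isom_groupoid_torsors:
  fixes e :: "(nat \<Rightarrow> real) \<Rightarrow> 'p" and Q0 :: "'p mfd" and \<Gamma> :: "'p lgpd"
  assumes stk: "stack X" and v: "versal_family X x" and e: "inj e" and Q0: "manifold Q0" "pts Q0 = {q0}"
    and \<Gamma>: "isom_groupoid X x \<Gamma>"
  shows "X \<cong>\<^sub>\<SS> B \<Gamma>"
proof -
  have x: "x \<in> Ob" using v by (simp add: versal_family_def)
  have lie: "lie_groupoid \<Gamma>" and base: "base \<Gamma> = po' x" using \<Gamma> by (auto simp: isom_groupoid_def)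
  have A: "manifold (arrs \<Gamma>)" using lie by (simp add: lie_groupoid_def)
  let ?A = "arrs \<Gamma>"
  obtain E where E: "gf_equivalence (Rep ?A) (Isom X x x) E"
    and Er: "\<forall>r\<in>pts ?A. fo E (const_smap Q0 ?A r) = (const_smap Q0 (po' x) (gs \<Gamma> r), const_smap Q0 (po' x) (gt \<Gamma> r), snd (snd (fo E (const_smap Q0 ?A r))))"
    and Em: "\<forall>r\<in>pts ?A. \<forall>r'\<in>pts ?A. gt \<Gamma> r = gs \<Gamma> r' \<longrightarrow>
      snd (snd (fo E (const_smap Q0 ?A (gm \<Gamma> r r')))) = snd (snd (fo E (const_smap Q0 ?A r'))) \<cdot> snd (snd (fo E (const_smap Q0 ?A r)))"
    using \<Gamma> Q0 unfolding isom_groupoid_def Let_def base by blast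
  obtain s t \<theta> where Eid: "fo E (sm_id ?A) = (s, t, \<theta>)" by (cases "fo E (sm_id ?A)") auto
  interpret isom_data X x ?A s t \<theta> Q0 q0 by (rule isom_dataI(1)[OF x A E Eid Q0])
  have Eh: "fo E (K ?A r) = (K B0 (fn s r), K B0 (fn t r), th (K ?A r))" if r: "r \<in> pts ?A" for r
    using isom_dataI(2)[OF x A E Eid Q0 K[OF A r]] comp_K[OF s r] comp_K[OF t r] by simp
  have gst: "gs \<Gamma> r = fn s r" "gt \<Gamma> r = fn t r" if r: "r \<in> pts ?A" for r
    using bspec[OF Er r] Eh[OF r] K_inj[of B0 "gs \<Gamma> r" "fn s r"] K_inj[of B0 "gt \<Gamma> r" "fn t r"] by auto
  have gm: "gm \<Gamma> r r' = gmp r r'" if r: "r \<in> pts ?A" "r' \<in> pts ?A" "fn t r = fn s r'" for r r'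
  proof -
    have c: "gt \<Gamma> r = gs \<Gamma> r'" using gst r by simp
    have g: "gm \<Gamma> r r' \<in> pts ?A" "gs \<Gamma> (gm \<Gamma> r r') = gs \<Gamma> r" "gt \<Gamma> (gm \<Gamma> r r') = gt \<Gamma> r'"
      using lie r c by (auto simp: lie_groupoid_def)
    have "th (K ?A (gm \<Gamma> r r')) = th (K ?A r') \<cdot> th (K ?A r)"
      using Em[rule_format, OF r(1,2) c] Eh[OF g(1)] Eh[OF r(1)] Eh[OF r(2)] by simp
    then show ?thesis
      using pt_ext[OF g(1) gmp(1)[OF r]] gmp(2-4)[OF r] g gst[OF g(1)] gst[OF r(1)] gst[OF r(2)] by simp
  qed
  have "\<forall>y\<in>Ob. \<exists>V m \<xi>. univ x y V m \<xi> \<and> surj_submersion V (po' y) (fn (pa X \<xi>))"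
  proof
    fix y assume y: "y \<in> Ob"
    show "\<exists>V m \<xi>. univ x y V m \<xi> \<and> surj_submersion V (po' y) (fn (pa X \<xi>))"
      by (rule versal_family_univ[OF v y]) metis
  qed
  then obtain V m \<xi> where V: "\<And>y. y \<in> Ob \<Longrightarrow> univ x y (V y) (m y) (\<xi> y)"
    "\<And>y. y \<in> Ob \<Longrightarrow> surj_submersion (V y) (po' y) (fn (pa X (\<xi> y)))" by metis
  interpret vgpd X x ?A s t \<theta> Q0 q0 \<Gamma> V m \<xi> e
    by unfold_locales (use stk lie base gst gm V e in \<open>auto simp: stack_def\<close>)
  show ?thesis unfolding gf_isomorphic_def using FT_equivalence by blast
qed

end

theorem theorem2p22:
  fixes X :: "('o, 'm, 'p) gfib" and x :: 'o
  assumes "large_universe TYPE('p)"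
    and "differentiable_stack X"
    and "versal_family X x"
  shows "(\<exists>\<Gamma>. isom_groupoid X x \<Gamma>) \<and> (\<forall>\<Gamma>. isom_groupoid X x \<Gamma> \<longrightarrow> X \<cong>\<^sub>\<SS> B \<Gamma>)"
proof -
  obtain e :: "(nat \<Rightarrow> real) \<Rightarrow> 'p" where e: "inj e" by (rule large_universe_sequences[OF assms(1)])
  obtain Q :: "'p mfd" and q where Q: "manifold Q" "pts Q = {q}" by (rule point_manifold[OF e])
  have st: "stack X" using assms(2) by (simp add: differentiable_stack_def)
  interpret gfib X by unfold_locales (use st in \<open>simp add: stack_def\<close>)
  show ?thesis using isom_groupoid_exists[OF assms(3) Q] isom_groupoid_torsors[OF st assms(3) e Q] by blast
qed

end
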